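(* Let $\mathcal C$ be a left $H$-category and let $\mathcal M,\mathcal N\in Mod\text{-}(\mathcal C\# H)$. Then there exists a first quadrant spectral sequence $$R^{p}(-)^H\left(\mathrm{Ext}^q_{Mod\text{-}\mathcal{C}}(\mathcal{M},\mathcal N)\right)\Rightarrow \left(R^{p+q}Hom_{Mod\text{-}(\mathcal{C}\#H)}(\mathcal{M},-)\right)(\mathcal{N}).$$
   Context: $K$ is a field and $H$ is a Hopf algebra over $K$ with comultiplication $\Delta(h)=\sum h_1\otimes h_2$, counit $\varepsilon$ and bijective antipode $S$. $H\text{-}Mod$ is the category of left $H$-modules. A left $H$-category $\mathcal C$ is a small $K$-linear category such that every $Hom_{\mathcal C}(X,Y)$ is a left $H$-module, $h(\mathrm{id}_X)=\varepsilon(h)\,\mathrm{id}_X$, and $h(fg)=\sum h_1(f)h_2(g)$ for all $h\in H$ and composable $g:X\to Y$, $f:Y\to Z$. For a small $K$-linear category $\mathcal E$, $Mod\text{-}\mathcal E$ is the category of right $\mathcal E$-modules, i.e. $K$-linear functors $\mathcal E^{op}\to Vect_K$. The smash product $\mathcal C\# H$ is the $K$-linear category with $Ob(\mathcal C\# H)=Ob(\mathcal C)$, $Hom_{\mathcal C\# H}(X,Y)=Hom_{\mathcal C}(X,Y)\otimes H$ (with $f\otimes h$ written $f\# h$), and composition $(f\# h)(g\# h')=\sum f(h_1g)\# (h_2h')$. A module $\mathcal M\in Mod\text{-}(\mathcal C\# H)$ is regarded as a right $\mathcal C$-module via $\mathcal M(f):=\mathcal M(f\#1_H)$, and each $\mathcal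 M(X)$ is a left $H$-module via $hm:=\mathcal M(\mathrm{id}_X\# S(h))(m)$. For $\mathcal M,\mathcal N\in Mod\text{-}(\mathcal C\# H)$, $Hom_{Mod\text{-}\mathcal C}(\mathcal M,\mathcal N)$ is a left $H$-module via $(h\cdot\eta)(X)(m)=\sum h_1\big(\eta(X)(S(h_2)m)\big)$. The groups $\mathrm{Ext}^q_{Mod\text{-}\mathcal C}(\mathcal M,\mathcal N)$ are regarded as left $H$-modules as the values at $\mathcal N$ of the $q$-th right derived functor of $Hom_{Mod\text{-}\mathcal C}(\mathcal M,-):Mod\text{-}(\mathcal C\# H)\to H\text{-}Mod$, that is, $H^q(Hom_{Mod\text{-}\mathcal C}(\mathcal M,\mathcal I^* ))$ for an injective resolution $\mathcal I^*$ of $\mathcal N$ in $Mod\text{-}(\mathcal C\# H)$. The functor $(-)^H:H\text{-}Mod\to Vect_K$ is $M\mapsto M^H=\{m\in M\mid hm=\varepsilon(h)m\ \forall h\in H\}$, and $R^p(-)^H$ are its right derived functors. *)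

theory Defs
  imports "HOL-Algebra.Module" "HOL-Algebra.AbelCoset"
begin

section \<open>Vector spaces\<close>

text \<open>A vector space over a field \<open>K\<close> is a record \<open>V\<close> with \<open>module K V\<close>; the ring components
  \<open>mult\<close> and \<open>one\<close> of the record are irrelevant.  Linear maps are extensional functions, so that
  equal maps are equal as HOL functions.\<close>

definition lin_maps ::
  "'k ring \<Rightarrow> ('k, 'v, 'y) module_scheme \<Rightarrow> ('k, 'w, 'z) module_scheme \<Rightarrow> ('v \<Rightarrow> 'w) set" where
  "lin_maps K V W = {f \<in> carrier V \<rightarrow>\<^sub>E carrier W.
     (\<forall>x\<in>carrier V. \<forall>y\<in>carrier V. f (x \<oplus>\<^bsub>V\<^esub> y) = f x \<oplus>\<^bsub>W\<^esub> f y) \<and>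
     (\<forall>k\<in>carrier K. \<forall>x\<in>carrier V. f (k \<odot>\<^bsub>V\<^esub> x) = k \<odot>\<^bsub>W\<^esub> f x)}"

definition vs_iso ::
  "'k ring \<Rightarrow> ('k, 'v, 'y) module_scheme \<Rightarrow> ('k, 'w, 'z) module_scheme \<Rightarrow> bool" where
  "vs_iso K V W \<longleftrightarrow> (\<exists>f\<in>lin_maps K V W. bij_betw f (carrier V) (carrier W))"

text \<open>\<open>quot_space V U\<close> is \<open>V/U\<close>.  All the cosets in the unions below coincide when \<open>U\<close> is a
  subspace.\<close>

definition quot_space :: "('k, 'v, 'z) module_scheme \<Rightarrow> 'v set \<Rightarrow> ('k, 'v set) module" where
  "quot_space V U =
    \<lparr>carrier = A_RCOSETS V U, monoid.mult = undefined, one = undefined,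
     zero = U, add = set_add V,
     smult = (\<lambda>k A. \<Union>a\<in>A. a_r_coset V U (k \<odot>\<^bsub>V\<^esub> a))\<rparr>"

definition cocycles :: "(nat \<Rightarrow> ('k, 'v, 'z) module_scheme) \<Rightarrow> (nat \<Rightarrow> 'v \<Rightarrow> 'v) \<Rightarrow> nat \<Rightarrow> 'v set" where
  "cocycles V d n = {x \<in> carrier (V n). d n x = \<zero>\<^bsub>V (Suc n)\<^esub>}"

definition coboundaries :: "(nat \<Rightarrow> ('k, 'v, 'z) module_scheme) \<Rightarrow> (nat \<Rightarrow> 'v \<Rightarrow> 'v) \<Rightarrow> nat \<Rightarrow> 'v set" where
  "coboundaries V d n = (case n of 0 \<Rightarrow> {\<zero>\<^bsub>V 0\<^esub>} | Suc m \<Rightarrow> d m ` carrier (V m))"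

definition cohomology ::
  "(nat \<Rightarrow> ('k, 'v, 'z) module_scheme) \<Rightarrow> (nat \<Rightarrow> 'v \<Rightarrow> 'v) \<Rightarrow> nat \<Rightarrow> ('k, 'v set) module" where
  "cohomology V d n = quot_space ((V n)\<lparr>carrier := cocycles V d n\<rparr>) (coboundaries V d n)"


section \<open>Tensor products\<close>

text \<open>A tensor is a class of finite formal sums of pairs.  The tensor product is the free
  commutative monoid on \<open>carrier V \<times> carrier W\<close> (words up to permutation) modulo the congruence
  generated by bilinearity; negatives exist because \<open>(\<ominus> v) \<otimes> w\<close> is inverse to \<open>v \<otimes> w\<close>.\<close>

type_synonym ('a, 'b) tensor = "('a \<times> 'b) list set"

inductive_set tensor_rel ::
  "'k ring \<Rightarrow> ('k, 'a, 'y) module_scheme \<Rightarrow> ('k, 'b, 'z) module_scheme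
    \<Rightarrow> (('a \<times> 'b) list \<times> ('a \<times> 'b) list) set"
  for K :: "'k ring" and V :: "('k, 'a, 'y) module_scheme" and W :: "('k, 'b, 'z) module_scheme"
  where
  refl: "l \<in> lists (carrier V \<times> carrier W) \<Longrightarrow> (l, l) \<in> tensor_rel K V W"
| sym: "(l, m) \<in> tensor_rel K V W \<Longrightarrow> (m, l) \<in> tensor_rel K V W"
| trans: "(l, m) \<in> tensor_rel K V W \<Longrightarrow> (m, n) \<in> tensor_rel K V W \<Longrightarrow> (l, n) \<in> tensor_rel K V W"
| append: "(l, m) \<in> tensor_rel K V W \<Longrightarrow> (l', m') \<in> tensor_rel K V W
    \<Longrightarrow> (l @ l', m @ m') \<in> tensor_rel K V W"
| commute: "l \<in> lists (carrier V \<times> carrier W) \<Longrightarrow> m \<in> lists (carrier V \<times> carrier W)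
    \<Longrightarrow> (l @ m, m @ l) \<in> tensor_rel K V W"
| add_left: "v \<in> carrier V \<Longrightarrow> v' \<in> carrier V \<Longrightarrow> w \<in> carrier W
    \<Longrightarrow> ([(v \<oplus>\<^bsub>V\<^esub> v', w)], [(v, w), (v', w)]) \<in> tensor_rel K V W"
| add_right: "v \<in> carrier V \<Longrightarrow> w \<in> carrier W \<Longrightarrow> w' \<in> carrier W
    \<Longrightarrow> ([(v, w \<oplus>\<^bsub>W\<^esub> w')], [(v, w), (v, w')]) \<in> tensor_rel K V W"
| balanced: "k \<in> carrier K \<Longrightarrow> v \<in> carrier V \<Longrightarrow> w \<in> carrier W
    \<Longrightarrow> ([(k \<odot>\<^bsub>V\<^esub> v, w)], [(v, k \<odot>\<^bsub>W\<^esub> w)]) \<in> tensor_rel K V W"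
| zero: "w \<in> carrier W \<Longrightarrow> ([(\<zero>\<^bsub>V\<^esub>, w)], []) \<in> tensor_rel K V W"

definition tensor ::
  "'k ring \<Rightarrow> ('k, 'a, 'y) module_scheme \<Rightarrow> ('k, 'b, 'z) module_scheme
    \<Rightarrow> ('k, ('a, 'b) tensor) module" where
  "tensor K V W =
    \<lparr>carrier = lists (carrier V \<times> carrier W) // tensor_rel K V W,
     monoid.mult = undefined, one = undefined,
     zero = tensor_rel K V W `` {[]},
     add = (\<lambda>s t. \<Union>l\<in>s. \<Union>m\<in>t. tensor_rel K V W `` {l @ m}),
     smult = (\<lambda>k t. \<Union>l\<in>t. tensor_rel K V W `` {map (\<lambda>(v, w). (k \<odot>\<^bsub>V\<^esub> v, w)) l})\<rparr>"

definition pure ::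
  "'k ring \<Rightarrow> ('k, 'a, 'y) module_scheme \<Rightarrow> ('k, 'b, 'z) module_scheme
    \<Rightarrow> 'a \<Rightarrow> 'b \<Rightarrow> ('a, 'b) tensor" where
  "pure K V W v w = tensor_rel K V W `` {[(v, w)]}"

text \<open>If \<open>t = \<Sum> v\<^sub>i \<otimes> w\<^sub>i\<close>, then \<open>tsum P \<beta> t = \<Sum> \<beta> v\<^sub>i w\<^sub>i\<close> in \<open>P\<close>.  For bilinear \<open>\<beta>\<close> this does not
  depend on the representative, i.e. \<open>tsum P \<beta>\<close> is the linear map induced by \<open>\<beta>\<close>.  Sweedler's
  notation \<open>\<Sum> \<beta> h\<^sub>1 h\<^sub>2\<close> is rendered as \<open>tsum P \<beta> (comult H h)\<close>.\<close>

definition tsum :: "('k, 'p, 'z) module_scheme \<Rightarrow> ('a \<Rightarrow> 'b \<Rightarrow> 'p) \<Rightarrow> ('a, 'b) tensor \<Rightarrow> 'p" where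
  "tsum P \<beta> t = foldr (\<lambda>(v, w) s. \<beta> v w \<oplus>\<^bsub>P\<^esub> s) (SOME l. l \<in> t) \<zero>\<^bsub>P\<^esub>"


section \<open>Hopf algebras and their modules\<close>

record ('k, 'h) hopf = "('k, 'h) module" +
  comult :: "'h \<Rightarrow> ('h, 'h) tensor"
  counit :: "'h \<Rightarrow> 'k"
  antipode :: "'h \<Rightarrow> 'h"

locale hopf_algebra =
  fixes K :: "'k ring" and H :: "('k, 'h) hopf"
  assumes field: "field K"
    and ring: "ring H"
    and vector_space: "module K H"
    and smult_mult_left: "\<And>k a b. k \<in> carrier K \<Longrightarrow> a \<in> carrier H \<Longrightarrow> b \<in> carrier H
      \<Longrightarrow> (k \<odot>\<^bsub>H\<^esub> a) \<otimes>\<^bsub>H\<^esub> b = k \<odot>\<^bsub>H\<^esub> (a \<otimes>\<^bsub>H\<^esub> b)"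
    and smult_mult_right: "\<And>k a b. k \<in> carrier K \<Longrightarrow> a \<in> carrier H \<Longrightarrow> b \<in> carrier H
      \<Longrightarrow> a \<otimes>\<^bsub>H\<^esub> (k \<odot>\<^bsub>H\<^esub> b) = k \<odot>\<^bsub>H\<^esub> (a \<otimes>\<^bsub>H\<^esub> b)"
    and comult_closed: "\<And>a. a \<in> carrier H \<Longrightarrow> comult H a \<in> carrier (tensor K H H)"
    and comult_add: "\<And>a b. a \<in> carrier H \<Longrightarrow> b \<in> carrier H
      \<Longrightarrow> comult H (a \<oplus>\<^bsub>H\<^esub> b) = comult H a \<oplus>\<^bsub>tensor K H H\<^esub> comult H b"
    and comult_smult: "\<And>k a. k \<in> carrier K \<Longrightarrow> a \<in> carrier H
      \<Longrightarrow> comult H (k \<odot>\<^bsub>H\<^esub> a) = k \<odot>\<^bsub>tensor K H H\<^esub> comult H a"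
    and comult_mult: "\<And>a b. a \<in> carrier H \<Longrightarrow> b \<in> carrier H
      \<Longrightarrow> comult H (a \<otimes>\<^bsub>H\<^esub> b) =
        tsum (tensor K H H) (\<lambda>a\<^sub>1 a\<^sub>2.
          tsum (tensor K H H) (\<lambda>b\<^sub>1 b\<^sub>2. pure K H H (a\<^sub>1 \<otimes>\<^bsub>H\<^esub> b\<^sub>1) (a\<^sub>2 \<otimes>\<^bsub>H\<^esub> b\<^sub>2)) (comult H b))
        (comult H a)"
    and comult_one: "comult H \<one>\<^bsub>H\<^esub> = pure K H H \<one>\<^bsub>H\<^esub> \<one>\<^bsub>H\<^esub>"
    and coassoc: "\<And>a. a \<in> carrier H \<Longrightarrow>
        tsum (tensor K H (tensor K H H)) (\<lambda>a\<^sub>1 a\<^sub>2.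
          tsum (tensor K H (tensor K H H))
            (\<lambda>x y. pure K H (tensor K H H) x (pure K H H y a\<^sub>2)) (comult H a\<^sub>1))
        (comult H a)
      = tsum (tensor K H (tensor K H H))
          (\<lambda>a\<^sub>1 a\<^sub>2. pure K H (tensor K H H) a\<^sub>1 (comult H a\<^sub>2)) (comult H a)"
    and counit_closed: "\<And>a. a \<in> carrier H \<Longrightarrow> counit H a \<in> carrier K"
    and counit_add: "\<And>a b. a \<in> carrier H \<Longrightarrow> b \<in> carrier H
      \<Longrightarrow> counit H (a \<oplus>\<^bsub>H\<^esub> b) = counit H a \<oplus>\<^bsub>K\<^esub> counit H b"
    and counit_smult: "\<And>k a. k \<in> carrier K \<Longrightarrow> a \<in> carrier H
      \<Longrightarrow> counit H (k \<odot>\<^bsub>H\<^esub> a) = k \<otimes>\<^bsub>K\<^esub> counit H a"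
    and counit_mult: "\<And>a b. a \<in> carrier H \<Longrightarrow> b \<in> carrier H
      \<Longrightarrow> counit H (a \<otimes>\<^bsub>H\<^esub> b) = counit H a \<otimes>\<^bsub>K\<^esub> counit H b"
    and counit_one: "counit H \<one>\<^bsub>H\<^esub> = \<one>\<^bsub>K\<^esub>"
    and counit_left: "\<And>a. a \<in> carrier H \<Longrightarrow> tsum H (\<lambda>a\<^sub>1 a\<^sub>2. counit H a\<^sub>1 \<odot>\<^bsub>H\<^esub> a\<^sub>2) (comult H a) = a"
    and counit_right: "\<And>a. a \<in> carrier H \<Longrightarrow> tsum H (\<lambda>a\<^sub>1 a\<^sub>2. counit H a\<^sub>2 \<odot>\<^bsub>H\<^esub> a\<^sub>1) (comult H a) = a"
    and antipode_add: "\<And>a b. a \<in> carrier H \<Longrightarrow> b \<in> carrier H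
      \<Longrightarrow> antipode H (a \<oplus>\<^bsub>H\<^esub> b) = antipode H a \<oplus>\<^bsub>H\<^esub> antipode H b"
    and antipode_smult: "\<And>k a. k \<in> carrier K \<Longrightarrow> a \<in> carrier H
      \<Longrightarrow> antipode H (k \<odot>\<^bsub>H\<^esub> a) = k \<odot>\<^bsub>H\<^esub> antipode H a"
    and antipode_left: "\<And>a. a \<in> carrier H \<Longrightarrow>
      tsum H (\<lambda>a\<^sub>1 a\<^sub>2. antipode H a\<^sub>1 \<otimes>\<^bsub>H\<^esub> a\<^sub>2) (comult H a) = counit H a \<odot>\<^bsub>H\<^esub> \<one>\<^bsub>H\<^esub>"
    and antipode_right: "\<And>a. a \<in> carrier H \<Longrightarrow>
      tsum H (\<lambda>a\<^sub>1 a\<^sub>2. a\<^sub>1 \<otimes>\<^bsub>H\<^esub> antipode H a\<^sub>2) (comult H a) = counit H a \<odot>\<^bsub>H\<^esub> \<one>\<^bsub>H\<^esub>"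
    and antipode_bij: "bij_betw (antipode H) (carrier H) (carrier H)"

record ('k, 'h, 'v) hmodule = "('k, 'v) module" +
  act :: "'h \<Rightarrow> 'v \<Rightarrow> 'v"

definition with_act :: "('k, 'v) module \<Rightarrow> ('h \<Rightarrow> 'v \<Rightarrow> 'v) \<Rightarrow> ('k, 'h, 'v) hmodule" where
  "with_act V \<alpha> = module.extend V (hmodule.fields \<alpha>)"

locale left_H_module =
  fixes K :: "'k ring" and H :: "('k, 'h) hopf" and V :: "('k, 'h, 'v) hmodule"
  assumes vector_space: "module K V"
    and act_closed: "\<And>h v. h \<in> carrier H \<Longrightarrow> v \<in> carrier V \<Longrightarrow> act V h v \<in> carrier V"
    and act_add_left: "\<And>g h v. g \<in> carrier H \<Longrightarrow> h \<in> carrier H \<Longrightarrow> v \<in> carrier V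
      \<Longrightarrow> act V (g \<oplus>\<^bsub>H\<^esub> h) v = act V g v \<oplus>\<^bsub>V\<^esub> act V h v"
    and act_add_right: "\<And>h v w. h \<in> carrier H \<Longrightarrow> v \<in> carrier V \<Longrightarrow> w \<in> carrier V
      \<Longrightarrow> act V h (v \<oplus>\<^bsub>V\<^esub> w) = act V h v \<oplus>\<^bsub>V\<^esub> act V h w"
    and act_smult_left: "\<And>k h v. k \<in> carrier K \<Longrightarrow> h \<in> carrier H \<Longrightarrow> v \<in> carrier V
      \<Longrightarrow> act V (k \<odot>\<^bsub>H\<^esub> h) v = k \<odot>\<^bsub>V\<^esub> act V h v"
    and act_smult_right: "\<And>k h v. k \<in> carrier K \<Longrightarrow> h \<in> carrier H \<Longrightarrow> v \<in> carrier V
      \<Longrightarrow> act V h (k \<odot>\<^bsub>V\<^esub> v) = k \<odot>\<^bsub>V\<^esub> act V h v"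
    and act_mult: "\<And>g h v. g \<in> carrier H \<Longrightarrow> h \<in> carrier H \<Longrightarrow> v \<in> carrier V
      \<Longrightarrow> act V (g \<otimes>\<^bsub>H\<^esub> h) v = act V g (act V h v)"
    and act_one: "\<And>v. v \<in> carrier V \<Longrightarrow> act V \<one>\<^bsub>H\<^esub> v = v"

definition H_maps ::
  "'k ring \<Rightarrow> ('k, 'h) hopf \<Rightarrow> ('k, 'h, 'v) hmodule \<Rightarrow> ('k, 'h, 'w) hmodule \<Rightarrow> ('v \<Rightarrow> 'w) set" where
  "H_maps K H V W =
    {f \<in> lin_maps K V W. \<forall>h\<in>carrier H. \<forall>v\<in>carrier V. f (act V h v) = act W h (f v)}"

text \<open>The cohomology of a complex of \<open>H\<close>-modules, with the induced action.\<close>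

definition H_cohomology ::
  "(nat \<Rightarrow> ('k, 'h, 'v) hmodule) \<Rightarrow> (nat \<Rightarrow> 'v \<Rightarrow> 'v) \<Rightarrow> nat \<Rightarrow> ('k, 'h, 'v set) hmodule" where
  "H_cohomology V d n = with_act (cohomology V d n)
     (\<lambda>h A. \<Union>a\<in>A. a_r_coset (V n) (coboundaries V d n) (act (V n) h a))"

definition invariants ::
  "('k, 'h) hopf \<Rightarrow> ('k, 'h, 'v) hmodule \<Rightarrow> ('k, 'v) module" where
  "invariants H V = module.truncate
     (V\<lparr>carrier := {m \<in> carrier V. \<forall>h\<in>carrier H. act V h m = counit H h \<odot>\<^bsub>V\<^esub> m}\<rparr>)"


section \<open>Linear categories and their right modules\<close>

text \<open>\<open>Comp C X Y Z f g\<close> is the composite \<open>f g\<close> of \<open>g : X \<rightarrow> Y\<close> and \<open>f : Y \<rightarrow> Z\<close>.\<close>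

record ('k, 'o, 'c) lincat =
  Ob :: "'o set"
  Hom :: "'o \<Rightarrow> 'o \<Rightarrow> ('k, 'c) module"
  Ident :: "'o \<Rightarrow> 'c"
  Comp :: "'o \<Rightarrow> 'o \<Rightarrow> 'o \<Rightarrow> 'c \<Rightarrow> 'c \<Rightarrow> 'c"

locale linear_category =
  fixes K :: "'k ring" and C :: "('k, 'o, 'c, 'z) lincat_scheme"
  assumes hom_space: "\<And>X Y. X \<in> Ob C \<Longrightarrow> Y \<in> Ob C \<Longrightarrow> module K (Hom C X Y)"
    and ident_closed: "\<And>X. X \<in> Ob C \<Longrightarrow> Ident C X \<in> carrier (Hom C X X)"
    and comp_closed: "\<And>X Y Z f g. \<lbrakk>X \<in> Ob C; Y \<in> Ob C; Z \<in> Ob C;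
        f \<in> carrier (Hom C Y Z); g \<in> carrier (Hom C X Y)\<rbrakk>
      \<Longrightarrow> Comp C X Y Z f g \<in> carrier (Hom C X Z)"
    and comp_add_left: "\<And>X Y Z f f' g. \<lbrakk>X \<in> Ob C; Y \<in> Ob C; Z \<in> Ob C;
        f \<in> carrier (Hom C Y Z); f' \<in> carrier (Hom C Y Z); g \<in> carrier (Hom C X Y)\<rbrakk>
      \<Longrightarrow> Comp C X Y Z (f \<oplus>\<^bsub>Hom C Y Z\<^esub> f') g = Comp C X Y Z f g \<oplus>\<^bsub>Hom C X Z\<^esub> Comp C X Y Z f' g"
    and comp_add_right: "\<And>X Y Z f g g'. \<lbrakk>X \<in> Ob C; Y \<in> Ob C; Z \<in> Ob C;
        f \<in> carrier (Hom C Y Z); g \<in> carrier (Hom C X Y); g' \<in> carrier (Hom C X Y)\<rbrakk>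
      \<Longrightarrow> Comp C X Y Z f (g \<oplus>\<^bsub>Hom C X Y\<^esub> g') = Comp C X Y Z f g \<oplus>\<^bsub>Hom C X Z\<^esub> Comp C X Y Z f g'"
    and comp_smult_left: "\<And>X Y Z k f g. \<lbrakk>X \<in> Ob C; Y \<in> Ob C; Z \<in> Ob C; k \<in> carrier K;
        f \<in> carrier (Hom C Y Z); g \<in> carrier (Hom C X Y)\<rbrakk>
      \<Longrightarrow> Comp C X Y Z (k \<odot>\<^bsub>Hom C Y Z\<^esub> f) g = k \<odot>\<^bsub>Hom C X Z\<^esub> Comp C X Y Z f g"
    and comp_smult_right: "\<And>X Y Z k f g. \<lbrakk>X \<in> Ob C; Y \<in> Ob C; Z \<in> Ob C; k \<in> carrier K;
        f \<in> carrier (Hom C Y Z); g \<in> carrier (Hom C X Y)\<rbrakk>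
      \<Longrightarrow> Comp C X Y Z f (k \<odot>\<^bsub>Hom C X Y\<^esub> g) = k \<odot>\<^bsub>Hom C X Z\<^esub> Comp C X Y Z f g"
    and comp_assoc: "\<And>W X Y Z f g h. \<lbrakk>W \<in> Ob C; X \<in> Ob C; Y \<in> Ob C; Z \<in> Ob C;
        f \<in> carrier (Hom C Y Z); g \<in> carrier (Hom C X Y); h \<in> carrier (Hom C W X)\<rbrakk>
      \<Longrightarrow> Comp C W X Z (Comp C X Y Z f g) h = Comp C W Y Z f (Comp C W X Y g h)"
    and ident_left: "\<And>X Y f. \<lbrakk>X \<in> Ob C; Y \<in> Ob C; f \<in> carrier (Hom C X Y)\<rbrakk>
      \<Longrightarrow> Comp C X Y Y (Ident C Y) f = f"
    and ident_right: "\<And>X Y f. \<lbrakk>X \<in> Ob C; Y \<in> Ob C; f \<in> carrier (Hom C X Y)\<rbrakk>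
      \<Longrightarrow> Comp C X X Y f (Ident C X) = f"

text \<open>A right module is a contravariant functor to vector spaces: for \<open>f : X \<rightarrow> Y\<close>,
  \<open>Mor M X Y f\<close> maps \<open>Obj M Y\<close> to \<open>Obj M X\<close>.\<close>

record ('k, 'o, 'e, 'v) rmodule =
  Obj :: "'o \<Rightarrow> ('k, 'v) module"
  Mor :: "'o \<Rightarrow> 'o \<Rightarrow> 'e \<Rightarrow> 'v \<Rightarrow> 'v"

locale right_module =
  fixes K :: "'k ring" and E :: "('k, 'o, 'e, 'z) lincat_scheme" and M :: "('k, 'o, 'e, 'v) rmodule"
  assumes obj_space: "\<And>X. X \<in> Ob E \<Longrightarrow> module K (Obj M X)"
    and mor_closed: "\<And>X Y f m. \<lbrakk>X \<in> Ob E; Y \<in> Ob E; f \<in> carrier (Hom E X Y); m \<in> carrier (Obj M Y)\<rbrakk>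
      \<Longrightarrow> Mor M X Y f m \<in> carrier (Obj M X)"
    and mor_add: "\<And>X Y f m m'. \<lbrakk>X \<in> Ob E; Y \<in> Ob E; f \<in> carrier (Hom E X Y);
        m \<in> carrier (Obj M Y); m' \<in> carrier (Obj M Y)\<rbrakk>
      \<Longrightarrow> Mor M X Y f (m \<oplus>\<^bsub>Obj M Y\<^esub> m') = Mor M X Y f m \<oplus>\<^bsub>Obj M X\<^esub> Mor M X Y f m'"
    and mor_smult: "\<And>X Y f k m. \<lbrakk>X \<in> Ob E; Y \<in> Ob E; f \<in> carrier (Hom E X Y);
        k \<in> carrier K; m \<in> carrier (Obj M Y)\<rbrakk>
      \<Longrightarrow> Mor M X Y f (k \<odot>\<^bsub>Obj M Y\<^esub> m) = k \<odot>\<^bsub>Obj M X\<^esub> Mor M X Y f m"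
    and functor_add: "\<And>X Y f g m. \<lbrakk>X \<in> Ob E; Y \<in> Ob E; f \<in> carrier (Hom E X Y);
        g \<in> carrier (Hom E X Y); m \<in> carrier (Obj M Y)\<rbrakk>
      \<Longrightarrow> Mor M X Y (f \<oplus>\<^bsub>Hom E X Y\<^esub> g) m = Mor M X Y f m \<oplus>\<^bsub>Obj M X\<^esub> Mor M X Y g m"
    and functor_smult: "\<And>X Y f k m. \<lbrakk>X \<in> Ob E; Y \<in> Ob E; f \<in> carrier (Hom E X Y);
        k \<in> carrier K; m \<in> carrier (Obj M Y)\<rbrakk>
      \<Longrightarrow> Mor M X Y (k \<odot>\<^bsub>Hom E X Y\<^esub> f) m = k \<odot>\<^bsub>Obj M X\<^esub> Mor M X Y f m"
    and functor_ident: "\<And>X m. \<lbrakk>X \<in> Ob E; m \<in> carrier (Obj M X)\<rbrakk> \<Longrightarrow> Mor M X X (Ident E X) m = m"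
    and functor_comp: "\<And>X Y Z f g m. \<lbrakk>X \<in> Ob E; Y \<in> Ob E; Z \<in> Ob E;
        f \<in> carrier (Hom E Y Z); g \<in> carrier (Hom E X Y); m \<in> carrier (Obj M Z)\<rbrakk>
      \<Longrightarrow> Mor M X Z (Comp E X Y Z f g) m = Mor M X Y g (Mor M Y Z f m)"

definition nat_maps ::
  "'k ring \<Rightarrow> ('k, 'o, 'e, 'z) lincat_scheme \<Rightarrow> ('k, 'o, 'e, 'v) rmodule \<Rightarrow> ('k, 'o, 'e, 'w) rmodule
    \<Rightarrow> ('o \<Rightarrow> 'v \<Rightarrow> 'w) set" where
  "nat_maps K E M N = {\<eta> \<in> (\<Pi>\<^sub>E X\<in>Ob E. lin_maps K (Obj M X) (Obj N X)).
     \<forall>X\<in>Ob E. \<forall>Y\<in>Ob E. \<forall>f\<in>carrier (Hom E X Y). \<forall>m\<in>carrier (Obj M Y).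
       \<eta> X (Mor M X Y f m) = Mor N X Y f (\<eta> Y m)}"

definition Hom_Mod ::
  "'k ring \<Rightarrow> ('k, 'o, 'e, 'z) lincat_scheme \<Rightarrow> ('k, 'o, 'e, 'v) rmodule \<Rightarrow> ('k, 'o, 'e, 'w) rmodule
    \<Rightarrow> ('k, 'o \<Rightarrow> 'v \<Rightarrow> 'w) module" where
  "Hom_Mod K E M N =
    \<lparr>carrier = nat_maps K E M N, monoid.mult = undefined, one = undefined,
     zero = (\<lambda>X\<in>Ob E. \<lambda>m\<in>carrier (Obj M X). \<zero>\<^bsub>Obj N X\<^esub>),
     add = (\<lambda>\<eta> \<theta>. \<lambda>X\<in>Ob E. \<lambda>m\<in>carrier (Obj M X). \<eta> X m \<oplus>\<^bsub>Obj N X\<^esub> \<theta> X m),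
     smult = (\<lambda>k \<eta>. \<lambda>X\<in>Ob E. \<lambda>m\<in>carrier (Obj M X). k \<odot>\<^bsub>Obj N X\<^esub> \<eta> X m)\<rparr>"

text \<open>The map \<open>Hom(M, f)\<close>, that is \<open>\<eta> \<mapsto> f \<circ> \<eta>\<close>.\<close>

definition Hom_Mod_map ::
  "('k, 'o, 'e, 'z) lincat_scheme \<Rightarrow> ('k, 'o, 'f, 'v) rmodule \<Rightarrow> ('o \<Rightarrow> 'w \<Rightarrow> 'u)
    \<Rightarrow> ('o \<Rightarrow> 'v \<Rightarrow> 'w) \<Rightarrow> ('o \<Rightarrow> 'v \<Rightarrow> 'u)" where
  "Hom_Mod_map E M f \<eta> = (\<lambda>X\<in>Ob E. \<lambda>m\<in>carrier (Obj M X). f X (\<eta> X m))"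


section \<open>\<open>H\<close>-categories and smash products\<close>

record ('k, 'h, 'o, 'c) hcat = "('k, 'o, 'c) lincat" +
  hact :: "'o \<Rightarrow> 'o \<Rightarrow> 'h \<Rightarrow> 'c \<Rightarrow> 'c"

locale left_H_category = linear_category K C
  for K :: "'k ring" and H :: "('k, 'h) hopf" and C :: "('k, 'h, 'o, 'c) hcat" +
  assumes hom_H_module: "\<And>X Y. X \<in> Ob C \<Longrightarrow> Y \<in> Ob C
      \<Longrightarrow> left_H_module K H (with_act (Hom C X Y) (hact C X Y))"
    and hact_ident: "\<And>X h. X \<in> Ob C \<Longrightarrow> h \<in> carrier H
      \<Longrightarrow> hact C X X h (Ident C X) = counit H h \<odot>\<^bsub>Hom C X X\<^esub> Ident C X"
    and hact_comp: "\<And>X Y Z h f g. \<lbrakk>X \<in> Ob C; Y \<in> Ob C; Z \<in> Ob C; h \<in> carrier H;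
        f \<in> carrier (Hom C Y Z); g \<in> carrier (Hom C X Y)\<rbrakk>
      \<Longrightarrow> hact C X Z h (Comp C X Y Z f g) =
        tsum (Hom C X Z) (\<lambda>h\<^sub>1 h\<^sub>2. Comp C X Y Z (hact C Y Z h\<^sub>1 f) (hact C X Y h\<^sub>2 g)) (comult H h)"

definition smash ::
  "'k ring \<Rightarrow> ('k, 'h) hopf \<Rightarrow> ('k, 'h, 'o, 'c) hcat \<Rightarrow> ('k, 'o, ('c, 'h) tensor) lincat" where
  "smash K H C =
    \<lparr>Ob = Ob C,
     Hom = (\<lambda>X Y. tensor K (Hom C X Y) H),
     Ident = (\<lambda>X. pure K (Hom C X X) H (Ident C X) \<one>\<^bsub>H\<^esub>),
     Comp = (\<lambda>X Y Z s t.
       tsum (tensor K (Hom C X Z) H) (\<lambda>f h.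
         tsum (tensor K (Hom C X Z) H) (\<lambda>g h'.
           tsum (tensor K (Hom C X Z) H) (\<lambda>h\<^sub>1 h\<^sub>2.
             pure K (Hom C X Z) H (Comp C X Y Z f (hact C X Y h\<^sub>1 g)) (h\<^sub>2 \<otimes>\<^bsub>H\<^esub> h'))
           (comult H h))
         t)
       s)\<rparr>"

definition restrict_module ::
  "'k ring \<Rightarrow> ('k, 'h) hopf \<Rightarrow> ('k, 'h, 'o, 'c) hcat \<Rightarrow> ('k, 'o, ('c, 'h) tensor, 'v) rmodule
    \<Rightarrow> ('k, 'o, 'c, 'v) rmodule" where
  "restrict_module K H C M =
    \<lparr>Obj = Obj M, Mor = (\<lambda>X Y f. Mor M X Y (pure K (Hom C X Y) H f \<one>\<^bsub>H\<^esub>))\<rparr>"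

definition module_hact ::
  "'k ring \<Rightarrow> ('k, 'h) hopf \<Rightarrow> ('k, 'h, 'o, 'c) hcat \<Rightarrow> ('k, 'o, ('c, 'h) tensor, 'v) rmodule
    \<Rightarrow> 'o \<Rightarrow> 'h \<Rightarrow> 'v \<Rightarrow> 'v" where
  "module_hact K H C M X h m =
    Mor M X X (pure K (Hom C X X) H (Ident C X) (antipode H h)) m"

text \<open>The left \<open>H\<close>-module of morphisms of right \<open>C\<close>-modules between two right \<open>C#H\<close>-modules.\<close>

definition H_Hom_Mod ::
  "'k ring \<Rightarrow> ('k, 'h) hopf \<Rightarrow> ('k, 'h, 'o, 'c) hcat \<Rightarrow> ('k, 'o, ('c, 'h) tensor, 'v) rmodule
    \<Rightarrow> ('k, 'o, ('c, 'h) tensor, 'w) rmodule \<Rightarrow> ('k, 'h, 'o \<Rightarrow> 'v \<Rightarrow> 'w) hmodule" where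
  "H_Hom_Mod K H C M N =
    with_act (Hom_Mod K C (restrict_module K H C M) (restrict_module K H C N))
      (\<lambda>h \<eta>. \<lambda>X\<in>Ob C. \<lambda>m\<in>carrier (Obj M X).
        tsum (Obj N X)
          (\<lambda>h\<^sub>1 h\<^sub>2. module_hact K H C N X h\<^sub>1 (\<eta> X (module_hact K H C M X (antipode H h\<^sub>2) m)))
          (comult H h))"


section \<open>Injective resolutions and derived functors\<close>

text \<open>Exactness and monomorphisms of modules over a linear category are objectwise.  Injectivity of
  a module with carriers in a type \<open>'v\<close> refers to extension problems between modules with carriers
  in \<open>'v\<close>, so \<open>'v\<close> plays the role of the universe of the module category.\<close>

definition injective_module ::
  "'k ring \<Rightarrow> ('k, 'o, 'e, 'z) lincat_scheme \<Rightarrow> ('k, 'o, 'e, 'v) rmodule \<Rightarrow> bool" where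
  "injective_module K E I \<longleftrightarrow> right_module K E I \<and>
    (\<forall>(A :: ('k, 'o, 'e, 'v) rmodule) (B :: ('k, 'o, 'e, 'v) rmodule) i g.
      right_module K E A \<and> right_module K E B \<and>
      i \<in> nat_maps K E A B \<and> (\<forall>X\<in>Ob E. inj_on (i X) (carrier (Obj A X))) \<and>
      g \<in> nat_maps K E A I \<longrightarrow>
      (\<exists>g'\<in>nat_maps K E B I. \<forall>X\<in>Ob E. \<forall>a\<in>carrier (Obj A X). g' X (i X a) = g X a))"

definition injective_resolution ::
  "'k ring \<Rightarrow> ('k, 'o, 'e, 'z) lincat_scheme \<Rightarrow> ('k, 'o, 'e, 'v) rmodule
    \<Rightarrow> (nat \<Rightarrow> ('k, 'o, 'e, 'w) rmodule) \<Rightarrow> (nat \<Rightarrow> 'o \<Rightarrow> 'w \<Rightarrow> 'w) \<Rightarrow> ('o \<Rightarrow> 'v \<Rightarrow> 'w) \<Rightarrow> bool" where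
  "injective_resolution K E N I d e \<longleftrightarrow>
    (\<forall>n. injective_module K E (I n)) \<and>
    (\<forall>n. d n \<in> nat_maps K E (I n) (I (Suc n))) \<and>
    e \<in> nat_maps K E N (I 0) \<and>
    (\<forall>X\<in>Ob E. inj_on (e X) (carrier (Obj N X)) \<and>
      e X ` carrier (Obj N X) = cocycles (\<lambda>n. Obj (I n) X) (\<lambda>n. d n X) 0 \<and>
      (\<forall>n. d n X ` carrier (Obj (I n) X) = cocycles (\<lambda>n. Obj (I n) X) (\<lambda>n. d n X) (Suc n)))"

definition injective_H_module ::
  "'k ring \<Rightarrow> ('k, 'h) hopf \<Rightarrow> ('k, 'h, 'v) hmodule \<Rightarrow> bool" where
  "injective_H_module K H I \<longleftrightarrow> left_H_module K H I \<and>
    (\<forall>(A :: ('k, 'h, 'v) hmodule) (B :: ('k, 'h, 'v) hmodule) i g.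
      left_H_module K H A \<and> left_H_module K H B \<and>
      i \<in> H_maps K H A B \<and> inj_on i (carrier A) \<and> g \<in> H_maps K H A I \<longrightarrow>
      (\<exists>g'\<in>H_maps K H B I. \<forall>a\<in>carrier A. g' (i a) = g a))"

definition injective_H_resolution ::
  "'k ring \<Rightarrow> ('k, 'h) hopf \<Rightarrow> ('k, 'h, 'v) hmodule
    \<Rightarrow> (nat \<Rightarrow> ('k, 'h, 'w) hmodule) \<Rightarrow> (nat \<Rightarrow> 'w \<Rightarrow> 'w) \<Rightarrow> ('v \<Rightarrow> 'w) \<Rightarrow> bool" where
  "injective_H_resolution K H V J d e \<longleftrightarrow>
    (\<forall>n. injective_H_module K H (J n)) \<and>
    (\<forall>n. d n \<in> H_maps K H (J n) (J (Suc n))) \<and>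
    e \<in> H_maps K H V (J 0) \<and> inj_on e (carrier V) \<and>
    e ` carrier V = cocycles J d 0 \<and>
    (\<forall>n. d n ` carrier (J n) = cocycles J d (Suc n))"

text \<open>Resolutions of an object with carrier(s) in \<open>'v\<close> are taken in the universe
  \<open>('s, 'v) univ\<close>, where \<open>'s\<close> indexes the operations: \<open>'o \<times> 'e\<close> for modules over a category with
  objects in \<open>'o\<close> and morphisms in \<open>'e\<close>, and \<open>'h\<close> for modules over \<open>H\<close>.  This type contains \<open>'v\<close>
  and, up to injection, is closed under powers with exponent \<open>nat \<times> 's\<close>.  Hence it contains, with
  any module \<open>N\<close>, the cofree module \<open>Y \<mapsto> \<Prod>\<^sub>X Hom\<^sub>K(Hom(X, Y), N X)\<close> (respectively
  \<open>Hom\<^sub>K(H, N)\<close>), which is injective with respect to modules on arbitrary types and into which \<open>N\<close>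
  embeds.  So injective resolutions exist in it, and a module with carriers in it is
  injective relative to it if and only if it is injective relative to every type.\<close>

type_synonym ('s, 'v) univ = "nat \<times> 's \<Rightarrow> 'v"

lemma univ_contains: "\<exists>c :: 'v \<Rightarrow> ('s, 'v) univ. inj c"
  by (rule exI[of _ "\<lambda>v _. v"]) (auto simp: inj_def fun_eq_iff)

lemma univ_closed_power: "\<exists>c :: (nat \<times> 's \<Rightarrow> ('s, 'v) univ) \<Rightarrow> ('s, 'v) univ. inj c"
proof -
  have "infinite (UNIV :: (nat \<times> 's) set)"
    by (simp add: finite_prod)
  from card_of_Times_same_infinite[OF this]
  obtain f :: "(nat \<times> 's) \<times> (nat \<times> 's) \<Rightarrow> nat \<times> 's" where f: "inj f"
    unfolding card_of_ordIso[symmetric] by (auto simp: bij_betw_def)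
  have "inj (\<lambda>(x :: nat \<times> 's \<Rightarrow> ('s, 'v) univ) k. x (fst (inv_into UNIV f k)) (snd (inv_into UNIV f k)))"
  proof (intro injI ext)
    fix x y :: "nat \<times> 's \<Rightarrow> ('s, 'v) univ" and a b
    assume "(\<lambda>k. x (fst (inv_into UNIV f k)) (snd (inv_into UNIV f k))) = (\<lambda>k. y (fst (inv_into UNIV f k)) (snd (inv_into UNIV f k)))"
    from fun_cong[OF this, of "f (a, b)"] show "x a b = y a b"
      using f by simp
  qed
  then show ?thesis by blast
qed

definition chosen_resolution ::
  "'k ring \<Rightarrow> ('k, 'o, 'e, 'z) lincat_scheme \<Rightarrow> ('k, 'o, 'e, 'v) rmodule
    \<Rightarrow> (nat \<Rightarrow> ('k, 'o, 'e, ('o \<times> 'e, 'v) univ) rmodule)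
      \<times> (nat \<Rightarrow> 'o \<Rightarrow> ('o \<times> 'e, 'v) univ \<Rightarrow> ('o \<times> 'e, 'v) univ)
      \<times> ('o \<Rightarrow> 'v \<Rightarrow> ('o \<times> 'e, 'v) univ)" where
  "chosen_resolution K E N = (SOME (I, d, e). injective_resolution K E N I d e)"

definition chosen_H_resolution ::
  "'k ring \<Rightarrow> ('k, 'h) hopf \<Rightarrow> ('k, 'h, 'v) hmodule
    \<Rightarrow> (nat \<Rightarrow> ('k, 'h, ('h, 'v) univ) hmodule)
      \<times> (nat \<Rightarrow> ('h, 'v) univ \<Rightarrow> ('h, 'v) univ)
      \<times> ('v \<Rightarrow> ('h, 'v) univ)" where
  "chosen_H_resolution K H V = (SOME (J, d, e). injective_H_resolution K H V J d e)"

text \<open>\<open>(R\<^sup>n Hom(M, -))(N)\<close> for the functor \<open>Hom(M, -)\<close> from right \<open>E\<close>-modules to vector spaces.\<close>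

definition RHom ::
  "'k ring \<Rightarrow> ('k, 'o, 'e, 'z) lincat_scheme \<Rightarrow> nat \<Rightarrow> ('k, 'o, 'e, 'm) rmodule
    \<Rightarrow> ('k, 'o, 'e, 'n) rmodule \<Rightarrow> ('k, ('o \<Rightarrow> 'm \<Rightarrow> ('o \<times> 'e, 'n) univ) set) module" where
  "RHom K E n M N = (case chosen_resolution K E N of (I, d, e) \<Rightarrow>
     cohomology (\<lambda>i. Hom_Mod K E M (I i)) (\<lambda>i. Hom_Mod_map E M (d i)) n)"

text \<open>\<open>Ext\<^sup>q\<close> over \<open>C\<close> of two right \<open>C#H\<close>-modules, as a left \<open>H\<close>-module: the derived functor of
  \<open>Hom\<^sub>C(M, -)\<close> from right \<open>C#H\<close>-modules to left \<open>H\<close>-modules.  The resolution is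
  one over \<open>C#H\<close>.\<close>

definition H_Ext ::
  "'k ring \<Rightarrow> ('k, 'h) hopf \<Rightarrow> ('k, 'h, 'o, 'c) hcat \<Rightarrow> nat
    \<Rightarrow> ('k, 'o, ('c, 'h) tensor, 'm) rmodule \<Rightarrow> ('k, 'o, ('c, 'h) tensor, 'n) rmodule
    \<Rightarrow> ('k, 'h, ('o \<Rightarrow> 'm \<Rightarrow> ('o \<times> ('c, 'h) tensor, 'n) univ) set) hmodule" where
  "H_Ext K H C q M N = (case chosen_resolution K (smash K H C) N of (I, d, e) \<Rightarrow>
     H_cohomology (\<lambda>i. H_Hom_Mod K H C M (I i)) (\<lambda>i. Hom_Mod_map C M (d i)) q)"

text \<open>The value at \<open>V\<close> of the \<open>p\<close>-th right derived functor of \<open>(-)\<^sup>H\<close>.\<close>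

definition R_invariants ::
  "'k ring \<Rightarrow> ('k, 'h) hopf \<Rightarrow> nat \<Rightarrow> ('k, 'h, 'v) hmodule \<Rightarrow> ('k, ('h, 'v) univ set) module" where
  "R_invariants K H p V = (case chosen_H_resolution K H V of (J, d, e) \<Rightarrow>
     cohomology (\<lambda>i. invariants H (J i)) d p)"


section \<open>Spectral sequences\<close>

text \<open>First quadrant cohomological spectral sequences of vector spaces starting at the second page;
  \<open>d r p q : E r p q \<rightarrow> E r (p + r) (q - r + 1)\<close>.\<close>

locale first_quadrant_spectral_sequence =
  fixes K :: "'k ring"
    and E :: "nat \<Rightarrow> int \<Rightarrow> int \<Rightarrow> ('k, 'v) module"
    and d :: "nat \<Rightarrow> int \<Rightarrow> int \<Rightarrow> 'v \<Rightarrow> 'v"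
  assumes term_space: "\<And>r p q. 2 \<le> r \<Longrightarrow> module K (E r p q)"
    and first_quadrant: "\<And>r p q. 2 \<le> r \<Longrightarrow> p < 0 \<or> q < 0 \<Longrightarrow> carrier (E r p q) = {\<zero>\<^bsub>E r p q\<^esub>}"
    and differential: "\<And>r p q. 2 \<le> r \<Longrightarrow> d r p q \<in> lin_maps K (E r p q) (E r (p + int r) (q - int r + 1))"
    and differential_squared: "\<And>r p q x. 2 \<le> r \<Longrightarrow> x \<in> carrier (E r p q) \<Longrightarrow>
      d r (p + int r) (q - int r + 1) (d r p q x)
        = \<zero>\<^bsub>E r (p + int r + int r) (q - int r + 1 - int r + 1)\<^esub>"
    and next_page: "\<And>r p q. 2 \<le> r \<Longrightarrow> vs_iso K (E (Suc r) p q)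
      (quot_space
        ((E r p q)\<lparr>carrier := {x \<in> carrier (E r p q). d r p q x = \<zero>\<^bsub>E r (p + int r) (q - int r + 1)\<^esub>}\<rparr>)
        (d r (p - int r) (q + int r - 1) ` carrier (E r (p - int r) (q + int r - 1))))"

text \<open>Each \<open>A n\<close> has a finite decreasing filtration \<open>A n = F n 0 \<supseteq> \<dots> \<supseteq> F n (n + 1) = 0\<close> whose
  graded pieces are the limit terms.  In the first quadrant the differentials into and out of
  \<open>E r p q\<close> vanish once \<open>r > p\<close> and \<open>r > q + 1\<close>, so that the limit term at \<open>(p, q)\<close> is \<open>E r p q\<close> for
  any such \<open>r\<close>.\<close>

definition converges_to ::
  "'k ring \<Rightarrow> (nat \<Rightarrow> int \<Rightarrow> int \<Rightarrow> ('k, 'v) module) \<Rightarrow> (nat \<Rightarrow> ('k, 'a) module) \<Rightarrow> bool" where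
  "converges_to K E A \<longleftrightarrow> (\<exists>F :: nat \<Rightarrow> nat \<Rightarrow> 'a set.
     (\<forall>n p. submodule (F n p) K (A n)) \<and>
     (\<forall>n p. F n (Suc p) \<subseteq> F n p) \<and>
     (\<forall>n. F n 0 = carrier (A n)) \<and>
     (\<forall>n. F n (Suc n) = {\<zero>\<^bsub>A n\<^esub>}) \<and>
     (\<forall>p q r. p < r \<and> q + 1 < r \<longrightarrow>
       vs_iso K (E r (int p) (int q))
         (quot_space ((A (p + q))\<lparr>carrier := F (p + q) p\<rparr>) (F (p + q) (Suc p)))))"

end

theory Submission
 imports Defs
begin

text \<open>For an \<open>H\<close>-module \<open>A\<close> let \<open>\<Omega> A\<close> be the space of linear maps \<open>\<phi> : H \<rightarrow> A\<close> with \<open>\<phi> 1 = 0\<close>, with the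
 action \<open>(g \<phi>) h = \<phi> (h g) - h (\<phi> g)\<close>.  The kernel of \<open>\<partial> : A \<rightarrow> \<Omega> A\<close>, \<open>\<partial> a = (h \<mapsto> h a - \<epsilon> h a)\<close>, is
 \<open>A\<^sup>H\<close>, its image lies in the invariants of \<open>\<Omega> A\<close>, and it is all of them if \<open>A\<close> is relatively injective,
 i.e. an equivariant retract of the space of linear maps \<open>H \<rightarrow> A\<close>.  The functor \<open>\<Omega>\<close> is exact and preserves
 relative injectivity.  For a complex \<open>A\<^sup>q\<close> of relatively injective modules, the \<open>\<Omega>\<^sup>p A\<^sup>q\<close> hence form
 a double complex that is exact in the direction of \<open>\<partial>\<close>.  Its exact couple yields a spectral sequence
 which converges to the cohomology of the invariants of \<open>A\<close> and whose second page is
 \<open>(\<Omega>\<^sup>p V)\<^sup>H / \<partial> (\<Omega>\<^sup>p\<^sup>-\<^sup>1 V)\<close> for the cohomology \<open>V\<close> of \<open>A\<close> in degree \<open>q\<close>.  Applied to an injective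
 resolution of \<open>V\<close>, the same construction identifies this with \<open>R\<^sup>p (V)\<^sup>H\<close>.

 With \<open>A\<^sup>q\<close> the \<open>C\<close>-linear maps from \<open>M\<close> to \<open>I\<^sup>q\<close>, the invariants of \<open>A\<^sup>q\<close> are the \<open>C#H\<close>-linear maps.
 They are relatively injective because \<open>I\<^sup>q\<close> is a retract of a cofree \<open>C#H\<close>-module: a linear map
 \<open>\<phi> : H \<rightarrow> A\<^sup>q\<close> is sent to \<open>m \<mapsto> (f # h \<mapsto> \<Sum> \<phi> (S\<^sup>-\<^sup>1 h\<^sub>2) ((m f) h\<^sub>1))\<close>, followed by the retraction.\<close>

section \<open>Linear algebra\<close>

text \<open>The space \<Omega> A is a cokernel in disguise. The map a \<mapsto> (h \<mapsto> h a)
  embeds A into the linear maps H \<rightarrow> A, on which H acts by right translation; subtracting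
  h \<mapsto> h (\<phi> 1) picks the representative with \<phi> 1 = 0 in each class modulo A, and
  translation by g turns into \<phi> (h g) - h (\<phi> g). Invariants of \<Omega> A are the
  derivations \<phi> (h k) = \<epsilon> k (\<phi> h) + h (\<phi> k), the image of \<partial>
  consists of the inner ones, and iterating \<Omega> is dimension shifting. The usual route, a
  Cartan-Eilenberg resolution, would need choices in each degree; \<Omega> is a functor, exact
  because linear maps over a field split.

  The types shape the rest. All pages share one type, and the second page must equal the values of
  the derived functors rather than be isomorphic to them. So the E-term of the couple is a
  parameter, any space isomorphic to the expected one, and the couple is built in its derived form,
  whose first page is already the second. The inverse antipode occurs because h acts on C-linear
  maps through S h.\<close>

abbreviation "car \<equiv> carrier"

text \<open>Unlike \<open>a_minus\<close>, this difference does not depend on the carrier, so that it is the same in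
 subspaces.\<close>

definition dif :: "'k ring => ('k, 'v, 'z) module_scheme => 'v => 'v => 'v" where
 "dif K V x y = x \<oplus>\<^bsub>V\<^esub> (\<ominus>\<^bsub>K\<^esub> \<one>\<^bsub>K\<^esub>) \<odot>\<^bsub>V\<^esub> y"

lemma dif_restrict [simp]: "dif K (V\<lparr>carrier := U\<rparr>) = dif K V"
 by (simp add: dif_def fun_eq_iff)

context
 fixes K :: "'k ring" and V :: "('k, 'v, 'z) module_scheme"
 assumes V: "module K V"
begin

interpretation V: module K V by (rule V)

lemma dif_eq_minus: "x \<in> car V ==> y \<in> car V ==> dif K V x y = x \<ominus>\<^bsub>V\<^esub> y"
 by (simp add: dif_def V.smult_l_minus V.minus_eq)

lemma dif_closed: "x \<in> car V ==> y \<in> car V ==> dif K V x y \<in> car V"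
 by (simp add: dif_eq_minus)

lemma dif_eq_zero_iff: "x \<in> car V ==> y \<in> car V ==> dif K V x y = \<zero>\<^bsub>V\<^esub> \<longleftrightarrow> x = y"
 using V.minus_equality[of x "\<ominus>\<^bsub>V\<^esub> y"] by (auto simp: dif_eq_minus V.minus_eq V.r_neg)

lemma dif_zero: "x \<in> car V ==> dif K V x \<zero>\<^bsub>V\<^esub> = x"
 by (simp add: dif_def)

lemma dif_add_cancel: "x \<in> car V ==> y \<in> car V ==> dif K V x y \<oplus>\<^bsub>V\<^esub> y = x"
 by (simp add: dif_eq_minus V.minus_eq V.a_assoc V.l_neg)

lemma add_dif_cancel: "x \<in> car V ==> y \<in> car V ==> dif K V (x \<oplus>\<^bsub>V\<^esub> y) y = x"
 by (simp add: dif_eq_minus V.minus_eq V.a_assoc V.r_neg)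

lemma add_dif_cancel_left: "x \<in> car V ==> y \<in> car V ==> dif K V (x \<oplus>\<^bsub>V\<^esub> y) x = y"
 using add_dif_cancel[of y x] by (simp add: V.a_comm)

lemma dif_dif_cancel: "x \<in> car V ==> y \<in> car V ==> dif K V x (dif K V x y) = y"
 by (simp add: dif_eq_minus V.minus_eq V.minus_add V.a_assoc[symmetric] V.r_neg)

lemma dif_dif_zero: "x \<in> car V ==> dif K V x x = \<zero>\<^bsub>V\<^esub>"
 by (simp add: dif_eq_zero_iff)

lemma dif_eq_iff: "x \<in> car V ==> y \<in> car V ==> z \<in> car V
  ==> dif K V x y = z \<longleftrightarrow> x = z \<oplus>\<^bsub>V\<^esub> y"
 using dif_add_cancel add_dif_cancel by metis

lemma dif_add_add: "\<lbrakk>x \<in> car V; y \<in> car V; z \<in> car V; w \<in> car V\<rbrakk>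
  \<Longrightarrow> dif K V (x \<oplus>\<^bsub>V\<^esub> y) (z \<oplus>\<^bsub>V\<^esub> w) = dif K V x z \<oplus>\<^bsub>V\<^esub> dif K V y w"
 by (simp add: dif_eq_minus V.minus_eq V.minus_add V.a_ac)

lemma dif_smult: "\<lbrakk>k \<in> car K; x \<in> car V; y \<in> car V\<rbrakk>
  \<Longrightarrow> dif K V (k \<odot>\<^bsub>V\<^esub> x) (k \<odot>\<^bsub>V\<^esub> y) = k \<odot>\<^bsub>V\<^esub> dif K V x y"
 by (simp add: dif_eq_minus V.minus_eq V.smult_r_distr V.smult_r_minus)

lemma dif_trans: "\<lbrakk>x \<in> car V; y \<in> car V; z \<in> car V\<rbrakk>
  \<Longrightarrow> dif K V x y \<oplus>\<^bsub>V\<^esub> dif K V y z = dif K V x z"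
 by (simp add: dif_eq_minus V.minus_eq V.a_assoc V.r_neg1 V.r_neg2)

section \<open>Subspaces\<close>

lemma submodule_iff: "submodule U K V \<longleftrightarrow> U \<subseteq> car V \<and> \<zero>\<^bsub>V\<^esub> \<in> U \<and>
  (\<forall>x\<in>U. \<forall>y\<in>U. x \<oplus>\<^bsub>V\<^esub> y \<in> U) \<and> (\<forall>k\<in>car K. \<forall>x\<in>U. k \<odot>\<^bsub>V\<^esub> x \<in> U)"
proof
 assume U: "submodule U K V"
 show "U \<subseteq> car V \<and> \<zero>\<^bsub>V\<^esub> \<in> U \<and>
  (\<forall>x\<in>U. \<forall>y\<in>U. x \<oplus>\<^bsub>V\<^esub> y \<in> U) \<and> (\<forall>k\<in>car K. \<forall>x\<in>U. k \<odot>\<^bsub>V\<^esub> x \<in> U)"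
  using V.submoduleE[OF U] subgroup.one_closed[OF submodule.axioms(1)[OF U]] by auto
next
 assume U: "U \<subseteq> car V \<and> \<zero>\<^bsub>V\<^esub> \<in> U \<and>
  (\<forall>x\<in>U. \<forall>y\<in>U. x \<oplus>\<^bsub>V\<^esub> y \<in> U) \<and> (\<forall>k\<in>car K. \<forall>x\<in>U. k \<odot>\<^bsub>V\<^esub> x \<in> U)"
 \<comment> \<open>Closure under negation comes from closure under the scalar -1.\<close>
 have "\<ominus>\<^bsub>V\<^esub> a = (\<ominus>\<^bsub>K\<^esub> \<one>\<^bsub>K\<^esub>) \<odot>\<^bsub>V\<^esub> a" if "a \<in> car V" for a
  using that by (simp add: V.smult_l_minus)
 with U have "\<ominus>\<^bsub>V\<^esub> a \<in> U" if "a \<in> U" for a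
  using that by (metis V.R.a_inv_closed V.R.one_closed subsetD)
 with U show "submodule U K V"
  by (intro V.submoduleI) auto
qed

lemma submodule_dif: "submodule U K V ==> x \<in> U ==> y \<in> U ==> dif K V x y \<in> U"
 by (simp add: submodule_iff dif_def)

lemma submodule_dif_iff: "submodule U K V ==> x \<in> car V ==> y \<in> U ==> dif K V x y \<in> U \<longleftrightarrow> x \<in> U"
proof -
 assume U: "submodule U K V" and x: "x \<in> car V" and y: "y \<in> U"
 then have yV: "y \<in> car V" by (auto simp: submodule_iff)
 have "dif K V x y \<oplus>\<^bsub>V\<^esub> y \<in> U" if "dif K V x y \<in> U"
  using that U y by (simp add: submodule_iff)
 then show ?thesis using submodule_dif[OF U _ y] dif_add_cancel[OF x yV] by auto
qed

lemma submodule_module: "submodule U K V ==> module K (V\<lparr>carrier := U\<rparr>)"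
 by (rule submodule.submodule_is_module[OF _ V])

lemma submodule_carrier: "submodule (car V) K V"
 by (rule V.carrier_is_submodule)

lemma submodule_zero: "submodule {\<zero>\<^bsub>V\<^esub>} K V"
 by (simp add: submodule_iff)

lemma submodule_inter: "submodule U K V ==> submodule W K V ==> submodule (U \<inter> W) K V"
 by (auto simp: submodule_iff)

lemma submodule_sum: "submodule U K V ==> submodule W K V
  ==> submodule {x \<oplus>\<^bsub>V\<^esub> y | x y. x \<in> U \<and> y \<in> W} K V"
 unfolding submodule_iff
proof (intro conjI ballI, goal_cases)
 case 1 then show ?case by auto
next
 case 2
 have "\<zero>\<^bsub>V\<^esub> = \<zero>\<^bsub>V\<^esub> \<oplus>\<^bsub>V\<^esub> \<zero>\<^bsub>V\<^esub>" by simp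
 then show ?case using 2 by blast
next
 case (3 x y)
 then obtain a b c d where *: "x = a \<oplus>\<^bsub>V\<^esub> b" "y = c \<oplus>\<^bsub>V\<^esub> d" "a \<in> U" "b \<in> W" "c \<in> U" "d \<in> W" by blast
 then have "x \<oplus>\<^bsub>V\<^esub> y = (a \<oplus>\<^bsub>V\<^esub> c) \<oplus>\<^bsub>V\<^esub> (b \<oplus>\<^bsub>V\<^esub> d)"
  using 3 by (simp add: subset_iff V.a_ac)
 with * 3 show ?case by blast
next
 case (4 k x)
 then obtain a b where *: "x = a \<oplus>\<^bsub>V\<^esub> b" "a \<in> U" "b \<in> W" by blast
 then have "k \<odot>\<^bsub>V\<^esub> x = k \<odot>\<^bsub>V\<^esub> a \<oplus>\<^bsub>V\<^esub> k \<odot>\<^bsub>V\<^esub> b"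
  using 4 by (simp add: subset_iff V.smult_r_distr)
 with * 4 show ?case by blast
qed

lemma submodule_restrict: "submodule U K V ==> submodule W K V ==> W \<subseteq> U
  ==> submodule W K (V\<lparr>carrier := U\<rparr>)"
proof -
 assume *: "submodule U K V" "submodule W K V" "W \<subseteq> U"
 have "module K ((V\<lparr>carrier := U\<rparr>)\<lparr>carrier := W\<rparr>)"
  using submodule_module[OF *(2)] by simp
 with * show ?thesis
  by (intro module.module_incl_imp_submodule[OF submodule_module[OF *(1)]]) auto
qed

end

section \<open>Linear maps, kernels and images\<close>

lemma lin_mapsI:
 assumes "\<And>x. x \<in> car V ==> f x \<in> car W"
  and "\<And>x. x \<notin> car V ==> f x = undefined"
  and "\<And>x y. x \<in> car V ==> y \<in> car V ==> f (x \<oplus>\<^bsub>V\<^esub> y) = f x \<oplus>\<^bsub>W\<^esub> f y"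
  and "\<And>k x. k \<in> car K ==> x \<in> car V ==> f (k \<odot>\<^bsub>V\<^esub> x) = k \<odot>\<^bsub>W\<^esub> f x"
 shows "f \<in> lin_maps K V W"
 using assms by (auto simp: lin_maps_def PiE_def extensional_def)

lemma lin_restrictI:
 assumes V: "module K V"
  and "\<And>x. x \<in> car V ==> f x \<in> car W"
  and "\<And>x y. x \<in> car V ==> y \<in> car V ==> f (x \<oplus>\<^bsub>V\<^esub> y) = f x \<oplus>\<^bsub>W\<^esub> f y"
  and "\<And>k x. k \<in> car K ==> x \<in> car V ==> f (k \<odot>\<^bsub>V\<^esub> x) = k \<odot>\<^bsub>W\<^esub> f x"
 shows "restrict f (car V) \<in> lin_maps K V W"
proof -
 interpret V: module K V by fact
 show ?thesis using assms by (intro lin_mapsI) auto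
qed

lemma lin_closed: "f \<in> lin_maps K V W ==> x \<in> car V ==> f x \<in> car W"
 by (auto simp: lin_maps_def)

lemma lin_undef: "f \<in> lin_maps K V W ==> x \<notin> car V ==> f x = undefined"
 by (auto simp: lin_maps_def PiE_def extensional_def)

lemma lin_add: "f \<in> lin_maps K V W ==> x \<in> car V ==> y \<in> car V
  ==> f (x \<oplus>\<^bsub>V\<^esub> y) = f x \<oplus>\<^bsub>W\<^esub> f y"
 by (auto simp: lin_maps_def)

lemma lin_smult: "f \<in> lin_maps K V W ==> k \<in> car K ==> x \<in> car V
  ==> f (k \<odot>\<^bsub>V\<^esub> x) = k \<odot>\<^bsub>W\<^esub> f x"
 by (auto simp: lin_maps_def)

lemma lin_eqI: "f \<in> lin_maps K V W ==> g \<in> lin_maps K V' W' ==> car V = car V'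
  ==> (\<And>x. x \<in> car V ==> f x = g x) ==> f = g"
 by (rule ext) (metis lin_undef)

lemma lin_zero:
 assumes "f \<in> lin_maps K V W" "module K V" "module K W"
 shows "f \<zero>\<^bsub>V\<^esub> = \<zero>\<^bsub>W\<^esub>"
proof -
 interpret V: module K V by fact
 interpret W: module K W by fact
 have "f \<zero>\<^bsub>V\<^esub> = f (\<zero>\<^bsub>K\<^esub> \<odot>\<^bsub>V\<^esub> \<zero>\<^bsub>V\<^esub>)" by simp
 also have "\<dots> = \<zero>\<^bsub>K\<^esub> \<odot>\<^bsub>W\<^esub> f \<zero>\<^bsub>V\<^esub>"
  by (rule lin_smult[OF assms(1)]) auto
 finally show ?thesis using lin_closed[OF assms(1)] by simp
qed

lemma lin_dif:
 assumes "f \<in> lin_maps K V W" "module K V" "x \<in> car V" "y \<in> car V"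
 shows "f (dif K V x y) = dif K W (f x) (f y)"
proof -
 interpret V: module K V by fact
 show ?thesis using assms by (simp add: dif_def lin_add[OF assms(1)] lin_smult[OF assms(1)])
qed

lemma lin_compose:
 assumes "module K V" "f \<in> lin_maps K V W" "g \<in> lin_maps K W X"
 shows "(\<lambda>x\<in>car V. g (f x)) \<in> lin_maps K V X"
 by (rule lin_restrictI)
  (simp_all add: assms lin_closed[OF assms(2)] lin_closed[OF assms(3)]
   lin_add[OF assms(2)] lin_add[OF assms(3)]
   lin_smult[OF assms(2)] lin_smult[OF assms(3)])

lemma lin_zero_map:
 assumes "module K V" "module K W"
 shows "(\<lambda>x\<in>car V. \<zero>\<^bsub>W\<^esub>) \<in> lin_maps K V W"
proof -
 interpret W: module K W by fact
 show ?thesis by (rule lin_restrictI) (use assms in auto)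
qed

lemma lin_id: "module K V ==> (\<lambda>x\<in>car V. x) \<in> lin_maps K V V"
 by (rule lin_restrictI) auto

lemma lin_restrict_dom:
 assumes "f \<in> lin_maps K V W" "module K V" "submodule U K V" "\<And>x. x \<in> U ==> f x \<in> U'"
 shows "restrict f U \<in> lin_maps K (V\<lparr>carrier := U\<rparr>) (W\<lparr>carrier := U'\<rparr>)"
proof -
 have U: "U \<subseteq> car V" using assms by (simp add: submodule_iff)
 have "restrict f (car (V\<lparr>carrier := U\<rparr>)) \<in> lin_maps K (V\<lparr>carrier := U\<rparr>) (W\<lparr>carrier := U'\<rparr>)"
  by (rule lin_restrictI)
   (use assms U in \<open>auto intro: submodule_module lin_add[OF assms(1)] lin_smult[OF assms(1)]\<close>)
 then show ?thesis by simp
qed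

lemma lin_carrier:
 "f \<in> lin_maps K V W ==> (\<And>x. x \<in> car V ==> f x \<in> U) ==> f \<in> lin_maps K V (W\<lparr>carrier := U\<rparr>)"
 by (auto simp: lin_maps_def)

lemma submodule_vimage:
 assumes "f \<in> lin_maps K V W" "module K V" "module K W" "submodule U K W"
 shows "submodule {x \<in> car V. f x \<in> U} K V"
proof -
 interpret V: module K V by fact
 show ?thesis using assms
  by (auto simp: submodule_iff lin_zero lin_add[OF assms(1)] lin_smult[OF assms(1)])
qed

lemma submodule_kernel:
 assumes "f \<in> lin_maps K V W" "module K V" "module K W"
 shows "submodule {x \<in> car V. f x = \<zero>\<^bsub>W\<^esub>} K V"
 using submodule_vimage[OF assms submodule_zero[OF assms(3)]] by simp

lemma submodule_image:
 assumes "f \<in> lin_maps K V W" "module K V" "module K W" "submodule U K V"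
 shows "submodule (f ` U) K W"
proof -
 interpret V: module K V by fact
 interpret W: module K W by fact
 have U: "U \<subseteq> car V" using assms by (simp add: submodule_iff)
 show ?thesis
  unfolding submodule_iff[OF assms(3)]
 proof (intro conjI ballI, goal_cases)
  case 1 show ?case using U lin_closed[OF assms(1)] by auto
 next
  case 2 show ?case using assms lin_zero[OF assms(1-3)] by (metis imageI submodule_iff)
 next
  case (3 x y)
  then obtain u v where "u \<in> U" "v \<in> U" "x = f u" "y = f v" by auto
  then show ?case using lin_add[OF assms(1), of u v] U assms(4)
   by (metis (no_types, lifting) assms(2) imageI submodule_iff subsetD)
 next
  case (4 k x)
  then obtain u where "u \<in> U" "x = f u" by auto
  then show ?case using lin_smult[OF assms(1), of k u] U assms(4) 4
   by (metis (no_types, lifting) assms(2) imageI submodule_iff subsetD)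
 qed
qed

lemma lin_inj_iff:
 assumes "f \<in> lin_maps K V W" "module K V" "module K W"
 shows "inj_on f (car V) \<longleftrightarrow> (\<forall>x\<in>car V. f x = \<zero>\<^bsub>W\<^esub> \<longrightarrow> x = \<zero>\<^bsub>V\<^esub>)"
proof
 interpret V: module K V by fact
 assume "inj_on f (car V)"
 then show "\<forall>x\<in>car V. f x = \<zero>\<^bsub>W\<^esub> \<longrightarrow> x = \<zero>\<^bsub>V\<^esub>"
  using lin_zero[OF assms] by (metis V.zero_closed inj_onD)
next
 assume *: "\<forall>x\<in>car V. f x = \<zero>\<^bsub>W\<^esub> \<longrightarrow> x = \<zero>\<^bsub>V\<^esub>"
 show "inj_on f (car V)"
 proof (rule inj_onI)
  fix x y assume xy: "x \<in> car V" "y \<in> car V" "f x = f y"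
  then have "f (dif K V x y) = \<zero>\<^bsub>W\<^esub>"
   using assms by (simp add: lin_dif[OF assms(1)] dif_dif_zero lin_closed[OF assms(1)])
  with * xy show "x = y" using dif_eq_zero_iff[OF assms(2)] dif_closed[OF assms(2)] by blast
 qed
qed

text \<open>The axioms of a vector space are identities between the operations, and negatives can be
  taken upstairs; so they pass along any surjection that respects the operations. This supplies the
  structure on quotients, on truncated or extended records and on encodings alike.\<close>

lemma module_surj:
 fixes Q :: "('k, 'w, 'y) module_scheme"
 assumes V: "module K V" and f: "f ` car V = car Q"
  and add: "\<And>x y. x \<in> car V ==> y \<in> car V ==> f x \<oplus>\<^bsub>Q\<^esub> f y = f (x \<oplus>\<^bsub>V\<^esub> y)"
  and smult: "\<And>k x. k \<in> car K ==> x \<in> car V ==> k \<odot>\<^bsub>Q\<^esub> f x = f (k \<odot>\<^bsub>V\<^esub> x)"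
  and zero: "\<zero>\<^bsub>Q\<^esub> = f \<zero>\<^bsub>V\<^esub>"
 shows "module K Q"
proof -
 interpret V: module K V by fact
 have ex: "\<exists>x\<in>car V. q = f x" if "q \<in> car Q" for q
  using that f by auto
 have cl: "f x \<in> car Q" if "x \<in> car V" for x using that f by auto
 show ?thesis
 proof (rule moduleI)
  show "cring K" by (rule V.is_cring)
  show "abelian_group Q"
  proof (rule abelian_groupI)
   show "\<exists>y\<in>car Q. y \<oplus>\<^bsub>Q\<^esub> x = \<zero>\<^bsub>Q\<^esub>" if x: "x \<in> car Q" for x
   proof -
    obtain v where "v \<in> car V" "x = f v" using ex[OF x] by auto
    then show ?thesis
     by (intro bexI[of _ "f (\<ominus>\<^bsub>V\<^esub> v)"]) (simp_all add: add zero cl V.l_neg)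
   qed
  qed (auto dest!: ex simp: add zero cl V.a_assoc, simp add: V.a_comm)
 qed (auto dest!: ex simp: add smult zero cl V.smult_l_distr V.smult_r_distr V.smult_assoc1)
qed

text \<open>Spaces of families are vector spaces because the axioms hold pointwise; \<open>ev x p\<close> is the component
 of \<open>x\<close> at \<open>p\<close>.\<close>

lemma pointwise_module:
 assumes K: "cring K" and W: "\<And>p. p \<in> D ==> module K (W p)"
  and ev: "\<And>x p. x \<in> car Q ==> p \<in> D ==> ev x p \<in> car (W p)"
  and eq: "\<And>x y. x \<in> car Q ==> y \<in> car Q ==> (\<And>p. p \<in> D ==> ev x p = ev y p) ==> x = y"
  and zero: "\<zero>\<^bsub>Q\<^esub> \<in> car Q" "\<And>p. p \<in> D ==> ev \<zero>\<^bsub>Q\<^esub> p = \<zero>\<^bsub>W p\<^esub>"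
  and add: "\<And>x y. x \<in> car Q ==> y \<in> car Q ==> x \<oplus>\<^bsub>Q\<^esub> y \<in> car Q"
   "\<And>x y p. x \<in> car Q ==> y \<in> car Q ==> p \<in> D ==> ev (x \<oplus>\<^bsub>Q\<^esub> y) p = ev x p \<oplus>\<^bsub>W p\<^esub> ev y p"
  and smult: "\<And>k x. k \<in> car K ==> x \<in> car Q ==> k \<odot>\<^bsub>Q\<^esub> x \<in> car Q"
   "\<And>k x p. k \<in> car K ==> x \<in> car Q ==> p \<in> D ==> ev (k \<odot>\<^bsub>Q\<^esub> x) p = k \<odot>\<^bsub>W p\<^esub> ev x p"
 shows "module K Q"
proof -
 interpret K: cring K by fact
 have m: "abelian_monoid (W p)" if "p \<in> D" for p
  using W[OF that] by (simp add: module_def abelian_group_def)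
 note W' = abelian_monoid.a_assoc[OF m] abelian_monoid.l_zero[OF m] module.smult_l_distr[OF W] module.smult_r_distr[OF W]
  module.smult_assoc1[OF W] module.smult_one[OF W]
 note [simp] = ev zero add smult W'
 show ?thesis
 proof (rule moduleI)
  show "abelian_group Q"
  proof (rule abelian_groupI)
   fix x assume x: "x \<in> car Q"
   have "(\<ominus>\<^bsub>K\<^esub> \<one>\<^bsub>K\<^esub>) \<odot>\<^bsub>Q\<^esub> x \<oplus>\<^bsub>Q\<^esub> x = \<zero>\<^bsub>Q\<^esub>"
   proof (rule eq)
    fix p assume p: "p \<in> D"
    interpret W: module K "W p" by (rule W[OF p])
    show "ev ((\<ominus>\<^bsub>K\<^esub> \<one>\<^bsub>K\<^esub>) \<odot>\<^bsub>Q\<^esub> x \<oplus>\<^bsub>Q\<^esub> x) p = ev \<zero>\<^bsub>Q\<^esub> p"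
     using x p by (simp add: W.smult_l_minus W.l_neg)
   qed (use x in simp_all)
   then show "\<exists>y\<in>car Q. y \<oplus>\<^bsub>Q\<^esub> x = \<zero>\<^bsub>Q\<^esub>" using x by (intro bexI[of _ "(\<ominus>\<^bsub>K\<^esub> \<one>\<^bsub>K\<^esub>) \<odot>\<^bsub>Q\<^esub> x"]) simp_all
   show "x \<oplus>\<^bsub>Q\<^esub> y = y \<oplus>\<^bsub>Q\<^esub> x" if "y \<in> car Q" for y
    using x that by (intro eq) (simp_all add: abelian_monoid.a_comm[OF m])
  qed (auto intro!: eq)
 qed (auto intro!: eq simp: K)
qed

section \<open>Quotients, complements and projections\<close>

lemma coset_map:
 assumes V: "module K V" and U: "submodule U K V"
 defines "f \<equiv> \<lambda>x\<in>car V. a_r_coset V U x"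
 shows "module K (quot_space V U)"
  and "f \<in> lin_maps K V (quot_space V U)"
  and "f ` car V = car (quot_space V U)"
  and "\<And>x. x \<in> car V ==> f x = \<zero>\<^bsub>quot_space V U\<^esub> \<longleftrightarrow> x \<in> U"
  and "\<And>k x. k \<in> car K ==> x \<in> car V ==> k \<odot>\<^bsub>quot_space V U\<^esub> f x = f (k \<odot>\<^bsub>V\<^esub> x)"
  and "\<And>x y. x \<in> car V ==> y \<in> car V ==> y \<in> f x \<longleftrightarrow> dif K V y x \<in> U"
proof -
 interpret V: module K V by fact
 have Uc: "U \<subseteq> car V" using U by (simp add: submodule_iff[OF V])
 have asub: "additive_subgroup U V"
  using U by (simp add: additive_subgroup_def submodule_def)
 interpret U: abelian_subgroup U V
  using asub V.abelian_group_axioms by (rule abelian_subgroupI3)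
 show surj: "f ` car V = car (quot_space V U)"
  by (auto simp: f_def quot_space_def A_RCOSETS_def')
 have a_r: "a_r_coset V U x = f x" if "x \<in> car V" for x using that by (simp add: f_def)
 show mem: "y \<in> f x \<longleftrightarrow> dif K V y x \<in> U" if "x \<in> car V" "y \<in> car V" for x y
  using that by (simp add: f_def a_r_coset_def' dif_eq_iff[OF V] dif_closed[OF V] Bex_def) 
   (metis Uc dif_eq_iff[OF V] subsetD dif_closed[OF V])
 have add: "f x \<oplus>\<^bsub>quot_space V U\<^esub> f y = f (x \<oplus>\<^bsub>V\<^esub> y)" if "x \<in> car V" "y \<in> car V" for x y
  using that by (simp add: f_def quot_space_def U.a_rcos_sum)
 show smult: "k \<odot>\<^bsub>quot_space V U\<^esub> f x = f (k \<odot>\<^bsub>V\<^esub> x)" if k: "k \<in> car K" and x: "x \<in> car V" for k x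
 proof -
  \<comment> \<open>All members of a coset give the same scaled coset, so the union in the
    definition of \<open>quot_space\<close> is a union of equal sets.\<close>
  have *: "f (k \<odot>\<^bsub>V\<^esub> a) = f (k \<odot>\<^bsub>V\<^esub> x)" if "a \<in> f x" for a
  proof -
   have a: "a \<in> car V" using that x Uc by (auto simp: f_def a_r_coset_def')
   have "dif K V a x \<in> U" using mem a x that by simp
   then have "k \<odot>\<^bsub>V\<^esub> dif K V a x \<in> U" using U k by (simp add: submodule_iff[OF V])
   then have "dif K V (k \<odot>\<^bsub>V\<^esub> a) (k \<odot>\<^bsub>V\<^esub> x) \<in> U" using k x a by (simp add: dif_smult[OF V])
   then have "k \<odot>\<^bsub>V\<^esub> a \<in> f (k \<odot>\<^bsub>V\<^esub> x)" using mem k x a by simp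
   then show ?thesis using V.a_repr_independence[of "k \<odot>\<^bsub>V\<^esub> a" U "k \<odot>\<^bsub>V\<^esub> x"] k x a U
    by (simp add: f_def submodule_def)
  qed
  have ne: "x \<in> f x" using x U.a_rcos_self by (simp add: f_def)
  have cl: "a \<in> car V" if "a \<in> f x" for a
   using that x Uc by (auto simp: f_def a_r_coset_def')
  have "k \<odot>\<^bsub>quot_space V U\<^esub> f x = (\<Union>a\<in>f x. a_r_coset V U (k \<odot>\<^bsub>V\<^esub> a))"
   by (simp add: quot_space_def)
  also have "\<dots> = (\<Union>a\<in>f x. f (k \<odot>\<^bsub>V\<^esub> a))"
   using k by (intro SUP_cong refl a_r) (auto dest: cl)
  also have "\<dots> = (\<Union>a\<in>f x. f (k \<odot>\<^bsub>V\<^esub> x))"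
   using * by simp
  finally show ?thesis using ne by auto
 qed
 have zero: "\<zero>\<^bsub>quot_space V U\<^esub> = f \<zero>\<^bsub>V\<^esub>"
  using Uc by (simp add: quot_space_def f_def)
 show "f x = \<zero>\<^bsub>quot_space V U\<^esub> \<longleftrightarrow> x \<in> U" if x: "x \<in> car V" for x
 proof
  assume "f x = \<zero>\<^bsub>quot_space V U\<^esub>"
  then have "f x = U" by (simp add: quot_space_def)
  then show "x \<in> U" using x U.a_rcos_self by (auto simp: f_def)
 next
  assume "x \<in> U"
  then show "f x = \<zero>\<^bsub>quot_space V U\<^esub>"
   using x V.a_coset_join2[of x U] U by (simp add: quot_space_def f_def submodule_def)
 qed
 show "module K (quot_space V U)"
  by (rule module_surj[OF V surj add smult zero])
 show "f \<in> lin_maps K V (quot_space V U)"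
  unfolding f_def
  by (rule lin_restrictI[OF V]) (use add smult a_r surj in auto)
qed

text \<open>By Zorn's lemma some W is maximal among the subspaces that meet U only in zero. For x
  outside W, maximality forces a nonzero u = w + k x in U; here k is invertible, and solving for x
  writes it as an element of W plus an element of U.\<close>

lemma exists_complement:
 assumes K: "field K" and V: "module K V" and U: "submodule U K V"
 obtains W where "submodule W K V" "W \<inter> U = {\<zero>\<^bsub>V\<^esub>}"
  "\<And>x. x \<in> car V ==> \<exists>w\<in>W. dif K V x w \<in> U"
proof -
 interpret V: module K V by fact
 interpret K: field K by fact
 let ?A = "{W. submodule W K V \<and> W \<inter> U = {\<zero>\<^bsub>V\<^esub>}}"
 have U0: "\<zero>\<^bsub>V\<^esub> \<in> U" "U \<subseteq> car V" using U by (auto simp: submodule_iff[OF V])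
 have "\<exists>W\<in>?A. \<forall>X\<in>?A. W \<subseteq> X \<longrightarrow> X = W"
 proof (rule subset_Zorn_nonempty)
  show "?A \<noteq> {}" using submodule_zero[OF V] U0 by blast
  fix C assume C: "C \<noteq> {}" "subset.chain ?A C"
  have sub: "submodule W K V" "W \<inter> U = {\<zero>\<^bsub>V\<^esub>}" if "W \<in> C" for W
   using C(2) that by (auto simp: subset_chain_def)
  have "submodule (\<Union>C) K V"
   unfolding submodule_iff[OF V]
  proof (intro conjI ballI)
   show "\<Union>C \<subseteq> car V" using sub(1) unfolding submodule_iff[OF V] by blast
   show "\<zero>\<^bsub>V\<^esub> \<in> \<Union>C" using C(1) sub(2) by blast
   fix x y assume "x \<in> \<Union>C" "y \<in> \<Union>C"
   then obtain X Y where XY: "X \<in> C" "Y \<in> C" "x \<in> X" "y \<in> Y" by blast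
   then have "X \<subseteq> Y \<or> Y \<subseteq> X" using C(2) unfolding subset_chain_def by blast
   with XY obtain W where "W \<in> C" "x \<in> W" "y \<in> W" by blast
   then show "x \<oplus>\<^bsub>V\<^esub> y \<in> \<Union>C" using sub(1)[of W] by (auto simp: submodule_iff[OF V])
  next
   fix k x assume "k \<in> car K" "x \<in> \<Union>C"
   then show "k \<odot>\<^bsub>V\<^esub> x \<in> \<Union>C" using sub(1) unfolding submodule_iff[OF V] by blast
  qed
  moreover have "\<Union>C \<inter> U = {\<zero>\<^bsub>V\<^esub>}" using C(1) sub(2) by blast
  ultimately show "\<Union>C \<in> ?A" by blast
 qed
 then obtain W where WA: "W \<in> ?A" and maxA: "\<forall>X\<in>?A. W \<subseteq> X \<longrightarrow> X = W" ..
 have W: "submodule W K V" "W \<inter> U = {\<zero>\<^bsub>V\<^esub>}" using WA by simp_all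
 have max: "X = W" if "submodule X K V" "X \<inter> U = {\<zero>\<^bsub>V\<^esub>}" "W \<subseteq> X" for X
  using maxA that by simp
 have W0: "\<zero>\<^bsub>V\<^esub> \<in> W" "W \<subseteq> car V" using W by (auto simp: submodule_iff[OF V])
 have "\<exists>w\<in>W. dif K V x w \<in> U" if x: "x \<in> car V" for x
 proof (cases "x \<in> W")
  case True
  then show ?thesis using x U0 by (intro bexI[of _ x]) (auto simp: dif_dif_zero[OF V])
 next
  case False
  let ?L = "(\<lambda>k. k \<odot>\<^bsub>V\<^esub> x) ` car K"
  have L: "submodule ?L K V"
   unfolding submodule_iff[OF V]
  proof (intro conjI ballI)
   show "?L \<subseteq> car V" using x by auto
   show "\<zero>\<^bsub>V\<^esub> \<in> ?L" using x by (intro image_eqI[of _ _ "\<zero>\<^bsub>K\<^esub>"]) auto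
   show "a \<oplus>\<^bsub>V\<^esub> b \<in> ?L" if ab: "a \<in> ?L" "b \<in> ?L" for a b
   proof -
    obtain k l where kl: "k \<in> car K" "l \<in> car K" "a = k \<odot>\<^bsub>V\<^esub> x" "b = l \<odot>\<^bsub>V\<^esub> x" using ab by auto
    then have "a \<oplus>\<^bsub>V\<^esub> b = (k \<oplus>\<^bsub>K\<^esub> l) \<odot>\<^bsub>V\<^esub> x" using x by (simp add: V.smult_l_distr)
    then show ?thesis using kl by auto
   qed
   show "c \<odot>\<^bsub>V\<^esub> a \<in> ?L" if c: "c \<in> car K" "a \<in> ?L" for c a
   proof -
    obtain k where kl: "k \<in> car K" "a = k \<odot>\<^bsub>V\<^esub> x" using c by auto
    then have "c \<odot>\<^bsub>V\<^esub> a = (c \<otimes>\<^bsub>K\<^esub> k) \<odot>\<^bsub>V\<^esub> x" using x c by (simp add: V.smult_assoc1)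
    then show ?thesis using kl c by auto
   qed
  qed
  let ?X = "{w \<oplus>\<^bsub>V\<^esub> l | w l. w \<in> W \<and> l \<in> ?L}"
  have X: "submodule ?X K V" by (rule submodule_sum[OF V W(1) L])
  have "W \<subseteq> ?X"
  proof
   fix w assume "w \<in> W"
   then have "w = w \<oplus>\<^bsub>V\<^esub> \<zero>\<^bsub>K\<^esub> \<odot>\<^bsub>V\<^esub> x" using W0 x by auto
   then show "w \<in> ?X" using \<open>w \<in> W\<close> by blast
  qed
  moreover have "x \<in> ?X"
  proof -
   have "x = \<zero>\<^bsub>V\<^esub> \<oplus>\<^bsub>V\<^esub> \<one>\<^bsub>K\<^esub> \<odot>\<^bsub>V\<^esub> x" using x by simp
   then show ?thesis using W0 by blast
  qed
  ultimately have "?X \<inter> U \<noteq> {\<zero>\<^bsub>V\<^esub>}" using max[OF X] False by blast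
  moreover have "\<zero>\<^bsub>V\<^esub> \<in> ?X \<inter> U" using \<open>W \<subseteq> ?X\<close> W0 U0 by blast
  ultimately obtain u where u: "u \<in> U" "u \<in> ?X" "u \<noteq> \<zero>\<^bsub>V\<^esub>" by blast
  then obtain w k where wk: "w \<in> W" "k \<in> car K" "u = w \<oplus>\<^bsub>V\<^esub> k \<odot>\<^bsub>V\<^esub> x" by blast
  have wV: "w \<in> car V" using wk W0 by auto
  \<comment> \<open>Otherwise u = w would be a nonzero common element of W and U.\<close>
  have "k \<noteq> \<zero>\<^bsub>K\<^esub>"
  proof
   assume "k = \<zero>\<^bsub>K\<^esub>"
   then have "u = w" using wk wV x by simp
   then show False using u wk W(2) by blast
  qed
  then have k: "inv\<^bsub>K\<^esub> k \<in> car K" "inv\<^bsub>K\<^esub> k \<otimes>\<^bsub>K\<^esub> k = \<one>\<^bsub>K\<^esub>"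
   using wk(2) K.field_Units by auto
  let ?w = "(\<ominus>\<^bsub>K\<^esub> \<one>\<^bsub>K\<^esub>) \<odot>\<^bsub>V\<^esub> (inv\<^bsub>K\<^esub> k \<odot>\<^bsub>V\<^esub> w)"
  have w': "?w \<in> W" using W(1) wk k by (simp add: submodule_iff[OF V])
  have "?w = \<ominus>\<^bsub>V\<^esub> (inv\<^bsub>K\<^esub> k \<odot>\<^bsub>V\<^esub> w)"
   using wV k by (simp add: V.smult_l_minus)
  then have "dif K V x ?w = inv\<^bsub>K\<^esub> k \<odot>\<^bsub>V\<^esub> u"
   using wV wk k x
   by (simp add: dif_eq_minus[OF V] V.minus_eq V.smult_r_distr V.smult_assoc1[symmetric] V.a_comm)
  moreover have "inv\<^bsub>K\<^esub> k \<odot>\<^bsub>V\<^esub> u \<in> U" using U u k by (simp add: submodule_iff[OF V])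
  ultimately show ?thesis using w' by (metis (no_types, lifting))
 qed
 with W that show ?thesis by blast
qed

text \<open>Two candidates for the component of x in a complement differ by an element of both
  subspaces, so the component is unique; uniqueness makes the chosen component additive and
  homogeneous in x.\<close>

lemma exists_projection:
 assumes K: "field K" and V: "module K V" and U: "submodule U K V"
 shows "\<exists>p\<in>lin_maps K V V. (\<forall>x\<in>car V. p (p x) = p x) \<and>
  (\<forall>x\<in>car V. p x = \<zero>\<^bsub>V\<^esub> \<longleftrightarrow> x \<in> U) \<and> (\<forall>x\<in>car V. dif K V x (p x) \<in> U)"
proof -
 interpret V: module K V by fact
 obtain W where W: "submodule W K V" "W \<inter> U = {\<zero>\<^bsub>V\<^esub>}"
  and ex: "\<And>x. x \<in> car V ==> \<exists>w\<in>W. dif K V x w \<in> U"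
  using exists_complement[OF assms] by blast
 have W0: "W \<subseteq> car V" "\<zero>\<^bsub>V\<^esub> \<in> W" using W by (auto simp: submodule_iff[OF V])
 have uniq: "w = w'" if "w \<in> W" "w' \<in> W" "x \<in> car V" "dif K V x w \<in> U" "dif K V x w' \<in> U" for x w w'
 proof -
  have "dif K V (dif K V x w') (dif K V x w) \<in> U" using that U submodule_dif[OF V] by blast
  moreover have "dif K V (dif K V x w') (dif K V x w) = dif K V w w'"
  proof -
   have c: "w \<in> car V" "w' \<in> car V" using that W0 by auto
   have "dif K V x w' = dif K V x w \<oplus>\<^bsub>V\<^esub> dif K V w w'" using dif_trans[OF V] that c by metis
   then show ?thesis
    using add_dif_cancel_left[OF V, of "dif K V x w" "dif K V w w'"] dif_closed[OF V] that c by simp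
  qed
  moreover have "dif K V w w' \<in> W" using that W submodule_dif[OF V] by blast
  ultimately have "dif K V w w' = \<zero>\<^bsub>V\<^esub>" using W(2) by auto
  then show ?thesis using that W0 by (simp add: subset_iff dif_eq_zero_iff[OF V])
 qed
 define p where "p = (\<lambda>x\<in>car V. SOME w. w \<in> W \<and> dif K V x w \<in> U)"
 have p: "p x \<in> W" "dif K V x (p x) \<in> U" if "x \<in> car V" for x
  using someI_ex[of "\<lambda>w. w \<in> W \<and> dif K V x w \<in> U"] ex[OF that] that by (auto simp: p_def)
 have peq: "p x = w" if "x \<in> car V" "w \<in> W" "dif K V x w \<in> U" for x w
  using p that uniq by blast
 have pc: "p x \<in> car V" if "x \<in> car V" for x using p that W0 by auto
 show ?thesis
 proof (rule bexI[of _ p], intro conjI ballI)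
  show "p \<in> lin_maps K V V"
  proof (rule lin_mapsI)
   fix x y assume x: "x \<in> car V" and y: "y \<in> car V"
   have "dif K V x (p x) \<oplus>\<^bsub>V\<^esub> dif K V y (p y) \<in> U"
    using p x y U by (simp add: submodule_iff[OF V])
   then have "dif K V (x \<oplus>\<^bsub>V\<^esub> y) (p x \<oplus>\<^bsub>V\<^esub> p y) \<in> U"
    using x y pc by (simp add: dif_add_add[OF V])
   then show "p (x \<oplus>\<^bsub>V\<^esub> y) = p x \<oplus>\<^bsub>V\<^esub> p y"
    using x y p W(1) by (intro peq) (auto simp: submodule_iff[OF V])
  next
   fix k x assume k: "k \<in> car K" and x: "x \<in> car V"
   have "k \<odot>\<^bsub>V\<^esub> dif K V x (p x) \<in> U" using p x k U by (simp add: submodule_iff[OF V])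
   then have "dif K V (k \<odot>\<^bsub>V\<^esub> x) (k \<odot>\<^bsub>V\<^esub> p x) \<in> U" using x k pc by (simp add: dif_smult[OF V])
   then show "p (k \<odot>\<^bsub>V\<^esub> x) = k \<odot>\<^bsub>V\<^esub> p x"
    using x k p W(1) by (intro peq) (auto simp: submodule_iff[OF V])
  qed (auto simp: pc, simp add: p_def)
  fix x assume x: "x \<in> car V"
  show "p (p x) = p x"
   using p x pc U by (intro peq) (auto simp: dif_dif_zero[OF V] submodule_iff[OF V])
  show "dif K V x (p x) \<in> U" using p x by blast
  show "p x = \<zero>\<^bsub>V\<^esub> \<longleftrightarrow> x \<in> U"
  proof
   assume "p x = \<zero>\<^bsub>V\<^esub>" then show "x \<in> U" using p(2)[OF x] x by (simp add: dif_zero[OF V])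
  next
   assume "x \<in> U" then show "p x = \<zero>\<^bsub>V\<^esub>" using x W0 by (intro peq) (auto simp: dif_zero[OF V])
  qed
 qed
qed

text \<open>The quotient by \<open>U\<close> is represented by a complement of \<open>U\<close>, so that all pages of a spectral sequence
 have the same type.\<close>

definition prj :: "'k ring => ('k, 'v, 'z) module_scheme => 'v set => 'v => 'v" where
 "prj K V U = (SOME p. p \<in> lin_maps K V V \<and> (\<forall>x\<in>car V. p (p x) = p x) \<and>
  (\<forall>x\<in>car V. p x = \<zero>\<^bsub>V\<^esub> \<longleftrightarrow> x \<in> U) \<and> (\<forall>x\<in>car V. dif K V x (p x) \<in> U))"

definition qspace :: "'k ring => ('k, 'v, 'z) module_scheme => 'v set => ('k, 'v, 'z) module_scheme" where
 "qspace K V U = V\<lparr>carrier := prj K V U ` car V\<rparr>"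

lemma qspace_simps [simp]:
 "add (qspace K V U) = add V" "zero (qspace K V U) = zero V" "smult (qspace K V U) = smult V"
 by (simp_all add: qspace_def)

lemma
 assumes K: "field K" and V: "module K V" and U: "submodule U K V"
 shows prj_endo: "prj K V U \<in> lin_maps K V V"
  and prj_idem: "x \<in> car V ==> prj K V U (prj K V U x) = prj K V U x"
  and prj_eq_zero: "x \<in> car V ==> prj K V U x = \<zero>\<^bsub>V\<^esub> \<longleftrightarrow> x \<in> U"
  and prj_dif: "x \<in> car V ==> dif K V x (prj K V U x) \<in> U"
  and prj_lin: "prj K V U \<in> lin_maps K V (qspace K V U)"
  and qspace_carrier: "car (qspace K V U) = prj K V U ` car V"
  and qspace_subset: "car (qspace K V U) \<subseteq> car V"
  and qspace_submodule: "submodule (car (qspace K V U)) K V"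
  and qspace_module: "module K (qspace K V U)"
proof -
 have "\<exists>p. p \<in> lin_maps K V V \<and> (\<forall>x\<in>car V. p (p x) = p x) \<and>
  (\<forall>x\<in>car V. p x = \<zero>\<^bsub>V\<^esub> \<longleftrightarrow> x \<in> U) \<and> (\<forall>x\<in>car V. dif K V x (p x) \<in> U)"
  using exists_projection[OF assms] by blast
 from someI_ex[OF this, folded prj_def]
 have *: "prj K V U \<in> lin_maps K V V"
  "\<And>x. x \<in> car V ==> prj K V U (prj K V U x) = prj K V U x"
  "\<And>x. x \<in> car V ==> prj K V U x = \<zero>\<^bsub>V\<^esub> \<longleftrightarrow> x \<in> U"
  "\<And>x. x \<in> car V ==> dif K V x (prj K V U x) \<in> U" by auto
 show "prj K V U \<in> lin_maps K V V" by (rule *)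
 show "x \<in> car V ==> prj K V U (prj K V U x) = prj K V U x"
  "x \<in> car V ==> prj K V U x = \<zero>\<^bsub>V\<^esub> \<longleftrightarrow> x \<in> U"
  "x \<in> car V ==> dif K V x (prj K V U x) \<in> U"
  by (rule *, assumption)+
 show c: "car (qspace K V U) = prj K V U ` car V" by (simp add: qspace_def)
 show "prj K V U \<in> lin_maps K V (qspace K V U)"
  unfolding qspace_def by (rule lin_carrier[OF *(1)]) auto
 show s: "submodule (car (qspace K V U)) K V"
  unfolding c by (rule submodule_image[OF *(1) V V submodule_carrier[OF V]])
 show "car (qspace K V U) \<subseteq> car V" using s by (simp add: submodule_iff[OF V])
 show "module K (qspace K V U)"
  using submodule_module[OF V s] by (simp add: qspace_def)
qed

text \<open>Lifts of x along a differ by elements of the kernel of a, which b kills, so b of an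
  arbitrary lift is a linear function of x. The maps of the exact couple of a double complex, which
  are zigzags on representatives, are obtained in this way.\<close>

lemma lin_factor:
 assumes L: "module K L" and X: "module K X" and Y: "module K Y"
  and a: "a \<in> lin_maps K L X" and b: "b \<in> lin_maps K L Y"
  and surj: "a ` car L = car X"
  and ker: "\<And>l. l \<in> car L ==> a l = \<zero>\<^bsub>X\<^esub> ==> b l = \<zero>\<^bsub>Y\<^esub>"
 shows "\<exists>f\<in>lin_maps K X Y. \<forall>l\<in>car L. f (a l) = b l"
proof -
 interpret L: module K L by fact
 have eq: "b l = b l'" if "l \<in> car L" "l' \<in> car L" "a l = a l'" for l l'
 proof -
  have "a (dif K L l l') = \<zero>\<^bsub>X\<^esub>"
   using that by (simp add: lin_dif[OF a L] dif_dif_zero[OF X] lin_closed[OF a])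
  then have "b (dif K L l l') = \<zero>\<^bsub>Y\<^esub>" using ker that dif_closed[OF L] by blast
  then show ?thesis
   using that by (simp add: lin_dif[OF b L] dif_eq_zero_iff[OF Y] lin_closed[OF b])
 qed
 define g where "g x = (SOME l. l \<in> car L \<and> a l = x)" for x
 have g: "g x \<in> car L" "a (g x) = x" if "x \<in> car X" for x
  using someI_ex[of "\<lambda>l. l \<in> car L \<and> a l = x"] that surj unfolding g_def by (metis (lifting) imageE)+
 define f where "f = (\<lambda>x\<in>car X. b (g x))"
 have f: "f (a l) = b l" if "l \<in> car L" for l
 proof -
  have al: "a l \<in> car X" using lin_closed[OF a that] .
  then show ?thesis using eq[OF g(1)[OF al] that g(2)[OF al]] by (simp add: f_def)
 qed
 have ex: "\<exists>l\<in>car L. x = a l" if "x \<in> car X" for x using that surj by auto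
 have "f \<in> lin_maps K X Y"
 proof (rule lin_mapsI)
  show "f x \<in> car Y" if "x \<in> car X" for x
   using ex[OF that] f lin_closed[OF b] by auto
  show "f x = undefined" if "x \<notin> car X" for x using that by (simp add: f_def)
  fix x assume "x \<in> car X"
  then obtain l where l: "l \<in> car L" "x = a l" using ex by blast
  { fix y assume "y \<in> car X"
   then obtain m where m: "m \<in> car L" "y = a m" using ex by blast
   then show "f (x \<oplus>\<^bsub>X\<^esub> y) = f x \<oplus>\<^bsub>Y\<^esub> f y"
    using l f[of "l \<oplus>\<^bsub>L\<^esub> m"] by (simp add: f lin_add[OF a] lin_add[OF b]) }
  fix k assume "k \<in> car K"
  then show "f (k \<odot>\<^bsub>X\<^esub> x) = k \<odot>\<^bsub>Y\<^esub> f x"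
   using l f[of "k \<odot>\<^bsub>L\<^esub> l"] by (simp add: f lin_smult[OF a] lin_smult[OF b])
 qed
 with f show ?thesis by blast
qed

text \<open>First project W onto the image of f, then go back to a complement of the kernel of f.
  Wherever preimages have to be chosen linearly, this is the source of the choice: in the
  differentials, in the exactness of \<Omega> and in the injectivity of cofree modules.\<close>

lemma lin_pseudo_inverse:
 assumes K: "field K" and V: "module K V" and W: "module K W" and f: "f \<in> lin_maps K V W"
 shows "\<exists>s\<in>lin_maps K W V. \<forall>x\<in>car V. f (s (f x)) = f x"
proof -
 let ?Kf = "{x \<in> car V. f x = \<zero>\<^bsub>W\<^esub>}" and ?I = "f ` car V"
 have kf: "submodule ?Kf K V" by (rule submodule_kernel[OF f V W])
 have im: "submodule ?I K W" by (rule submodule_image[OF f V W submodule_carrier[OF V]])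
 let ?p = "prj K V ?Kf" and ?W = "W\<lparr>carrier := ?I\<rparr>"
 have f': "f \<in> lin_maps K V ?W" by (rule lin_carrier[OF f]) auto
 have W': "module K ?W" by (rule submodule_module[OF W im])
 obtain s where s: "s \<in> lin_maps K ?W V" "\<forall>l\<in>car V. s (f l) = ?p l"
  using lin_factor[OF V W' V f' prj_endo[OF K V kf]] prj_eq_zero[OF K V kf] by auto
 let ?q = "prj K W ?I"
 have q: "?q \<in> lin_maps K W W" by (rule prj_endo[OF K W im])
 interpret W: module K W by fact
 \<comment> \<open>\<open>?q\<close> has the image of f as its kernel, so x - \<open>?q\<close> x is
   the component of x in that image.\<close>
 let ?t = "\<lambda>x\<in>car W. dif K W x (?q x)"
 have qc: "?q x \<in> car W" if "x \<in> car W" for x using that lin_closed[OF q] by simp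
 have t: "?t \<in> lin_maps K W ?W"
 proof (rule lin_restrictI[OF W])
  show "dif K W x (?q x) \<in> car ?W" if "x \<in> car W" for x
   using prj_dif[OF K W im that] by simp
 qed (simp_all add: lin_add[OF q] lin_smult[OF q] dif_add_add[OF W] dif_smult[OF W] qc)
 have t1: "?t (f x) = f x" if "x \<in> car V" for x
  using that prj_eq_zero[OF K W im, of "f x"] lin_closed[OF f] by (simp add: dif_zero[OF W])
 have t2: "f (s (f x)) = f x" if "x \<in> car V" for x
 proof -
  have px: "?p x \<in> car V" using that lin_closed[OF prj_endo[OF K V kf]] by blast
  have "dif K W (f x) (f (?p x)) = \<zero>\<^bsub>W\<^esub>"
   using prj_dif[OF K V kf that] lin_dif[OF f V that px] by simp
  then have "f x = f (?p x)"
   using dif_eq_zero_iff[OF W lin_closed[OF f that] lin_closed[OF f px]] by simp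
  then have "f (?p x) = f x" by simp
  then show ?thesis using s(2) that by simp
 qed
 have *: "f (s (?t (f x))) = f x" if "x \<in> car V" for x
  by (simp only: t1[OF that] t2[OF that])
 have "(\<lambda>x\<in>car W. s (?t x)) \<in> lin_maps K W V" by (rule lin_compose[OF W t s(1)])
 then show ?thesis
 proof (rule bexI[rotated], intro ballI)
  fix x assume "x \<in> car V"
  then show "f ((\<lambda>x\<in>car W. s (?t x)) (f x)) = f x"
   using *[of x] lin_closed[OF f, of x] by (simp only: restrict_apply if_True)
 qed
qed

section \<open>Isomorphisms\<close>

lemma lin_inverse:
 assumes f: "f \<in> lin_maps K V W" and V: "module K V" and bij: "bij_betw f (car V) (car W)"
 defines "g \<equiv> restrict (inv_into (car V) f) (car W)"
 shows "g \<in> lin_maps K W V" "bij_betw g (car W) (car V)"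
  "\<And>x. x \<in> car V ==> g (f x) = x" "\<And>y. y \<in> car W ==> f (g y) = y"
proof -
 interpret V: module K V by fact
 show gf: "g (f x) = x" if "x \<in> car V" for x
  using that bij lin_closed[OF f] by (simp add: g_def bij_betw_def)
 show "f (g y) = y" if "y \<in> car W" for y
  using that bij by (simp add: g_def bij_betw_def f_inv_into_f)
 have ex: "\<exists>x\<in>car V. y = f x" if "y \<in> car W" for y
  using that bij by (auto simp: bij_betw_def)
 show "g \<in> lin_maps K W V"
 proof (rule lin_mapsI)
  show "g y = undefined" if "y \<notin> car W" for y using that by (simp add: g_def)
 next
  fix y assume "y \<in> car W"
  then obtain x where "x \<in> car V" "y = f x" using ex by blast
  then show "g y \<in> car V" using gf by simp
 next
  fix y z assume "y \<in> car W" "z \<in> car W"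
  then obtain u v where "u \<in> car V" "y = f u" "v \<in> car V" "z = f v" using ex by meson
  then show "g (y \<oplus>\<^bsub>W\<^esub> z) = g y \<oplus>\<^bsub>V\<^esub> g z"
   using gf lin_add[OF f, symmetric] by simp
 next
  fix k y assume "k \<in> car K" "y \<in> car W"
  then obtain u where "u \<in> car V" "y = f u" using ex by blast
  then show "g (k \<odot>\<^bsub>W\<^esub> y) = k \<odot>\<^bsub>V\<^esub> g y"
   using gf lin_smult[OF f, symmetric] \<open>k \<in> car K\<close> by simp
 qed
 show "bij_betw g (car W) (car V)"
  unfolding g_def using bij_betw_inv_into[OF bij] by (simp cong: bij_betw_cong)
qed

lemma vs_iso_sym: "module K V ==> vs_iso K V W ==> vs_iso K W V"
 unfolding vs_iso_def using lin_inverse(1,2) by blast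

lemma vs_iso_trans: "module K V ==> vs_iso K V W ==> vs_iso K W X ==> vs_iso K V X"
 unfolding vs_iso_def
proof (elim bexE)
 fix f g assume V: "module K V" and f: "f \<in> lin_maps K V W" "bij_betw f (car V) (car W)"
  and g: "g \<in> lin_maps K W X" "bij_betw g (car W) (car X)"
 show "\<exists>h\<in>lin_maps K V X. bij_betw h (car V) (car X)"
  using lin_compose[OF V f(1) g(1)] bij_betw_trans[OF f(2) g(2)]
  by (auto simp: comp_def intro!: bexI[of _ "\<lambda>x\<in>car V. g (f x)"] cong: bij_betw_cong)
qed

lemma vs_iso_refl: "module K V ==> vs_iso K V V"
 unfolding vs_iso_def using lin_id
 by (intro bexI[of _ "\<lambda>x\<in>car V. x"]) (auto simp: bij_betw_def inj_on_def)

lemma bij_betw_linI: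
 assumes X: "module K X" and Y: "module K Y" and f: "f \<in> lin_maps K X Y"
  and ker: "\<And>x. x \<in> car X ==> f x = \<zero>\<^bsub>Y\<^esub> ==> x = \<zero>\<^bsub>X\<^esub>"
  and surj: "\<And>y. y \<in> car Y ==> \<exists>x\<in>car X. f x = y"
 shows "bij_betw f (car X) (car Y)"
 unfolding bij_betw_def
proof
 show "inj_on f (car X)" using lin_inj_iff[OF f X Y] ker by blast
 show "f ` car X = car Y" using surj lin_closed[OF f] by force
qed

text \<open>Both spaces are quotients of L by the same kernel.\<close>

lemma lin_iso_span:
 assumes L: "module K L" and X: "module K X" and Y: "module K Y"
  and a: "a \<in> lin_maps K L X" and b: "b \<in> lin_maps K L Y"
  and a_surj: "a ` car L = car X" and b_surj: "b ` car L = car Y"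
  and ker: "\<And>l. l \<in> car L ==> a l = \<zero>\<^bsub>X\<^esub> \<longleftrightarrow> b l = \<zero>\<^bsub>Y\<^esub>"
 obtains f where "f \<in> lin_maps K X Y" "bij_betw f (car X) (car Y)"
  "\<And>l. l \<in> car L ==> f (a l) = b l"
proof -
 obtain f where f: "f \<in> lin_maps K X Y" "\<forall>l\<in>car L. f (a l) = b l"
  using lin_factor[OF L X Y a b a_surj] ker by blast
 have "bij_betw f (car X) (car Y)"
 proof (rule bij_betw_linI[OF X Y f(1)])
  fix x assume x: "x \<in> car X" "f x = \<zero>\<^bsub>Y\<^esub>"
  then obtain l where "l \<in> car L" "x = a l" using a_surj by blast
  then show "x = \<zero>\<^bsub>X\<^esub>" using x f(2) ker by simp
 next
  fix y assume "y \<in> car Y"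
  then obtain l where l: "l \<in> car L" "y = b l" using b_surj by blast
  then show "\<exists>x\<in>car X. f x = y" using f(2) lin_closed[OF a] by blast
 qed
 with f that show ?thesis by blast
qed

text \<open>Composing b with the quotient map reduces this to two quotients of L by one kernel, and
  b has to reach Y only modulo U. It is the form in which pages are compared with
  subquotients.\<close>

lemma vs_iso_quot_span:
 assumes L: "module K L" and X: "module K X" and Y: "module K Y" and U: "submodule U K Y"
  and a: "a \<in> lin_maps K L X" and b: "b \<in> lin_maps K L Y"
  and surj: "a ` car L = car X"
  and ex: "\<And>y. y \<in> car Y ==> \<exists>l\<in>car L. dif K Y y (b l) \<in> U"
  and ker: "\<And>l. l \<in> car L ==> a l = \<zero>\<^bsub>X\<^esub> \<longleftrightarrow> b l \<in> U"
 shows "vs_iso K X (quot_space Y U)"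
proof -
 let ?q = "\<lambda>x\<in>car Y. a_r_coset Y U x" and ?Q = "quot_space Y U"
 note q = coset_map[OF Y U]
 let ?b = "\<lambda>l\<in>car L. ?q (b l)"
 have b': "?b \<in> lin_maps K L ?Q" by (rule lin_compose[OF L b q(2)])
 have "?b ` car L = car ?Q"
 proof
  show "?b ` car L \<subseteq> car ?Q" using lin_closed[OF b'] by blast
  show "car ?Q \<subseteq> ?b ` car L"
  proof
   fix z assume "z \<in> car ?Q"
   then obtain y where y: "y \<in> car Y" "z = ?q y" using q(3) by blast
   then obtain l where l: "l \<in> car L" "dif K Y y (b l) \<in> U" using ex by blast
   have bl: "b l \<in> car Y" using l lin_closed[OF b] by blast
   then have "?q (dif K Y y (b l)) = \<zero>\<^bsub>?Q\<^esub>" using q(4)[of "dif K Y y (b l)"] l y dif_closed[OF Y] by simp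
   then have "dif K ?Q (?q y) (?q (b l)) = \<zero>\<^bsub>?Q\<^esub>"
    using lin_dif[OF q(2) Y y(1) bl] by metis
   then have "?q y = ?q (b l)"
    using dif_eq_zero_iff[OF q(1)] lin_closed[OF q(2)] y(1) bl by metis
   then show "z \<in> ?b ` car L" using l y by (intro image_eqI[of _ _ l]) auto
  qed
 qed
 moreover have "a l = \<zero>\<^bsub>X\<^esub> \<longleftrightarrow> ?b l = \<zero>\<^bsub>?Q\<^esub>" if "l \<in> car L" for l
  using that ker q(4)[of "b l"] lin_closed[OF b] by simp
 ultimately obtain f where "f \<in> lin_maps K X ?Q" "bij_betw f (car X) (car ?Q)"
  using lin_iso_span[OF L X q(1) a b' surj] by metis
 then show ?thesis by (auto simp: vs_iso_def)
qed

section \<open>Exact couples\<close>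

text \<open>The degrees (-1, 1), (0, 0) and (2, -1) of i, j and k are those of a derived couple: j
  after k has the bidegree of the differential on a second page. D vanishes below the quadrant only
  for p \<ge> 0. To the left of it E is zero, hence i is bijective there, and D keeps repeating the
  values that it has at p = 0.\<close>

locale exact_couple =
 fixes K :: "'k ring"
  and D :: "int => int => ('k, 'u) module"
  and E :: "int => int => ('k, 'v) module"
  and i :: "int => int => 'u => 'u"
  and j :: "int => int => 'u => 'v"
  and k :: "int => int => 'v => 'u"
 assumes K: "field K"
  and D: "\<And>p q. module K (D p q)"
  and E: "\<And>p q. module K (E p q)"
  and i: "\<And>p q. i p q \<in> lin_maps K (D p q) (D (p - 1) (q + 1))"
  and j: "\<And>p q. j p q \<in> lin_maps K (D p q) (E p q)"
  and k: "\<And>p q. k p q \<in> lin_maps K (E p q) (D (p + 2) (q - 1))"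
  and exact_i: "\<And>p q y. y \<in> car (D p q) ==>
   i p q y = \<zero>\<^bsub>D (p - 1) (q + 1)\<^esub> \<longleftrightarrow> y \<in> k (p - 2) (q + 1) ` car (E (p - 2) (q + 1))"
  and exact_j: "\<And>p q y. y \<in> car (D p q) ==>
   j p q y = \<zero>\<^bsub>E p q\<^esub> \<longleftrightarrow> y \<in> i (p + 1) (q - 1) ` car (D (p + 1) (q - 1))"
  and exact_k: "\<And>p q x. x \<in> car (E p q) ==>
   k p q x = \<zero>\<^bsub>D (p + 2) (q - 1)\<^esub> \<longleftrightarrow> x \<in> j p q ` car (D p q)"
  and E_trivial: "\<And>p q. p < 0 \<or> q < 0 ==> car (E p q) = {\<zero>\<^bsub>E p q\<^esub>}"
  and D_trivial: "\<And>p q. 0 \<le> p ==> q < 0 ==> car (D p q) = {\<zero>\<^bsub>D p q\<^esub>}"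
begin

lemma D0 [simp]: "\<zero>\<^bsub>D p q\<^esub> \<in> car (D p q)" and E0 [simp]: "\<zero>\<^bsub>E p q\<^esub> \<in> car (E p q)"
 using submodule_zero[OF D] submodule_zero[OF E] by (auto simp: submodule_iff[OF D] submodule_iff[OF E])

lemma i_closed: "y \<in> car (D p q) ==> i p q y \<in> car (D (p - 1) (q + 1))"
 by (rule lin_closed[OF i])

lemma i_closed': "y \<in> car (D (p + 1) (q - 1)) ==> i (p + 1) (q - 1) y \<in> car (D p q)"
 using i_closed[of y "p + 1" "q - 1"] by simp

lemma j_closed: "y \<in> car (D p q) ==> j p q y \<in> car (E p q)"
 by (rule lin_closed[OF j])

lemma k_closed: "x \<in> car (E p q) ==> k p q x \<in> car (D (p + 2) (q - 1))"
 by (rule lin_closed[OF k])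

section \<open>Iterates of i, cycles, boundaries and pages\<close>

abbreviation "sp s p \<equiv> p + (int s + 2)"
abbreviation "sq s q \<equiv> q - (int s + 2) + 1"

fun it :: "nat => int => int => 'u => 'u" where
 "it 0 p q = (\<lambda>y\<in>car (D p q). y)"
| "it (Suc s) p q = (\<lambda>y\<in>car (D p q). it s (p - 1) (q + 1) (i p q y))"

lemma it_lin: "it s p q \<in> lin_maps K (D p q) (D (p - int s) (q + int s))"
proof (induction s arbitrary: p q)
 case 0
 show ?case using lin_id[OF D] by (simp only: it.simps of_nat_0 diff_0_right add_0_right)
next
 case (Suc s)
 have "p - 1 - int s = p - int (Suc s)" "q + 1 + int s = q + int (Suc s)" by simp_all
 then show ?case using lin_compose[OF D i Suc.IH[of "p - 1" "q + 1"]] by (simp only: it.simps)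
qed

lemma it_lin2: "it s (sp s p) (sq s q)
  \<in> lin_maps K (D (sp s p) (sq s q)) (D (p + 2) (q - 1))"
proof -
 have "p + (int s + 2) - int s = p + 2" "q - (int s + 2) + 1 + int s = q - 1" by simp_all
 then show ?thesis using it_lin[of s "sp s p" "sq s q"] by (simp only:)
qed

lemma it_lin0: "it p (int p) (int n - int p) \<in> lin_maps K (D (int p) (int n - int p)) (D 0 (int n))"
 using it_lin[of p "int p" "int n - int p"] by simp

lemma it_Suc_right: "y \<in> car (D p q) ==> it (Suc s) p q y = i (p - int s) (q + int s) (it s p q y)"
proof (induction s arbitrary: p q y)
 case 0 then show ?case by (simp add: i_closed)
next
 case (Suc s)
 have "p - 1 - int s = p - int (Suc s)" "q + 1 + int s = q + int (Suc s)" by simp_all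
 moreover have "it (Suc (Suc s)) p q y = it (Suc s) (p - 1) (q + 1) (i p q y)"
  using Suc.prems by (simp del: it.simps add: it.simps(2)[of "Suc s"])
 moreover have "it (Suc s) p q y = it s (p - 1) (q + 1) (i p q y)" using Suc.prems by simp
 ultimately show ?case using Suc.IH[OF i_closed[OF Suc.prems]] by (simp only:)
qed

text \<open>The closed description of all derived couples at once: a cycle is mapped by k into the
  image of the iterate of i, and a boundary is the image under j of an element of its kernel. Hence
  no recursion over pages occurs. The index s belongs to page r = s + 2, and (\<open>sp s p\<close>,
  \<open>sq s q\<close>) is the target of the differential of that page.\<close>

definition cyc :: "nat => int => int => 'v set" where
 "cyc s p q = {x \<in> car (E p q). k p q x \<in>
  it s (sp s p) (sq s q) ` car (D (sp s p) (sq s q))}"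

definition bnd :: "nat => int => int => 'v set" where
 "bnd s p q = j p q ` {y \<in> car (D p q). it s p q y = \<zero>\<^bsub>D (p - int s) (q + int s)\<^esub>}"

abbreviation "cspace s p q \<equiv> (E p q)\<lparr>carrier := cyc s p q\<rparr>"
abbreviation "proj s p q \<equiv> prj K (cspace s p q) (bnd s p q)"

definition page :: "nat => int => int => ('k, 'v) module" where
 "page s p q = qspace K (cspace s p q) (bnd s p q)"

lemma page_simps [simp]:
 "add (page s p q) = add (E p q)" "zero (page s p q) = zero (E p q)" "smult (page s p q) = smult (E p q)"
 "dif K (page s p q) = dif K (E p q)"
 by (simp_all add: page_def dif_def fun_eq_iff)

lemma cyc_sub: "submodule (cyc s p q) K (E p q)"
 unfolding cyc_def
 by (rule submodule_vimage[OF k E D submodule_image[OF it_lin2 D D submodule_carrier[OF D]]])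

lemma cspace_module: "module K (cspace s p q)"
 by (rule submodule_module[OF E cyc_sub])

lemma bnd_sub_E: "submodule (bnd s p q) K (E p q)"
 unfolding bnd_def by (rule submodule_image[OF j D E submodule_kernel[OF it_lin D D]])

lemma kj: "y \<in> car (D p q) ==> k p q (j p q y) = \<zero>\<^bsub>D (p + 2) (q - 1)\<^esub>"
 using exact_k[OF j_closed] by blast

lemma ji: "y \<in> car (D (p + 1) (q - 1)) ==> j p q (i (p + 1) (q - 1) y) = \<zero>\<^bsub>E p q\<^esub>"
 using exact_j[OF i_closed'] by blast

lemma j_cyc: "y \<in> car (D p q) ==> j p q y \<in> cyc s p q"
 using submodule_image[OF it_lin2 D D submodule_carrier[OF D], of s p q]
 by (simp add: cyc_def j_closed kj submodule_iff[OF D])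

lemma bnd_cyc: "bnd s p q \<subseteq> cyc s p q"
 by (auto simp: bnd_def j_cyc)

lemma bnd_sub: "submodule (bnd s p q) K (cspace s p q)"
 by (rule submodule_restrict[OF E cyc_sub bnd_sub_E bnd_cyc])

lemma cyc_subset: "cyc s p q \<subseteq> car (E p q)"
 by (auto simp: cyc_def)

lemmas proj_endo = prj_endo[OF K cspace_module bnd_sub]
lemmas proj_idem = prj_idem[OF K cspace_module bnd_sub]
lemmas proj_lin = prj_lin[OF K cspace_module bnd_sub, folded page_def]
lemmas page_module = qspace_module[OF K cspace_module bnd_sub, folded page_def]
lemmas page_subset = qspace_subset[OF K cspace_module bnd_sub, folded page_def, simplified]
lemmas page_carrier = qspace_carrier[OF K cspace_module bnd_sub, folded page_def, simplified]

lemma proj_eq_zero: "x \<in> cyc s p q ==> proj s p q x = \<zero>\<^bsub>E p q\<^esub> \<longleftrightarrow> x \<in> bnd s p q"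
 using prj_eq_zero[OF K cspace_module bnd_sub, of x] by simp

lemma proj_dif: "x \<in> cyc s p q ==> dif K (E p q) x (proj s p q x) \<in> bnd s p q"
 using prj_dif[OF K cspace_module bnd_sub, of x] by simp

lemma proj_closed: "x \<in> cyc s p q ==> proj s p q x \<in> car (page s p q)"
 by (simp add: page_carrier)

lemma proj_page: "x \<in> car (page s p q) ==> proj s p q x = x"
 using proj_idem[of _ s p q] by (auto simp: page_carrier)

lemma k_bnd: "x \<in> bnd s p q ==> k p q x = \<zero>\<^bsub>D (p + 2) (q - 1)\<^esub>"
 by (auto simp: bnd_def kj)

text \<open>The projection moves x by a boundary, and boundaries lie in the image of j, which k
  kills.\<close>

lemma k_proj: assumes x: "x \<in> cyc s p q" shows "k p q (proj s p q x) = k p q x"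
proof -
 have px: "proj s p q x \<in> car (E p q)" "x \<in> car (E p q)"
  using x proj_closed page_subset cyc_subset by blast+
 have "dif K (D (p + 2) (q - 1)) (k p q x) (k p q (proj s p q x)) = \<zero>\<^bsub>D (p + 2) (q - 1)\<^esub>"
  using k_bnd[OF proj_dif[OF x]] lin_dif[OF k E px(2,1)] by simp
 then show ?thesis using dif_eq_zero_iff[OF D] k_closed px by metis
qed

text \<open>A linear choice of preimages under the iterate of i. It makes the differential linear by
  construction; \<open>diff_eq\<close> shows that its values do not depend on the choice.\<close>

definition sec :: "nat => int => int => 'u => 'u" where
 "sec s p q = (SOME f. f \<in> lin_maps K (D (p + 2) (q - 1)) (D (sp s p) (sq s q)) \<and>
  (\<forall>y\<in>car (D (sp s p) (sq s q)).
   it s (sp s p) (sq s q) (f (it s (sp s p) (sq s q) y))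
    = it s (sp s p) (sq s q) y))"

lemma sec: "sec s p q \<in> lin_maps K (D (p + 2) (q - 1)) (D (sp s p) (sq s q))"
 and it_sec: "y \<in> car (D (sp s p) (sq s q)) ==>
   it s (sp s p) (sq s q) (sec s p q (it s (sp s p) (sq s q) y))
    = it s (sp s p) (sq s q) y"
 using someI_ex[OF lin_pseudo_inverse[OF K D D it_lin2, unfolded Bex_def], folded sec_def] by blast+

definition diff :: "nat => int => int => 'v => 'v" where
 "diff s p q = (\<lambda>x\<in>car (page s p q).
  proj s (sp s p) (sq s q) (j (sp s p) (sq s q) (sec s p q (k p q x))))"

lemma diff_lin: "diff s p q \<in> lin_maps K (page s p q) (page s (sp s p) (sq s q))"
proof -
 define P Q where "P = p + (int s + 2)" and "Q = q - (int s + 2) + 1"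
 have E': "x \<in> car (E p q)" if "x \<in> car (page s p q)" for x
  using that page_subset cyc_subset by blast
 have j': "j P Q \<in> lin_maps K (D P Q) (cspace s P Q)"
  by (rule lin_carrier[OF j j_cyc])
 have sec': "sec s p q \<in> lin_maps K (D (p + 2) (q - 1)) (D P Q)"
  unfolding P_def Q_def by (rule sec)
 have pl: "proj s P Q \<in> lin_maps K (cspace s P Q) (page s P Q)" by (rule proj_lin)
 have "k p q (x \<oplus>\<^bsub>E p q\<^esub> y) = k p q x \<oplus>\<^bsub>D (p + 2) (q - 1)\<^esub> k p q y"
  if "x \<in> car (page s p q)" "y \<in> car (page s p q)" for x y
  using that by (intro lin_add[OF k] E')
 moreover have "k p q (c \<odot>\<^bsub>E p q\<^esub> x) = c \<odot>\<^bsub>D (p + 2) (q - 1)\<^esub> k p q x"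
  if "c \<in> car K" "x \<in> car (page s p q)" for x c
  using that by (intro lin_smult[OF k] E')
 ultimately show ?thesis
  unfolding diff_def P_def[symmetric] Q_def[symmetric]
  by (intro lin_restrictI[OF page_module])
   (simp_all add: lin_closed[OF pl] lin_add[OF pl, simplified] lin_smult[OF pl, simplified]
    lin_closed[OF j', simplified] lin_add[OF j', simplified] lin_smult[OF j', simplified]
    lin_closed[OF sec'] lin_add[OF sec'] lin_smult[OF sec'] k_closed E')
qed

text \<open>Two preimages of k x under the iterate of i differ by an element of the kernel of the
  iterate, and j sends such an element to a boundary by the definition of \<open>bnd\<close>. So the
  differential may be computed with any preimage.\<close>

lemma diff_eq:
 assumes x: "x \<in> cyc s p q" and y: "y \<in> car (D (sp s p) (sq s q))"
  and eq: "it s (sp s p) (sq s q) y = k p q x"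
 shows "diff s p q (proj s p q x) = proj s (sp s p) (sq s q) (j (sp s p) (sq s q) y)"
proof -
 let ?p = "sp s p" and ?q = "sq s q"
 let ?y = "sec s p q (k p q x)"
 have xE: "x \<in> car (E p q)" using x cyc_subset by blast
 have y': "?y \<in> car (D ?p ?q)" using lin_closed[OF sec] k_closed[OF xE] by blast
 have "it s ?p ?q ?y = it s ?p ?q y" using it_sec[OF y] eq by simp
 then have "it s ?p ?q (dif K (D ?p ?q) ?y y) = \<zero>\<^bsub>D (p + 2) (q - 1)\<^esub>"
  using y y' by (simp only: lin_dif[OF it_lin2 D y' y] dif_dif_zero[OF D lin_closed[OF it_lin2 y]])
 moreover have "p + 2 = ?p - int s" "q - 1 = ?q + int s" by simp_all
 ultimately have "j ?p ?q (dif K (D ?p ?q) ?y y) \<in> bnd s ?p ?q"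
  unfolding bnd_def using dif_closed[OF D y' y] by (intro imageI) (simp only: mem_Collect_eq simp_thms)
 then have "dif K (E ?p ?q) (j ?p ?q ?y) (j ?p ?q y) \<in> bnd s ?p ?q"
  by (simp only: lin_dif[OF j D y' y])
 then have "proj s ?p ?q (dif K (E ?p ?q) (j ?p ?q ?y) (j ?p ?q y)) = \<zero>\<^bsub>E ?p ?q\<^esub>"
  using proj_eq_zero bnd_cyc by blast
 moreover have "proj s ?p ?q (dif K (E ?p ?q) (j ?p ?q ?y) (j ?p ?q y))
   = dif K (E ?p ?q) (proj s ?p ?q (j ?p ?q ?y)) (proj s ?p ?q (j ?p ?q y))"
  using lin_dif[OF proj_endo cspace_module, of "j ?p ?q ?y" s ?p ?q "j ?p ?q y"] j_cyc[OF y'] j_cyc[OF y] by simp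
 moreover have "proj s ?p ?q (j ?p ?q ?y) \<in> car (E ?p ?q)" "proj s ?p ?q (j ?p ?q y) \<in> car (E ?p ?q)"
  using proj_closed j_cyc y y' page_subset cyc_subset by blast+
 ultimately have "proj s ?p ?q (j ?p ?q ?y) = proj s ?p ?q (j ?p ?q y)"
  using dif_eq_zero_iff[OF E] by metis
 then show ?thesis using proj_closed[OF x] k_proj[OF x] by (simp add: diff_def)
qed

lemma cycE: assumes "x \<in> cyc s p q"
 obtains y where "y \<in> car (D (sp s p) (sq s q))"
  "it s (sp s p) (sq s q) y = k p q x"
 using assms by (auto simp: cyc_def)

text \<open>If the differential kills x, then j y = j y' for some y' that the iterate kills. The
  difference y - y' is killed by j, hence is a value i w, and it is still mapped to k x by the
  iterate: k x comes from one step further out. Conversely j kills the values of i.\<close>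

lemma cyc_Suc_iff:
 assumes x: "x \<in> cyc s p q"
 shows "x \<in> cyc (Suc s) p q \<longleftrightarrow> diff s p q (proj s p q x) = \<zero>\<^bsub>E (sp s p) (sq s q)\<^esub>"
proof -
 let ?p = "sp s p" and ?q = "sq s q"
 have idx: "p + (int (Suc s) + 2) = ?p + 1" "q - (int (Suc s) + 2) + 1 = ?q - 1" by simp_all
 have xE: "x \<in> car (E p q)" using x cyc_subset by blast
 have itS: "it (Suc s) (?p + 1) (?q - 1) y = it s ?p ?q (i (?p + 1) (?q - 1) y)" if "y \<in> car (D (?p + 1) (?q - 1))" for y
  using that by (simp only: it.simps restrict_apply if_True add_diff_cancel_right' diff_add_cancel)
 show ?thesis
 proof
  assume "x \<in> cyc (Suc s) p q"
  then obtain y where y: "y \<in> car (D (?p + 1) (?q - 1))" "it (Suc s) (?p + 1) (?q - 1) y = k p q x"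
   by (elim cycE) (simp only: idx)
  have iy: "i (?p + 1) (?q - 1) y \<in> car (D ?p ?q)" by (rule i_closed'[OF y(1)])
  have "diff s p q (proj s p q x) = proj s ?p ?q (j ?p ?q (i (?p + 1) (?q - 1) y))"
   using y(2) by (intro diff_eq[OF x iy]) (simp only: itS[OF y(1)])
  also have "\<dots> = \<zero>\<^bsub>E ?p ?q\<^esub>"
   using ji[OF y(1)] lin_zero[OF proj_endo cspace_module cspace_module] by simp
  finally show "diff s p q (proj s p q x) = \<zero>\<^bsub>E ?p ?q\<^esub>" .
 next
  assume d: "diff s p q (proj s p q x) = \<zero>\<^bsub>E ?p ?q\<^esub>"
  obtain y where y: "y \<in> car (D ?p ?q)" "it s ?p ?q y = k p q x" using cycE[OF x] .
  have "j ?p ?q y \<in> bnd s ?p ?q"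
   using d diff_eq[OF x y] proj_eq_zero[OF j_cyc[OF y(1)]] by simp
  then obtain y' where y': "y' \<in> car (D ?p ?q)" "it s ?p ?q y' = \<zero>\<^bsub>D (?p - int s) (?q + int s)\<^esub>"
   "j ?p ?q y = j ?p ?q y'" by (auto simp: bnd_def)
  have z: "?p - int s = p + 2" "?q + int s = q - 1" by simp_all
  have yy: "dif K (D ?p ?q) y y' \<in> car (D ?p ?q)" by (rule dif_closed[OF D y(1) y'(1)])
  have "j ?p ?q (dif K (D ?p ?q) y y') = \<zero>\<^bsub>E ?p ?q\<^esub>"
   using y'(3) by (simp only: lin_dif[OF j D y(1) y'(1)] dif_dif_zero[OF E j_closed[OF y'(1)]])
  then obtain w where w: "w \<in> car (D (?p + 1) (?q - 1))" "dif K (D ?p ?q) y y' = i (?p + 1) (?q - 1) w"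
   using exact_j[OF yy] by blast
  have "it (Suc s) (?p + 1) (?q - 1) w = it s ?p ?q (dif K (D ?p ?q) y y')"
   by (simp only: itS[OF w(1)] w(2))
  also have "\<dots> = dif K (D (p + 2) (q - 1)) (k p q x) \<zero>\<^bsub>D (p + 2) (q - 1)\<^esub>"
   using y'(2) by (simp only: lin_dif[OF it_lin2 D y(1) y'(1)] y(2) z)
  also have "\<dots> = k p q x" by (rule dif_zero[OF D k_closed[OF xE]])
  finally show "x \<in> cyc (Suc s) p q"
   unfolding cyc_def idx using w(1) xE by (simp only: mem_Collect_eq simp_thms) (metis imageI)
 qed
qed

lemma cyc_Suc_subset: "cyc (Suc s) p q \<subseteq> cyc s p q"
proof
 let ?p = "sp s p" and ?q = "sq s q"
 fix x assume x: "x \<in> cyc (Suc s) p q"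
 have idx: "p + (int (Suc s) + 2) = ?p + 1" "q - (int (Suc s) + 2) + 1 = ?q - 1" by simp_all
 from x obtain y where y: "y \<in> car (D (?p + 1) (?q - 1))" "it (Suc s) (?p + 1) (?q - 1) y = k p q x"
  by (elim cycE) (simp only: idx)
 then have "it s ?p ?q (i (?p + 1) (?q - 1) y) = k p q x"
  by (simp only: it.simps restrict_apply if_True add_diff_cancel_right' diff_add_cancel)
 then show "x \<in> cyc s p q"
  using i_closed'[OF y(1)] x cyc_subset unfolding cyc_def by (metis (lifting) imageI mem_Collect_eq)
qed

lemma bnd_Suc_supset: "bnd s p q \<subseteq> bnd (Suc s) p q"
proof -
 have "it (Suc s) p q y = \<zero>\<^bsub>D (p - int (Suc s)) (q + int (Suc s))\<^esub>"
  if "y \<in> car (D p q)" "it s p q y = \<zero>\<^bsub>D (p - int s) (q + int s)\<^esub>" for y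
 proof -
  have "it (Suc s) p q y = \<zero>\<^bsub>D (p - int s - 1) (q + int s + 1)\<^esub>"
   using that it_Suc_right[OF that(1), of s] lin_zero[OF i D D] by simp
  moreover have "p - int s - 1 = p - int (Suc s)" "q + int s + 1 = q + int (Suc s)" by simp_all
  ultimately show ?thesis by (simp only:)
 qed
 then show ?thesis unfolding bnd_def by blast
qed

text \<open>By exactness, one more application of i kills the s-fold iterate of y exactly if that
  iterate is some k x. Then y is a preimage of k x, so j y represents the differential of x. The
  indices \<open>p0\<close> and \<open>q0\<close> are those of the source of the differential ending
  at (p, q).\<close>

lemma diff_image:
 defines "p0 p s \<equiv> p - (int s + 2)" and "q0 q s \<equiv> q + (int s + 2) - 1"
 shows "diff s (p0 p s) (q0 q s) ` car (page s (p0 p s) (q0 q s)) = proj s p q ` bnd (Suc s) p q"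
proof -
 let ?p = "p0 p s" and ?q = "q0 q s"
 have idx: "?p + (int s + 2) = p" "?q - (int s + 2) + 1 = q" by (simp_all add: p0_def q0_def)
 have idx2: "?p + 2 = p - int s" "?q - 1 = q + int s" by (simp_all add: p0_def q0_def)
 have idx3: "p - int s - 2 = ?p" "q + int s + 1 = ?q" "p - int s - 1 = p - int (Suc s)" by (simp_all add: p0_def q0_def)
 have ker: "it (Suc s) p q y = \<zero>\<^bsub>D (p - int (Suc s)) (q + int (Suc s))\<^esub> \<longleftrightarrow> (\<exists>x\<in>car (E ?p ?q). it s p q y = k ?p ?q x)"
  if y: "y \<in> car (D p q)" for y
 proof -
  have "it s p q y \<in> car (D (p - int s) (q + int s))" using lin_closed[OF it_lin y] .
  from exact_i[OF this]
  have "it (Suc s) p q y = \<zero>\<^bsub>D (p - int s - 1) (q + int s + 1)\<^esub> \<longleftrightarrow>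
    it s p q y \<in> k (p - int s - 2) (q + int s + 1) ` car (E (p - int s - 2) (q + int s + 1))"
   by (simp only: it_Suc_right[OF y])
  moreover have "q + int s + 1 = q + int (Suc s)" by simp
  ultimately show ?thesis unfolding idx3 image_iff by metis
 qed
 show ?thesis
 proof (intro equalityI subsetI)
  fix z assume "z \<in> diff s ?p ?q ` car (page s ?p ?q)"
  then obtain x where x: "x \<in> cyc s ?p ?q" "z = diff s ?p ?q (proj s ?p ?q x)"
   by (auto simp: page_carrier)
  then obtain y where y: "y \<in> car (D p q)" "it s p q y = k ?p ?q x"
   by (elim cycE) (simp only: idx)
  then have "z = proj s p q (j p q y)" using x diff_eq[OF x(1), of y] by (simp only: idx)
  moreover have "j p q y \<in> bnd (Suc s) p q"
   unfolding bnd_def using y x(1) cyc_subset ker[OF y(1)] by blast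
  ultimately show "z \<in> proj s p q ` bnd (Suc s) p q" by blast
 next
  fix z assume "z \<in> proj s p q ` bnd (Suc s) p q"
  then obtain y where y: "y \<in> car (D p q)" "z = proj s p q (j p q y)"
   "it (Suc s) p q y = \<zero>\<^bsub>D (p - int (Suc s)) (q + int (Suc s))\<^esub>"
   unfolding bnd_def by blast
  then obtain x where x: "x \<in> car (E ?p ?q)" "it s p q y = k ?p ?q x" using ker by blast
  then have xc: "x \<in> cyc s ?p ?q"
   unfolding cyc_def idx using y(1) by (metis (lifting) imageI mem_Collect_eq)
  have "diff s ?p ?q (proj s ?p ?q x) = z"
   using diff_eq[OF xc, of y] x(2) y(1,2) by (simp only: idx)
  then show "z \<in> diff s ?p ?q ` car (page s ?p ?q)" using proj_closed[OF xc] by blast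
 qed
qed

lemma bnd_cyc_Suc: "bnd (Suc s) p q \<subseteq> cyc s p q"
 using bnd_cyc cyc_Suc_subset by blast

text \<open>The kernel of the projection, the boundaries of page s, is contained in the boundaries
  of the next page; membership in the latter can therefore be tested after projecting.\<close>

lemma proj_bnd_iff:
 assumes x: "x \<in> cyc (Suc s) p q"
 shows "proj s p q x \<in> proj s p q ` bnd (Suc s) p q \<longleftrightarrow> x \<in> bnd (Suc s) p q"
proof
 assume "proj s p q x \<in> proj s p q ` bnd (Suc s) p q"
 then obtain b where b: "b \<in> bnd (Suc s) p q" "proj s p q x = proj s p q b" by blast
 have c: "x \<in> cyc s p q" "b \<in> cyc s p q" using x b cyc_Suc_subset bnd_cyc_Suc by blast+
 have "proj s p q (dif K (E p q) x b) = \<zero>\<^bsub>E p q\<^esub>"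
  using lin_dif[OF proj_endo cspace_module, of x s p q b] c b(2)
   dif_dif_zero[OF cspace_module, of "proj s p q b" s p q] lin_closed[OF proj_endo, of b s p q] by simp
 moreover have "dif K (E p q) x b \<in> cyc s p q" by (rule submodule_dif[OF E cyc_sub c])
 ultimately have "dif K (E p q) x b \<in> bnd (Suc s) p q" using proj_eq_zero bnd_Suc_supset by blast
 moreover have "x \<in> car (E p q)" using c cyc_subset by blast
 ultimately show "x \<in> bnd (Suc s) p q" using submodule_dif_iff[OF E bnd_sub_E _ b(1)] by blast
qed auto

text \<open>Both sides are quotients of the cycles of the next page by its boundaries:
  \<open>cyc_Suc_iff\<close> finds the kernel of the differential and \<open>diff_image\<close> its
  image.\<close>

lemma next_page:
 "vs_iso K (page (Suc s) p q)
  (quot_space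
   ((page s p q)\<lparr>carrier := {x \<in> car (page s p q). diff s p q x = \<zero>\<^bsub>page s (sp s p) (sq s q)\<^esub>}\<rparr>)
   (diff s (p - (int s + 2)) (q + (int s + 2) - 1) ` car (page s (p - (int s + 2)) (q + (int s + 2) - 1))))"
 (is "vs_iso K _ (quot_space (_\<lparr>carrier := ?Y\<rparr>) ?T)")
proof -
 let ?U = "proj s p q ` bnd (Suc s) p q"
 have Ysub: "submodule ?Y K (page s p q)"
  by (rule submodule_kernel[OF diff_lin page_module page_module])
 have U: "?T = ?U" by (rule diff_image)
 have Y: "proj s p q x \<in> ?Y" if "x \<in> cyc (Suc s) p q" for x
  using that cyc_Suc_iff[of x s p q] cyc_Suc_subset[of s p q] proj_closed[of x s p q] by auto
 have Y': "y \<in> cyc (Suc s) p q" if "y \<in> ?Y" for y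
  using that cyc_Suc_iff[of y s p q] page_subset[of s p q] proj_page[of y s p q] by auto
 have pl: "proj s p q \<in> lin_maps K (cspace s p q) (page s p q)" by (rule proj_lin)
 have c': "submodule (cyc (Suc s) p q) K (cspace s p q)"
  by (rule submodule_restrict[OF E cyc_sub cyc_sub cyc_Suc_subset])
 have b: "restrict (proj s p q) (cyc (Suc s) p q) \<in> lin_maps K (cspace (Suc s) p q) ((page s p q)\<lparr>carrier := ?Y\<rparr>)"
  using lin_restrict_dom[OF pl cspace_module c' Y] by simp
 have b'': "submodule (bnd (Suc s) p q) K (cspace s p q)"
  by (rule submodule_restrict[OF E cyc_sub bnd_sub_E bnd_cyc_Suc])
 have Us: "submodule ?U K ((page s p q)\<lparr>carrier := ?Y\<rparr>)"
  using Y bnd_cyc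
  by (intro submodule_restrict[OF page_module Ysub] submodule_image[OF pl cspace_module page_module b'']) blast
 show ?thesis
  unfolding U
 proof (rule vs_iso_quot_span[OF cspace_module page_module submodule_module[OF page_module Ysub] Us proj_lin b])
  show "proj (Suc s) p q ` car (cspace (Suc s) p q) = car (page (Suc s) p q)"
   by (simp add: page_carrier)
  fix l assume "l \<in> car (cspace (Suc s) p q)"
  then have l: "l \<in> cyc (Suc s) p q" by simp
  show "proj (Suc s) p q l = \<zero>\<^bsub>page (Suc s) p q\<^esub> \<longleftrightarrow> restrict (proj s p q) (cyc (Suc s) p q) l \<in> ?U"
   using l proj_eq_zero[OF l] proj_bnd_iff[OF l] by simp
 next
  fix y assume "y \<in> car ((page s p q)\<lparr>carrier := ?Y\<rparr>)"
  then have y: "y \<in> ?Y" by simp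
  have "proj s p q y = y" using y proj_page by simp
  moreover have "dif K (page s p q) y y = \<zero>\<^bsub>page s p q\<^esub>"
   using y by (intro dif_dif_zero[OF page_module]) simp
  moreover have "\<zero>\<^bsub>page s p q\<^esub> \<in> ?U"
   using submodule_image[OF pl cspace_module page_module b''] unfolding submodule_iff[OF page_module] by blast
  ultimately show "\<exists>l\<in>car (cspace (Suc s) p q).
   dif K ((page s p q)\<lparr>carrier := ?Y\<rparr>) y (restrict (proj s p q) (cyc (Suc s) p q) l) \<in> ?U"
   using Y'[OF y] by (intro bexI[of _ y]) auto
 qed
qed

text \<open>A value of the differential is represented by a boundary of the next page. Boundaries of
  that page are cycles of it, and those are what the differential kills.\<close>

lemma diff_squared:
 assumes x: "x \<in> car (page s p q)"
 shows "diff s (sp s p) (sq s q) (diff s p q x)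
  = \<zero>\<^bsub>page s (p + (int s + 2) + (int s + 2)) (q - (int s + 2) + 1 - (int s + 2) + 1)\<^esub>"
proof -
 let ?p = "sp s p" and ?q = "sq s q"
 have "diff s p q x \<in> proj s ?p ?q ` bnd (Suc s) ?p ?q"
  using diff_image[of s ?p ?q] x by auto
 then obtain b where b: "b \<in> bnd (Suc s) ?p ?q" "diff s p q x = proj s ?p ?q b" by blast
 then show ?thesis using cyc_Suc_iff[of b s ?p ?q] bnd_cyc bnd_cyc_Suc by (metis (no_types, lifting) page_simps(2) subsetD)
qed

text \<open>For s = 0 only zero is a boundary, so the chosen projection moves nothing. The result is
  an equality and not only an isomorphism, which lets the second page be prescribed exactly.\<close>

lemma page_0: "page 0 p q = E p q"
proof -
 have c: "cyc 0 p q = car (E p q)"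
  using k_closed by (auto simp: cyc_def image_def)
 have b: "bnd 0 p q = {\<zero>\<^bsub>E p q\<^esub>}"
  using lin_zero[OF j D E] by (auto simp: bnd_def image_def)
 have "proj 0 p q x = x" if x: "x \<in> car (E p q)" for x
 proof -
  have "dif K (E p q) x (proj 0 p q x) = \<zero>\<^bsub>E p q\<^esub>" using proj_dif[of x 0 p q] x b c by simp
  moreover have "proj 0 p q x \<in> car (E p q)" using proj_closed[of x 0 p q] page_subset c x by blast
  ultimately show ?thesis using dif_eq_zero_iff[OF E x] by simp
 qed
 then have "proj 0 p q ` car (E p q) = car (E p q)" by simp
 then show ?thesis unfolding page_def qspace_def c by simp
qed

lemma spectral_sequence: "first_quadrant_spectral_sequence K (\<lambda>r. page (r - 2)) (\<lambda>r. diff (r - 2))"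
proof -
 have *: "\<exists>s. r = s + 2" if "2 \<le> r" for r :: nat
  using that by (metis le_add_diff_inverse2)
 show ?thesis
 proof (intro first_quadrant_spectral_sequence.intro, goal_cases)
  case 1 show ?case by (rule page_module)
 next
  case (2 r p q)
  have "\<zero>\<^bsub>page (r - 2) p q\<^esub> \<in> car (page (r - 2) p q)"
   using submodule_zero[OF page_module, of "r - 2" p q] by (simp add: submodule_iff[OF page_module])
  moreover have "car (page (r - 2) p q) \<subseteq> {\<zero>\<^bsub>E p q\<^esub>}"
   using page_subset[of "r - 2" p q] cyc_subset[of "r - 2" p q] E_trivial[OF 2(2)] by blast
  ultimately show ?case by auto
 next
  case (3 r p q)
  then obtain s where "r = s + 2" using * by blast
  then have e: "r - 2 = s" "int r = int s + 2" by simp_all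
  show ?case unfolding e by (rule diff_lin)
 next
  case (4 r p q x)
  then obtain s where "r = s + 2" using * by blast
  then have e: "r - 2 = s" "int r = int s + 2" by simp_all
  show ?case using diff_squared 4(2) unfolding e .
 next
  case (5 r p q)
  then obtain s where "r = s + 2" using * by blast
  then have e: "r - 2 = s" "Suc r - 2 = Suc s" "int r = int s + 2" by simp_all
  show ?case unfolding e by (rule next_page)
 qed
qed

section \<open>Convergence\<close>

lemma i_inj: "p \<le> 1 ==> y \<in> car (D p q) ==> i p q y = \<zero>\<^bsub>D (p - 1) (q + 1)\<^esub> ==> y = \<zero>\<^bsub>D p q\<^esub>"
proof -
 assume *: "p \<le> 1" "y \<in> car (D p q)" "i p q y = \<zero>\<^bsub>D (p - 1) (q + 1)\<^esub>"
 then obtain x where x: "x \<in> car (E (p - 2) (q + 1))" "y = k (p - 2) (q + 1) x"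
  using exact_i by blast
 then have "x = \<zero>\<^bsub>E (p - 2) (q + 1)\<^esub>" using E_trivial[of "p - 2" "q + 1"] *(1) by auto
 then show ?thesis using x(2) lin_zero[OF k E D, of "p - 2" "q + 1"] by simp
qed

lemma it_zero_Suc:
 assumes "p \<le> int s + 1" and y: "y \<in> car (D p q)"
 shows "it (Suc s) p q y = \<zero>\<^bsub>D (p - int (Suc s)) (q + int (Suc s))\<^esub> \<longleftrightarrow> it s p q y = \<zero>\<^bsub>D (p - int s) (q + int s)\<^esub>"
proof -
 have idx: "p - int (Suc s) = p - int s - 1" "q + int (Suc s) = q + int s + 1" by simp_all
 show ?thesis
  unfolding it_Suc_right[OF y] idx
  using i_inj[of "p - int s", OF _ lin_closed[OF it_lin y]] assms(1) lin_zero[OF i D D] by auto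
qed

text \<open>After s steps from column p the column p - s \<le> 1 is reached. From there on i is
  injective, because its kernel comes through k from a column with negative index, where E
  vanishes.\<close>

lemma it_zero_iff:
 assumes "p \<le> int s + 1" "s \<le> t" and y: "y \<in> car (D p q)"
 shows "it t p q y = \<zero>\<^bsub>D (p - int t) (q + int t)\<^esub> \<longleftrightarrow> it s p q y = \<zero>\<^bsub>D (p - int s) (q + int s)\<^esub>"
 using assms(2)
proof (induction t rule: dec_induct)
 case (step t)
 have "p \<le> int t + 1" using step(1) assms(1) by linarith
 from it_zero_Suc[OF this y] step(3) show ?case by blast
qed auto

text \<open>The filtration of D 0 n consists of the images of the iterates of i that start at D p (n
  - p). Its graded piece is D p q modulo the kernel of the iterate and the image of i. Under j this
  becomes the image of j, which is the kernel of k, modulo the image under j of the kernel of the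
  iterate; for large r these are the cycles and boundaries of the page.\<close>

lemma converges:
 fixes A :: "nat => ('k, 'a) module"
 assumes A: "\<And>n. module K (A n)" and \<alpha>: "\<And>n. \<alpha> n \<in> lin_maps K (D 0 (int n)) (A n)"
  and bij: "\<And>n. bij_betw (\<alpha> n) (car (D 0 (int n))) (car (A n))"
 shows "converges_to K (\<lambda>r. page (r - 2)) A"
proof -
 define f where "f n p = (\<lambda>y\<in>car (D (int p) (int n - int p)). \<alpha> n (it p (int p) (int n - int p) y))" for n p :: nat
 have f: "f n p \<in> lin_maps K (D (int p) (int n - int p)) (A n)" for n p
  unfolding f_def by (rule lin_compose[OF D it_lin0 \<alpha>])
 have \<alpha>0: "\<alpha> n y = \<zero>\<^bsub>A n\<^esub> \<longleftrightarrow> y = \<zero>\<^bsub>D 0 (int n)\<^esub>" if "y \<in> car (D 0 (int n))" for n y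
  using that lin_inj_iff[OF \<alpha> D A, of n] bij[of n] lin_zero[OF \<alpha> D A] by (auto simp: bij_betw_def)
 have fS: "f n (Suc p) y = f n p (i (int p + 1) (int n - int p - 1) y)"
  if y: "y \<in> car (D (int p + 1) (int n - int p - 1))" for n p y
 proof -
  have e: "int (Suc p) = int p + 1" "int n - (int p + 1) = int n - int p - 1" by simp_all
  have "it (Suc p) (int p + 1) (int n - int p - 1) y
    = it p (int p) (int n - int p) (i (int p + 1) (int n - int p - 1) y)"
   using y by (simp only: it.simps restrict_apply if_True add_diff_cancel_right' diff_add_cancel)
  then show ?thesis unfolding f_def e using y i_closed'[OF y] by (simp only: restrict_apply if_True)
 qed
 define F where "F n p = f n p ` car (D (int p) (int n - int p))" for n p :: nat
 have Fs: "submodule (F n p) K (A n)" for n p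
  unfolding F_def by (rule submodule_image[OF f D A submodule_carrier[OF D]])
 have FSuc: "F n (Suc p) = f n p ` i (int p + 1) (int n - int p - 1) ` car (D (int p + 1) (int n - int p - 1))" for n p
 proof -
  have "int (Suc p) = int p + 1" "int n - int (Suc p) = int n - int p - 1" by simp_all
  then show ?thesis unfolding F_def image_image using fS by (simp only:) (rule image_cong, auto)
 qed
 have dec: "F n (Suc p) \<subseteq> F n p" for n p
  unfolding FSuc unfolding F_def using i_closed' by blast
 have F0: "F n 0 = car (A n)" for n
 proof -
  have "F n 0 = \<alpha> n ` car (D 0 (int n))" by (auto simp: F_def f_def)
  then show ?thesis using bij[of n] by (simp add: bij_betw_def)
 qed
 have FS: "F n (Suc n) = {\<zero>\<^bsub>A n\<^esub>}" for n
  \<comment> \<open>The last iterate starts at D (n + 1) (-1), which is zero.\<close>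
  using D_trivial[of "int (Suc n)" "int n - int (Suc n)"] lin_zero[OF f D A, of n "Suc n"] by (simp add: F_def)
 have gr: "vs_iso K (page (r - 2) (int p) (int q))
   (quot_space ((A (p + q))\<lparr>carrier := F (p + q) p\<rparr>) (F (p + q) (Suc p)))"
  if pq: "p < r" "q + 1 < r" for p q r :: nat
 proof -
  obtain s where r: "r = s + 2" using pq by (metis le_add_diff_inverse2 Suc_eq_plus1 Suc_leI le_trans le_add2 one_add_one plus_1_eq_Suc Suc_le_mono zero_le)
  let ?p = "int p" and ?q = "int q"
  have n: "int (p + q) - ?p = ?q" by simp
  \<comment> \<open>As q + 1 < r, the iterate in the definition of cycles starts at the negative
    index q - r + 1, where D is zero. So k must kill a cycle.\<close>
  have cyc: "cyc s ?p ?q = j ?p ?q ` car (D ?p ?q)"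
  proof -
   have "car (D (?p + (int s + 2)) (?q - (int s + 2) + 1)) = {\<zero>\<^bsub>D (?p + (int s + 2)) (?q - (int s + 2) + 1)\<^esub>}"
    using pq r by (intro D_trivial) auto
   then have "cyc s ?p ?q = {x \<in> car (E ?p ?q). k ?p ?q x = \<zero>\<^bsub>D (?p + 2) (?q - 1)\<^esub>}"
    unfolding cyc_def using lin_zero[OF it_lin2 D D, of s ?p ?q] by simp
   then show ?thesis using exact_k j_closed by blast
  qed
  have it0: "it s ?p ?q y = \<zero>\<^bsub>D (?p - int s) (?q + int s)\<^esub> \<longleftrightarrow> it p ?p ?q y = \<zero>\<^bsub>D 0 (?q + ?p)\<^esub>"
   if "y \<in> car (D ?p ?q)" for y
  proof -
   have "it s ?p ?q y = \<zero>\<^bsub>D (?p - int s) (?q + int s)\<^esub> \<longleftrightarrow> it p ?p ?q y = \<zero>\<^bsub>D (?p - int p) (?q + int p)\<^esub>"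
   proof (cases "p \<le> s")
    case True then show ?thesis using it_zero_iff[of ?p p s y ?q] that by simp
   next
    \<comment> \<open>Here p = s + 1, the largest value with p < r. The one further application of i
      leaves column 1 and is still injective.\<close>
    case False then show ?thesis using it_zero_iff[of ?p s p y ?q] that pq r by simp
   qed
   then show ?thesis by simp
  qed
  let ?f = "f (p + q) p"
  have f': "?f \<in> lin_maps K (D ?p ?q) (A (p + q))" using f[of "p + q" p] n by simp
  have fker: "?f y = \<zero>\<^bsub>A (p + q)\<^esub> \<longleftrightarrow> it s ?p ?q y = \<zero>\<^bsub>D (?p - int s) (?q + int s)\<^esub>" if "y \<in> car (D ?p ?q)" for y
  proof -
   have "it p ?p ?q y \<in> car (D 0 (int (p + q)))" using that lin_closed[OF it_lin0[of p "p + q"], of y] n by simp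
   from \<alpha>0[OF this] show ?thesis using it0[OF that] that by (simp add: f_def add.commute)
  qed
  have Fq: "F (p + q) p = ?f ` car (D ?p ?q)" by (simp add: F_def)
  have FqS: "F (p + q) (Suc p) = ?f ` i (?p + 1) (?q - 1) ` car (D (?p + 1) (?q - 1))"
   using FSuc[of "p + q" p] by simp
  have j': "j ?p ?q \<in> lin_maps K (D ?p ?q) (cspace s ?p ?q)" by (rule lin_carrier[OF j j_cyc])
  have a: "(\<lambda>y\<in>car (D ?p ?q). proj s ?p ?q (j ?p ?q y)) \<in> lin_maps K (D ?p ?q) (page s ?p ?q)"
   by (rule lin_compose[OF D j' proj_lin])
  have b: "?f \<in> lin_maps K (D ?p ?q) ((A (p + q))\<lparr>carrier := F (p + q) p\<rparr>)"
   by (rule lin_carrier[OF f']) (auto simp: Fq)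
  have "vs_iso K (page s ?p ?q) (quot_space ((A (p + q))\<lparr>carrier := F (p + q) p\<rparr>) (F (p + q) (Suc p)))"
  proof (rule vs_iso_quot_span[OF D page_module submodule_module[OF A Fs] submodule_restrict[OF A Fs Fs dec] a b])
   show "(\<lambda>y\<in>car (D ?p ?q). proj s ?p ?q (j ?p ?q y)) ` car (D ?p ?q) = car (page s ?p ?q)"
    by (simp add: page_carrier cyc image_image)
  next
   fix y assume "y \<in> car ((A (p + q))\<lparr>carrier := F (p + q) p\<rparr>)"
   then obtain l where l: "l \<in> car (D ?p ?q)" "y = ?f l" by (auto simp: Fq)
   have "dif K (A (p + q)) y (?f l) = \<zero>\<^bsub>A (p + q)\<^esub>" using l dif_dif_zero[OF A] lin_closed[OF f'] by simp
   then show "\<exists>l\<in>car (D ?p ?q). dif K ((A (p + q))\<lparr>carrier := F (p + q) p\<rparr>) y (?f l) \<in> F (p + q) (Suc p)"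
    using l(1) Fs[of "p + q" "Suc p"] by (intro bexI[of _ l]) (auto simp: submodule_iff[OF A])
  next
   fix l assume l: "l \<in> car (D ?p ?q)"
   have "(\<lambda>y\<in>car (D ?p ?q). proj s ?p ?q (j ?p ?q y)) l = \<zero>\<^bsub>page s ?p ?q\<^esub> \<longleftrightarrow> j ?p ?q l \<in> bnd s ?p ?q"
    using l proj_eq_zero[OF j_cyc] by simp
   also have "\<dots> \<longleftrightarrow> ?f l \<in> F (p + q) (Suc p)"
   proof
    assume "j ?p ?q l \<in> bnd s ?p ?q"
    then obtain m where m: "m \<in> car (D ?p ?q)" "?f m = \<zero>\<^bsub>A (p + q)\<^esub>" "j ?p ?q l = j ?p ?q m"
     unfolding bnd_def using fker by auto
    have "j ?p ?q (dif K (D ?p ?q) l m) = \<zero>\<^bsub>E ?p ?q\<^esub>"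
     using m lin_dif[OF j D l m(1)] dif_dif_zero[OF E j_closed[OF m(1)]] by simp
    then have "dif K (D ?p ?q) l m \<in> i (?p + 1) (?q - 1) ` car (D (?p + 1) (?q - 1))"
     using exact_j dif_closed[OF D l m(1)] by blast
    then have "?f (dif K (D ?p ?q) l m) \<in> F (p + q) (Suc p)" unfolding FqS by blast
    then show "?f l \<in> F (p + q) (Suc p)"
     using m lin_dif[OF f' D l m(1)] dif_zero[OF A] lin_closed[OF f' l] by simp
   next
    assume "?f l \<in> F (p + q) (Suc p)"
    then obtain w where w: "w \<in> car (D (?p + 1) (?q - 1))" "?f l = ?f (i (?p + 1) (?q - 1) w)"
     unfolding FqS by blast
    have iw: "i (?p + 1) (?q - 1) w \<in> car (D ?p ?q)" by (rule i_closed'[OF w(1)])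
    let ?m = "dif K (D ?p ?q) l (i (?p + 1) (?q - 1) w)"
    have m: "?m \<in> car (D ?p ?q)" by (rule dif_closed[OF D l iw])
    have "?f ?m = \<zero>\<^bsub>A (p + q)\<^esub>"
     using w(2) lin_dif[OF f' D l iw] dif_dif_zero[OF A lin_closed[OF f' iw]] by simp
    then have "j ?p ?q ?m \<in> bnd s ?p ?q" unfolding bnd_def using m fker[OF m] by blast
    moreover have "j ?p ?q ?m = j ?p ?q l"
     using lin_dif[OF j D l iw] ji[OF w(1)] dif_zero[OF E j_closed[OF l]] by simp
    ultimately show "j ?p ?q l \<in> bnd s ?p ?q" by simp
   qed
   finally show "(\<lambda>y\<in>car (D ?p ?q). proj s ?p ?q (j ?p ?q y)) l = \<zero>\<^bsub>page s ?p ?q\<^esub> \<longleftrightarrow> ?f l \<in> F (p + q) (Suc p)" .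
  qed
  then show ?thesis using r by simp
 qed
 show ?thesis
  unfolding converges_to_def using Fs dec F0 FS gr by (intro exI[of _ F]) simp
qed

end

section \<open>Double complexes with exact columns\<close>

text \<open>Exactness along b is asked for from p = 1 on. At p = 0 the kernel of b is left over, and
  its cohomology with respect to a will be the abutment.\<close>

locale double_complex =
 fixes K :: "'k ring"
  and X :: "nat => nat => ('k, 'x) module"
  and a b :: "nat => nat => 'x => 'x"
 assumes K: "field K"
  and X: "\<And>p q. module K (X p q)"
  and a: "\<And>p q. a p q \<in> lin_maps K (X p q) (X p (Suc q))"
  and b: "\<And>p q. b p q \<in> lin_maps K (X p q) (X (Suc p) q)"
  and aa: "\<And>p q x. x \<in> car (X p q) ==> a p (Suc q) (a p q x) = \<zero>\<^bsub>X p (Suc (Suc q))\<^esub>"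
  and bb: "\<And>p q x. x \<in> car (X p q) ==> b (Suc p) q (b p q x) = \<zero>\<^bsub>X (Suc (Suc p)) q\<^esub>"
  and ab: "\<And>p q x. x \<in> car (X p q) ==> a (Suc p) q (b p q x) = b p (Suc q) (a p q x)"
  and exact: "\<And>p q x. x \<in> car (X (Suc p) q) ==> b (Suc p) q x = \<zero>\<^bsub>X (Suc (Suc p)) q\<^esub> ==> x \<in> b p q ` car (X p q)"
begin

section \<open>Cycles, boundaries and the D-terms of the couple\<close>

definition "acyc p q = {x \<in> car (X p q). a p q x = \<zero>\<^bsub>X p (Suc q)\<^esub>}"
definition "bcyc p q = {x \<in> car (X p q). b p q x = \<zero>\<^bsub>X (Suc p) q\<^esub>}"
definition "abnd p q = (case q of 0 => {\<zero>\<^bsub>X p 0\<^esub>} | Suc q' => a p q' ` car (X p q'))"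
definition "bbnd p q = (case p of 0 => {\<zero>\<^bsub>X 0 q\<^esub>} | Suc p' => b p' q ` acyc p' q)"
text \<open>Let Z p be the kernel of b at p, a complex with differential a. The short exact
  sequences 0 \<rightarrow> Z p \<rightarrow> X p \<rightarrow> Z (p + 1) \<rightarrow> 0 give an
  exact couple whose D-terms are the cohomology of the Z p. Dividing the cohomology of Z p by the
  image of that of X (p - 1), which is the kernel of the connecting map, yields the derived couple;
  for p > 0 this quotient is \<open>Lam\<close> modulo \<open>Nul\<close>. At p = 0 no connecting
  map leaves, and \<open>Nul\<close> consists of the coboundaries of Z 0.\<close>

definition "Lam p q = acyc p q \<inter> bcyc p q"
definition "Nul p q = (if p = 0 then (case q of 0 => {\<zero>\<^bsub>X 0 0\<^esub>} | Suc q' => a 0 q' ` bcyc 0 q') else bbnd p q)"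
text \<open>\<open>Ecyc\<close> modulo \<open>Enul\<close> is the cohomology with respect to b of
  the cohomology with respect to a, expressed in elements of X.\<close>

definition "Ecyc p q = {x \<in> acyc p q. b p q x \<in> abnd (Suc p) q}"
definition "Enul p q = {u \<oplus>\<^bsub>X p q\<^esub> v | u v. u \<in> abnd p q \<and> v \<in> bbnd p q}"
abbreviation "Lspace p q \<equiv> (X p q)\<lparr>carrier := Lam p q\<rparr>"
abbreviation "Espace p q \<equiv> (X p q)\<lparr>carrier := Ecyc p q\<rparr>"
definition "D p q = qspace K (Lspace p q) (Nul p q)"
abbreviation "pD p q \<equiv> prj K (Lspace p q) (Nul p q)"

lemma X0: "\<zero>\<^bsub>X p q\<^esub> \<in> car (X p q)"
 using submodule_zero[OF X] by (simp add: submodule_iff[OF X])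

lemma acyc_sub: "submodule (acyc p q) K (X p q)"
 unfolding acyc_def by (rule submodule_kernel[OF a X X])

lemma bcyc_sub: "submodule (bcyc p q) K (X p q)"
 unfolding bcyc_def by (rule submodule_kernel[OF b X X])

lemma abnd_sub: "submodule (abnd p q) K (X p q)"
 by (cases q) (simp_all add: abnd_def submodule_zero[OF X] submodule_image[OF a X X submodule_carrier[OF X]])

lemma bbnd_sub: "submodule (bbnd p q) K (X p q)"
 by (cases p) (simp_all add: bbnd_def submodule_zero[OF X] submodule_image[OF b X X acyc_sub])

lemma Lam_sub: "submodule (Lam p q) K (X p q)"
 unfolding Lam_def by (rule submodule_inter[OF X acyc_sub bcyc_sub])

lemma Nul_sub: "submodule (Nul p q) K (X p q)"
 using bbnd_sub[of p q]
 by (cases q) (auto simp: Nul_def submodule_zero[OF X] submodule_image[OF a X X bcyc_sub])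

lemma a_closed: "x \<in> car (X p q) ==> a p q x \<in> car (X p (Suc q))"
 by (rule lin_closed[OF a])

lemma b_closed: "x \<in> car (X p q) ==> b p q x \<in> car (X (Suc p) q)"
 by (rule lin_closed[OF b])

lemma a0: "a p q \<zero>\<^bsub>X p q\<^esub> = \<zero>\<^bsub>X p (Suc q)\<^esub>" by (rule lin_zero[OF a X X])
lemma b0: "b p q \<zero>\<^bsub>X p q\<^esub> = \<zero>\<^bsub>X (Suc p) q\<^esub>" by (rule lin_zero[OF b X X])

lemma acyc_carrier: "x \<in> acyc p q ==> x \<in> car (X p q)" by (simp add: acyc_def)
lemma bcyc_carrier: "x \<in> bcyc p q ==> x \<in> car (X p q)" by (simp add: bcyc_def)
lemma Lam_carrier: "x \<in> Lam p q ==> x \<in> car (X p q)" by (simp add: Lam_def acyc_def)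

lemma a_acyc: "x \<in> car (X p q) ==> a p q x \<in> acyc p (Suc q)"
 by (simp add: acyc_def a_closed aa)

lemma b_bcyc: "x \<in> car (X p q) ==> b p q x \<in> bcyc (Suc p) q"
 by (simp add: bcyc_def b_closed bb)

lemma b_acyc: "x \<in> acyc p q ==> b p q x \<in> acyc (Suc p) q"
 by (simp add: acyc_def b_closed ab b0)

lemma a_bcyc: "x \<in> bcyc p q ==> a p q x \<in> bcyc p (Suc q)"
 by (simp add: bcyc_def a_closed ab[symmetric] a0)

lemma abnd_acyc: "abnd p q \<subseteq> acyc p q"
 by (cases q) (auto simp: abnd_def a_acyc, simp add: acyc_def X0 a0)

lemma bbnd_Lam: "bbnd p q \<subseteq> Lam p q"
 by (cases p) (auto simp: bbnd_def Lam_def b_acyc b_bcyc acyc_carrier, simp_all add: acyc_def bcyc_def X0 a0 b0)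

lemma Nul_Lam: "Nul p q \<subseteq> Lam p q"
 using bbnd_Lam[of p q]
 by (cases q) (auto simp: Nul_def Lam_def a_acyc a_bcyc bcyc_carrier, simp_all add: acyc_def bcyc_def X0 a0 b0)

lemma abnd_b: "u \<in> abnd p q ==> b p q u \<in> abnd (Suc p) q"
 by (cases q) (auto simp: abnd_def b0 ab[symmetric] b_closed)

lemma Ecyc_sub: "submodule (Ecyc p q) K (X p q)"
proof -
 have "Ecyc p q = acyc p q \<inter> {x \<in> car (X p q). b p q x \<in> abnd (Suc p) q}"
  by (auto simp: Ecyc_def acyc_carrier)
 then show ?thesis
  using submodule_inter[OF X acyc_sub submodule_vimage[OF b X X abnd_sub]] by simp
qed

lemma Lam_Ecyc: "Lam p q \<subseteq> Ecyc p q"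
 using abnd_sub by (auto simp: Lam_def Ecyc_def bcyc_def submodule_iff[OF X])

lemma abnd_Ecyc: "abnd p q \<subseteq> Ecyc p q"
 using abnd_acyc abnd_b by (auto simp: Ecyc_def)

lemma abnd_Enul: "abnd p q \<subseteq> Enul p q"
proof
 fix u assume u: "u \<in> abnd p q"
 interpret X: module K "X p q" by (rule X)
 have "u \<in> car (X p q)" using u abnd_sub[of p q] by (auto simp: submodule_iff[OF X])
 then have "u = u \<oplus>\<^bsub>X p q\<^esub> \<zero>\<^bsub>X p q\<^esub>" by simp
 then show "u \<in> Enul p q" using u bbnd_sub unfolding Enul_def submodule_iff[OF X] by blast
qed

lemma bbnd_Enul: "bbnd p q \<subseteq> Enul p q"
proof
 fix u assume u: "u \<in> bbnd p q"
 interpret X: module K "X p q" by (rule X)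
 have "u \<in> car (X p q)" using u bbnd_sub[of p q] by (auto simp: submodule_iff[OF X])
 then have "u = \<zero>\<^bsub>X p q\<^esub> \<oplus>\<^bsub>X p q\<^esub> u" by simp
 then show "u \<in> Enul p q" using u abnd_sub unfolding Enul_def submodule_iff[OF X] by blast
qed

lemma Nul_Enul: "Nul p q \<subseteq> Enul p q"
proof (cases p)
 case 0
 have "Nul p q \<subseteq> abnd p q"
  by (cases q) (auto simp: Nul_def abnd_def 0 bcyc_carrier)
 then show ?thesis using abnd_Enul by blast
next
 case (Suc n) then show ?thesis using bbnd_Enul by (simp add: Nul_def)
qed

lemma bbnd_Nul: "bbnd p q \<subseteq> Nul p q"
proof (cases "p = 0")
 case True
 then show ?thesis using Nul_sub[of 0 q] by (simp add: bbnd_def submodule_iff[OF X])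
qed (simp add: Nul_def)

lemma Lspace: "module K (Lspace p q)" by (rule submodule_module[OF X Lam_sub])
lemma Espace: "module K (Espace p q)" by (rule submodule_module[OF X Ecyc_sub])
lemma Nul_L: "submodule (Nul p q) K (Lspace p q)" by (rule submodule_restrict[OF X Lam_sub Nul_sub Nul_Lam])
lemma Dspace: "module K (D p q)" unfolding D_def by (rule qspace_module[OF K Lspace Nul_L])
lemma pD: "pD p q \<in> lin_maps K (Lspace p q) (D p q)" unfolding D_def by (rule prj_lin[OF K Lspace Nul_L])

lemma D_zero [simp]: "\<zero>\<^bsub>D p q\<^esub> = \<zero>\<^bsub>X p q\<^esub>" by (simp add: D_def)

lemma pD_zero: "x \<in> Lam p q ==> pD p q x = \<zero>\<^bsub>X p q\<^esub> \<longleftrightarrow> x \<in> Nul p q"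
 using prj_eq_zero[OF K Lspace Nul_L, of x] by simp

lemma D_carrier: "car (D p q) = pD p q ` Lam p q"
 using qspace_carrier[OF K Lspace Nul_L] by (simp add: D_def)

lemma pD_closed: "x \<in> Lam p q ==> pD p q x \<in> car (D p q)" by (simp add: D_carrier)

lemma D_cases: assumes "d \<in> car (D p q)" obtains x where "x \<in> Lam p q" "d = pD p q x"
 using assms by (auto simp: D_carrier)

lemma pD_eq: assumes "x \<in> Lam p q" "y \<in> Lam p q" "dif K (X p q) x y \<in> Nul p q" shows "pD p q x = pD p q y"
proof -
 have "dif K (X p q) x y \<in> Lam p q" by (rule submodule_dif[OF X Lam_sub assms(1,2)])
 then have "pD p q (dif K (X p q) x y) = \<zero>\<^bsub>D p q\<^esub>" using pD_zero assms(3) by simp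
 then have "dif K (D p q) (pD p q x) (pD p q y) = \<zero>\<^bsub>D p q\<^esub>"
  using lin_dif[OF pD Lspace, of x p q y] assms(1,2) by simp
 then show ?thesis using dif_eq_zero_iff[OF Dspace] pD_closed assms(1,2) by blast
qed

lemma Nul_Suc: "Nul (Suc p) q = b p q ` acyc p q" by (simp add: Nul_def bbnd_def)

text \<open>The domain of the zigzag b y \<mapsto> a y that defines i.\<close>

definition "Icyc p q = {y \<in> car (X p q). b p q y \<in> acyc (Suc p) q}"

lemma Icyc_sub: "submodule (Icyc p q) K (X p q)"
 unfolding Icyc_def by (rule submodule_vimage[OF b X X acyc_sub])

lemma Icyc_b: "y \<in> Icyc p q ==> b p q y \<in> Lam (Suc p) q"
 by (simp add: Icyc_def Lam_def b_bcyc)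

lemma Icyc_a: "y \<in> Icyc p q ==> a p q y \<in> Lam p (Suc q)"
 by (simp add: Icyc_def Lam_def a_acyc) (simp add: acyc_def bcyc_def ab[symmetric] a_closed)

lemma Lam_Suc_b: assumes "x \<in> Lam (Suc p) q" obtains y where "y \<in> Icyc p q" "x = b p q y"
 using exact[of x p q] assms by (auto simp: Lam_def bcyc_def Icyc_def)

text \<open>Subtracting the cocycle z from y does not change a y and achieves b (y - z) = 0. At p =
  0 this exhibits a y as a coboundary of the kernel of b. For p > 0 exactness gives y - z = b u,
  hence a y = b (a u), and a u is a cocycle.\<close>

lemma i_kernel: assumes y: "y \<in> Icyc p q" and n: "b p q y \<in> Nul (Suc p) q" shows "a p q y \<in> Nul p (Suc q)"
proof -
 have yX: "y \<in> car (X p q)" using y by (simp add: Icyc_def)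
 obtain z where z: "z \<in> acyc p q" "b p q y = b p q z" using n by (auto simp: Nul_Suc)
 let ?d = "dif K (X p q) y z"
 have zX: "z \<in> car (X p q)" using z acyc_carrier by blast
 have d: "?d \<in> car (X p q)" by (rule dif_closed[OF X yX zX])
 have bd: "b p q ?d = \<zero>\<^bsub>X (Suc p) q\<^esub>"
  using z by (simp add: lin_dif[OF b X yX zX] dif_dif_zero[OF X b_closed[OF zX]])
 have ad: "a p q ?d = a p q y"
  using z by (simp add: lin_dif[OF a X yX zX] acyc_def dif_zero[OF X a_closed[OF yX]])
 show ?thesis
 proof (cases p)
  case 0
  have "?d \<in> bcyc p q" using d bd by (simp add: bcyc_def)
  then have "a p q ?d \<in> a p q ` bcyc p q" by (rule imageI)
  then show ?thesis using 0 ad by (simp add: Nul_def)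
 next
  case (Suc p')
  then obtain u where u: "u \<in> car (X p' q)" "?d = b p' q u" using exact[of ?d p' q] d bd by auto
  have "a p q y = b p' (Suc q) (a p' q u)" using ad u Suc ab[of u p' q] by simp
  then show ?thesis using Suc a_acyc[OF u(1)] by (simp add: Nul_Suc)
 qed
qed

text \<open>The connecting homomorphism: lift along b, then apply a.\<close>

definition i where "i p q = (SOME f. f \<in> lin_maps K (D (Suc p) q) (D p (Suc q)) \<and>
 (\<forall>y\<in>Icyc p q. f (pD (Suc p) q (b p q y)) = pD p (Suc q) (a p q y)))"

lemma i_lin: "i p q \<in> lin_maps K (D (Suc p) q) (D p (Suc q))"
 and i_eq: "y \<in> Icyc p q ==> i p q (pD (Suc p) q (b p q y)) = pD p (Suc q) (a p q y)"
proof -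
 let ?L = "(X p q)\<lparr>carrier := Icyc p q\<rparr>"
 have L: "module K ?L" by (rule submodule_module[OF X Icyc_sub])
 have bl: "restrict (b p q) (Icyc p q) \<in> lin_maps K ?L (Lspace (Suc p) q)"
  by (rule lin_restrict_dom[OF b X Icyc_sub Icyc_b])
 have al: "restrict (a p q) (Icyc p q) \<in> lin_maps K ?L (Lspace p (Suc q))"
  by (rule lin_restrict_dom[OF a X Icyc_sub Icyc_a])
 note \<beta> = lin_compose[OF L bl pD] and \<alpha> = lin_compose[OF L al pD]
 have surj: "(\<lambda>y\<in>car ?L. pD (Suc p) q (restrict (b p q) (Icyc p q) y)) ` car ?L = car (D (Suc p) q)"
 proof
  show "(\<lambda>y\<in>car ?L. pD (Suc p) q (restrict (b p q) (Icyc p q) y)) ` car ?L \<subseteq> car (D (Suc p) q)"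
   using lin_closed[OF \<beta>] by blast
  show "car (D (Suc p) q) \<subseteq> (\<lambda>y\<in>car ?L. pD (Suc p) q (restrict (b p q) (Icyc p q) y)) ` car ?L"
  proof
   fix d assume "d \<in> car (D (Suc p) q)"
   then obtain x where x: "x \<in> Lam (Suc p) q" "d = pD (Suc p) q x" by (rule D_cases)
   then obtain y where "y \<in> Icyc p q" "x = b p q y" by (elim Lam_Suc_b)
   then show "d \<in> (\<lambda>y\<in>car ?L. pD (Suc p) q (restrict (b p q) (Icyc p q) y)) ` car ?L"
    using x by (intro image_eqI[of _ _ y]) auto
  qed
 qed
 have "\<exists>f\<in>lin_maps K (D (Suc p) q) (D p (Suc q)). \<forall>y\<in>Icyc p q. f (pD (Suc p) q (b p q y)) = pD p (Suc q) (a p q y)"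
  using lin_factor[OF L Dspace Dspace \<beta> \<alpha> surj] i_kernel pD_zero Icyc_a Icyc_b by simp
 from someI_ex[OF this[unfolded Bex_def], folded i_def]
 show "i p q \<in> lin_maps K (D (Suc p) q) (D p (Suc q))"
  and "y \<in> Icyc p q ==> i p q (pD (Suc p) q (b p q y)) = pD p (Suc q) (a p q y)" by blast+
qed

end

text \<open>E is only known through a surjection e from \<open>Ecyc\<close> with kernel
  \<open>Enul\<close>. Thus any space isomorphic to the second page can literally take its
  place.\<close>

locale double_complex_E = double_complex K X a b
 for K :: "'k ring" and X :: "nat => nat => ('k, 'x) module" and a b +
 fixes E :: "nat => nat => ('k, 'e) module" and e :: "nat => nat => 'x => 'e"
 assumes E: "\<And>p q. module K (E p q)"
  and e: "\<And>p q. e p q \<in> lin_maps K (Espace p q) (E p q)"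
  and e_surj: "\<And>p q. e p q ` Ecyc p q = car (E p q)"
  and e_zero: "\<And>p q x. x \<in> Ecyc p q ==> e p q x = \<zero>\<^bsub>E p q\<^esub> \<longleftrightarrow> x \<in> Enul p q"
begin

lemma e_closed: "x \<in> Ecyc p q ==> e p q x \<in> car (E p q)"
 using e_surj by blast

lemma E_cases: assumes "z \<in> car (E p q)" obtains x where "x \<in> Ecyc p q" "z = e p q x"
 using assms e_surj by blast

definition j where "j p q = (SOME f. f \<in> lin_maps K (D p q) (E p q) \<and> (\<forall>x\<in>Lam p q. f (pD p q x) = e p q x))"

lemma j_lin: "j p q \<in> lin_maps K (D p q) (E p q)"
 and j_eq: "x \<in> Lam p q ==> j p q (pD p q x) = e p q x"
proof -
 have "submodule (Lam p q) K (Espace p q)"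
  by (rule submodule_restrict[OF X Ecyc_sub Lam_sub Lam_Ecyc])
 then have r: "restrict (e p q) (Lam p q) \<in> lin_maps K (Lspace p q) (E p q)"
  using lin_restrict_dom[OF e Espace, of "Lam p q" p q "car (E p q)"] e_closed Lam_Ecyc[of p q]
  by (simp add: subset_iff)
 have "\<exists>f\<in>lin_maps K (D p q) (E p q). \<forall>l\<in>Lam p q. f (pD p q l) = e p q l"
  using lin_factor[OF Lspace Dspace E pD r] D_carrier pD_zero e_zero Nul_Enul Lam_Ecyc by (simp add: subset_iff)
 from someI_ex[OF this[unfolded Bex_def], folded j_def]
 show "j p q \<in> lin_maps K (D p q) (E p q)" and "x \<in> Lam p q ==> j p q (pD p q x) = e p q x" by blast+
qed

lemma k_Lam: assumes "x \<in> acyc p (Suc q)" "w \<in> car (X (Suc p) q)" "a (Suc p) q w = b p (Suc q) x"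
 shows "b (Suc p) q w \<in> Lam (Suc (Suc p)) q"
 using assms bb[of x p "Suc q"] by (simp add: Lam_def b_bcyc) (simp add: acyc_def b_closed ab)

text \<open>The zigzag from x to b x = a w and on to b w. It starts at q + 1: for q = 0 membership
  in \<open>Ecyc\<close> already says b x = 0, and the target would lie outside the
  quadrant.\<close>

definition k where "k p q = (SOME f. f \<in> lin_maps K (E p (Suc q)) (D (Suc (Suc p)) q) \<and>
 (\<forall>x\<in>Ecyc p (Suc q). \<forall>w\<in>car (X (Suc p) q). a (Suc p) q w = b p (Suc q) x \<longrightarrow>
  f (e p (Suc q) x) = pD (Suc (Suc p)) q (b (Suc p) q w)))"

lemma k_lin: "k p q \<in> lin_maps K (E p (Suc q)) (D (Suc (Suc p)) q)" (is ?lin)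
 and k_eq: "x \<in> Ecyc p (Suc q) ==> w \<in> car (X (Suc p) q) ==> a (Suc p) q w = b p (Suc q) x ==>
  k p q (e p (Suc q) x) = pD (Suc (Suc p)) q (b (Suc p) q w)"
proof -
 \<comment> \<open>A linear choice of w, which makes the zigzag linear; \<open>indep\<close> then
   removes the choice from the formula.\<close>
 obtain s where s: "s \<in> lin_maps K (X (Suc p) (Suc q)) (X (Suc p) q)"
  "\<And>w. w \<in> car (X (Suc p) q) ==> a (Suc p) q (s (a (Suc p) q w)) = a (Suc p) q w"
  using lin_pseudo_inverse[OF K X X a] by blast
 have Ec: "x \<in> car (X p (Suc q))" "x \<in> acyc p (Suc q)" if "x \<in> Ecyc p (Suc q)" for x
  using that acyc_carrier by (auto simp: Ecyc_def)
 have w: "s (b p (Suc q) x) \<in> car (X (Suc p) q)" "a (Suc p) q (s (b p (Suc q) x)) = b p (Suc q) x"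
  if "x \<in> Ecyc p (Suc q)" for x
 proof -
  show "s (b p (Suc q) x) \<in> car (X (Suc p) q)"
   using that by (intro lin_closed[OF s(1)] b_closed Ec)
  show "a (Suc p) q (s (b p (Suc q) x)) = b p (Suc q) x"
   using that s(2) by (auto simp: Ecyc_def abnd_def)
 qed
 have L: "module K (Espace p (Suc q))" by (rule Espace)
 let ?g = "\<lambda>x\<in>Ecyc p (Suc q). b (Suc p) q (s (b p (Suc q) x))"
 have g: "?g \<in> lin_maps K (Espace p (Suc q)) (Lspace (Suc (Suc p)) q)"
  using lin_restrictI[OF L, of "\<lambda>x. b (Suc p) q (s (b p (Suc q) x))" "Lspace (Suc (Suc p)) q"]
  by (simp add: k_Lam[OF Ec(2) w] Ec lin_add[OF b] lin_smult[OF b] lin_add[OF s(1)]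
    lin_smult[OF s(1)] b_closed lin_closed[OF s(1)])
 \<comment> \<open>Two choices of w differ by a cocycle for a, so their images under b differ by an
   element of \<open>Nul\<close>.\<close>
 have indep: "pD (Suc (Suc p)) q (b (Suc p) q w) = pD (Suc (Suc p)) q (b (Suc p) q w')"
  if *: "x \<in> Ecyc p (Suc q)" "w \<in> car (X (Suc p) q)" "a (Suc p) q w = b p (Suc q) x"
   "w' \<in> car (X (Suc p) q)" "a (Suc p) q w' = b p (Suc q) x" for x w w'
 proof (rule pD_eq)
  show "b (Suc p) q w \<in> Lam (Suc (Suc p)) q" "b (Suc p) q w' \<in> Lam (Suc (Suc p)) q"
   using * Ec k_Lam by blast+
  have "dif K (X (Suc p) q) w w' \<in> acyc (Suc p) q"
   using * Ec(1)[OF *(1)] by (simp add: acyc_def dif_closed[OF X] lin_dif[OF a X] dif_dif_zero[OF X] b_closed)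
  then show "dif K (X (Suc (Suc p)) q) (b (Suc p) q w) (b (Suc p) q w') \<in> Nul (Suc (Suc p)) q"
   using * by (simp add: lin_dif[OF b X, symmetric] Nul_Suc)
 qed
 have ker: "(\<lambda>x\<in>car (Espace p (Suc q)). pD (Suc (Suc p)) q (?g x)) l = \<zero>\<^bsub>D (Suc (Suc p)) q\<^esub>"
  if l: "l \<in> car (Espace p (Suc q))" "e p (Suc q) l = \<zero>\<^bsub>E p (Suc q)\<^esub>" for l
 proof -
  have lE: "l \<in> Ecyc p (Suc q)" using l by simp
  then have "l \<in> Enul p (Suc q)" using e_zero l by blast
  then obtain u v where uv: "u \<in> car (X p q)" "v \<in> bbnd p (Suc q)" "l = a p q u \<oplus>\<^bsub>X p (Suc q)\<^esub> v"
   by (auto simp: Enul_def abnd_def)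
  have v: "v \<in> car (X p (Suc q))" "b p (Suc q) v = \<zero>\<^bsub>X (Suc p) (Suc q)\<^esub>"
   using uv(2) bbnd_Lam[of p "Suc q"] by (auto simp: Lam_def bcyc_def)
  interpret X': module K "X (Suc p) (Suc q)" by (rule X)
  have "b p (Suc q) l = a (Suc p) q (b p q u)"
   using uv v by (simp add: lin_add[OF b] a_closed b_closed ab)
  then have "pD (Suc (Suc p)) q (b (Suc p) q (s (b p (Suc q) l))) = pD (Suc (Suc p)) q (b (Suc p) q (b p q u))"
   using w[OF lE] uv by (intro indep[OF lE]) (auto intro: b_closed)
  also have "\<dots> = \<zero>\<^bsub>D (Suc (Suc p)) q\<^esub>"
   using uv(1) lin_zero[OF pD Lspace Dspace, of "Suc (Suc p)" q] by (simp add: bb)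
  finally show ?thesis using lE by simp
 qed
 have es: "e p (Suc q) ` car (Espace p (Suc q)) = car (E p (Suc q))" by (simp add: e_surj)
 obtain f where f: "f \<in> lin_maps K (E p (Suc q)) (D (Suc (Suc p)) q)"
  "\<forall>x\<in>car (Espace p (Suc q)). f (e p (Suc q) x) = (\<lambda>x\<in>car (Espace p (Suc q)). pD (Suc (Suc p)) q (?g x)) x"
  using lin_factor[OF L E Dspace e lin_compose[OF L g pD] es ker] by (rule bexE)
 have f2: "\<forall>x\<in>Ecyc p (Suc q). f (e p (Suc q) x) = pD (Suc (Suc p)) q (b (Suc p) q (s (b p (Suc q) x)))"
  using f(2) by simp
 have "\<forall>x\<in>Ecyc p (Suc q). \<forall>w\<in>car (X (Suc p) q). a (Suc p) q w = b p (Suc q) x \<longrightarrow>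
  f (e p (Suc q) x) = pD (Suc (Suc p)) q (b (Suc p) q w)"
 proof (intro ballI impI)
  fix x w' assume x: "x \<in> Ecyc p (Suc q)" and w': "w' \<in> car (X (Suc p) q)" "a (Suc p) q w' = b p (Suc q) x"
  show "f (e p (Suc q) x) = pD (Suc (Suc p)) q (b (Suc p) q w')"
   using f2 x indep[OF x w[OF x] w'] by simp
 qed
 with f(1) have "\<exists>f. f \<in> lin_maps K (E p (Suc q)) (D (Suc (Suc p)) q) \<and>
  (\<forall>x\<in>Ecyc p (Suc q). \<forall>w\<in>car (X (Suc p) q). a (Suc p) q w = b p (Suc q) x \<longrightarrow>
   f (e p (Suc q) x) = pD (Suc (Suc p)) q (b (Suc p) q w))" by blast
 from someI_ex[OF this, folded k_def]
 show ?lin and "x \<in> Ecyc p (Suc q) ==> w \<in> car (X (Suc p) q) ==> a (Suc p) q w = b p (Suc q) x ==>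
  k p q (e p (Suc q) x) = pD (Suc (Suc p)) q (b (Suc p) q w)" by blast+
qed

lemma EcycE: assumes "x \<in> Ecyc p (Suc q)"
 obtains w where "w \<in> car (X (Suc p) q)" "a (Suc p) q w = b p (Suc q) x"
 using assms by (auto simp: Ecyc_def abnd_def)

text \<open>The class of b w is killed by i exactly if a w = b v for some cocycle v. Read from v,
  the same equation is the zigzag that defines k, and it sends v to the class of b w.\<close>

lemma exact_i_Suc: assumes y: "y \<in> car (D (Suc (Suc p)) q)"
 shows "i (Suc p) q y = \<zero>\<^bsub>D (Suc p) (Suc q)\<^esub> \<longleftrightarrow> y \<in> k p q ` car (E p (Suc q))"
proof
 assume i0: "i (Suc p) q y = \<zero>\<^bsub>D (Suc p) (Suc q)\<^esub>"
 obtain x where x: "x \<in> Lam (Suc (Suc p)) q" "y = pD (Suc (Suc p)) q x" using y by (rule D_cases)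
 obtain w where w: "w \<in> Icyc (Suc p) q" "x = b (Suc p) q w" using x(1) by (rule Lam_Suc_b)
 have "a (Suc p) q w \<in> Nul (Suc p) (Suc q)"
  using i0 x w i_eq[OF w(1)] pD_zero[OF Icyc_a[OF w(1)]] by simp
 then obtain v where v: "v \<in> acyc p (Suc q)" "a (Suc p) q w = b p (Suc q) v" by (auto simp: Nul_Suc)
 have wX: "w \<in> car (X (Suc p) q)" using w by (simp add: Icyc_def)
 have vE: "v \<in> Ecyc p (Suc q)" using v wX by (simp add: Ecyc_def abnd_def) (metis imageI)
 have "k p q (e p (Suc q) v) = y" using k_eq[OF vE wX v(2)] x w by simp
 then show "y \<in> k p q ` car (E p (Suc q))" using e_closed[OF vE] by blast
next
 assume "y \<in> k p q ` car (E p (Suc q))"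
 then obtain x where x: "x \<in> Ecyc p (Suc q)" "y = k p q (e p (Suc q) x)" by (auto elim: E_cases)
 obtain w where w: "w \<in> car (X (Suc p) q)" "a (Suc p) q w = b p (Suc q) x" using x(1) by (rule EcycE)
 have xa: "x \<in> acyc p (Suc q)" using x by (simp add: Ecyc_def)
 have wI: "w \<in> Icyc (Suc p) q" using w k_Lam[OF xa w] by (simp add: Icyc_def Lam_def)
 have "i (Suc p) q y = pD (Suc p) (Suc q) (b p (Suc q) x)" using x k_eq[OF x(1) w] i_eq[OF wI] w by simp
 also have "\<dots> = \<zero>\<^bsub>D (Suc p) (Suc q)\<^esub>"
  using pD_zero[of "b p (Suc q) x" "Suc p" "Suc q"] Icyc_a[OF wI] w(2) xa by (simp add: Nul_Suc)
 finally show "i (Suc p) q y = \<zero>\<^bsub>D (Suc p) (Suc q)\<^esub>" .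
qed

text \<open>Here a w = a g with b g = 0. Then w - g is a cocycle for a with the same image under b
  as w, so the class of b w is zero.\<close>

lemma exact_i_0: assumes y: "y \<in> car (D (Suc 0) q)" and i0: "i 0 q y = \<zero>\<^bsub>D 0 (Suc q)\<^esub>"
 shows "y = \<zero>\<^bsub>D (Suc 0) q\<^esub>"
proof -
 obtain x where x: "x \<in> Lam (Suc 0) q" "y = pD (Suc 0) q x" using y by (rule D_cases)
 obtain w where w: "w \<in> Icyc 0 q" "x = b 0 q w" using x(1) by (rule Lam_Suc_b)
 have "a 0 q w \<in> Nul 0 (Suc q)"
  using i0 x w i_eq[OF w(1)] pD_zero[OF Icyc_a[OF w(1)]] by simp
 then obtain g where g: "g \<in> bcyc 0 q" "a 0 q w = a 0 q g" by (auto simp: Nul_def)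
 have wX: "w \<in> car (X 0 q)" and gX: "g \<in> car (X 0 q)" using w g by (simp_all add: Icyc_def bcyc_def)
 have "dif K (X 0 q) w g \<in> acyc 0 q"
  using g wX gX by (simp add: acyc_def dif_closed[OF X] lin_dif[OF a X] dif_dif_zero[OF X] a_closed)
 moreover have "b 0 q (dif K (X 0 q) w g) = x"
  using g wX gX w(2) by (simp add: lin_dif[OF b X] bcyc_def dif_zero[OF X] b_closed)
 ultimately have "x \<in> Nul (Suc 0) q" by (auto simp: Nul_Suc)
 then show ?thesis using x pD_zero by simp
qed

text \<open>If j kills the class of x, then x = a u + v with v in \<open>bbnd\<close>. Modulo
  \<open>Nul\<close> the summand v disappears, and a u is the value of i at the class of b
  u.\<close>

lemma exact_j_Suc: assumes y: "y \<in> car (D p (Suc q))"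
 shows "j p (Suc q) y = \<zero>\<^bsub>E p (Suc q)\<^esub> \<longleftrightarrow> y \<in> i p q ` car (D (Suc p) q)"
proof
 assume j0: "j p (Suc q) y = \<zero>\<^bsub>E p (Suc q)\<^esub>"
 obtain x where x: "x \<in> Lam p (Suc q)" "y = pD p (Suc q) x" using y by (rule D_cases)
 have "x \<in> Enul p (Suc q)" using j0 x j_eq[OF x(1)] e_zero subsetD[OF Lam_Ecyc x(1)] by metis
 then obtain u v where uv: "u \<in> car (X p q)" "v \<in> bbnd p (Suc q)" "x = a p q u \<oplus>\<^bsub>X p (Suc q)\<^esub> v"
  by (auto simp: Enul_def abnd_def)
 have vL: "v \<in> Lam p (Suc q)" and vX: "v \<in> car (X p (Suc q))"
  using uv(2) bbnd_Lam Lam_carrier by blast+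
 have xX: "x \<in> car (X p (Suc q))" using x Lam_carrier by blast
 have aX: "a p q u \<in> car (X p (Suc q))" by (rule a_closed[OF uv(1)])
 have au: "a p q u = dif K (X p (Suc q)) x v" using uv(3) add_dif_cancel[OF X aX vX] by simp
 then have aL: "a p q u \<in> Lam p (Suc q)" using submodule_dif[OF X Lam_sub x(1) vL] by simp
 have uI: "u \<in> Icyc p q"
  using aL uv(1) by (simp add: Icyc_def acyc_def Lam_def bcyc_def b_closed ab)
 have "pD p (Suc q) x = pD p (Suc q) (a p q u)"
 proof (rule pD_eq[OF x(1) aL])
  show "dif K (X p (Suc q)) x (a p q u) \<in> Nul p (Suc q)"
   unfolding au using uv(2) bbnd_Nul by (auto simp: dif_dif_cancel[OF X xX vX])
 qed
 then have "y = i p q (pD (Suc p) q (b p q u))" using x i_eq[OF uI] by simp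
 then show "y \<in> i p q ` car (D (Suc p) q)" using pD_closed[OF Icyc_b[OF uI]] by blast
next
 assume "y \<in> i p q ` car (D (Suc p) q)"
 then obtain x where x: "x \<in> Lam (Suc p) q" "y = i p q (pD (Suc p) q x)" by (auto elim: D_cases)
 obtain w where w: "w \<in> Icyc p q" "x = b p q w" using x(1) by (rule Lam_Suc_b)
 have wX: "w \<in> car (X p q)" using w by (simp add: Icyc_def)
 have "a p q w \<in> Enul p (Suc q)" using abnd_Enul[of p "Suc q"] wX by (auto simp: abnd_def)
 then show "j p (Suc q) y = \<zero>\<^bsub>E p (Suc q)\<^esub>"
  using x w i_eq[OF w(1)] j_eq[OF Icyc_a[OF w(1)]] e_zero subsetD[OF Lam_Ecyc Icyc_a[OF w(1)]] by simp
qed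

lemma exact_j_0: assumes y: "y \<in> car (D p 0)" and j0: "j p 0 y = \<zero>\<^bsub>E p 0\<^esub>"
 shows "y = \<zero>\<^bsub>D p 0\<^esub>"
proof -
 obtain x where x: "x \<in> Lam p 0" "y = pD p 0 x" using y by (rule D_cases)
 have "x \<in> Enul p 0" using j0 x j_eq[OF x(1)] e_zero subsetD[OF Lam_Ecyc x(1)] by metis
 then obtain v where v: "v \<in> bbnd p 0" "x = \<zero>\<^bsub>X p 0\<^esub> \<oplus>\<^bsub>X p 0\<^esub> v"
  by (auto simp: Enul_def abnd_def)
 interpret X: module K "X p 0" by (rule X)
 have "x = v" using v bbnd_sub[of p 0] by (auto simp: submodule_iff[OF X])
 then show ?thesis using v x pD_zero subsetD[OF bbnd_Nul v(1)] by simp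
qed

text \<open>If k kills the class of x, then b w = b v for a cocycle v, and exactness gives w - v = b
  u. The element x - a u has the same class as x in E and is killed by both a and b, so it comes
  from D.\<close>

lemma exact_k_Suc: assumes z: "z \<in> car (E p (Suc q))"
 shows "k p q z = \<zero>\<^bsub>D (Suc (Suc p)) q\<^esub> \<longleftrightarrow> z \<in> j p (Suc q) ` car (D p (Suc q))"
proof
 assume k0: "k p q z = \<zero>\<^bsub>D (Suc (Suc p)) q\<^esub>"
 obtain x where x: "x \<in> Ecyc p (Suc q)" "z = e p (Suc q) x" using z by (rule E_cases)
 obtain w where w: "w \<in> car (X (Suc p) q)" "a (Suc p) q w = b p (Suc q) x" using x(1) by (rule EcycE)
 have xa: "x \<in> acyc p (Suc q)" and xX: "x \<in> car (X p (Suc q))" using x acyc_carrier by (auto simp: Ecyc_def)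
 have "b (Suc p) q w \<in> Nul (Suc (Suc p)) q"
  using k0 x k_eq[OF x(1) w] pD_zero[OF k_Lam[OF xa w]] by simp
 then obtain v where v: "v \<in> acyc (Suc p) q" "b (Suc p) q w = b (Suc p) q v" by (auto simp: Nul_Suc)
 have vX: "v \<in> car (X (Suc p) q)" using v acyc_carrier by blast
 have "b (Suc p) q (dif K (X (Suc p) q) w v) = \<zero>\<^bsub>X (Suc (Suc p)) q\<^esub>"
  using v by (simp add: lin_dif[OF b X w(1) vX] dif_dif_zero[OF X] b_closed[OF vX])
 then obtain u where u: "u \<in> car (X p q)" "dif K (X (Suc p) q) w v = b p q u"
  using exact[OF dif_closed[OF X w(1) vX]] by blast
 have "b p (Suc q) (a p q u) = a (Suc p) q (dif K (X (Suc p) q) w v)" using u ab by simp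
 also have "\<dots> = b p (Suc q) x"
  using v w by (simp add: lin_dif[OF a X w(1) vX] acyc_def dif_zero[OF X] b_closed[OF xX])
 finally have bu: "b p (Suc q) (a p q u) = b p (Suc q) x" .
 have aX: "a p q u \<in> car (X p (Suc q))" by (rule a_closed[OF u(1)])
 let ?x = "dif K (X p (Suc q)) x (a p q u)"
 have xL: "?x \<in> Lam p (Suc q)"
  using submodule_dif[OF X acyc_sub xa a_acyc[OF u(1)]] bu
  by (simp add: Lam_def bcyc_def dif_closed[OF X xX aX] lin_dif[OF b X xX aX] dif_dif_zero[OF X b_closed[OF xX]])
 have aE: "a p q u \<in> abnd p (Suc q)" using u by (simp add: abnd_def)
 have aE': "a p q u \<in> Ecyc p (Suc q)" using aE abnd_Ecyc by blast
 have "e p (Suc q) ?x = dif K (E p (Suc q)) (e p (Suc q) x) (e p (Suc q) (a p q u))"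
  using lin_dif[OF e Espace, of x p "Suc q" "a p q u"] x(1) aE' by simp
 also have "e p (Suc q) (a p q u) = \<zero>\<^bsub>E p (Suc q)\<^esub>" using e_zero[OF aE'] aE abnd_Enul by blast
 also have "dif K (E p (Suc q)) (e p (Suc q) x) \<zero>\<^bsub>E p (Suc q)\<^esub> = z" using x dif_zero[OF E e_closed] by simp
 finally have "z = j p (Suc q) (pD p (Suc q) ?x)" using j_eq[OF xL] by simp
 then show "z \<in> j p (Suc q) ` car (D p (Suc q))" using pD_closed[OF xL] by blast
next
 assume "z \<in> j p (Suc q) ` car (D p (Suc q))"
 then obtain x where x: "x \<in> Lam p (Suc q)" "z = j p (Suc q) (pD p (Suc q) x)" by (auto elim: D_cases)
 have xE: "x \<in> Ecyc p (Suc q)" using x Lam_Ecyc by blast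
 have "k p q (e p (Suc q) x) = pD (Suc (Suc p)) q (b (Suc p) q \<zero>\<^bsub>X (Suc p) q\<^esub>)"
  using x by (intro k_eq[OF xE X0]) (simp add: Lam_def bcyc_def a0)
 then show "k p q z = \<zero>\<^bsub>D (Suc (Suc p)) q\<^esub>"
  using x j_eq[OF x(1)] lin_zero[OF pD Lspace Dspace, of "Suc (Suc p)" q] by (simp add: b0)
qed

lemma exact_k_0: assumes z: "z \<in> car (E p 0)" shows "z \<in> j p 0 ` car (D p 0)"
proof -
 obtain x where x: "x \<in> Ecyc p 0" "z = e p 0 x" using z by (rule E_cases)
 then have "x \<in> Lam p 0" using acyc_carrier by (auto simp: Ecyc_def Lam_def bcyc_def abnd_def)
 then show ?thesis using x j_eq pD_closed by (intro image_eqI[of _ _ "pD p 0 x"]) auto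
qed

text \<open>If E lives in q = 0 only, then k vanishes and all maps i are bijective. They connect D 0
  n with D n 0, and j identifies the latter with E n 0.\<close>

lemma vs_iso_edge:
 assumes triv: "\<And>p q. car (E p (Suc q)) = {\<zero>\<^bsub>E p (Suc q)\<^esub>}"
 shows "vs_iso K (D 0 n) (E n 0)"
proof -
 have k0: "k p q x = \<zero>\<^bsub>D (Suc (Suc p)) q\<^esub>" if "x \<in> car (E p (Suc q))" for p q x
  using that triv lin_zero[OF k_lin E Dspace] by simp
 have i: "bij_betw (i p q) (car (D (Suc p) q)) (car (D p (Suc q)))" for p q
 proof (rule bij_betw_linI[OF Dspace Dspace i_lin])
  fix x assume x: "x \<in> car (D (Suc p) q)" "i p q x = \<zero>\<^bsub>D p (Suc q)\<^esub>"
  show "x = \<zero>\<^bsub>D (Suc p) q\<^esub>"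
  proof (cases p)
   case 0 then show ?thesis using exact_i_0 x by blast
  next
   case (Suc p') then show ?thesis using exact_i_Suc[of x p' q] x k0 by auto
  qed
 next
  fix y assume y: "y \<in> car (D p (Suc q))"
  then have "j p (Suc q) y = \<zero>\<^bsub>E p (Suc q)\<^esub>" using lin_closed[OF j_lin y] triv by blast
  then show "\<exists>x\<in>car (D (Suc p) q). i p q x = y" using exact_j_Suc[OF y] by blast
 qed
 have "vs_iso K (D p q) (D 0 (q + p))" for p q
 proof (induction p arbitrary: q)
  case 0 show ?case using vs_iso_refl[OF Dspace] by simp
 next
  case (Suc p)
  have "vs_iso K (D (Suc p) q) (D p (Suc q))" using i i_lin unfolding vs_iso_def by blast
  then show ?case using vs_iso_trans[OF Dspace _ Suc.IH[of "Suc q"]] by simp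
 qed
 from this[of n 0] have 1: "vs_iso K (D 0 n) (D n 0)" using vs_iso_sym[OF Dspace] by simp
 have "bij_betw (j n 0) (car (D n 0)) (car (E n 0))"
  using exact_j_0 exact_k_0 by (intro bij_betw_linI[OF Dspace E j_lin]) blast+
 then have "vs_iso K (D n 0) (E n 0)" using j_lin by (auto simp: vs_iso_def)
 with 1 show ?thesis by (rule vs_iso_trans[OF Dspace])
qed

section \<open>Extension of the couple to integer indices\<close>

definition "DZ = (D 0 0)\<lparr>carrier := {\<zero>\<^bsub>D 0 0\<^esub>}\<rparr>"
definition "EZ = (E 0 0)\<lparr>carrier := {\<zero>\<^bsub>E 0 0\<^esub>}\<rparr>"
text \<open>For p < 0 the terms repeat D 0 (p + q) with i as the identity: since E is zero there,
  exactness forces i to be bijective. Below both boundaries D is a zero space.\<close>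

definition Di :: "int => int => ('k, 'x) module" where
 "Di p q = (if 0 \<le> p then if 0 \<le> q then D (nat p) (nat q) else DZ
  else if 0 \<le> p + q then D 0 (nat (p + q)) else DZ)"
definition Ei :: "int => int => ('k, 'e) module" where
 "Ei p q = (if 0 \<le> p \<and> 0 \<le> q then E (nat p) (nat q) else EZ)"
definition "ii p q = (if p \<le> 0 then (\<lambda>x\<in>car (Di p q). x)
  else if 0 \<le> q then i (nat (p - 1)) (nat q) else (\<lambda>x\<in>car (Di p q). \<zero>\<^bsub>Di (p - 1) (q + 1)\<^esub>))"
definition "ji p q = (if 0 \<le> p \<and> 0 \<le> q then j (nat p) (nat q) else (\<lambda>x\<in>car (Di p q). \<zero>\<^bsub>Ei p q\<^esub>))"
definition "ki p q = (if 0 \<le> p \<and> 1 \<le> q then k (nat p) (nat (q - 1)) else (\<lambda>x\<in>car (Ei p q). \<zero>\<^bsub>Di (p + 2) (q - 1)\<^esub>))"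

lemma DZ: "module K DZ" "\<zero>\<^bsub>DZ\<^esub> \<in> car DZ"
 unfolding DZ_def using submodule_module[OF Dspace submodule_zero[OF Dspace]] by simp_all

lemma EZ: "module K EZ" "\<zero>\<^bsub>EZ\<^esub> \<in> car EZ"
 unfolding EZ_def using submodule_module[OF E submodule_zero[OF E]] by simp_all

lemma Di: "module K (Di p q)" by (simp add: Di_def Dspace DZ)
lemma Ei: "module K (Ei p q)" by (simp add: Ei_def E EZ)

lemma Di_triv: "0 \<le> p ==> q < 0 ==> car (Di p q) = {\<zero>\<^bsub>Di p q\<^esub>}"
 by (simp add: Di_def DZ_def)

lemma Ei_triv: "p < 0 \<or> q < 0 ==> car (Ei p q) = {\<zero>\<^bsub>Ei p q\<^esub>}"
 by (auto simp: Ei_def EZ_def)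

lemma Di_neg: "p \<le> 0 ==> Di (p - 1) (q + 1) = Di p q"
 by (auto simp: Di_def)

lemma Di_nat: "Di (int p) (int q) = D p q" by (simp add: Di_def)
lemma Ei_nat: "Ei (int p) (int q) = E p q" by (simp add: Ei_def)

lemma ii_lin: "ii p q \<in> lin_maps K (Di p q) (Di (p - 1) (q + 1))"
proof (cases "p \<le> 0")
 case True then show ?thesis using Di_neg[OF True, of q] lin_id[OF Di, of p q] by (simp add: ii_def)
next
 case False
 then obtain m where p: "p = int (Suc m)" by (metis int_eq_iff not_le order.strict_implies_order Suc_pred zero_less_nat_eq)
 show ?thesis
 proof (cases "0 \<le> q")
  case True
  then obtain n where q: "q = int n" using nonneg_int_cases by blast
  have "p - 1 = int m" "q + 1 = int (Suc n)" using p q by simp_all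
  then have "Di (p - 1) (q + 1) = D m (Suc n)" by (simp only: Di_nat)
  moreover have "ii p q = i m n" unfolding ii_def using p q by simp
  ultimately show ?thesis using i_lin[of m n] p q Di_nat by (simp only:)
 next
  case F: False
  then show ?thesis using False lin_zero_map[OF Di Di] by (simp add: ii_def)
 qed
qed

lemma ji_lin: "ji p q \<in> lin_maps K (Di p q) (Ei p q)"
 using j_lin[of "nat p" "nat q"] lin_zero_map[OF Di Ei, of p q p q] by (simp add: ji_def Di_def Ei_def)

lemma ki_lin: "ki p q \<in> lin_maps K (Ei p q) (Di (p + 2) (q - 1))"
proof (cases "0 \<le> p \<and> 1 \<le> q")
 case True
 then obtain m n where p: "p = int m" and q: "q = int (Suc n)"
  by (metis nonneg_int_cases zero_le_one order_trans One_nat_def Suc_pred int_one_le_iff_zero_less zero_less_iff_neq_zero not_less_zero le_zero_eq of_nat_0_less_iff)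
 have "p + 2 = int (Suc (Suc m))" "q - 1 = int n" using p q by simp_all
 then have "Di (p + 2) (q - 1) = D (Suc (Suc m)) n" by (simp only: Di_nat)
 moreover have "ki p q = k m n" unfolding ki_def using p q by simp
 ultimately show ?thesis using k_lin[of m n] p q Ei_nat by (simp only:)
next
 case False then show ?thesis using lin_zero_map[OF Ei Di] by (simp add: ki_def if_not_P del: not_le)
qed

lemma ki_triv: "p < 0 \<or> q < 1 ==> ki p q ` car (Ei p q) = {\<zero>\<^bsub>Di (p + 2) (q - 1)\<^esub>}"
 using EZ E submodule_zero[OF Ei, of p q] unfolding submodule_iff[OF Ei] by (auto simp: ki_def)

lemma ii_exact: assumes y: "y \<in> car (Di p q)"
 shows "ii p q y = \<zero>\<^bsub>Di (p - 1) (q + 1)\<^esub> \<longleftrightarrow> y \<in> ki (p - 2) (q + 1) ` car (Ei (p - 2) (q + 1))"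
proof (cases "p \<le> 0")
 case True
 then show ?thesis using y Di_neg[OF True, of q] ki_triv[of "p - 2" "q + 1"] by (simp add: ii_def)
next
 case False
 then obtain m where p: "p = int (Suc m)" by (metis int_eq_iff not_le order.strict_implies_order Suc_pred zero_less_nat_eq)
 show ?thesis
 proof (cases "0 \<le> q")
  case True
  then obtain n where q: "q = int n" using nonneg_int_cases by blast
  have "p - 1 = int m" "q + 1 = int (Suc n)" using p q by simp_all
  then have 1: "Di (p - 1) (q + 1) = D m (Suc n)" by (simp only: Di_nat)
  have 2: "ii p q = i m n" unfolding ii_def using p q by simp
  have y': "y \<in> car (D (Suc m) n)" using y p q Di_nat by (simp only:)
  show ?thesis
  proof (cases m)
   case 0
   have "i 0 n \<zero>\<^bsub>D (Suc 0) n\<^esub> = \<zero>\<^bsub>D 0 (Suc n)\<^esub>" by (rule lin_zero[OF i_lin Dspace Dspace])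
   then have "i 0 n y = \<zero>\<^bsub>D 0 (Suc n)\<^esub> \<longleftrightarrow> y = \<zero>\<^bsub>D (Suc 0) n\<^esub>"
    using exact_i_0[of y n] y' 0 by metis
   moreover have "Di (p - 2 + 2) (q + 1 - 1) = D (Suc 0) n" using p q 0 Di_nat[of "Suc 0" n] by simp
   ultimately show ?thesis using ki_triv[of "p - 2" "q + 1"] 1 2 p 0 by auto
  next
   case (Suc m')
   have "p - 2 = int m'" "q + 1 = int (Suc n)" using p q Suc by simp_all
   then have "Ei (p - 2) (q + 1) = E m' (Suc n)" by (simp only: Ei_nat)
   moreover have "ki (p - 2) (q + 1) = k m' n" unfolding ki_def using p q Suc by simp
   ultimately show ?thesis using exact_i_Suc[of y m' n] y' Suc 1 2 by (simp only:)
  qed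
 next
  case F: False
  then have "y = \<zero>\<^bsub>Di p q\<^esub>" using y False Di_triv[of p q] by auto
  moreover have "ii p q y = \<zero>\<^bsub>Di (p - 1) (q + 1)\<^esub>" using F False y by (simp add: ii_def)
  moreover have "\<zero>\<^bsub>Di p q\<^esub> \<in> ki (p - 2) (q + 1) ` car (Ei (p - 2) (q + 1))"
   using ki_triv[of "p - 2" "q + 1"] F by simp
  ultimately show ?thesis by simp
 qed
qed

lemma ji_exact: assumes y: "y \<in> car (Di p q)"
 shows "ji p q y = \<zero>\<^bsub>Ei p q\<^esub> \<longleftrightarrow> y \<in> ii (p + 1) (q - 1) ` car (Di (p + 1) (q - 1))"
proof (cases "0 \<le> p")
 case False
 then have "Di (p + 1) (q - 1) = Di p q" using Di_neg[of "p + 1" "q - 1"] by simp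
 then show ?thesis using False y by (simp add: ii_def ji_def)
next
 case p: True
 then obtain m where m: "p = int m" using nonneg_int_cases by blast
 have D0: "\<zero>\<^bsub>Di (p + 1) (q - 1)\<^esub> \<in> car (Di (p + 1) (q - 1))"
  using submodule_zero[OF Di, of "p + 1" "q - 1"] by (simp add: submodule_iff[OF Di])
 have triv: "ii (p + 1) (q - 1) ` car (Di (p + 1) (q - 1)) = {\<zero>\<^bsub>Di p q\<^esub>}" if "q \<le> 0"
  using that p D0 Di_triv[of "p + 1" "q - 1"] by (simp add: ii_def)
 show ?thesis
 proof (cases "0 \<le> q")
  case True
  then obtain n where n: "q = int n" using nonneg_int_cases by blast
  have 1: "ji p q = j m n" "Ei p q = E m n" "Di p q = D m n" using m n by (simp_all add: ji_def Ei_nat Di_nat)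
  show ?thesis
  proof (cases n)
   case 0
   have "j m n y = \<zero>\<^bsub>E m n\<^esub> \<longleftrightarrow> y = \<zero>\<^bsub>D m n\<^esub>"
    using exact_j_0[of y m] y 1 0 lin_zero[OF j_lin Dspace E, of m n] by auto
   then show ?thesis using triv n 0 1 by simp
  next
   case (Suc n')
   have idx: "p + 1 = int (Suc m)" "q - 1 = int n'" using m n Suc by simp_all
   have "Di (p + 1) (q - 1) = D (Suc m) n'" unfolding idx by (rule Di_nat)
   moreover have "ii (p + 1) (q - 1) = i m n'" using m n Suc by (simp add: ii_def)
   ultimately show ?thesis using exact_j_Suc[of y m n'] y 1 Suc by simp
  qed
 next
  case False
  then have "y = \<zero>\<^bsub>Di p q\<^esub>" using y p Di_triv[of p q] by auto
  then show ?thesis using triv False y p by (simp add: ji_def)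
 qed
qed

lemma ki_exact: assumes x: "x \<in> car (Ei p q)"
 shows "ki p q x = \<zero>\<^bsub>Di (p + 2) (q - 1)\<^esub> \<longleftrightarrow> x \<in> ji p q ` car (Di p q)"
proof (cases "0 \<le> p \<and> 0 \<le> q")
 case False
 then have "x = \<zero>\<^bsub>Ei p q\<^esub>" using x Ei_triv[of p q] by auto
 moreover have "\<zero>\<^bsub>Di p q\<^esub> \<in> car (Di p q)"
  using submodule_zero[OF Di, of p q] by (simp add: submodule_iff[OF Di])
 moreover have "ki p q x = \<zero>\<^bsub>Di (p + 2) (q - 1)\<^esub>" using False x by (auto simp: ki_def)
 ultimately show ?thesis using False by (auto simp: ji_def if_not_P simp del: not_le)
next
 case True
 obtain m where m: "p = int m" using True nonneg_int_cases by blast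
 obtain n where n: "q = int n" using True nonneg_int_cases by blast
 have 1: "ji p q = j m n" "Ei p q = E m n" "Di p q = D m n" using m n by (simp_all add: ji_def Ei_nat Di_nat)
 show ?thesis
 proof (cases n)
  case 0
  then show ?thesis using exact_k_0[of x m] x 1 n by (simp add: ki_def)
 next
  case (Suc n')
  have idx: "p + 2 = int (Suc (Suc m))" "q - 1 = int n'" using m n Suc by simp_all
  have "Di (p + 2) (q - 1) = D (Suc (Suc m)) n'" unfolding idx by (rule Di_nat)
  moreover have "ki p q = k m n'" using m n Suc by (simp add: ki_def)
  ultimately show ?thesis using exact_k_Suc[of x m n'] x 1 Suc by simp
 qed
qed

lemma exact_couple: "exact_couple K Di Ei ii ji ki"
 by (intro exact_couple.intro K Di Ei ii_lin ji_lin ki_lin ii_exact ji_exact ki_exact Ei_triv Di_triv)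

lemma D0_iso:
 assumes A: "module K A" and h: "h \<in> lin_maps K (Lspace 0 n) A" and surj: "h ` Lam 0 n = car A"
  and zero: "\<And>x. x \<in> Lam 0 n ==> h x = \<zero>\<^bsub>A\<^esub> \<longleftrightarrow> x \<in> Nul 0 n"
 shows "\<exists>\<alpha>\<in>lin_maps K (D 0 n) A. bij_betw \<alpha> (car (D 0 n)) (car A)"
proof -
 show ?thesis
 proof (rule lin_iso_span[OF Lspace Dspace A pD h])
  show "pD 0 n ` car (Lspace 0 n) = car (D 0 n)" by (simp add: D_carrier)
  show "h ` car (Lspace 0 n) = car A" by (simp add: surj)
  show "pD 0 n l = \<zero>\<^bsub>D 0 n\<^esub> \<longleftrightarrow> h l = \<zero>\<^bsub>A\<^esub>" if "l \<in> car (Lspace 0 n)" for l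
   using that zero pD_zero by simp
 qed blast
qed

theorem spectral_sequence:
 fixes A :: "nat => ('k, 'a) module"
 assumes A: "\<And>n. module K (A n)" and h: "\<And>n. h n \<in> lin_maps K (Lspace 0 n) (A n)"
  and surj: "\<And>n. h n ` Lam 0 n = car (A n)"
  and zero: "\<And>n x. x \<in> Lam 0 n ==> h n x = \<zero>\<^bsub>A n\<^esub> \<longleftrightarrow> x \<in> Nul 0 n"
 shows "\<exists>E' d. first_quadrant_spectral_sequence K E' d \<and> (\<forall>p q. E' 2 (int p) (int q) = E p q) \<and> converges_to K E' A"
proof -
 interpret C: exact_couple K Di Ei ii ji ki by (rule exact_couple)
 have "\<forall>n. \<exists>\<alpha>. \<alpha> \<in> lin_maps K (Di 0 (int n)) (A n) \<and> bij_betw \<alpha> (car (Di 0 (int n))) (car (A n))"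
  using D0_iso[OF A h surj zero] Di_nat[of 0] by (auto simp: Bex_def)
 then obtain \<alpha> where "\<And>n. \<alpha> n \<in> lin_maps K (Di 0 (int n)) (A n)"
  "\<And>n. bij_betw (\<alpha> n) (car (Di 0 (int n))) (car (A n))" by metis
 from C.converges[OF A this] have "converges_to K (\<lambda>r. C.page (r - 2)) A" .
 moreover have "\<forall>p q. C.page (2 - 2) (int p) (int q) = E p q" by (simp add: C.page_0 Ei_nat)
 ultimately show ?thesis using C.spectral_sequence
  by (intro exI[of _ "\<lambda>r. C.page (r - 2)"] exI[of _ "\<lambda>r. C.diff (r - 2)"]) simp
qed

theorem edge_iso:
 assumes "\<And>p q. car (E p (Suc q)) = {\<zero>\<^bsub>E p (Suc q)\<^esub>}"
  and "module K A" and "h \<in> lin_maps K (Lspace 0 n) A" and "h ` Lam 0 n = car A"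
  and "\<And>x. x \<in> Lam 0 n ==> h x = \<zero>\<^bsub>A\<^esub> \<longleftrightarrow> x \<in> Nul 0 n"
 shows "vs_iso K A (E n 0)"
proof -
 have "vs_iso K (D 0 n) A" using D0_iso[OF assms(2-5)] by (auto simp: vs_iso_def)
 then show ?thesis using vs_iso_edge[OF assms(1), of n] vs_iso_sym[OF Dspace] vs_iso_trans[OF assms(2)] by blast
qed

end

section \<open>Relatively injective modules\<close>

lemma with_act_simps [simp]:
 "car (with_act V \<alpha>) = car V" "add (with_act V \<alpha>) = add V" "zero (with_act V \<alpha>) = zero V"
 "smult (with_act V \<alpha>) = smult V" "act (with_act V \<alpha>) = \<alpha>"
 by (simp_all add: with_act_def module.defs hmodule.defs)

lemma truncate_simps [simp]:
 "car (module.truncate V) = car V" "add (module.truncate V) = add V"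
 "zero (module.truncate V) = zero V" "smult (module.truncate V) = smult V"
 by (simp_all add: module.defs)

lemma dif_truncate [simp]: "dif K (module.truncate V) = dif K V"
 by (simp add: dif_def fun_eq_iff)

lemma module_cong:
 assumes "module K V" "car W = car V" "add W = add V" "zero W = zero V" "smult W = smult V"
 shows "module K W"
 using module_surj[of K V "\<lambda>x. x" W] assms by auto

lemma module_truncate: "module K V ==> module K (module.truncate V)"
 by (rule module_cong) simp_all

lemma module_with_act: "module K V ==> module K (with_act V \<alpha>)"
 by (rule module_cong) simp_all

lemma lin_truncate [simp]: "lin_maps K (module.truncate V) W = lin_maps K V W"
 "lin_maps K V (module.truncate W') = lin_maps K V W'"
 by (simp_all add: lin_maps_def)

lemma (in left_H_module) act_zero: "h \<in> car H ==> act V h \<zero>\<^bsub>V\<^esub> = \<zero>\<^bsub>V\<^esub>"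
proof -
 interpret V: module K V by (rule vector_space)
 assume "h \<in> car H"
 then have "act V h (\<zero>\<^bsub>K\<^esub> \<odot>\<^bsub>V\<^esub> \<zero>\<^bsub>V\<^esub>) = \<zero>\<^bsub>K\<^esub> \<odot>\<^bsub>V\<^esub> act V h \<zero>\<^bsub>V\<^esub>"
  by (intro act_smult_right) auto
 then show ?thesis using act_closed \<open>h \<in> car H\<close> by simp
qed

lemma (in left_H_module) act_dif: "h \<in> car H ==> x \<in> car V ==> y \<in> car V ==>
  act V h (dif K V x y) = dif K V (act V h x) (act V h y)"
proof -
 interpret V: module K V by (rule vector_space)
 assume "h \<in> car H" "x \<in> car V" "y \<in> car V"
 then show ?thesis by (simp add: dif_def act_add_right act_smult_right)
qed

lemma H_mapsI: "f \<in> lin_maps K V W ==> (\<And>h v. h \<in> car H ==> v \<in> car V ==> f (act V h v) = act W h (f v))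
  ==> f \<in> H_maps K H V W"
 by (simp add: H_maps_def)

lemma H_maps_lin: "f \<in> H_maps K H V W ==> f \<in> lin_maps K V W" by (simp add: H_maps_def)
lemma H_maps_act: "f \<in> H_maps K H V W ==> h \<in> car H ==> v \<in> car V ==> f (act V h v) = act W h (f v)"
 by (simp add: H_maps_def)
lemma H_maps_closed: "f \<in> H_maps K H V W ==> v \<in> car V ==> f v \<in> car W"
 by (rule lin_closed[OF H_maps_lin])

lemma H_maps_compose:
 assumes "left_H_module K H V" "f \<in> H_maps K H V W" "g \<in> H_maps K H W X"
 shows "(\<lambda>x\<in>car V. g (f x)) \<in> H_maps K H V X"
proof -
 interpret V: left_H_module K H V by fact
 show ?thesis
  using lin_compose[OF V.vector_space H_maps_lin[OF assms(2)] H_maps_lin[OF assms(3)]]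
  by (rule H_mapsI) (simp add: V.act_closed H_maps_act[OF assms(2)] H_maps_act[OF assms(3)] H_maps_closed[OF assms(2)])
qed

lemma left_H_module_transport:
 fixes W :: "('k, 'h, 'w) hmodule"
 assumes V: "left_H_module K H V" and f: "f ` car V = car W"
  and add: "\<And>x y. x \<in> car V ==> y \<in> car V ==> f x \<oplus>\<^bsub>W\<^esub> f y = f (x \<oplus>\<^bsub>V\<^esub> y)"
  and smult: "\<And>k x. k \<in> car K ==> x \<in> car V ==> k \<odot>\<^bsub>W\<^esub> f x = f (k \<odot>\<^bsub>V\<^esub> x)"
  and zero: "\<zero>\<^bsub>W\<^esub> = f \<zero>\<^bsub>V\<^esub>"
  and act: "\<And>h x. h \<in> car H ==> x \<in> car V ==> act W h (f x) = f (act V h x)"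
  and H: "hopf_algebra K H"
 shows "left_H_module K H W"
proof -
 interpret V: left_H_module K H V by fact
 interpret VM: module K V by (rule V.vector_space)
 interpret H: hopf_algebra K H by fact
 interpret HM: module K H by (rule H.vector_space)
 interpret HR: ring H by (rule H.ring)
 have ex: "\<exists>x\<in>car V. q = f x" if "q \<in> car W" for q using that f by auto
 have cl: "f x \<in> car W" if "x \<in> car V" for x using that f by auto
 show ?thesis
 proof (rule left_H_module.intro)
  show "module K W" by (rule module_surj[OF V.vector_space f add smult zero])
 qed (auto dest!: ex simp: add smult act cl V.act_closed V.act_add_left V.act_add_right V.act_smult_left
     V.act_smult_right V.act_mult V.act_one)
qed

section \<open>Spaces of linear maps\<close>

definition Lin :: "'k ring => ('k, 'v, 'y) module_scheme => ('k, 'w, 'z) module_scheme => ('k, 'v => 'w) module" where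
 "Lin K V W = \<lparr>carrier = lin_maps K V W, monoid.mult = undefined, one = undefined,
   zero = (\<lambda>x\<in>car V. \<zero>\<^bsub>W\<^esub>), add = (\<lambda>f g. \<lambda>x\<in>car V. f x \<oplus>\<^bsub>W\<^esub> g x),
   smult = (\<lambda>k f. \<lambda>x\<in>car V. k \<odot>\<^bsub>W\<^esub> f x)\<rparr>"

lemma Lin_simps [simp]:
 "car (Lin K V W) = lin_maps K V W" "zero (Lin K V W) = (\<lambda>x\<in>car V. \<zero>\<^bsub>W\<^esub>)"
 "add (Lin K V W) = (\<lambda>f g. \<lambda>x\<in>car V. f x \<oplus>\<^bsub>W\<^esub> g x)"
 "smult (Lin K V W) = (\<lambda>k f. \<lambda>x\<in>car V. k \<odot>\<^bsub>W\<^esub> f x)"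
 by (simp_all add: Lin_def)

lemma lin_plus:
 assumes V: "module K V" and W: "module K W" and f: "f \<in> lin_maps K V W" and g: "g \<in> lin_maps K V W"
 shows "(\<lambda>x\<in>car V. f x \<oplus>\<^bsub>W\<^esub> g x) \<in> lin_maps K V W"
proof -
 interpret W: module K W by fact
 show ?thesis
  by (rule lin_restrictI[OF V])
   (simp_all add: lin_closed[OF f] lin_closed[OF g] lin_add[OF f] lin_add[OF g]
    lin_smult[OF f] lin_smult[OF g] W.smult_r_distr W.a_ac)
qed

lemma lin_scale:
 assumes V: "module K V" and W: "module K W" and f: "f \<in> lin_maps K V W" and k: "k \<in> car K"
 shows "(\<lambda>x\<in>car V. k \<odot>\<^bsub>W\<^esub> f x) \<in> lin_maps K V W"
proof -
 interpret W: module K W by fact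
 show ?thesis
  by (rule lin_restrictI[OF V])
   (simp_all add: lin_closed[OF f] lin_add[OF f] k
    lin_smult[OF f] W.smult_r_distr W.smult_assoc1[symmetric] W.R.m_comm)
qed

lemma lin_difference:
 assumes V: "module K V" and W: "module K W" and f: "f \<in> lin_maps K V W" and g: "g \<in> lin_maps K V W"
 shows "(\<lambda>x\<in>car V. dif K W (f x) (g x)) \<in> lin_maps K V W"
proof -
 interpret W: module K W by fact
 have "(\<lambda>x\<in>car V. f x \<oplus>\<^bsub>W\<^esub> (\<lambda>x\<in>car V. (\<ominus>\<^bsub>K\<^esub> \<one>\<^bsub>K\<^esub>) \<odot>\<^bsub>W\<^esub> g x) x) \<in> lin_maps K V W"
  by (intro lin_plus V W f lin_scale g) simp
 moreover have "(\<lambda>x\<in>car V. f x \<oplus>\<^bsub>W\<^esub> (\<lambda>x\<in>car V. (\<ominus>\<^bsub>K\<^esub> \<one>\<^bsub>K\<^esub>) \<odot>\<^bsub>W\<^esub> g x) x) = (\<lambda>x\<in>car V. dif K W (f x) (g x))"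
  by (auto simp: dif_def)
 ultimately show ?thesis by simp
qed

lemma Lin_module:
 assumes V: "module K V" and W: "module K W"
 shows "module K (Lin K V W)"
 by (rule pointwise_module[where D="car V" and W="\<lambda>_. W" and ev="\<lambda>f. f"])
  (use lin_eqI[of _ K V W _ V W] in \<open>auto simp: V W module.axioms(1)[OF V] lin_zero_map lin_plus lin_scale intro: lin_closed\<close>)

text \<open>A map from \<open>'h\<close> to functions on lists is encoded as a function on lists, so that all \<open>\<Omega>\<^sup>p V\<close> have
 the same type.\<close>

definition unc :: "('h => 'h list => 'v) => 'h list => 'v" where
 "unc \<phi> l = (case l of [] => undefined | h # t => \<phi> h t)"
definition cur :: "('h list => 'v) => 'h => 'h list => 'v" where
 "cur f h t = f (h # t)"

lemma cur_unc [simp]: "cur (unc \<phi>) = \<phi>"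
 by (simp add: cur_def unc_def fun_eq_iff)

lemma unc_eq_iff: "unc \<phi> = unc \<psi> \<longleftrightarrow> \<phi> = \<psi>"
 by (metis cur_unc)

section \<open>The functor \<Omega> and the map \<partial>\<close>

definition Om :: "'k ring => ('k, 'h) hopf => ('k, 'h, 'h list => 'v) hmodule => ('k, 'h, 'h list => 'v) hmodule" where
 "Om K H U = \<lparr>carrier = unc ` {\<phi> \<in> lin_maps K H U. \<phi> \<one>\<^bsub>H\<^esub> = \<zero>\<^bsub>U\<^esub>},
   monoid.mult = undefined, one = undefined, zero = unc (\<lambda>h\<in>car H. \<zero>\<^bsub>U\<^esub>),
   add = (\<lambda>f g. unc (\<lambda>h\<in>car H. cur f h \<oplus>\<^bsub>U\<^esub> cur g h)),
   smult = (\<lambda>k f. unc (\<lambda>h\<in>car H. k \<odot>\<^bsub>U\<^esub> cur f h)),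
   act = (\<lambda>k f. unc (\<lambda>h\<in>car H. dif K U (cur f (h \<otimes>\<^bsub>H\<^esub> k)) (act U h (cur f k))))\<rparr>"

definition OmF :: "'k ring => ('k, 'h) hopf => ('k, 'h, 'h list => 'v) hmodule
  => (('h list => 'v) => ('h list => 'w)) => ('h list => 'v) => ('h list => 'w)" where
 "OmF K H U f = (\<lambda>x\<in>car (Om K H U). unc (\<lambda>h\<in>car H. f (cur x h)))"

definition del :: "'k ring => ('k, 'h) hopf => ('k, 'h, 'h list => 'v) hmodule => ('h list => 'v) => ('h list => 'v)" where
 "del K H U = (\<lambda>u\<in>car U. unc (\<lambda>h\<in>car H. dif K U (act U h u) (counit H h \<odot>\<^bsub>U\<^esub> u)))"

definition inv_set :: "('k, 'h) hopf => ('k, 'h, 'v) hmodule => 'v set" where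
 "inv_set H V = {m \<in> car V. \<forall>h\<in>car H. act V h m = counit H h \<odot>\<^bsub>V\<^esub> m}"

lemma unc_restrict_eq_iff [simp]: "unc (restrict A S) = unc (restrict B S) \<longleftrightarrow> (\<forall>h\<in>S. A h = B h)"
 unfolding unc_eq_iff by (metis restrict_apply' restrict_ext)

declare restrict_cong [cong]

lemma lin_eta: "\<phi> \<in> lin_maps K V W ==> restrict \<phi> (car V) = \<phi>"
 by (simp add: lin_maps_def PiE_def extensional_restrict)

text \<open>The action on linear maps \<open>\<phi> : H \<rightarrow> U\<close> is \<open>(k \<phi>) h = \<phi> (h k)\<close>; \<open>\<rho>\<close> is an equivariant retraction
 of \<open>u \<mapsto> (h \<mapsto> h u)\<close>.\<close>

definition rinj_map :: "'k ring => ('k, 'h) hopf => ('k, 'h, 'v) hmodule => (('h => 'v) => 'v) => bool" where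
 "rinj_map K H U \<rho> \<longleftrightarrow> (\<forall>\<phi>\<in>lin_maps K H U. \<rho> \<phi> \<in> car U) \<and>
   (\<forall>\<phi>\<in>lin_maps K H U. \<forall>\<psi>\<in>lin_maps K H U. \<rho> (\<lambda>h\<in>car H. \<phi> h \<oplus>\<^bsub>U\<^esub> \<psi> h) = \<rho> \<phi> \<oplus>\<^bsub>U\<^esub> \<rho> \<psi>) \<and>
   (\<forall>k\<in>car H. \<forall>\<phi>\<in>lin_maps K H U. \<rho> (\<lambda>h\<in>car H. \<phi> (h \<otimes>\<^bsub>H\<^esub> k)) = act U k (\<rho> \<phi>)) \<and>
   (\<forall>u\<in>car U. \<rho> (\<lambda>h\<in>car H. act U h u) = u)"

definition rinj :: "'k ring => ('k, 'h) hopf => ('k, 'h, 'v) hmodule => bool" where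
 "rinj K H U \<longleftrightarrow> (\<exists>\<rho>. rinj_map K H U \<rho>)"

lemma Om_simps [simp]:
 "\<zero>\<^bsub>Om K H U\<^esub> = unc (\<lambda>h\<in>car H. \<zero>\<^bsub>U\<^esub>)"
 "unc \<phi> \<oplus>\<^bsub>Om K H U\<^esub> unc \<psi> = unc (\<lambda>h\<in>car H. \<phi> h \<oplus>\<^bsub>U\<^esub> \<psi> h)"
 "k \<odot>\<^bsub>Om K H U\<^esub> unc \<phi> = unc (\<lambda>h\<in>car H. k \<odot>\<^bsub>U\<^esub> \<phi> h)"
 "act (Om K H U) g (unc \<phi>) = unc (\<lambda>h\<in>car H. dif K U (\<phi> (h \<otimes>\<^bsub>H\<^esub> g)) (act U h (\<phi> g)))"
 by (simp_all add: Om_def)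

lemma Om_carrier: "car (Om K H U) = unc ` {\<phi> \<in> lin_maps K H U. \<phi> \<one>\<^bsub>H\<^esub> = \<zero>\<^bsub>U\<^esub>}"
 by (simp add: Om_def)

lemma Om_cases: assumes "x \<in> car (Om K H U)"
 obtains \<phi> where "\<phi> \<in> lin_maps K H U" "\<phi> \<one>\<^bsub>H\<^esub> = \<zero>\<^bsub>U\<^esub>" "x = unc \<phi>"
 using assms by (auto simp: Om_carrier)

lemma unc_in_Om [simp]: "unc \<phi> \<in> car (Om K H U) \<longleftrightarrow> \<phi> \<in> lin_maps K H U \<and> \<phi> \<one>\<^bsub>H\<^esub> = \<zero>\<^bsub>U\<^esub>"
 by (auto simp: Om_carrier unc_eq_iff)

lemma rinj_mapD:
 assumes "rinj_map K H U \<rho>"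
 shows "\<And>\<phi>. \<phi> \<in> lin_maps K H U ==> \<rho> \<phi> \<in> car U"
  "\<And>\<phi> \<psi>. \<phi> \<in> lin_maps K H U ==> \<psi> \<in> lin_maps K H U ==> \<rho> (\<lambda>h\<in>car H. \<phi> h \<oplus>\<^bsub>U\<^esub> \<psi> h) = \<rho> \<phi> \<oplus>\<^bsub>U\<^esub> \<rho> \<psi>"
  "\<And>k \<phi>. k \<in> car H ==> \<phi> \<in> lin_maps K H U ==> \<rho> (\<lambda>h\<in>car H. \<phi> (h \<otimes>\<^bsub>H\<^esub> k)) = act U k (\<rho> \<phi>)"
  "\<And>u. u \<in> car U ==> \<rho> (\<lambda>h\<in>car H. act U h u) = u"
 using assms unfolding rinj_map_def by blast+

context hopf_algebra
begin

abbreviation hmult (infixl "\<cdot>" 70) where "a \<cdot> b \<equiv> a \<otimes>\<^bsub>H\<^esub> b"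
abbreviation "Hmod \<equiv> left_H_module K H"

interpretation HM: module K H by (rule vector_space)
interpretation HR: ring H by (rule ring)
interpretation KF: field K by (rule field)

lemma lin_H_rmult: assumes "\<phi> \<in> lin_maps K H U" "k \<in> car H"
 shows "(\<lambda>h\<in>car H. \<phi> (h \<cdot> k)) \<in> lin_maps K H U"
 by (rule lin_restrictI[OF vector_space])
  (use assms in \<open>simp_all add: lin_closed[OF assms(1)] lin_add[OF assms(1)] lin_smult[OF assms(1)]
    HR.l_distr smult_mult_left\<close>)

lemma lin_H_act: assumes "Hmod U" "u \<in> car U"
 shows "(\<lambda>h\<in>car H. act U h u) \<in> lin_maps K H U"
proof -
 interpret U: left_H_module K H U by fact
 show ?thesis
  by (rule lin_restrictI[OF vector_space])
   (use assms in \<open>simp_all add: U.act_closed U.act_add_left U.act_smult_left\<close>)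
qed

lemma Om_act_lin: assumes U: "Hmod U" and \<phi>: "\<phi> \<in> lin_maps K H U" and k: "k \<in> car H"
 shows "(\<lambda>h\<in>car H. dif K U (\<phi> (h \<cdot> k)) (act U h (\<phi> k))) \<in> lin_maps K H U"
proof -
 interpret U: left_H_module K H U by fact
 have "(\<lambda>h\<in>car H. dif K U ((\<lambda>h\<in>car H. \<phi> (h \<cdot> k)) h) ((\<lambda>h\<in>car H. act U h (\<phi> k)) h)) \<in> lin_maps K H U"
  by (intro lin_difference vector_space U.vector_space lin_H_rmult lin_H_act U \<phi> k lin_closed[OF \<phi>])
 moreover have "(\<lambda>h\<in>car H. dif K U ((\<lambda>h\<in>car H. \<phi> (h \<cdot> k)) h) ((\<lambda>h\<in>car H. act U h (\<phi> k)) h))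
   = (\<lambda>h\<in>car H. dif K U (\<phi> (h \<cdot> k)) (act U h (\<phi> k)))" by auto
 ultimately show ?thesis by simp
qed

lemma Om_vector_space: assumes U: "module K U" shows "module K (Om K H U)"
proof -
 interpret U: module K U by fact
 let ?L = "Lin K H U" and ?Z = "{\<phi> \<in> lin_maps K H U. \<phi> \<one>\<^bsub>H\<^esub> = \<zero>\<^bsub>U\<^esub>}"
 have L: "module K ?L" by (rule Lin_module[OF vector_space U])
 have "submodule ?Z K ?L"
  unfolding submodule_iff[OF L]
  by (auto simp: lin_zero_map[OF vector_space U] lin_plus[OF vector_space U] lin_scale[OF vector_space U])
 from submodule_module[OF L this] show ?thesis
  by (rule module_surj[of K _ unc]) (auto simp: Om_carrier)
qed

lemma Om_H_module: assumes U: "Hmod U" shows "Hmod (Om K H U)"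
proof -
 interpret U: left_H_module K H U by fact
 interpret UM: module K U by (rule U.vector_space)
 note d = dif_closed[OF U.vector_space] dif_add_add[OF U.vector_space] dif_smult[OF U.vector_space]
 show ?thesis
 proof (rule left_H_module.intro)
  show "module K (Om K H U)" by (rule Om_vector_space[OF U.vector_space])
 next
  fix h v assume h: "h \<in> car H" and v: "v \<in> car (Om K H U)"
  from v obtain \<phi> where \<phi>: "\<phi> \<in> lin_maps K H U" "\<phi> \<one>\<^bsub>H\<^esub> = \<zero>\<^bsub>U\<^esub>" "v = unc \<phi>" by (rule Om_cases)
  note c = lin_closed[OF \<phi>(1)]
  show "act (Om K H U) h v \<in> car (Om K H U)"
   using \<phi>(3) h c by (simp add: Om_act_lin[OF U \<phi>(1)] U.act_one dif_dif_zero[OF U.vector_space])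
  { fix g assume g: "g \<in> car H"
   show "act (Om K H U) (g \<oplus>\<^bsub>H\<^esub> h) v = act (Om K H U) g v \<oplus>\<^bsub>Om K H U\<^esub> act (Om K H U) h v"
    unfolding \<phi>(3) using g h c
    by (auto simp: HR.r_distr lin_add[OF \<phi>(1)] U.act_add_right U.act_closed d)
   show "act (Om K H U) (g \<cdot> h) v = act (Om K H U) g (act (Om K H U) h v)"
   proof -
    \<comment> \<open>The term (x g) (\<phi> h) = x (g (\<phi> h)) occurs in both outer differences
      and cancels.\<close>
    have "dif K U (dif K U (\<phi> (x \<cdot> g \<cdot> h)) (act U (x \<cdot> g) (\<phi> h)))
       (act U x (dif K U (\<phi> (g \<cdot> h)) (act U g (\<phi> h))))
       = dif K U (\<phi> (x \<cdot> (g \<cdot> h))) (act U x (\<phi> (g \<cdot> h)))" if x: "x \<in> car H" for x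
    proof -
     have e: "dif K U (dif K U a b) (dif K U c b) = dif K U a c"
      if "a \<in> car U" "b \<in> car U" "c \<in> car U" for a b c
      using that dif_trans[OF U.vector_space, of a c b] add_dif_cancel[OF U.vector_space, of "dif K U a c" "dif K U c b"]
      by (simp add: dif_closed[OF U.vector_space])
     show ?thesis using x g h c
      by (simp add: U.act_dif U.act_closed U.act_mult HR.m_assoc e)
    qed
    then show ?thesis unfolding \<phi>(3) using g h by auto
   qed }
  { fix k assume k: "k \<in> car K"
   show "act (Om K H U) (k \<odot>\<^bsub>H\<^esub> h) v = k \<odot>\<^bsub>Om K H U\<^esub> act (Om K H U) h v"
    unfolding \<phi>(3) using k h c
    by (auto simp: smult_mult_right lin_smult[OF \<phi>(1)] U.act_smult_right U.act_closed d)
   show "act (Om K H U) h (k \<odot>\<^bsub>Om K H U\<^esub> v) = k \<odot>\<^bsub>Om K H U\<^esub> act (Om K H U) h v"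
    unfolding \<phi>(3) using k h c
    by (auto simp: U.act_smult_right U.act_closed d) }
  { fix w assume "w \<in> car (Om K H U)"
   then obtain \<psi> where \<psi>: "\<psi> \<in> lin_maps K H U" "\<psi> \<one>\<^bsub>H\<^esub> = \<zero>\<^bsub>U\<^esub>" "w = unc \<psi>" by (rule Om_cases)
   show "act (Om K H U) h (v \<oplus>\<^bsub>Om K H U\<^esub> w) = act (Om K H U) h v \<oplus>\<^bsub>Om K H U\<^esub> act (Om K H U) h w"
    unfolding \<phi>(3) \<psi>(3) using h c
    by (auto simp: lin_closed[OF \<psi>(1)] U.act_add_right U.act_closed d) }
 next
  fix v assume "v \<in> car (Om K H U)"
  then obtain \<phi> where \<phi>: "\<phi> \<in> lin_maps K H U" "\<phi> \<one>\<^bsub>H\<^esub> = \<zero>\<^bsub>U\<^esub>" "v = unc \<phi>" by (rule Om_cases)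
  note c = lin_closed[OF \<phi>(1)]
  have "act (Om K H U) \<one>\<^bsub>H\<^esub> (unc \<phi>) = unc (restrict \<phi> (car H))"
   using c \<phi>(2) by (simp add: U.act_zero dif_zero[OF U.vector_space])
  then show "act (Om K H U) \<one>\<^bsub>H\<^esub> v = v"
   unfolding \<phi>(3) by (simp add: lin_eta[OF \<phi>(1)])
 qed
qed

lemma del_lin: assumes U: "Hmod U" shows "del K H U \<in> lin_maps K U (Om K H U)"
proof -
 interpret U: left_H_module K H U by fact
 interpret UM: module K U by (rule U.vector_space)
 note d = dif_closed[OF U.vector_space] dif_add_add[OF U.vector_space] dif_smult[OF U.vector_space]
 have lin: "(\<lambda>h\<in>car H. dif K U (act U h u) (counit H h \<odot>\<^bsub>U\<^esub> u)) \<in> lin_maps K H U" if "u \<in> car U" for u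
  by (rule lin_restrictI[OF vector_space])
   (use that in \<open>simp_all add: d U.act_closed counit_closed U.act_add_left counit_add UM.smult_l_distr
     U.act_smult_left counit_smult UM.smult_assoc1\<close>)
 show ?thesis
  unfolding del_def
 proof (rule lin_restrictI[OF U.vector_space])
  fix u assume u: "u \<in> car U"
  show "unc (\<lambda>h\<in>car H. dif K U (act U h u) (counit H h \<odot>\<^bsub>U\<^esub> u)) \<in> car (Om K H U)"
   using u lin[OF u] by (simp add: U.act_one counit_one dif_dif_zero[OF U.vector_space])
  { fix v assume v: "v \<in> car U"
   show "unc (\<lambda>h\<in>car H. dif K U (act U h (u \<oplus>\<^bsub>U\<^esub> v)) (counit H h \<odot>\<^bsub>U\<^esub> (u \<oplus>\<^bsub>U\<^esub> v))) =
    unc (\<lambda>h\<in>car H. dif K U (act U h u) (counit H h \<odot>\<^bsub>U\<^esub> u)) \<oplus>\<^bsub>Om K H U\<^esub>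
    unc (\<lambda>h\<in>car H. dif K U (act U h v) (counit H h \<odot>\<^bsub>U\<^esub> v))"
    using u v by (auto simp: U.act_add_right UM.smult_r_distr U.act_closed counit_closed d) }
  { fix k assume k: "k \<in> car K"
   show "unc (\<lambda>h\<in>car H. dif K U (act U h (k \<odot>\<^bsub>U\<^esub> u)) (counit H h \<odot>\<^bsub>U\<^esub> (k \<odot>\<^bsub>U\<^esub> u))) =
    k \<odot>\<^bsub>Om K H U\<^esub> unc (\<lambda>h\<in>car H. dif K U (act U h u) (counit H h \<odot>\<^bsub>U\<^esub> u))"
   proof -
    have "counit H h \<odot>\<^bsub>U\<^esub> (k \<odot>\<^bsub>U\<^esub> u) = k \<odot>\<^bsub>U\<^esub> (counit H h \<odot>\<^bsub>U\<^esub> u)" if "h \<in> car H" for h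
     using that u k counit_closed by (simp add: UM.smult_assoc1[symmetric] HM.R.m_comm)
    then show ?thesis using u k by (auto simp: U.act_smult_right U.act_closed counit_closed d)
   qed }
 qed
qed

lemma del_zero_iff: assumes U: "Hmod U" and u: "u \<in> car U"
 shows "del K H U u = \<zero>\<^bsub>Om K H U\<^esub> \<longleftrightarrow> u \<in> inv_set H U"
proof -
 interpret U: left_H_module K H U by fact
 interpret UM: module K U by (rule U.vector_space)
 have "dif K U (act U h u) (counit H h \<odot>\<^bsub>U\<^esub> u) = \<zero>\<^bsub>U\<^esub> \<longleftrightarrow> act U h u = counit H h \<odot>\<^bsub>U\<^esub> u"
  if "h \<in> car H" for h
  using that u by (intro dif_eq_zero_iff[OF U.vector_space]) (simp_all add: U.act_closed counit_closed)
 then show ?thesis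
  using u by (simp add: del_def inv_set_def)
qed

text \<open>Inner derivations are derivations: in the formula for the action of g the terms (h g) u
  cancel, and \<epsilon> g times the inner derivation remains. Together with
  \<open>del_zero_iff\<close> this says that applying \<partial> twice gives zero.\<close>

lemma del_inv: assumes U: "Hmod U" and u: "u \<in> car U"
 shows "del K H U u \<in> inv_set H (Om K H U)"
proof -
 interpret U: left_H_module K H U by fact
 interpret UM: module K U by (rule U.vector_space)
 note d = dif_closed[OF U.vector_space] dif_add_add[OF U.vector_space] dif_smult[OF U.vector_space]
 have e: "dif K U (dif K U a b) (dif K U a c) = dif K U c b"
  if "a \<in> car U" "b \<in> car U" "c \<in> car U" for a b c
  using that by (simp add: dif_eq_minus[OF U.vector_space] UM.minus_eq UM.minus_add UM.a_ac UM.r_neg1 UM.r_neg2)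
 have "dif K U (dif K U (act U (h \<cdot> g) u) (counit H (h \<cdot> g) \<odot>\<^bsub>U\<^esub> u))
     (act U h (dif K U (act U g u) (counit H g \<odot>\<^bsub>U\<^esub> u)))
    = counit H g \<odot>\<^bsub>U\<^esub> dif K U (act U h u) (counit H h \<odot>\<^bsub>U\<^esub> u)"
  if "h \<in> car H" "g \<in> car H" for h g
 proof -
  have "counit H (h \<cdot> g) \<odot>\<^bsub>U\<^esub> u = counit H g \<odot>\<^bsub>U\<^esub> (counit H h \<odot>\<^bsub>U\<^esub> u)"
   using that u counit_closed
   by (simp add: counit_mult HM.R.m_comm[of "counit H h" "counit H g"] UM.smult_assoc1)
  then show ?thesis
   using that u
   by (simp add: U.act_mult U.act_dif U.act_closed counit_closed U.act_smult_right e dif_smult[OF U.vector_space, symmetric])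
 qed
 then have "act (Om K H U) g (del K H U u) = counit H g \<odot>\<^bsub>Om K H U\<^esub> del K H U u" if "g \<in> car H" for g
  using that u by (auto simp: del_def)
 then show ?thesis using lin_closed[OF del_lin[OF U] u] by (simp add: inv_set_def)
qed

lemma OmF_H_maps:
 assumes U: "Hmod U" and W: "Hmod W" and f: "f \<in> H_maps K H U W"
 shows "OmF K H U f \<in> H_maps K H (Om K H U) (Om K H W)"
proof -
 interpret U: left_H_module K H U by fact
 interpret W: left_H_module K H W by fact
 have fl: "f \<in> lin_maps K U W" by (rule H_maps_lin[OF f])
 have *: "OmF K H U f (unc \<phi>) = unc (\<lambda>h\<in>car H. f (\<phi> h))" if "unc \<phi> \<in> car (Om K H U)" for \<phi>
  using that by (simp add: OmF_def)
 interpret O: left_H_module K H "Om K H U" by (rule Om_H_module[OF U])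
 interpret OM: module K "Om K H U" by (rule O.vector_space)
 show ?thesis
 proof (rule H_mapsI)
  show "OmF K H U f \<in> lin_maps K (Om K H U) (Om K H W)"
  proof (rule lin_mapsI)
   show "OmF K H U f x = undefined" if "x \<notin> car (Om K H U)" for x using that by (simp add: OmF_def)
  next
   fix x assume x: "x \<in> car (Om K H U)"
   then obtain \<phi> where \<phi>: "\<phi> \<in> lin_maps K H U" "\<phi> \<one>\<^bsub>H\<^esub> = \<zero>\<^bsub>U\<^esub>" "x = unc \<phi>" by (rule Om_cases)
   show "OmF K H U f x \<in> car (Om K H W)"
    using x \<phi> lin_compose[OF vector_space \<phi>(1) fl] lin_zero[OF fl U.vector_space W.vector_space] by (simp add: *)
   { fix y assume y: "y \<in> car (Om K H U)"
    then obtain \<psi> where \<psi>: "\<psi> \<in> lin_maps K H U" "\<psi> \<one>\<^bsub>H\<^esub> = \<zero>\<^bsub>U\<^esub>" "y = unc \<psi>" by (rule Om_cases)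
    show "OmF K H U f (x \<oplus>\<^bsub>Om K H U\<^esub> y) = OmF K H U f x \<oplus>\<^bsub>Om K H W\<^esub> OmF K H U f y"
     using OM.a_closed[OF x y] x y unfolding \<phi>(3) \<psi>(3)
     by (simp only: Om_simps *) (auto simp: lin_add[OF fl] lin_closed[OF \<phi>(1)] lin_closed[OF \<psi>(1)]) }
   { fix k assume k: "k \<in> car K"
    show "OmF K H U f (k \<odot>\<^bsub>Om K H U\<^esub> x) = k \<odot>\<^bsub>Om K H W\<^esub> OmF K H U f x"
     using OM.smult_closed[OF k x] x k unfolding \<phi>(3)
     by (simp only: Om_simps *) (auto simp: lin_smult[OF fl] lin_closed[OF \<phi>(1)]) }
  qed
 next
  fix h x assume h: "h \<in> car H" and x: "x \<in> car (Om K H U)"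
  then obtain \<phi> where \<phi>: "\<phi> \<in> lin_maps K H U" "\<phi> \<one>\<^bsub>H\<^esub> = \<zero>\<^bsub>U\<^esub>" "x = unc \<phi>" by (elim Om_cases)
  show "OmF K H U f (act (Om K H U) h x) = act (Om K H W) h (OmF K H U f x)"
   using O.act_closed[OF h x] x h unfolding \<phi>(3)
   by (simp only: Om_simps *) (auto simp: lin_dif[OF fl U.vector_space] H_maps_act[OF f] U.act_closed lin_closed[OF \<phi>(1)])
 qed
qed

lemma del_natural:
 assumes U: "Hmod U" and f: "f \<in> H_maps K H U W" and u: "u \<in> car U"
 shows "OmF K H U f (del K H U u) = del K H W (f u)"
proof -
 interpret U: left_H_module K H U by fact
 interpret UM: module K U by (rule U.vector_space)
 have fl: "f \<in> lin_maps K U W" by (rule H_maps_lin[OF f])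
 have "del K H U u \<in> car (Om K H U)" using lin_closed[OF del_lin[OF U] u] .
 then show ?thesis
  using u lin_closed[OF fl u]
  by (simp add: OmF_def) (auto simp: del_def lin_dif[OF fl U.vector_space] H_maps_act[OF f]
    U.act_closed counit_closed lin_smult[OF fl])
qed

text \<open>Elements of \<Omega> are linear maps on H, so a linear pseudo-inverse of f lifts all
  values of x at once and keeps them linear in h. Exactness of \<Omega> rests on this.\<close>

lemma OmF_lift:
 assumes U: "Hmod U" and W: "Hmod W" and f: "f \<in> H_maps K H U W"
  and x: "x \<in> car (Om K H W)" and im: "\<And>h. h \<in> car H ==> cur x h \<in> f ` car U"
 shows "x \<in> OmF K H U f ` car (Om K H U)"
proof -
 interpret U: left_H_module K H U by fact
 interpret W: left_H_module K H W by fact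
 have fl: "f \<in> lin_maps K U W" by (rule H_maps_lin[OF f])
 obtain s where s: "s \<in> lin_maps K W U" "\<forall>u\<in>car U. f (s (f u)) = f u"
  using lin_pseudo_inverse[OF field U.vector_space W.vector_space fl] by blast
 from x obtain \<phi> where \<phi>: "\<phi> \<in> lin_maps K H W" "\<phi> \<one>\<^bsub>H\<^esub> = \<zero>\<^bsub>W\<^esub>" "x = unc \<phi>" by (rule Om_cases)
 let ?y = "unc (\<lambda>h\<in>car H. s (\<phi> h))"
 have y: "?y \<in> car (Om K H U)"
  using lin_compose[OF vector_space \<phi>(1) s(1)] \<phi>(2) lin_zero[OF s(1) W.vector_space U.vector_space] by simp
 have "f (s (\<phi> h)) = \<phi> h" if "h \<in> car H" for h
  using im[OF that] s(2) \<phi>(3) by auto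
 then have "OmF K H U f ?y = x"
  using y by (simp add: OmF_def \<phi>(3) lin_eta[OF \<phi>(1)])
 with y show ?thesis by blast
qed

lemma OmF_zero_iff:
 assumes x: "x \<in> car (Om K H U)"
 shows "OmF K H U f x = \<zero>\<^bsub>Om K H W\<^esub> \<longleftrightarrow> (\<forall>h\<in>car H. f (cur x h) = \<zero>\<^bsub>W\<^esub>)"
 using x by (simp add: OmF_def)

lemma cur_Om: "x \<in> car (Om K H U) ==> h \<in> car H ==> cur x h \<in> car U"
 by (auto elim!: Om_cases intro: lin_closed)

lemma cur_OmF: "x \<in> car (Om K H U) ==> h \<in> car H ==> cur (OmF K H U f x) h = f (cur x h)"
 by (simp add: OmF_def)

lemma Om_zero_iff: "x \<in> car (Om K H U) ==> x = \<zero>\<^bsub>Om K H U\<^esub> \<longleftrightarrow> (\<forall>h\<in>car H. cur x h = \<zero>\<^bsub>U\<^esub>)"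
proof -
 assume "x \<in> car (Om K H U)"
 then obtain \<phi> where \<phi>: "\<phi> \<in> lin_maps K H U" "x = unc \<phi>" by (rule Om_cases)
 then have "x = unc (restrict \<phi> (car H))" by (simp add: lin_eta)
 then show ?thesis by simp
qed

text \<open>The elements of \<Omega> of a subspace are the maps with values in it, as an equality of
  records. So \<Omega> of a kernel can be rewritten as a kernel without passing through an
  isomorphism.\<close>

lemma Om_restrict:
 "Om K H (U\<lparr>carrier := {u \<in> car U. P u}\<rparr>) = (Om K H U)\<lparr>carrier := {x \<in> car (Om K H U). \<forall>h\<in>car H. P (cur x h)}\<rparr>"
 by (auto simp: Om_def lin_maps_def)

text \<open>Scaling \<phi> by k amounts to translating it by the element k 1 of H, so homogeneity of
  \<rho> is a case of its equivariance.\<close>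

lemma rinj_map_smult:
 assumes U: "Hmod U" and r: "rinj_map K H U \<rho>" and that: "k \<in> car K" "\<phi> \<in> lin_maps K H U"
 shows "\<rho> (\<lambda>h\<in>car H. k \<odot>\<^bsub>U\<^esub> \<phi> h) = k \<odot>\<^bsub>U\<^esub> \<rho> \<phi>"
proof -
 interpret U: left_H_module K H U by fact
 note \<rho> = rinj_mapD[OF r]
 have "(\<lambda>h\<in>car H. k \<odot>\<^bsub>U\<^esub> \<phi> h) = (\<lambda>h\<in>car H. \<phi> (h \<cdot> (k \<odot>\<^bsub>H\<^esub> \<one>\<^bsub>H\<^esub>)))"
  using that by (auto simp: smult_mult_right lin_smult)
 then show ?thesis using \<rho>(3)[of "k \<odot>\<^bsub>H\<^esub> \<one>\<^bsub>H\<^esub>" \<phi>] that \<rho>(1) by (simp add: U.act_smult_left U.act_one)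
qed

text \<open>An invariant element is a derivation, \<phi> (h k) = \<epsilon> k (\<phi> h) + h (\<phi>
  k). Applying \<rho> to both sides as functions of h gives k u = \<epsilon> k u + \<phi> k with u =
  \<rho> \<phi>, so \<phi> is inner.\<close>

lemma rinj_exact:
 assumes U: "Hmod U" and R: "rinj K H U" and x: "x \<in> inv_set H (Om K H U)"
 shows "x \<in> del K H U ` car U"
proof -
 interpret U: left_H_module K H U by fact
 interpret UM: module K U by (rule U.vector_space)
 obtain \<rho> where rm: "rinj_map K H U \<rho>" using R by (auto simp: rinj_def)
 note \<rho> = rinj_mapD[OF rm]
 note \<rho>k = rinj_map_smult[OF U rm]
 from x have "x \<in> car (Om K H U)" by (simp add: inv_set_def)
 then obtain \<phi> where \<phi>: "\<phi> \<in> lin_maps K H U" "\<phi> \<one>\<^bsub>H\<^esub> = \<zero>\<^bsub>U\<^esub>" "x = unc \<phi>" by (rule Om_cases)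
 note c = lin_closed[OF \<phi>(1)]
 have inv: "\<phi> (h \<cdot> k) = counit H k \<odot>\<^bsub>U\<^esub> \<phi> h \<oplus>\<^bsub>U\<^esub> act U h (\<phi> k)" if hk: "h \<in> car H" "k \<in> car H" for h k
 proof -
  have "act (Om K H U) k (unc \<phi>) = counit H k \<odot>\<^bsub>Om K H U\<^esub> unc \<phi>" using x hk \<phi>(3) by (simp add: inv_set_def)
  then have "dif K U (\<phi> (h \<cdot> k)) (act U h (\<phi> k)) = counit H k \<odot>\<^bsub>U\<^esub> \<phi> h"
   using hk by simp
  then show ?thesis using dif_add_cancel[OF U.vector_space, of "\<phi> (h \<cdot> k)" "act U h (\<phi> k)"] hk c U.act_closed by simp
 qed
 let ?u = "\<rho> \<phi>"
 have "\<phi> k = dif K U (act U k ?u) (counit H k \<odot>\<^bsub>U\<^esub> ?u)" if k: "k \<in> car H" for k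
 proof -
  let ?a = "\<lambda>h\<in>car H. counit H k \<odot>\<^bsub>U\<^esub> \<phi> h" and ?b = "\<lambda>h\<in>car H. act U h (\<phi> k)"
  have a: "?a \<in> lin_maps K H U" by (rule lin_scale[OF vector_space U.vector_space \<phi>(1) counit_closed[OF k]])
  have b: "?b \<in> lin_maps K H U" by (rule lin_H_act[OF U c[OF k]])
  have "act U k ?u = \<rho> (\<lambda>h\<in>car H. \<phi> (h \<cdot> k))" using \<rho>(3)[OF k \<phi>(1)] by simp
  also have "(\<lambda>h\<in>car H. \<phi> (h \<cdot> k)) = (\<lambda>h\<in>car H. ?a h \<oplus>\<^bsub>U\<^esub> ?b h)"
   using inv k by auto
  also have "\<rho> \<dots> = counit H k \<odot>\<^bsub>U\<^esub> ?u \<oplus>\<^bsub>U\<^esub> \<phi> k"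
   using \<rho>(2)[OF a b] \<rho>k[OF counit_closed[OF k] \<phi>(1)] \<rho>(4)[OF c[OF k]] by simp
  finally show ?thesis
   using add_dif_cancel_left[OF U.vector_space, of "counit H k \<odot>\<^bsub>U\<^esub> ?u" "\<phi> k"] k \<rho>(1)[OF \<phi>(1)] c counit_closed by simp
 qed
 then have "x = del K H U ?u"
  using \<rho>(1)[OF \<phi>(1)] lin_eta[OF \<phi>(1)] unfolding \<phi>(3) del_def
  by (metis (no_types, lifting) restrict_apply' restrict_ext)
 then show ?thesis using \<rho>(1)[OF \<phi>(1)] by blast
qed

text \<open>A retraction splits U off from the linear maps H \<rightarrow> U, and \<Omega> U is the
  other summand. In formulas: send \<Phi> to \<rho> \<circ> \<Phi> and apply minus the projection
  \<psi> \<mapsto> \<psi> - (h \<mapsto> h (\<psi> 1)). Composing with \<rho> commutes with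
  translations. For \<Phi> = (h \<mapsto> h x) with x given by \<phi> it yields h \<mapsto> h
  (\<rho> \<phi>) - \<phi> h, from which minus the projection recovers \<phi>.\<close>

lemma rinj_Om: assumes U: "Hmod U" and R: "rinj K H U" shows "rinj K H (Om K H U)"
proof -
 interpret U: left_H_module K H U by fact
 interpret UM: module K U by (rule U.vector_space)
 obtain \<rho> where rm: "rinj_map K H U \<rho>" using R by (auto simp: rinj_def)
 note \<rho> = rinj_mapD[OF rm]
 note \<rho>k = rinj_map_smult[OF U rm]
 have \<rho>dif: "\<rho> (\<lambda>h\<in>car H. dif K U (\<phi> h) (\<psi> h)) = dif K U (\<rho> \<phi>) (\<rho> \<psi>)"
  if "\<phi> \<in> lin_maps K H U" "\<psi> \<in> lin_maps K H U" for \<phi> \<psi>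
 proof -
  let ?m = "\<ominus>\<^bsub>K\<^esub> \<one>\<^bsub>K\<^esub>"
  have "(\<lambda>h\<in>car H. dif K U (\<phi> h) (\<psi> h)) = (\<lambda>h\<in>car H. \<phi> h \<oplus>\<^bsub>U\<^esub> (\<lambda>h\<in>car H. ?m \<odot>\<^bsub>U\<^esub> \<psi> h) h)"
   by (auto simp: dif_def)
  then show ?thesis
   using \<rho>(2)[OF that(1) lin_scale[OF vector_space U.vector_space that(2), of ?m]] \<rho>k[OF _ that(2), of ?m]
   by (simp add: dif_def)
 qed
 let ?O = "Om K H U"
 let ?s = "\<lambda>\<Phi> h. \<rho> (cur (\<Phi> h))"
 let ?r = "\<lambda>\<Phi>. unc (\<lambda>h\<in>car H. dif K U (act U h (?s \<Phi> \<one>\<^bsub>H\<^esub>)) (?s \<Phi> h))"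
 have cl: "cur (\<Phi> h) \<in> lin_maps K H U" if "\<Phi> \<in> lin_maps K H ?O" "h \<in> car H" for \<Phi> h
  using lin_closed[OF that] by (auto elim: Om_cases)
 have s_lin: "(\<lambda>h\<in>car H. ?s \<Phi> h) \<in> lin_maps K H U" if \<Phi>: "\<Phi> \<in> lin_maps K H ?O" for \<Phi>
 proof (rule lin_restrictI[OF vector_space])
  fix x assume x: "x \<in> car H"
  show "?s \<Phi> x \<in> car U" using \<rho>(1) cl[OF \<Phi> x] .
  { fix y assume y: "y \<in> car H"
   have "cur (\<Phi> (x \<oplus>\<^bsub>H\<^esub> y)) = (\<lambda>h\<in>car H. cur (\<Phi> x) h \<oplus>\<^bsub>U\<^esub> cur (\<Phi> y) h)"
    unfolding lin_add[OF \<Phi> x y] by (simp add: Om_def)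
   then show "?s \<Phi> (x \<oplus>\<^bsub>H\<^esub> y) = ?s \<Phi> x \<oplus>\<^bsub>U\<^esub> ?s \<Phi> y" using \<rho>(2)[OF cl[OF \<Phi> x] cl[OF \<Phi> y]] by simp }
  { fix k assume k: "k \<in> car K"
   have "cur (\<Phi> (k \<odot>\<^bsub>H\<^esub> x)) = (\<lambda>h\<in>car H. k \<odot>\<^bsub>U\<^esub> cur (\<Phi> x) h)"
    unfolding lin_smult[OF \<Phi> k x] by (simp add: Om_def)
   then show "?s \<Phi> (k \<odot>\<^bsub>H\<^esub> x) = k \<odot>\<^bsub>U\<^esub> ?s \<Phi> x" using \<rho>k[OF k cl[OF \<Phi> x]] by simp }
 qed
 have s1: "?s \<Phi> h \<in> car U" if "\<Phi> \<in> lin_maps K H ?O" "h \<in> car H" for \<Phi> h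
  using \<rho>(1) cl[OF that] .
 have r_lin: "(\<lambda>h\<in>car H. dif K U (act U h (?s \<Phi> \<one>\<^bsub>H\<^esub>)) (?s \<Phi> h)) \<in> lin_maps K H U"
  if \<Phi>: "\<Phi> \<in> lin_maps K H ?O" for \<Phi>
  using lin_difference[OF vector_space U.vector_space lin_H_act[OF U s1[OF \<Phi> HR.one_closed]] s_lin[OF \<Phi>]]
  by (simp add: restrict_def cong: if_cong)
 have mid: "dif K U (a \<oplus>\<^bsub>U\<^esub> a') (c \<oplus>\<^bsub>U\<^esub> c') = dif K U a c \<oplus>\<^bsub>U\<^esub> dif K U a' c'"
  if "a \<in> car U" "a' \<in> car U" "c \<in> car U" "c' \<in> car U" for a a' c c'
  using that by (rule dif_add_add[OF U.vector_space])
 show ?thesis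
  unfolding rinj_def rinj_map_def
 proof (intro exI[of _ ?r] conjI ballI)
  fix \<Phi> assume \<Phi>: "\<Phi> \<in> lin_maps K H ?O"
  show "?r \<Phi> \<in> car ?O"
   using r_lin[OF \<Phi>] s1[OF \<Phi>] by (simp add: U.act_one dif_dif_zero[OF U.vector_space])
  { fix \<Psi> assume \<Psi>: "\<Psi> \<in> lin_maps K H ?O"
   have "\<rho> (cur (\<Phi> h \<oplus>\<^bsub>?O\<^esub> \<Psi> h)) = ?s \<Phi> h \<oplus>\<^bsub>U\<^esub> ?s \<Psi> h" if h: "h \<in> car H" for h
    using h \<rho>(2)[OF cl[OF \<Phi> h] cl[OF \<Psi> h]] by (simp add: Om_def)
   then show "?r (\<lambda>h\<in>car H. \<Phi> h \<oplus>\<^bsub>?O\<^esub> \<Psi> h) = ?r \<Phi> \<oplus>\<^bsub>?O\<^esub> ?r \<Psi>"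
    by (simp add: U.act_add_right s1[OF \<Phi>] s1[OF \<Psi>] U.act_closed mid) }
  { fix k assume k: "k \<in> car H"
   have "?s (\<lambda>h\<in>car H. \<Phi> (h \<cdot> k)) h = ?s \<Phi> (h \<cdot> k)" if "h \<in> car H" for h using that by simp
   \<comment> \<open>Here a, b, c stand for the values at 1, h k and k. The terms (h k) a cancel,
     and what remains is the formula for the translated map, whose value at 1 is c.\<close>
   moreover have "dif K U (dif K U (act U (h \<cdot> k) a) b) (act U h (dif K U (act U k a) c)) = dif K U (act U h c) b"
    if "h \<in> car H" "a \<in> car U" "b \<in> car U" "c \<in> car U" for h a b c
   proof -
    have e: "dif K U (dif K U a b) (dif K U a c) = dif K U c b"
     if "a \<in> car U" "b \<in> car U" "c \<in> car U" for a b c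
     using that by (simp add: dif_eq_minus[OF U.vector_space] UM.minus_eq UM.minus_add UM.a_ac UM.r_neg1 UM.r_neg2)
    show ?thesis using that k by (simp add: U.act_mult U.act_dif U.act_closed e)
   qed
   ultimately show "?r (\<lambda>h\<in>car H. \<Phi> (h \<cdot> k)) = act ?O k (?r \<Phi>)"
    using k s1[OF \<Phi>] by auto }
 next
  fix x assume "x \<in> car ?O"
  then obtain \<phi> where \<phi>: "\<phi> \<in> lin_maps K H U" "\<phi> \<one>\<^bsub>H\<^esub> = \<zero>\<^bsub>U\<^esub>" "x = unc \<phi>" by (rule Om_cases)
  note c = lin_closed[OF \<phi>(1)]
  let ?\<Phi> = "\<lambda>h\<in>car H. act ?O h x"
  have s: "?s ?\<Phi> h = dif K U (act U h (\<rho> \<phi>)) (\<phi> h)" if h: "h \<in> car H" for h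
  proof -
   have "cur (?\<Phi> h) = (\<lambda>t\<in>car H. dif K U ((\<lambda>t\<in>car H. \<phi> (t \<cdot> h)) t) ((\<lambda>t\<in>car H. act U t (\<phi> h)) t))"
    using h by (auto simp: \<phi>(3))
   then show ?thesis
    using \<rho>dif[OF lin_H_rmult[OF \<phi>(1) h] lin_H_act[OF U c[OF h]]] \<rho>(3)[OF h \<phi>(1)] \<rho>(4)[OF c[OF h]] by simp
  qed
  have s1': "?s ?\<Phi> \<one>\<^bsub>H\<^esub> = \<rho> \<phi>"
   using s[OF HR.one_closed] \<phi>(2) \<rho>(1)[OF \<phi>(1)] by (simp add: U.act_one dif_zero[OF U.vector_space])
  have "dif K U (act U h (?s ?\<Phi> \<one>\<^bsub>H\<^esub>)) (?s ?\<Phi> h) = \<phi> h" if h: "h \<in> car H" for h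
   unfolding s1' s[OF h] using h \<rho>(1)[OF \<phi>(1)] c U.act_closed by (simp add: dif_dif_cancel[OF U.vector_space])
  then show "?r ?\<Phi> = x" unfolding \<phi>(3) by (simp add: lin_eta[OF \<phi>(1)])
 qed
qed

text \<open>The retraction is conjugated, \<phi> \<mapsto> r (\<rho> (s \<circ> \<phi>)). It serves
  to change the type of a module by \<open>embH\<close>.\<close>

lemma rinj_retract:
 assumes U: "Hmod U" and W: "Hmod W"
  and s: "s \<in> H_maps K H W U" and r: "r \<in> H_maps K H U W" and rs: "\<And>w. w \<in> car W ==> r (s w) = w"
  and R: "rinj K H U"
 shows "rinj K H W"
proof -
 interpret U: left_H_module K H U by fact
 interpret W: left_H_module K H W by fact
 obtain \<rho> where rm: "rinj_map K H U \<rho>" using R by (auto simp: rinj_def)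
 note \<rho> = rinj_mapD[OF rm]
 have sl: "s \<in> lin_maps K W U" by (rule H_maps_lin[OF s])
 have rl: "r \<in> lin_maps K U W" by (rule H_maps_lin[OF r])
 let ?t = "\<lambda>\<phi>. \<lambda>h\<in>car H. s (\<phi> h)"
 have t: "?t \<phi> \<in> lin_maps K H U" if "\<phi> \<in> lin_maps K H W" for \<phi>
  by (rule lin_compose[OF vector_space that sl])
 show ?thesis
  unfolding rinj_def rinj_map_def
 proof (intro exI[of _ "\<lambda>\<phi>. r (\<rho> (?t \<phi>))"] conjI ballI)
  fix \<phi> assume \<phi>: "\<phi> \<in> lin_maps K H W"
  show "r (\<rho> (?t \<phi>)) \<in> car W" using lin_closed[OF rl \<rho>(1)[OF t[OF \<phi>]]] .
  { fix \<psi> assume \<psi>: "\<psi> \<in> lin_maps K H W"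
   have "?t (\<lambda>h\<in>car H. \<phi> h \<oplus>\<^bsub>W\<^esub> \<psi> h) = (\<lambda>h\<in>car H. ?t \<phi> h \<oplus>\<^bsub>U\<^esub> ?t \<psi> h)"
    by (auto simp: lin_add[OF sl] lin_closed[OF \<phi>] lin_closed[OF \<psi>])
   then show "r (\<rho> (?t (\<lambda>h\<in>car H. \<phi> h \<oplus>\<^bsub>W\<^esub> \<psi> h))) = r (\<rho> (?t \<phi>)) \<oplus>\<^bsub>W\<^esub> r (\<rho> (?t \<psi>))"
    using \<rho>(2)[OF t[OF \<phi>] t[OF \<psi>]] lin_add[OF rl \<rho>(1)[OF t[OF \<phi>]] \<rho>(1)[OF t[OF \<psi>]]] by simp }
  { fix k assume k: "k \<in> car H"
   have "?t (\<lambda>h\<in>car H. \<phi> (h \<cdot> k)) = (\<lambda>h\<in>car H. ?t \<phi> (h \<cdot> k))" using k by auto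
   then show "r (\<rho> (?t (\<lambda>h\<in>car H. \<phi> (h \<cdot> k)))) = act W k (r (\<rho> (?t \<phi>)))"
    using \<rho>(3)[OF k t[OF \<phi>]] H_maps_act[OF r k \<rho>(1)[OF t[OF \<phi>]]] by simp }
 next
  fix w assume w: "w \<in> car W"
  have "?t (\<lambda>h\<in>car H. act W h w) = (\<lambda>h\<in>car H. act U h (s w))"
   using w by (auto simp: H_maps_act[OF s])
  then show "r (\<rho> (?t (\<lambda>h\<in>car H. act W h w))) = w"
   using \<rho>(4)[OF lin_closed[OF sl w]] rs[OF w] by simp
 qed
qed

end

section \<open>The spectral sequence of a complex of relatively injective modules\<close>

text \<open>Places a module in the type of functions on words, at the empty word, where the
  iteration of \<Omega> starts.\<close>

definition emb :: "'v => 'h list => 'v" where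
 "emb v l = (if l = [] then v else undefined)"

lemma emb_Nil [simp]: "emb v [] = v" by (simp add: emb_def)
lemma emb_eq_iff [simp]: "emb v = emb w \<longleftrightarrow> v = w" by (metis emb_Nil)

definition embH :: "('k, 'h, 'v) hmodule => ('k, 'h, 'h list => 'v) hmodule" where
 "embH V = \<lparr>carrier = emb ` car V, monoid.mult = undefined, one = undefined,
   zero = emb \<zero>\<^bsub>V\<^esub>, add = (\<lambda>x y. emb (x [] \<oplus>\<^bsub>V\<^esub> y [])),
   smult = (\<lambda>k x. emb (k \<odot>\<^bsub>V\<^esub> x [])), act = (\<lambda>h x. emb (act V h (x [])))\<rparr>"

lemma embH_simps [simp]:
 "car (embH V) = emb ` car V" "zero (embH V) = emb \<zero>\<^bsub>V\<^esub>"
 "add (embH V) = (\<lambda>x y. emb (x [] \<oplus>\<^bsub>V\<^esub> y []))" "smult (embH V) = (\<lambda>k x. emb (k \<odot>\<^bsub>V\<^esub> x []))"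
 "act (embH V) = (\<lambda>h x. emb (act V h (x [])))"
 by (simp_all add: embH_def)

primrec Omn :: "'k ring => ('k, 'h) hopf => ('k, 'h, 'h list => 'v) hmodule => nat => ('k, 'h, 'h list => 'v) hmodule" where
 "Omn K H U 0 = U"
| "Omn K H U (Suc p) = Om K H (Omn K H U p)"

primrec OmnF :: "'k ring => ('k, 'h) hopf => ('k, 'h, 'h list => 'v) hmodule => (('h list => 'v) => ('h list => 'w)) => nat
  => ('h list => 'v) => ('h list => 'w)" where
 "OmnF K H U f 0 = f"
| "OmnF K H U f (Suc p) = OmF K H (Omn K H U p) (OmnF K H U f p)"

definition Tb where
 "Tb K H V p = (case p of 0 => {\<zero>\<^bsub>embH V\<^esub>} | Suc p' => del K H (Omn K H (embH V) p') ` car (Omn K H (embH V) p'))"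

definition Tc :: "'k ring => ('k, 'h) hopf => ('k, 'h, 'v) hmodule => nat => ('k, 'h list => 'v) module" where
 "Tc K H V p = (module.truncate (Omn K H (embH V) p))\<lparr>carrier := inv_set H (Omn K H (embH V) p)\<rparr>"

text \<open>The cohomology of \<open>H\<close> with coefficients in \<open>V\<close>, computed by the complex of all \<open>\<Omega>\<^sup>p V\<close>.\<close>

definition T :: "'k ring => ('k, 'h) hopf => ('k, 'h, 'v) hmodule => nat => ('k, 'h list => 'v) module" where
 "T K H V p = qspace K (Tc K H V p) (Tb K H V p)"

lemma H_maps_zero:
 assumes "f \<in> H_maps K H U W" "left_H_module K H U" "left_H_module K H W"
 shows "f \<zero>\<^bsub>U\<^esub> = \<zero>\<^bsub>W\<^esub>"
 using lin_zero[OF H_maps_lin[OF assms(1)]] assms(2,3) by (simp add: left_H_module_def)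

lemma left_H_submodule:
 assumes U: "left_H_module K H U" and Z: "submodule Z K U"
  and act: "\<And>h z. h \<in> car H ==> z \<in> Z ==> act U h z \<in> Z"
 shows "left_H_module K H (U\<lparr>carrier := Z\<rparr>)"
proof -
 interpret U: left_H_module K H U by fact
 have "Z \<subseteq> car U" using Z by (simp add: submodule_iff[OF U.vector_space])
 then have *: "z \<in> car U" if "z \<in> Z" for z using that by blast
 show ?thesis
  by (rule left_H_module.intro)
   (simp_all add: submodule_module[OF U.vector_space Z] act * U.act_add_left U.act_add_right
    U.act_smult_left U.act_smult_right U.act_mult U.act_one)
qed

lemma act_restrict [simp]: "act (U\<lparr>carrier := Z\<rparr>) = act U"
 by simp

lemma H_kernel:
 assumes U: "left_H_module K H U" and W: "left_H_module K H W" and f: "f \<in> H_maps K H U W"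
 shows "submodule {u \<in> car U. f u = \<zero>\<^bsub>W\<^esub>} K U" (is "submodule ?Z K U")
  and "left_H_module K H (U\<lparr>carrier := {u \<in> car U. f u = \<zero>\<^bsub>W\<^esub>}\<rparr>)"
proof -
 interpret U: left_H_module K H U by fact
 interpret W: left_H_module K H W by fact
 show Z: "submodule ?Z K U" by (rule submodule_kernel[OF H_maps_lin[OF f] U.vector_space W.vector_space])
 show "left_H_module K H (U\<lparr>carrier := {u \<in> car U. f u = \<zero>\<^bsub>W\<^esub>}\<rparr>)"
  by (rule left_H_submodule[OF U Z]) (simp add: U.act_closed H_maps_act[OF f] W.act_zero)
qed

context hopf_algebra
begin

lemma hopf: "hopf_algebra K H" by (rule hopf_algebra_axioms)

lemma embH_module: assumes V: "Hmod V" shows "Hmod (embH V)"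
 by (rule left_H_module_transport[OF V _ _ _ _ _ hopf, of emb]) auto

lemma emb_H_maps: assumes V: "Hmod V" shows "(\<lambda>v\<in>car V. emb v) \<in> H_maps K H V (embH V)"
proof -
 interpret V: left_H_module K H V by fact
 show ?thesis
  by (intro H_mapsI lin_restrictI[OF V.vector_space]) (auto simp: V.act_closed)
qed

lemma unemb_H_maps: assumes V: "Hmod V" shows "(\<lambda>x\<in>car (embH V). x []) \<in> H_maps K H (embH V) V"
proof -
 interpret V: left_H_module K H V by fact
 interpret E: left_H_module K H "embH V" by (rule embH_module[OF V])
 interpret EM: module K "embH V" by (rule E.vector_space)
 show ?thesis
  using EM.a_closed EM.smult_closed E.act_closed
  by (intro H_mapsI lin_restrictI[OF E.vector_space]) auto
qed

lemma embF_H_maps: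
 assumes V: "Hmod V" and W: "Hmod W" and f: "f \<in> H_maps K H V W"
 shows "(\<lambda>x\<in>car (embH V). emb (f (x []))) \<in> H_maps K H (embH V) (embH W)"
proof -
 have "(\<lambda>x\<in>car (embH V). f ((\<lambda>x\<in>car (embH V). x []) x)) \<in> H_maps K H (embH V) W"
  by (rule H_maps_compose[OF embH_module[OF V] unemb_H_maps[OF V] f])
 from H_maps_compose[OF embH_module[OF V] this emb_H_maps[OF W]]
 have "(\<lambda>x\<in>car (embH V). (\<lambda>v\<in>car W. emb v) ((\<lambda>x\<in>car (embH V). f ((\<lambda>x\<in>car (embH V). x []) x)) x))
  \<in> H_maps K H (embH V) (embH W)" .
 also have "(\<lambda>x\<in>car (embH V). (\<lambda>v\<in>car W. emb v) ((\<lambda>x\<in>car (embH V). f ((\<lambda>x\<in>car (embH V). x []) x)) x))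
   = (\<lambda>x\<in>car (embH V). emb (f (x [])))"
  using H_maps_closed[OF f] by (intro restrict_ext) auto
 finally show ?thesis .
qed

lemma embH_rinj: assumes V: "Hmod V" and R: "rinj K H V" shows "rinj K H (embH V)"
 by (rule rinj_retract[OF V embH_module[OF V] unemb_H_maps[OF V] emb_H_maps[OF V] _ R]) auto

lemma Omn_module: "Hmod U ==> Hmod (Omn K H U p)"
 by (induction p) (simp_all add: Om_H_module)

lemma OmnF_H_maps: "Hmod U ==> Hmod W ==> f \<in> H_maps K H U W
  ==> OmnF K H U f p \<in> H_maps K H (Omn K H U p) (Omn K H W p)"
 by (induction p) (simp_all add: OmF_H_maps Omn_module)

lemma rinj_Omn: "Hmod U ==> rinj K H U ==> rinj K H (Omn K H U p)"
 by (induction p) (simp_all add: rinj_Om Omn_module)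

lemma OmnF_comp_zero:
 assumes U: "Hmod U" and W: "Hmod W" and f: "f \<in> H_maps K H U W"
  and gf: "\<And>u. u \<in> car U ==> g (f u) = \<zero>\<^bsub>X\<^esub>" and x: "x \<in> car (Omn K H U p)"
 shows "OmnF K H W g p (OmnF K H U f p x) = \<zero>\<^bsub>Omn K H X p\<^esub>"
 using x
proof (induction p arbitrary: x)
 case 0 then show ?case using gf by simp
next
 case (Suc p)
 have x: "x \<in> car (Om K H (Omn K H U p))" using Suc.prems by simp
 have "OmnF K H U f (Suc p) x \<in> car (Om K H (Omn K H W p))"
  using H_maps_closed[OF OmnF_H_maps[OF U W f, of "Suc p"] Suc.prems] by simp
 then show ?case
  using Suc.IH[OF cur_Om[OF x]] by (simp add: OmF_zero_iff cur_OmF[OF x] del: Om_simps)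
qed

text \<open>All values of an element of the kernel lie in the kernel one level below and lift by
  induction; \<open>OmF_lift\<close> turns these single lifts into a linear one.\<close>

lemma OmnF_exact:
 assumes U: "Hmod U" and W: "Hmod W" and f: "f \<in> H_maps K H U W"
  and ex: "\<And>w. w \<in> car W ==> g w = \<zero>\<^bsub>X\<^esub> ==> w \<in> f ` car U"
  and x: "x \<in> car (Omn K H W p)" and gx: "OmnF K H W g p x = \<zero>\<^bsub>Omn K H X p\<^esub>"
 shows "x \<in> OmnF K H U f p ` car (Omn K H U p)"
 using x gx
proof (induction p arbitrary: x)
 case 0 then show ?case using ex by simp
next
 case (Suc p)
 have x: "x \<in> car (Om K H (Omn K H W p))" using Suc.prems by simp
 have "OmnF K H W g p (cur x h) = \<zero>\<^bsub>Omn K H X p\<^esub>" if "h \<in> car H" for h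
  using Suc.prems(2) that by (simp add: OmF_zero_iff[OF x] del: Om_simps)
 then have "cur x h \<in> OmnF K H U f p ` car (Omn K H U p)" if "h \<in> car H" for h
  using that by (intro Suc.IH cur_Om[OF x])
 then show ?case
  using OmF_lift[OF Omn_module[OF U] Omn_module[OF W] OmnF_H_maps[OF U W f] x] by simp
qed

lemma OmnF_surj:
 assumes U: "Hmod U" and W: "Hmod W" and f: "f \<in> H_maps K H U W"
  and surj: "f ` car U = car W"
 shows "OmnF K H U f p ` car (Omn K H U p) = car (Omn K H W p)"
proof (induction p)
 case (Suc p)
 have "OmnF K H U f (Suc p) x \<in> car (Omn K H W (Suc p))" if "x \<in> car (Omn K H U (Suc p))" for x
  using H_maps_closed[OF OmnF_H_maps[OF U W f] that] .
 moreover have "x \<in> OmnF K H U f (Suc p) ` car (Omn K H U (Suc p))" if "x \<in> car (Omn K H W (Suc p))" for x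
  using OmF_lift[OF Omn_module[OF U] Omn_module[OF W] OmnF_H_maps[OF U W f], of x p] that cur_Om[of x "Omn K H W p"] Suc by simp
 ultimately show ?case by blast
qed (use surj in simp)

lemma OmnF_inj:
 assumes f: "\<And>u. u \<in> car U ==> f u = \<zero>\<^bsub>W\<^esub> ==> u = \<zero>\<^bsub>U\<^esub>"
  and x: "x \<in> car (Omn K H U p)" and fx: "OmnF K H U f p x = \<zero>\<^bsub>Omn K H W p\<^esub>"
 shows "x = \<zero>\<^bsub>Omn K H U p\<^esub>"
 using x fx
proof (induction p arbitrary: x)
 case 0 then show ?case using f by simp
next
 case (Suc p)
 have x: "x \<in> car (Om K H (Omn K H U p))" using Suc.prems by simp
 have "OmnF K H U f p (cur x h) = \<zero>\<^bsub>Omn K H W p\<^esub>" if "h \<in> car H" for h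
  using Suc.prems(2) that by (simp add: OmF_zero_iff[OF x] del: Om_simps)
 then have "cur x h = \<zero>\<^bsub>Omn K H U p\<^esub>" if "h \<in> car H" for h
  using that by (intro Suc.IH cur_Om[OF x])
 then show ?case using Om_zero_iff[OF x] by simp
qed

lemma Omn_kernel:
 "Omn K H (U\<lparr>carrier := {u \<in> car U. g u = \<zero>\<^bsub>X\<^esub>}\<rparr>) p
  = (Omn K H U p)\<lparr>carrier := {x \<in> car (Omn K H U p). OmnF K H U g p x = \<zero>\<^bsub>Omn K H X p\<^esub>}\<rparr>"
proof (induction p)
 case (Suc p)
 have "{x \<in> car (Om K H (Omn K H U p)). \<forall>h\<in>car H. OmnF K H U g p (cur x h) = \<zero>\<^bsub>Omn K H X p\<^esub>}
  = {x \<in> car (Om K H (Omn K H U p)). OmF K H (Omn K H U p) (OmnF K H U g p) x = \<zero>\<^bsub>Om K H (Omn K H X p)\<^esub>}"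
  using OmF_zero_iff[where f = "OmnF K H U g p" and W = "Omn K H X p"] by blast
 then show ?case using Suc by (simp only: Omn.simps OmnF.simps Om_restrict)
qed simp

lemma inv_set_sub: assumes V: "Hmod V" shows "submodule (inv_set H V) K V"
proof -
 have "inv_set H V = {u \<in> car V. u \<in> inv_set H V}" by (auto simp: inv_set_def)
 interpret V: left_H_module K H V by fact
 interpret VM: module K V by (rule V.vector_space)
 show ?thesis
  unfolding submodule_iff[OF V.vector_space] inv_set_def
  by (auto simp: V.act_zero V.act_add_right V.act_smult_right counit_closed VM.smult_r_distr
    VM.smult_assoc1[symmetric] VM.R.m_comm)
qed

lemma assumes V: "Hmod V" shows Tc_module: "module K (Tc K H V p)"
 and Tb_sub: "submodule (Tb K H V p) K (Tc K H V p)"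
proof -
 have O: "Hmod (Omn K H (embH V) p)" for p by (rule Omn_module[OF embH_module[OF V]])
 then have OM: "module K (Omn K H (embH V) p)" for p by (simp add: left_H_module_def)
 have m: "module K (module.truncate (Omn K H (embH V) p))" for p by (rule module_truncate[OF OM])
 have s: "submodule (inv_set H (Omn K H (embH V) p)) K (module.truncate (Omn K H (embH V) p))" for p
  using inv_set_sub[OF O] by (simp add: submodule_iff[OF OM] submodule_iff[OF m])
 show "module K (Tc K H V p)" unfolding Tc_def by (rule submodule_module[OF m s])
 have "submodule (Tb K H V p) K (module.truncate (Omn K H (embH V) p))"
 proof (cases p)
  case 0 then show ?thesis using submodule_zero[OF m, of 0] by (simp add: Tb_def)
 next
  case (Suc p')
  then show ?thesis
   using submodule_image[OF del_lin[OF O] OM _ submodule_carrier[OF OM], of p'] OM[of "Suc p'"]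
   by (simp add: Tb_def submodule_iff[OF OM[of "Suc p'", simplified]] submodule_iff[OF m[of "Suc p'", simplified]] del: Om_simps)
 qed
 moreover have "Tb K H V p \<subseteq> inv_set H (Omn K H (embH V) p)"
  using s[of p] del_inv[OF O] by (cases p) (auto simp: Tb_def submodule_iff[OF m[of 0, simplified]])
 ultimately show "submodule (Tb K H V p) K (Tc K H V p)"
  unfolding Tc_def by (intro submodule_restrict[OF m s])
qed

lemma T_module: "Hmod V ==> module K (T K H V p)"
 unfolding T_def by (rule qspace_module[OF field Tc_module Tb_sub])

end

text \<open>The modules V q model the cohomology of A through surjections \<kappa> from the cocycles
  whose kernels are the coboundaries. Leaving the model open admits both uses: quotient spaces for
  the complex of interest, and a given module followed by zeros for a resolution of it.\<close>

locale H_complex = hopf_algebra K H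
 for K :: "'k ring" and H :: "('k, 'h) hopf" +
 fixes A :: "nat => ('k, 'h, 'a) hmodule" and d :: "nat => 'a => 'a"
  and V :: "nat => ('k, 'h, 'v) hmodule" and \<kappa> :: "nat => 'a => 'v"
 assumes A: "\<And>q. left_H_module K H (A q)" and A_rinj: "\<And>q. rinj K H (A q)"
  and d: "\<And>q. d q \<in> H_maps K H (A q) (A (Suc q))"
  and dd: "\<And>q x. x \<in> car (A q) ==> d (Suc q) (d q x) = \<zero>\<^bsub>A (Suc (Suc q))\<^esub>"
  and V: "\<And>q. left_H_module K H (V q)"
  and \<kappa>: "\<And>q. \<kappa> q \<in> H_maps K H ((A q)\<lparr>carrier := cocycles A d q\<rparr>) (V q)"
  and \<kappa>_surj: "\<And>q. \<kappa> q ` cocycles A d q = car (V q)"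
  and \<kappa>_zero: "\<And>q x. x \<in> cocycles A d q ==> \<kappa> q x = \<zero>\<^bsub>V q\<^esub> \<longleftrightarrow> x \<in> coboundaries A d q"
begin

abbreviation "OV q \<equiv> Omn K H (embH (V q))"

definition "U q = embH (A q)"
abbreviation "OU q \<equiv> Omn K H (U q)"
definition "e q = (\<lambda>x\<in>car (U q). emb (d q (x [])))"
definition X :: "nat => nat => ('k, 'h list => 'a) module" where
 "X p q = module.truncate (OU q p)"
definition "a p q = OmnF K H (U q) (e q) p"
definition "b p q = del K H (OU q p)"

lemma U: "Hmod (U q)" unfolding U_def by (rule embH_module[OF A])
lemma O: "Hmod (OU q p)" by (rule Omn_module[OF U])
lemma OM: "module K (OU q p)" using O by (simp add: left_H_module_def)
lemma e: "e q \<in> H_maps K H (U q) (U (Suc q))"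
 unfolding e_def U_def by (rule embF_H_maps[OF A A d])
lemma a_H: "a p q \<in> H_maps K H (OU q p) (OU (Suc q) p)"
 unfolding a_def by (rule OmnF_H_maps[OF U U e])

lemma X_simps [simp]: "car (X p q) = car (OU q p)" "zero (X p q) = zero (OU q p)"
 "add (X p q) = add (OU q p)" "smult (X p q) = smult (OU q p)"
 by (simp_all add: X_def)

lemma ee: "x \<in> car (U q) ==> e (Suc q) (e q x) = \<zero>\<^bsub>U (Suc (Suc q))\<^esub>"
 using H_maps_closed[OF d] by (auto simp: e_def U_def dd)

text \<open>The squares commute because \<partial> is natural for equivariant maps. Exactness along
  b is \<open>rinj_exact\<close>, as the iterates of \<Omega> inherit relative injectivity from
  A.\<close>

sublocale DC: double_complex K X a b
proof (rule double_complex.intro)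
 show "module K (X p q)" for p q unfolding X_def by (rule module_truncate[OF OM])
 show "a p q \<in> lin_maps K (X p q) (X p (Suc q))" for p q
  using H_maps_lin[OF a_H] by (simp add: X_def)
 show "b p q \<in> lin_maps K (X p q) (X (Suc p) q)" for p q
  using del_lin[OF O] by (simp add: X_def b_def)
 fix p q x
 { assume x: "x \<in> car (X p q)"
  show "a p (Suc q) (a p q x) = \<zero>\<^bsub>X p (Suc (Suc q))\<^esub>"
   unfolding a_def X_simps using x by (intro OmnF_comp_zero[where g = "e (Suc q)" and X = "U (Suc (Suc q))", OF U U e ee]) auto
  show "b (Suc p) q (b p q x) = \<zero>\<^bsub>X (Suc (Suc p)) q\<^esub>"
   using x del_inv[OF O, of x q p] del_zero_iff[OF Om_H_module[OF O], of "del K H (OU q p) x" q p]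
    lin_closed[OF del_lin[OF O], of x q p] by (simp add: b_def del: Om_simps)
  show "a (Suc p) q (b p q x) = b p (Suc q) (a p q x)"
   using del_natural[OF O a_H, of x q p] x by (simp add: a_def b_def) }
 assume x: "x \<in> car (X (Suc p) q)" and "b (Suc p) q x = \<zero>\<^bsub>X (Suc (Suc p)) q\<^esub>"
 then have "x \<in> inv_set H (Om K H (OU q p))"
  using del_zero_iff[OF Om_H_module[OF O], of x q p] by (simp add: b_def del: Om_simps)
 then show "x \<in> b p q ` car (X p q)"
  using rinj_exact[OF O rinj_Omn[OF U]] embH_rinj[OF A A_rinj] by (simp add: b_def U_def)
qed (rule field)

definition "Z q = (U q)\<lparr>carrier := {u \<in> car (U q). e q u = \<zero>\<^bsub>U (Suc q)\<^esub>}\<rparr>"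
definition "\<kappa>' q = (\<lambda>x\<in>car (Z q). emb (\<kappa> q (x [])))"
text \<open>The p-fold \<Omega> of the class map. Since \<Omega> is exact, it presents the p-fold
  \<Omega> of V q as the cohomology of the double complex with respect to a.\<close>

definition "kp p q = OmnF K H (Z q) (\<kappa>' q) p"

lemma Z: "Hmod (Z q)" unfolding Z_def by (rule H_kernel(2)[OF U U e])

lemma Z_carrier: "car (Z q) = emb ` cocycles A d q"
 by (auto simp: Z_def U_def e_def cocycles_def)

lemma cocycles_sub: "submodule (cocycles A d q) K (A q)"
 and cocycles_H: "Hmod ((A q)\<lparr>carrier := cocycles A d q\<rparr>)"
 unfolding cocycles_def using H_kernel[OF A A d] by auto

lemma \<kappa>': "\<kappa>' q \<in> H_maps K H (Z q) (embH (V q))"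
proof -
 let ?A = "(A q)\<lparr>carrier := cocycles A d q\<rparr>"
 have "(\<lambda>x\<in>car (embH ?A). emb (\<kappa> q (x []))) \<in> H_maps K H (embH ?A) (embH (V q))"
  by (rule embF_H_maps[OF cocycles_H V \<kappa>])
 moreover have "car (embH ?A) = car (Z q)" by (simp add: Z_carrier)
 moreover have "H_maps K H (embH ?A) (embH (V q)) = H_maps K H (Z q) (embH (V q))"
  using \<open>car (embH ?A) = car (Z q)\<close> by (simp add: H_maps_def lin_maps_def Z_def U_def)
 ultimately show ?thesis by (simp only: \<kappa>'_def)
qed

lemma OZ: "Omn K H (Z q) p = (OU q p)\<lparr>carrier := DC.acyc p q\<rparr>"
 unfolding Z_def Omn_kernel by (simp add: DC.acyc_def a_def)

lemma kp: "kp p q \<in> H_maps K H (Omn K H (Z q) p) (OV q p)"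
 unfolding kp_def by (rule OmnF_H_maps[OF Z embH_module[OF V] \<kappa>'])

lemma kp_lin: "kp p q \<in> lin_maps K ((X p q)\<lparr>carrier := DC.acyc p q\<rparr>) (module.truncate (OV q p))"
 using H_maps_lin[OF kp, of p q] by (simp add: OZ lin_maps_def)

lemma kp_closed: "x \<in> DC.acyc p q ==> kp p q x \<in> car (OV q p)"
 using lin_closed[OF kp_lin, of x p q] by simp

lemma kp_surj: "kp p q ` DC.acyc p q = car (OV q p)"
proof -
 have "\<kappa>' q ` car (Z q) = car (embH (V q))"
  by (simp add: \<kappa>'_def Z_carrier image_image \<kappa>_surj[symmetric])
 from OmnF_surj[OF Z embH_module[OF V] \<kappa>' this, of p] show ?thesis by (simp add: kp_def OZ)
qed

lemma kp_del: assumes x: "x \<in> DC.acyc p q" shows "kp (Suc p) q (b p q x) = del K H (OV q p) (kp p q x)"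
proof -
 have "del K H (Omn K H (Z q) p) x = b p q x"
  using x DC.acyc_carrier[OF x] by (simp add: OZ b_def del_def)
 then show ?thesis
  using del_natural[OF Omn_module[OF Z] kp, of x q p] x by (simp add: kp_def OZ)
qed

text \<open>The kernel of the class map is the image of the preceding differential, and zero in
  degree 0. Exactness of \<Omega> transports the first case, preservation of injectivity the
  second.\<close>

lemma kp_zero: assumes x: "x \<in> DC.acyc p q"
 shows "kp p q x = \<zero>\<^bsub>OV q p\<^esub> \<longleftrightarrow> x \<in> DC.abnd p q"
proof (cases q)
 case 0
 have inj: "u = \<zero>\<^bsub>Z 0\<^esub>" if u: "u \<in> car (Z 0)" "\<kappa>' 0 u = \<zero>\<^bsub>embH (V 0)\<^esub>" for u
 proof -
  obtain v where v: "v \<in> cocycles A d 0" "u = emb v" using u by (auto simp: Z_carrier)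
  have "\<kappa> 0 v = \<zero>\<^bsub>V 0\<^esub>" using u v by (simp add: \<kappa>'_def Z_carrier)
  then have "v = \<zero>\<^bsub>A 0\<^esub>" using \<kappa>_zero[OF v(1)] by (simp add: coboundaries_def)
  then show ?thesis using v by (simp add: Z_def U_def)
 qed
 have "x = \<zero>\<^bsub>OU 0 p\<^esub>" if "kp p q x = \<zero>\<^bsub>OV q p\<^esub>"
  using OmnF_inj[of "Z 0" "\<kappa>' 0" "embH (V 0)" x p, OF inj] x that 0 by (simp add: OZ kp_def)
 moreover have "kp p q \<zero>\<^bsub>Omn K H (Z q) p\<^esub> = \<zero>\<^bsub>OV q p\<^esub>"
  by (rule H_maps_zero[OF kp Omn_module[OF Z] Omn_module[OF embH_module[OF V]]])
 ultimately show ?thesis using 0 by (auto simp: DC.abnd_def OZ)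
next
 case (Suc q')
 have e': "e q' \<in> H_maps K H (U q') (Z q)"
  using e[of q'] ee[of _ q'] Suc by (auto simp: H_maps_def Z_def lin_maps_def)
 have ex: "w \<in> e q' ` car (U q')" if w: "w \<in> car (Z q)" "\<kappa>' q w = \<zero>\<^bsub>embH (V q)\<^esub>" for w
 proof -
  obtain v where v: "v \<in> cocycles A d q" "w = emb v" using w by (auto simp: Z_carrier)
  then have "v \<in> d q' ` car (A q')" using w \<kappa>_zero[OF v(1)] Suc by (auto simp: \<kappa>'_def coboundaries_def)
  then show ?thesis using v by (auto simp: e_def U_def image_image)
 qed
 have z: "\<kappa>' q (e q' u) = \<zero>\<^bsub>embH (V q)\<^esub>" if u: "u \<in> car (U q')" for u
 proof -
  obtain v where v: "v \<in> car (A q')" "u = emb v" using u by (auto simp: U_def)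
  have "d q' v \<in> cocycles A d q" using v dd[OF v(1)] H_maps_closed[OF d v(1)] Suc by (simp add: cocycles_def)
  moreover from this have "\<kappa> q (d q' v) = \<zero>\<^bsub>V q\<^esub>" using \<kappa>_zero Suc v by (simp add: coboundaries_def)
  ultimately show ?thesis using v u by (simp add: \<kappa>'_def e_def Z_carrier)
 qed
 show ?thesis
 proof
  assume "kp p q x = \<zero>\<^bsub>OV q p\<^esub>"
  then show "x \<in> DC.abnd p q"
   using OmnF_exact[where g = "\<kappa>' q" and X = "embH (V q)" and x = x and p = p, OF U Z e' ex] x Suc by (simp add: kp_def OZ DC.abnd_def a_def)
 next
  assume "x \<in> DC.abnd p q"
  then obtain y where "y \<in> car (OU q' p)" "x = OmnF K H (U q') (e q') p y"
   using Suc by (auto simp: DC.abnd_def a_def)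
  then show "kp p q x = \<zero>\<^bsub>OV q p\<^esub>"
   unfolding kp_def using OmnF_comp_zero[where g = "\<kappa>' q" and X = "embH (V q)", OF U Z e' z] by blast
 qed
qed

text \<open>The class of b x is \<partial> of the class of x. So b x is a coboundary for a exactly
  if \<partial> kills the class of x, that is, if this class is invariant.\<close>

lemma kp_Ecyc: assumes x: "x \<in> DC.acyc p q"
 shows "x \<in> DC.Ecyc p q \<longleftrightarrow> kp p q x \<in> inv_set H (OV q p)"
 using kp_zero[OF DC.b_acyc[OF x]] x kp_del[OF x] kp_closed[OF x]
  del_zero_iff[OF Omn_module[OF embH_module[OF V]], of "kp p q x" q p]
 by (simp add: DC.Ecyc_def del: Om_simps)

abbreviation "pT p q \<equiv> prj K (Tc K H (V q) p) (Tb K H (V q) p)"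

definition "ee' p q = (\<lambda>x\<in>DC.Ecyc p q. pT p q (kp p q x))"

lemma Tc_carrier [simp]: "car (Tc K H W p) = inv_set H (Omn K H (embH W) p)"
 by (simp add: Tc_def)

lemma Tc_zero [simp]: "zero (Tc K H W p) = zero (Omn K H (embH W) p)" by (simp add: Tc_def)

text \<open>If the class of x is \<partial> t, lift t to a cocycle z. The class of x - b z is then
  zero, so x - b z is a coboundary for a; this is the decomposition that defines
  \<open>Enul\<close>.\<close>

lemma kp_Enul: assumes x: "x \<in> DC.Ecyc p q"
 shows "kp p q x \<in> Tb K H (V q) p \<longleftrightarrow> x \<in> DC.Enul p q"
proof -
 have xa: "x \<in> DC.acyc p q" using x by (simp add: DC.Ecyc_def)
 have acyc: "module K ((X p q)\<lparr>carrier := DC.acyc p q\<rparr>)" by (rule submodule_module[OF DC.X DC.acyc_sub])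
 have W: "module K (module.truncate (OV q p))" for p
  by (rule module_truncate[OF left_H_module.vector_space[OF Omn_module[OF embH_module[OF V]]]])
 have bb: "kp p q y \<in> Tb K H (V q) p" if y: "y \<in> DC.bbnd p q" for y
 proof (cases p)
  case 0
  then have "y = \<zero>\<^bsub>X 0 q\<^esub>" using y by (simp add: DC.bbnd_def)
  then show ?thesis using 0 lin_zero[OF kp_lin acyc W] by (simp add: Tb_def)
 next
  case (Suc p')
  then obtain z where "z \<in> DC.acyc p' q" "y = b p' q z" using y by (auto simp: DC.bbnd_def)
  then show ?thesis using Suc kp_del[of z p' q] kp_closed[of z p' q] by (simp add: Tb_def)
 qed
 show ?thesis
 proof
  assume "kp p q x \<in> Tb K H (V q) p"
  then obtain y where y: "y \<in> DC.bbnd p q" "kp p q x = kp p q y"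
  proof (cases p)
   case 0
   have z: "\<zero>\<^bsub>X 0 q\<^esub> \<in> DC.bbnd 0 q" by (simp add: DC.bbnd_def)
   have "kp p q x = kp p q \<zero>\<^bsub>X 0 q\<^esub>"
    using \<open>kp p q x \<in> _\<close> 0 lin_zero[OF kp_lin acyc W] by (simp add: Tb_def)
   with z 0 that show ?thesis by blast
  next
   case (Suc p')
   then obtain t where t: "t \<in> car (OV q p')" "kp p q x = del K H (OV q p') t"
    using \<open>kp p q x \<in> _\<close> by (auto simp: Tb_def)
   then obtain z where z: "z \<in> DC.acyc p' q" "t = kp p' q z" using kp_surj[of p' q] by blast
   then have "kp p q x = kp p q (b p' q z)" using t Suc kp_del by simp
   moreover have "b p' q z \<in> DC.bbnd p q" using z Suc by (simp add: DC.bbnd_def)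
   ultimately show ?thesis using that by blast
  qed
  have ya: "y \<in> DC.acyc p q" using y DC.bbnd_Lam by (auto simp: DC.Lam_def)
  have d: "dif K (X p q) x y \<in> DC.acyc p q" by (rule submodule_dif[OF DC.X DC.acyc_sub xa ya])
  have "kp p q (dif K (X p q) x y) = \<zero>\<^bsub>OV q p\<^esub>"
   using lin_dif[OF kp_lin acyc, of x y] xa ya y(2) dif_dif_zero[OF W, of "kp p q y" p] kp_closed[OF ya] by simp
  then have "dif K (X p q) x y \<in> DC.abnd p q" using kp_zero[OF d] by simp
  moreover have "x = dif K (X p q) x y \<oplus>\<^bsub>X p q\<^esub> y"
   using dif_add_cancel[OF DC.X, of x p q y] DC.acyc_carrier[OF xa] DC.acyc_carrier[OF ya] by simp
  ultimately show "x \<in> DC.Enul p q" using y(1) unfolding DC.Enul_def by blast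
 next
  assume "x \<in> DC.Enul p q"
  then obtain u v where uv: "u \<in> DC.abnd p q" "v \<in> DC.bbnd p q" "x = u \<oplus>\<^bsub>X p q\<^esub> v" by (auto simp: DC.Enul_def)
  have "v \<in> DC.Lam p q" using uv(2) DC.bbnd_Lam by blast
  then have c: "u \<in> DC.acyc p q" "v \<in> DC.acyc p q" using uv(1) DC.abnd_acyc by (auto simp: DC.Lam_def)
  interpret W: module K "module.truncate (OV q p)" by (rule W)
  have "kp p q x = \<zero>\<^bsub>OV q p\<^esub> \<oplus>\<^bsub>OV q p\<^esub> kp p q v"
   using lin_add[OF kp_lin, of u p q v] c uv kp_zero[OF c(1)] by simp
  then have "kp p q x = kp p q v" using W.l_zero[of "kp p q v"] kp_closed[OF c(2)] by simp
  then show "kp p q x \<in> Tb K H (V q) p" using bb[OF uv(2)] by simp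
 qed
qed

lemma T_surj: "ee' p q ` DC.Ecyc p q = car (T K H (V q) p)"
proof -
 have "kp p q ` DC.Ecyc p q = inv_set H (OV q p)"
 proof (intro equalityI subsetI)
  fix t assume t: "t \<in> inv_set H (OV q p)"
  then have "t \<in> kp p q ` DC.acyc p q" by (simp add: kp_surj inv_set_def)
  then obtain x where x: "x \<in> DC.acyc p q" "t = kp p q x" by auto
  then have "x \<in> DC.Ecyc p q" using kp_Ecyc[OF x(1)] t by simp
  then show "t \<in> kp p q ` DC.Ecyc p q" using x(2) by simp
 next
  fix t assume "t \<in> kp p q ` DC.Ecyc p q"
  then obtain x where x: "x \<in> DC.Ecyc p q" "t = kp p q x" by auto
  then have "x \<in> DC.acyc p q" by (simp add: DC.Ecyc_def)
  then show "t \<in> inv_set H (OV q p)" using kp_Ecyc x by simp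
 qed
 moreover have "ee' p q ` DC.Ecyc p q = pT p q ` kp p q ` DC.Ecyc p q"
  unfolding image_image ee'_def by (rule image_cong) simp_all
 ultimately show ?thesis
  unfolding T_def qspace_carrier[OF field Tc_module[OF V] Tb_sub[OF V]] by simp
qed

lemma ee'_lin: "ee' p q \<in> lin_maps K (DC.Espace p q) (T K H (V q) p)"
proof -
 have acyc: "module K ((X p q)\<lparr>carrier := DC.acyc p q\<rparr>)" by (rule submodule_module[OF DC.X DC.acyc_sub])
 have E: "submodule (DC.Ecyc p q) K ((X p q)\<lparr>carrier := DC.acyc p q\<rparr>)"
  by (rule submodule_restrict[OF DC.X DC.acyc_sub DC.Ecyc_sub]) (auto simp: DC.Ecyc_def)
 have c: "kp p q x \<in> inv_set H (OV q p)" if "x \<in> DC.Ecyc p q" for x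
  using that kp_Ecyc[of x p q] by (simp add: DC.Ecyc_def)
 have "restrict (kp p q) (DC.Ecyc p q) \<in> lin_maps K (DC.Espace p q) (Tc K H (V q) p)"
  using lin_restrict_dom[OF kp_lin acyc E c] by (simp add: Tc_def)
 from lin_compose[OF DC.Espace this prj_lin[OF field Tc_module[OF V] Tb_sub[OF V]]]
 show ?thesis by (simp add: ee'_def T_def)
qed

lemma ee'_zero: "x \<in> DC.Ecyc p q ==> ee' p q x = \<zero>\<^bsub>T K H (V q) p\<^esub> \<longleftrightarrow> x \<in> DC.Enul p q"
 using kp_Enul[of x p q] kp_Ecyc[of x p q] prj_eq_zero[OF field Tc_module[OF V] Tb_sub[OF V], of "kp p q x" q p]
 by (simp add: ee'_def T_def DC.Ecyc_def)

text \<open>The class map is followed by the given isomorphisms, which puts the prescribed spaces E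
  in the place of the spaces T.\<close>

lemma double_complex_E:
 assumes E: "\<And>p q. module K (E p q)" and iso: "\<And>p q. vs_iso K (T K H (V q) p) (E p q)"
 shows "\<exists>e. double_complex_E K X a b E e"
proof -
 have "\<forall>p q. \<exists>f. f \<in> lin_maps K (T K H (V q) p) (E p q) \<and> bij_betw f (car (T K H (V q) p)) (car (E p q))"
  using iso by (auto simp: vs_iso_def)
 then obtain f where f: "\<And>p q. f p q \<in> lin_maps K (T K H (V q) p) (E p q)"
  "\<And>p q. bij_betw (f p q) (car (T K H (V q) p)) (car (E p q))" by metis
 have Tm: "module K (T K H (V q) p)" for p q by (rule T_module[OF V])
 have inj: "f p q y = \<zero>\<^bsub>E p q\<^esub> \<longleftrightarrow> y = \<zero>\<^bsub>T K H (V q) p\<^esub>" if "y \<in> car (T K H (V q) p)" for p q y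
  using that f(2)[of p q] lin_inj_iff[OF f(1) Tm E, of p q] lin_zero[OF f(1) Tm E, of p q] by (auto simp: bij_betw_def)
 have "double_complex_E_axioms K X a b E (\<lambda>p q. \<lambda>x\<in>car (DC.Espace p q). f p q (ee' p q x))"
 proof (rule double_complex_E_axioms.intro)
  fix p q
  show "module K (E p q)" by (rule E)
  show "(\<lambda>x\<in>car (DC.Espace p q). f p q (ee' p q x)) \<in> lin_maps K (DC.Espace p q) (E p q)"
   by (rule lin_compose[OF DC.Espace ee'_lin f(1)])
  have "(\<lambda>x\<in>car (DC.Espace p q). f p q (ee' p q x)) ` DC.Ecyc p q = f p q ` ee' p q ` DC.Ecyc p q"
   by (auto simp: image_image)
  then show "(\<lambda>x\<in>car (DC.Espace p q). f p q (ee' p q x)) ` DC.Ecyc p q = car (E p q)"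
   using f(2)[of p q] T_surj[of p q] by (simp add: bij_betw_def)
  fix x assume x: "x \<in> DC.Ecyc p q"
  then have "ee' p q x \<in> car (T K H (V q) p)" using T_surj by blast
  then show "(\<lambda>x\<in>car (DC.Espace p q). f p q (ee' p q x)) x = \<zero>\<^bsub>E p q\<^esub> \<longleftrightarrow> x \<in> DC.Enul p q"
   using x ee'_zero[OF x] inj by simp
 qed
 then show ?thesis using DC.double_complex_axioms by (auto simp: double_complex_E_def)
qed

section \<open>The abutment: cohomology of the invariants\<close>

abbreviation "G n \<equiv> invariants H (A n)"
abbreviation "Hn n \<equiv> cohomology (\<lambda>i. invariants H (A i)) d n"

lemma inv_simps [simp]: "car (invariants H W) = inv_set H W" "zero (invariants H W) = zero W"
 "add (invariants H W) = add W" "smult (invariants H W) = smult W"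
 by (simp_all add: invariants_def inv_set_def module.defs)

lemma G: "module K (G n)"
proof -
 have "module K (A n)" using A by (simp add: left_H_module_def)
 from submodule_module[OF this inv_set_sub[OF A]] show ?thesis by (rule module_cong) simp_all
qed

lemma d_G: "restrict (d n) (inv_set H (A n)) \<in> lin_maps K (G n) (G (Suc n))"
proof -
 have AM: "module K (A n)" for n using A by (simp add: left_H_module_def)
 have "d n x \<in> inv_set H (A (Suc n))" if "x \<in> inv_set H (A n)" for x
  using that H_maps_closed[OF d] H_maps_act[OF d, symmetric] lin_smult[OF H_maps_lin[OF d]] counit_closed
  by (auto simp: inv_set_def)
 from lin_restrict_dom[OF H_maps_lin[OF d] AM inv_set_sub[OF A] this]
 show ?thesis by (simp add: lin_maps_def)
qed

lemma d_G_closed: "x \<in> inv_set H (A n) ==> d n x \<in> inv_set H (A (Suc n))"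
 using lin_closed[OF d_G, of x n] by simp

lemma G_cocycles: "submodule (cocycles G d n) K (G n)"
proof -
 have "cocycles G d n = {x \<in> car (G n). restrict (d n) (inv_set H (A n)) x = \<zero>\<^bsub>G (Suc n)\<^esub>}"
  by (auto simp: cocycles_def)
 then show ?thesis using submodule_kernel[OF d_G G G] by simp
qed

lemma G_coboundaries: "submodule (coboundaries G d n) K (G n)"
proof (cases n)
 case 0 then show ?thesis using submodule_zero[OF G[of 0]] by (simp add: coboundaries_def)
next
 case (Suc m)
 have "coboundaries G d n = restrict (d m) (inv_set H (A m)) ` car (G m)"
  by (auto simp: coboundaries_def Suc)
 then show ?thesis using submodule_image[OF d_G G G submodule_carrier[OF G], of m] Suc by simp
qed

lemma G_coboundaries_cocycles: "coboundaries G d n \<subseteq> cocycles G d n"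
proof (cases n)
 case 0
 have "\<zero>\<^bsub>G 0\<^esub> \<in> cocycles G d 0" using G_cocycles[of 0] by (simp add: submodule_iff[OF G])
 then show ?thesis using 0 by (simp add: coboundaries_def)
next
 case (Suc m)
 then show ?thesis using d_G_closed by (auto simp: coboundaries_def cocycles_def inv_set_def dd)
qed

lemma Gc: "module K ((G n)\<lparr>carrier := cocycles G d n\<rparr>)"
 by (rule submodule_module[OF G G_cocycles])

lemma Gb: "submodule (coboundaries G d n) K ((G n)\<lparr>carrier := cocycles G d n\<rparr>)"
 by (rule submodule_restrict[OF G G_cocycles G_coboundaries G_coboundaries_cocycles])

lemma Hn_module: "module K (Hn n)"
 unfolding cohomology_def by (rule coset_map(1)[OF Gc Gb])

lemma inv_U: "inv_set H (U n) = emb ` inv_set H (A n)"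
 by (auto simp: inv_set_def U_def)

lemma bcyc0: "DC.bcyc 0 n = emb ` inv_set H (A n)"
proof -
 have "DC.bcyc 0 n = {x \<in> car (U n). x \<in> inv_set H (U n)}"
  unfolding DC.bcyc_def b_def using del_zero_iff[OF U] by (auto simp del: Om_simps)
 then show ?thesis by (simp add: inv_U[symmetric]) (auto simp: inv_set_def)
qed

lemma Lam0: "DC.Lam 0 n = emb ` cocycles G d n"
proof -
 have "emb v \<in> DC.acyc 0 n \<longleftrightarrow> d n v = \<zero>\<^bsub>A (Suc n)\<^esub>" if "v \<in> car (A n)" for v
  using that by (simp add: DC.acyc_def a_def e_def U_def)
 then show ?thesis by (auto simp: DC.Lam_def bcyc0 cocycles_def inv_set_def)
qed

lemma Nul0: "DC.Nul 0 n = emb ` coboundaries G d n"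
proof (cases n)
 case 0 then show ?thesis by (simp add: DC.Nul_def coboundaries_def U_def)
next
 case (Suc m)
 have "a 0 m (emb v) = emb (d m v)" if "v \<in> inv_set H (A m)" for v
  using that by (simp add: a_def e_def U_def inv_set_def)
 then show ?thesis using Suc by (simp add: DC.Nul_def coboundaries_def bcyc0 image_image)
qed

text \<open>At p = 0 the kernel of \<partial> consists of the invariants. Hence \<open>Lam\<close>
  and \<open>Nul\<close> are the cocycles and coboundaries of the complex of invariants, up to the
  encoding by \<open>emb\<close>.\<close>

lemma edge_map:
 obtains h where "h \<in> lin_maps K (DC.Lspace 0 n) (Hn n)" "h ` DC.Lam 0 n = car (Hn n)"
  "\<And>x. x \<in> DC.Lam 0 n ==> h x = \<zero>\<^bsub>Hn n\<^esub> \<longleftrightarrow> x \<in> DC.Nul 0 n"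
proof -
 let ?C = "(G n)\<lparr>carrier := cocycles G d n\<rparr>"
 have Hq: "Hn n = quot_space ?C (coboundaries G d n)" by (simp add: cohomology_def)
 note q = coset_map[OF Gc[of n] Gb[of n], folded Hq]
 let ?q = "\<lambda>x\<in>car ?C. a_r_coset ?C (coboundaries G d n) x"
 have add: "x \<oplus>\<^bsub>U n\<^esub> y = emb (x [] \<oplus>\<^bsub>A n\<^esub> y [])" for x y by (simp add: U_def)
 have u: "(\<lambda>x\<in>car (DC.Lspace 0 n). x []) \<in> lin_maps K (DC.Lspace 0 n) ?C"
  by (rule lin_restrictI[OF DC.Lspace]) (auto simp: Lam0 U_def)
 let ?h = "\<lambda>x\<in>car (DC.Lspace 0 n). ?q ((\<lambda>x\<in>car (DC.Lspace 0 n). x []) x)"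
 have h: "?h \<in> lin_maps K (DC.Lspace 0 n) (Hn n)" by (rule lin_compose[OF DC.Lspace u q(2)])
 have hv: "?h (emb v) = ?q v" if "v \<in> cocycles G d n" for v
  using that by (simp add: Lam0)
 have "?h ` (emb ` cocycles G d n) = ?q ` cocycles G d n"
  unfolding image_image by (rule image_cong[OF HOL.refl hv])
 then have "?h ` DC.Lam 0 n = ?q ` cocycles G d n" unfolding Lam0[symmetric] .
 then have s: "?h ` DC.Lam 0 n = car (Hn n)" using q(3) by simp
 have "?h x = \<zero>\<^bsub>Hn n\<^esub> \<longleftrightarrow> x \<in> DC.Nul 0 n" if "x \<in> DC.Lam 0 n" for x
 proof -
  obtain v where v: "v \<in> cocycles G d n" "x = emb v" using \<open>x \<in> DC.Lam 0 n\<close> by (auto simp: Lam0)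
  have "?h x = \<zero>\<^bsub>Hn n\<^esub> \<longleftrightarrow> ?q v = \<zero>\<^bsub>Hn n\<^esub>" using hv[OF v(1)] v(2) by (simp only:)
  also have "\<dots> \<longleftrightarrow> v \<in> coboundaries G d n" using q(4)[of v] v(1) by simp
  also have "\<dots> \<longleftrightarrow> x \<in> DC.Nul 0 n" using v(2) by (auto simp: Nul0)
  finally show ?thesis .
 qed
 with h s that show ?thesis by blast
qed

theorem spectral_sequence:
 assumes E: "\<And>p q. module K (E p q)" and iso: "\<And>p q. vs_iso K (T K H (V q) p) (E p q)"
 shows "\<exists>E' d'. first_quadrant_spectral_sequence K E' d' \<and> (\<forall>p q. E' 2 (int p) (int q) = E p q) \<and> converges_to K E' Hn"
proof -
 obtain ee where "double_complex_E K X a b E ee" using double_complex_E[OF E iso] by blast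
 then interpret DE: double_complex_E K X a b E ee .
 have "\<forall>n. \<exists>h. h \<in> lin_maps K (DC.Lspace 0 n) (Hn n) \<and> h ` DC.Lam 0 n = car (Hn n) \<and>
  (\<forall>x\<in>DC.Lam 0 n. h x = \<zero>\<^bsub>Hn n\<^esub> \<longleftrightarrow> x \<in> DC.Nul 0 n)"
 proof
  fix n
  show "\<exists>h. h \<in> lin_maps K (DC.Lspace 0 n) (Hn n) \<and> h ` DC.Lam 0 n = car (Hn n) \<and>
   (\<forall>x\<in>DC.Lam 0 n. h x = \<zero>\<^bsub>Hn n\<^esub> \<longleftrightarrow> x \<in> DC.Nul 0 n)"
   by (rule edge_map[of n]) blast
 qed
 then obtain h where "\<And>n. h n \<in> lin_maps K (DC.Lspace 0 n) (Hn n)" "\<And>n. h n ` DC.Lam 0 n = car (Hn n)"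
  "\<And>n x. x \<in> DC.Lam 0 n ==> h n x = \<zero>\<^bsub>Hn n\<^esub> \<longleftrightarrow> x \<in> DC.Nul 0 n" by metis
 from DE.spectral_sequence[OF Hn_module this] show ?thesis .
qed

text \<open>\<Omega> of a zero module is zero, so cohomology in degree 0 only leaves a second page
  in q = 0 only, and the edge isomorphism of the couple applies.\<close>

theorem edge_iso:
 assumes triv: "\<And>q. car (V (Suc q)) = {\<zero>\<^bsub>V (Suc q)\<^esub>}"
 shows "vs_iso K (Hn n) (T K H (V 0) n)"
proof -
 have Tm: "module K (T K H (V q) p)" for p q by (rule T_module[OF V])
 obtain ee where "double_complex_E K X a b (\<lambda>p q. T K H (V q) p) ee"
  using double_complex_E[OF Tm vs_iso_refl[OF Tm]] by blast
 then interpret DE: double_complex_E K X a b "\<lambda>p q. T K H (V q) p" ee .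
 have O0: "car (OV (Suc q) p) = {\<zero>\<^bsub>OV (Suc q) p\<^esub>}" for p q
 proof (induction p)
  case (Suc p)
  have OM: "module K (OV (Suc q) p)" for p
   using Omn_module[OF embH_module[OF V]] by (simp add: left_H_module_def)
  have "x = \<zero>\<^bsub>OV (Suc q) (Suc p)\<^esub>" if x: "x \<in> car (OV (Suc q) (Suc p))" for x
   using x Om_zero_iff[of x "OV (Suc q) p"] cur_Om[of x "OV (Suc q) p"] Suc by auto
  moreover have "\<zero>\<^bsub>OV (Suc q) (Suc p)\<^esub> \<in> car (OV (Suc q) (Suc p))"
   using submodule_zero[OF OM] by (simp add: submodule_iff[OF OM] del: Omn.simps)
  ultimately show ?case by blast
 qed (simp add: triv)
 have "car (T K H (V (Suc q)) p) = {\<zero>\<^bsub>T K H (V (Suc q)) p\<^esub>}" for p q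
 proof -
  have "car (T K H (V (Suc q)) p) \<subseteq> car (Tc K H (V (Suc q)) p)"
   unfolding T_def by (rule qspace_subset[OF field Tc_module[OF V] Tb_sub[OF V]])
  also have "\<dots> \<subseteq> {\<zero>\<^bsub>T K H (V (Suc q)) p\<^esub>}" using O0[of q p] by (auto simp: inv_set_def T_def)
  finally show ?thesis using submodule_zero[OF Tm] by (auto simp: submodule_iff[OF Tm])
 qed
 note triv = this
 obtain h where h: "h \<in> lin_maps K (DC.Lspace 0 n) (Hn n)" "h ` DC.Lam 0 n = car (Hn n)"
  "\<And>x. x \<in> DC.Lam 0 n ==> h x = \<zero>\<^bsub>Hn n\<^esub> \<longleftrightarrow> x \<in> DC.Nul 0 n" using edge_map[of n] by blast
 show ?thesis by (rule DE.edge_iso[OF triv Hn_module h])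
qed

end

context hopf_algebra
begin

text \<open>A resolution of V is a complex whose cohomology is V in degree 0 and zero elsewhere. The
  edge isomorphism for it compares the cohomology of its invariants with \<open>T K H V\<close>,
  which is defined from V alone; this identifies T with the derived functors of the
  invariants.\<close>

theorem resolution_iso:
 fixes V :: "('k, 'h, 'v) hmodule" and J :: "nat => ('k, 'h, 'w) hmodule"
 assumes V: "Hmod V" and res: "injective_H_resolution K H V J d e"
  and R: "\<And>n. rinj K H (J n)"
 shows "module K (cohomology (\<lambda>i. invariants H (J i)) d n)"
  and "vs_iso K (T K H V n) (cohomology (\<lambda>i. invariants H (J i)) d n)"
proof -
 have J: "Hmod (J n)" for n using res by (simp add: injective_H_resolution_def injective_H_module_def)
 have d: "d n \<in> H_maps K H (J n) (J (Suc n))" for n using res by (simp add: injective_H_resolution_def)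
 have e: "e \<in> H_maps K H V (J 0)" "inj_on e (car V)" "e ` car V = cocycles J d 0"
  and ex: "d n ` car (J n) = cocycles J d (Suc n)" for n
  using res by (auto simp: injective_H_resolution_def)
 interpret V: left_H_module K H V by fact
 let ?Z = "\<lambda>q. (J q)\<lparr>carrier := cocycles J d q\<rparr>"
 have Z: "Hmod (?Z q)" for q
  unfolding cocycles_def by (rule H_kernel(2)[OF J J d])
 \<comment> \<open>A zero module on the type of V, because the cohomology modules of all degrees
   have to share a type.\<close>
 let ?O = "V\<lparr>carrier := {\<zero>\<^bsub>V\<^esub>}\<rparr>"
 have O: "Hmod ?O"
  by (rule left_H_submodule[OF V submodule_zero[OF V.vector_space]]) (simp add: V.act_zero)
 have e': "e \<in> H_maps K H V (?Z 0)"
  using e(1,3) by (auto simp: H_maps_def lin_maps_def)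
 have bij: "bij_betw e (car V) (car (?Z 0))" using e(2,3) by (simp add: bij_betw_def)
 \<comment> \<open>The cocycles in degree 0 are the image of V, so the inverse of the augmentation
   is the class map there.\<close>
 define f where "f = restrict (inv_into (car V) e) (car (?Z 0))"
 note f = lin_inverse[OF H_maps_lin[OF e'] V.vector_space bij, folded f_def]
 have fH: "f \<in> H_maps K H (?Z 0) V"
 proof (rule H_mapsI[OF f(1)])
  fix h v assume h: "h \<in> car H" and v: "v \<in> car (?Z 0)"
  have fv: "f v \<in> car V" by (rule lin_closed[OF f(1) v])
  have "act (?Z 0) h v = e (act V h (f v))" using H_maps_act[OF e' h fv] f(4)[OF v] by simp
  then show "f (act (?Z 0) h v) = act V h (f v)" using f(3) V.act_closed[OF h fv] by simp
 qed
 let ?V = "\<lambda>q. case q of 0 => V | Suc q' => ?O"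
 let ?\<kappa> = "\<lambda>q. case q of 0 => f | Suc q' => (\<lambda>x\<in>cocycles J d (Suc q'). \<zero>\<^bsub>V\<^esub>)"
 have C: "H_complex K H J d ?V ?\<kappa>"
 proof (intro H_complex.intro H_complex_axioms.intro hopf J R d)
  show "d (Suc q) (d q x) = \<zero>\<^bsub>J (Suc (Suc q))\<^esub>" if "x \<in> car (J q)" for q x
   using that ex[of q] by (auto simp: cocycles_def)
  show "Hmod (?V q)" for q using V O by (cases q) auto
  show "?\<kappa> q \<in> H_maps K H (?Z q) (?V q)" for q
  proof (cases q)
   case 0 then show ?thesis using fH by simp
  next
   case (Suc q')
   have "(\<lambda>x\<in>car (?Z (Suc q')). \<zero>\<^bsub>?O\<^esub>) \<in> lin_maps K (?Z (Suc q')) ?O"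
    using Z[of "Suc q'"] O by (intro lin_zero_map) (simp_all add: left_H_module_def)
   then show ?thesis
    using Suc left_H_module.act_closed[OF Z[of "Suc q'"]] V.act_zero by (auto intro!: H_mapsI)
  qed
  show "?\<kappa> q ` cocycles J d q = car (?V q)" for q
  proof (cases q)
   case 0 then show ?thesis using f(2) by (simp add: bij_betw_def)
  next
   case (Suc q')
   have "\<zero>\<^bsub>J q\<^esub> \<in> cocycles J d q"
    using submodule_zero[of K "?Z q"] Z[of q] by (auto simp: left_H_module_def submodule_iff)
   then show ?thesis using Suc by auto
  qed
  show "?\<kappa> q x = \<zero>\<^bsub>?V q\<^esub> \<longleftrightarrow> x \<in> coboundaries J d q" if x: "x \<in> cocycles J d q" for q x
  proof (cases q)
   case 0
   have Zm: "module K (?Z 0)" using Z[of 0] by (simp add: left_H_module_def)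
   have "f x = \<zero>\<^bsub>V\<^esub> \<longleftrightarrow> x = \<zero>\<^bsub>J 0\<^esub>"
    using x 0 f(2) lin_inj_iff[OF f(1) Zm V.vector_space] lin_zero[OF f(1) Zm V.vector_space]
    by (auto simp: bij_betw_def)
   then show ?thesis using 0 by (simp add: coboundaries_def)
  next
   case (Suc q') then show ?thesis using x ex[of q'] by (simp add: coboundaries_def)
  qed
 qed
 interpret C: H_complex K H J d ?V ?\<kappa> by (rule C)
 show m: "module K (cohomology (\<lambda>i. invariants H (J i)) d n)" by (rule C.Hn_module)
 have "vs_iso K (cohomology (\<lambda>i. invariants H (J i)) d n) (T K H (?V 0) n)"
  by (rule C.edge_iso) simp
 then show "vs_iso K (T K H V n) (cohomology (\<lambda>i. invariants H (J i)) d n)"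
  using vs_iso_sym[OF m] by simp
qed

text \<open>Coboundaries are stable under H because the differentials are equivariant. So all
  members of a coset are moved into one coset, and the union that defines the action has equal
  members.\<close>

lemma H_cohomology_module:
 fixes A :: "nat => ('k, 'h, 'a) hmodule"
 assumes A: "\<And>q. Hmod (A q)" and d: "\<And>q. d q \<in> H_maps K H (A q) (A (Suc q))"
  and dd: "\<And>q x. x \<in> car (A q) ==> d (Suc q) (d q x) = \<zero>\<^bsub>A (Suc (Suc q))\<^esub>"
 defines "\<kappa> q \<equiv> \<lambda>x\<in>cocycles A d q. a_r_coset ((A q)\<lparr>carrier := cocycles A d q\<rparr>) (coboundaries A d q) x"
 shows "Hmod (H_cohomology A d q)"
  and "\<kappa> q \<in> H_maps K H ((A q)\<lparr>carrier := cocycles A d q\<rparr>) (H_cohomology A d q)"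
  and "\<kappa> q ` cocycles A d q = car (H_cohomology A d q)"
  and "\<And>x. x \<in> cocycles A d q ==> \<kappa> q x = \<zero>\<^bsub>H_cohomology A d q\<^esub> \<longleftrightarrow> x \<in> coboundaries A d q"
proof -
 let ?HC = "H_cohomology A d q"
 let ?Z = "(A q)\<lparr>carrier := cocycles A d q\<rparr>" and ?B = "coboundaries A d q"
 have AM: "module K (A q)" for q using A by (simp add: left_H_module_def)
 have Z: "Hmod ?Z" and Zs: "submodule (cocycles A d q) K (A q)"
  unfolding cocycles_def using H_kernel[OF A A d] by auto
 interpret Z: left_H_module K H ?Z by (rule Z)
 have Bs: "submodule ?B K (A q)"
  using submodule_image[OF H_maps_lin[OF d] AM AM submodule_carrier[OF AM]] submodule_zero[OF AM]
  by (cases q) (simp_all add: coboundaries_def)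
 have "\<zero>\<^bsub>A q\<^esub> \<in> cocycles A d q" using Zs by (simp add: submodule_iff[OF AM])
 then have BZ: "?B \<subseteq> cocycles A d q"
  using dd H_maps_closed[OF d] by (cases q) (auto simp: coboundaries_def cocycles_def)
 have BactA: "act (A q) h x \<in> ?B" if hx: "h \<in> car H" "x \<in> ?B" for h x
 proof (cases q)
  case 0 then show ?thesis using hx left_H_module.act_zero[OF A] by (simp add: coboundaries_def)
 next
  case (Suc m)
  then obtain y where "y \<in> car (A m)" "x = d m y" using hx by (auto simp: coboundaries_def)
  then have "act (A q) h x = d m (act (A m) h y)" using H_maps_act[OF d hx(1)] Suc by simp
  then show ?thesis using \<open>y \<in> _\<close> hx(1) left_H_module.act_closed[OF A] Suc by (simp add: coboundaries_def)
 qed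
 have B: "submodule ?B K ?Z" by (rule submodule_restrict[OF AM Zs Bs BZ])
 note q = coset_map[OF Z.vector_space B, simplified]
 have k: "\<kappa> q = (\<lambda>x\<in>cocycles A d q. a_r_coset ?Z ?B x)" by (simp add: \<kappa>_def)
 \<comment> \<open>The action is defined with cosets formed in the whole space, the quotient with
   cosets formed in the cocycles; as sets they agree.\<close>
 have coset_eq: "a_r_coset (A q) ?B x = a_r_coset ?Z ?B x" for x by (simp add: a_r_coset_def')
 have H: "?HC = with_act (quot_space ?Z ?B) (\<lambda>h S. \<Union>a\<in>S. a_r_coset ?Z ?B (act (A q) h a))"
  by (simp add: H_cohomology_def cohomology_def coset_eq)
 have act: "act ?HC h (\<kappa> q x) = \<kappa> q (act ?Z h x)"
  if h: "h \<in> car H" and x: "x \<in> cocycles A d q" for h x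
 proof -
  have hx: "act (A q) h x \<in> cocycles A d q" using Z.act_closed[OF h, of x] x by simp
  have *: "a_r_coset ?Z ?B (act (A q) h a) = \<kappa> q (act (A q) h x)" if a: "a \<in> \<kappa> q x" for a
  proof -
   have aZ: "a \<in> cocycles A d q"
    using a x BZ Zs by (auto simp: k a_r_coset_def' submodule_iff[OF AM])
   have "dif K (A q) a x \<in> ?B" using q(6)[of x a] a aZ x by (simp add: k)
   then have "act (A q) h (dif K (A q) a x) \<in> ?B" by (rule BactA[OF h])
   then have "dif K (A q) (act (A q) h a) (act (A q) h x) \<in> ?B"
    using Z.act_dif[OF h, of a x] aZ x by simp
   then have dB: "dif K ?Z (act (A q) h a) (act (A q) h x) \<in> ?B" by simp
   have ha: "act (A q) h a \<in> cocycles A d q" using Z.act_closed[OF h, of a] aZ by simp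
   have "\<kappa> q (dif K ?Z (act (A q) h a) (act (A q) h x)) = \<zero>\<^bsub>quot_space ?Z ?B\<^esub>"
    using q(4)[of "dif K ?Z (act (A q) h a) (act (A q) h x)"] dB BZ unfolding k by auto
   then have "dif K (quot_space ?Z ?B) (\<kappa> q (act (A q) h a)) (\<kappa> q (act (A q) h x)) = \<zero>\<^bsub>quot_space ?Z ?B\<^esub>"
    using lin_dif[OF q(2) Z.vector_space, of "act (A q) h a" "act (A q) h x"] ha hx unfolding k by simp
   then have "\<kappa> q (act (A q) h a) = \<kappa> q (act (A q) h x)"
    using dif_eq_zero_iff[OF q(1), of "\<kappa> q (act (A q) h a)" "\<kappa> q (act (A q) h x)"] ha hx lin_closed[OF q(2)]
    unfolding k by simp
   then show ?thesis using ha unfolding k by simp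
  qed
  \<comment> \<open>The coset has a member, so the union of equal sets over it is that set.\<close>
  have ne: "x \<in> \<kappa> q x"
   using q(6)[of x x] x dif_dif_zero[OF Z.vector_space, of x] B by (simp add: k submodule_iff[OF Z.vector_space])
  have "act ?HC h (\<kappa> q x) = (\<Union>a\<in>\<kappa> q x. a_r_coset ?Z ?B (act (A q) h a))"
   by (simp add: H)
  also have "\<dots> = (\<Union>a\<in>\<kappa> q x. \<kappa> q (act (A q) h x))" using * by simp
  also have "\<dots> = \<kappa> q (act (A q) h x)" using ne by auto
  finally show ?thesis by simp
 qed
 show s: "\<kappa> q ` cocycles A d q = car ?HC" using q(3) by (simp add: H k)
 have lin: "\<kappa> q \<in> lin_maps K ?Z ?HC" using q(2) by (simp add: H k lin_maps_def)
 show "Hmod ?HC"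
 proof (rule left_H_module_transport[OF Z _ _ _ _ _ hopf, of "\<kappa> q"])
  show "\<kappa> q ` car ?Z = car ?HC" using s by simp
  show "\<zero>\<^bsub>?HC\<^esub> = \<kappa> q \<zero>\<^bsub>?Z\<^esub>"
   using lin_zero[OF q(2) Z.vector_space q(1)] by (simp add: H k)
 qed (simp_all add: act[simplified] lin_add[OF lin, simplified] lin_smult[OF lin, simplified])
 show "\<kappa> q \<in> H_maps K H ?Z ?HC"
  by (rule H_mapsI[OF lin]) (simp add: act)
 show "\<kappa> q x = \<zero>\<^bsub>?HC\<^esub> \<longleftrightarrow> x \<in> coboundaries A d q" if "x \<in> cocycles A d q" for x
  using q(4)[OF that] that by (simp add: H k)
qed

theorem grothendieck:
 fixes A :: "nat => ('k, 'h, 'a) hmodule"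
 assumes A: "\<And>q. Hmod (A q)" and R: "\<And>q. rinj K H (A q)"
  and d: "\<And>q. d q \<in> H_maps K H (A q) (A (Suc q))"
  and dd: "\<And>q x. x \<in> car (A q) ==> d (Suc q) (d q x) = \<zero>\<^bsub>A (Suc (Suc q))\<^esub>"
  and res: "\<And>q. case chosen_H_resolution K H (H_cohomology A d q) of (J, dJ, e) =>
   injective_H_resolution K H (H_cohomology A d q) J dJ e \<and> (\<forall>n. rinj K H (J n))"
 shows "\<exists>E' d'. first_quadrant_spectral_sequence K E' d'
  \<and> (\<forall>p q. E' 2 (int p) (int q) = R_invariants K H p (H_cohomology A d q))
  \<and> converges_to K E' (\<lambda>n. cohomology (\<lambda>i. invariants H (A i)) d n)"
proof -
 note c = H_cohomology_module[where A = A and d = d, OF A d dd]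
 have "H_complex K H A d (H_cohomology A d)
   (\<lambda>q. \<lambda>x\<in>cocycles A d q. a_r_coset ((A q)\<lparr>carrier := cocycles A d q\<rparr>) (coboundaries A d q) x)"
  by (intro H_complex.intro H_complex_axioms.intro hopf A R d dd c)
 then interpret C: H_complex K H A d "H_cohomology A d"
   "\<lambda>q. \<lambda>x\<in>cocycles A d q. a_r_coset ((A q)\<lparr>carrier := cocycles A d q\<rparr>) (coboundaries A d q) x" .
 have E: "module K (R_invariants K H p (H_cohomology A d q))"
  and iso: "vs_iso K (T K H (H_cohomology A d q) p) (R_invariants K H p (H_cohomology A d q))" for p q
 proof -
  obtain J dJ e where J: "chosen_H_resolution K H (H_cohomology A d q) = (J, dJ, e)" by (metis prod_cases3)
  then have "injective_H_resolution K H (H_cohomology A d q) J dJ e" "\<And>n. rinj K H (J n)" using res[of q] by auto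
  from resolution_iso[OF c(1) this]
  show "module K (R_invariants K H p (H_cohomology A d q))"
   "vs_iso K (T K H (H_cohomology A d q) p) (R_invariants K H p (H_cohomology A d q))"
   by (simp_all add: R_invariants_def J)
 qed
 show ?thesis using C.spectral_sequence[OF E iso] .
qed

end

section \<open>Injective resolutions\<close>

definition cdom :: "('k, 'o, 'e, 'z) lincat_scheme => 'o => ('o \<times> 'e) set" where
 "cdom E Y = (SIGMA X:Ob E. car (Hom E X Y))"

definition cofree_set ::
 "'k ring => ('k, 'o, 'e, 'z) lincat_scheme => ('o => ('k, 'w) module) => 'o => ('o \<times> 'e => 'w) set" where
 "cofree_set K E W Y = {\<phi> \<in> extensional (cdom E Y). \<forall>X\<in>Ob E. \<forall>s\<in>car (Hom E X Y).
   \<phi> (X, s) \<in> car (W X) \<and>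
   (\<forall>t\<in>car (Hom E X Y). \<phi> (X, s \<oplus>\<^bsub>Hom E X Y\<^esub> t) = \<phi> (X, s) \<oplus>\<^bsub>W X\<^esub> \<phi> (X, t)) \<and>
   (\<forall>k\<in>car K. \<phi> (X, k \<odot>\<^bsub>Hom E X Y\<^esub> s) = k \<odot>\<^bsub>W X\<^esub> \<phi> (X, s))}"

text \<open>The elements of \<open>\<Prod>\<^sub>X Hom\<^sub>K(Hom(X, Y), W X)\<close> are encoded in a fixed type by an injection \<open>c\<close>.\<close>

definition cofree_obj ::
 "'k ring => ('k, 'o, 'e, 'z) lincat_scheme => (('o \<times> 'e => 'w) => 'u) => ('o => ('k, 'w) module)
  => 'o => ('k, 'u) module" where
 "cofree_obj K E c W Y =
   \<lparr>carrier = c ` cofree_set K E W Y, monoid.mult = undefined, one = undefined,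
   zero = c (\<lambda>p\<in>cdom E Y. \<zero>\<^bsub>W (fst p)\<^esub>),
   add = (\<lambda>x y. c (\<lambda>p\<in>cdom E Y. inv_into UNIV c x p \<oplus>\<^bsub>W (fst p)\<^esub> inv_into UNIV c y p)),
   smult = (\<lambda>k x. c (\<lambda>p\<in>cdom E Y. k \<odot>\<^bsub>W (fst p)\<^esub> inv_into UNIV c x p))\<rparr>"

definition cofree ::
 "'k ring => ('k, 'o, 'e, 'z) lincat_scheme => (('o \<times> 'e => 'w) => 'u) => ('o => ('k, 'w) module)
  => ('k, 'o, 'e, 'u) rmodule" where
 "cofree K E c W =
  \<lparr>Obj = cofree_obj K E c W,
   Mor = (\<lambda>Y' Y t x. c (\<lambda>p\<in>cdom E Y'. inv_into UNIV c x (fst p, Comp E (fst p) Y' Y t (snd p))))\<rparr>"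

text \<open>One direction of the adjunction: linear maps b X on the single objects give the module
  map y \<mapsto> (s \<mapsto> b (y s)), where y s is the result of the morphism s acting on
  y.\<close>

definition cofree_lift ::
 "'k ring => ('k, 'o, 'e, 'z) lincat_scheme => (('o \<times> 'e => 'w) => 'u) => ('k, 'o, 'e, 'b) rmodule
  => ('o => 'b => 'w) => 'o => 'b => 'u" where
 "cofree_lift K E c B b = (\<lambda>Y\<in>Ob E. \<lambda>y\<in>car (Obj B Y).
   c (\<lambda>p\<in>cdom E Y. b (fst p) (Mor B (fst p) Y (snd p) y)))"

lemma cofree_Obj [simp]: "Obj (cofree K E c W) = cofree_obj K E c W"
 by (simp add: cofree_def)

lemma nat_mapsI:
 assumes "\<And>X. X \<in> Ob E ==> \<eta> X \<in> lin_maps K (Obj M X) (Obj N X)"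
  and "\<And>X. X \<notin> Ob E ==> \<eta> X = undefined"
  and "\<And>X Y f m. X \<in> Ob E ==> Y \<in> Ob E ==> f \<in> car (Hom E X Y) ==> m \<in> car (Obj M Y)
   ==> \<eta> X (Mor M X Y f m) = Mor N X Y f (\<eta> Y m)"
 shows "\<eta> \<in> nat_maps K E M N"
 using assms by (auto simp: nat_maps_def PiE_def extensional_def)

lemma nat_maps_lin: "\<eta> \<in> nat_maps K E M N ==> X \<in> Ob E ==> \<eta> X \<in> lin_maps K (Obj M X) (Obj N X)"
 by (auto simp: nat_maps_def)

lemma nat_maps_undef: "\<eta> \<in> nat_maps K E M N ==> X \<notin> Ob E ==> \<eta> X = undefined"
 by (auto simp: nat_maps_def PiE_def extensional_def)

lemma nat_maps_natural: "\<eta> \<in> nat_maps K E M N ==> X \<in> Ob E ==> Y \<in> Ob E ==> f \<in> car (Hom E X Y)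
  ==> m \<in> car (Obj M Y) ==> \<eta> X (Mor M X Y f m) = Mor N X Y f (\<eta> Y m)"
 by (auto simp: nat_maps_def)

lemma nat_maps_closed: "\<eta> \<in> nat_maps K E M N ==> X \<in> Ob E ==> m \<in> car (Obj M X) ==> \<eta> X m \<in> car (Obj N X)"
 by (rule lin_closed[OF nat_maps_lin])

lemma nat_maps_compose:
 assumes M: "right_module K E M" and \<eta>: "\<eta> \<in> nat_maps K E M N" and \<theta>: "\<theta> \<in> nat_maps K E N P"
 shows "(\<lambda>X\<in>Ob E. \<lambda>m\<in>car (Obj M X). \<theta> X (\<eta> X m)) \<in> nat_maps K E M P"
proof -
 interpret M: right_module K E M by fact
 show ?thesis
  by (rule nat_mapsI)
   (simp_all add: lin_compose[OF M.obj_space nat_maps_lin[OF \<eta>] nat_maps_lin[OF \<theta>]] M.mor_closed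
    nat_maps_natural[OF \<eta>] nat_maps_natural[OF \<theta>] nat_maps_closed[OF \<eta>])
qed

lemma (in right_module) mor_lin: "X \<in> Ob E ==> Y \<in> Ob E ==> f \<in> car (Hom E X Y) ==>
  (\<lambda>m\<in>car (Obj M Y). Mor M X Y f m) \<in> lin_maps K (Obj M Y) (Obj M X)"
 by (rule lin_restrictI) (simp_all add: obj_space mor_closed mor_add mor_smult)

lemma (in right_module) mor_dif: "X \<in> Ob E ==> Y \<in> Ob E ==> f \<in> car (Hom E X Y) ==>
  m \<in> car (Obj M Y) ==> m' \<in> car (Obj M Y) ==>
  Mor M X Y f (dif K (Obj M Y) m m') = dif K (Obj M X) (Mor M X Y f m) (Mor M X Y f m')"
 using lin_dif[OF mor_lin obj_space, of X Y f m m'] dif_closed[OF obj_space, of Y m m'] by simp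

locale cofree_data = linear_category K E
 for K :: "'k ring" and E :: "('k, 'o, 'e, 'z) lincat_scheme" +
 fixes c :: "('o \<times> 'e => 'w) => 'u" and W :: "'o => ('k, 'w) module"
 assumes c: "inj c" and W: "\<And>X. X \<in> Ob E ==> module K (W X)"
begin

abbreviation "CO \<equiv> cofree_obj K E c W"
abbreviation "CF \<equiv> cofree K E c W"

lemma dec [simp]: "inv_into UNIV c (c \<phi>) = \<phi>" using c by simp
lemma c_eq [simp]: "c \<phi> = c \<psi> \<longleftrightarrow> \<phi> = \<psi>" using c by (auto simp: inj_def)

lemma cofree_obj_simps [simp]:
 "car (CO Y) = c ` cofree_set K E W Y"
 "zero (CO Y) = c (\<lambda>p\<in>cdom E Y. \<zero>\<^bsub>W (fst p)\<^esub>)"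
 "c \<phi> \<oplus>\<^bsub>CO Y\<^esub> c \<psi> = c (\<lambda>p\<in>cdom E Y. \<phi> p \<oplus>\<^bsub>W (fst p)\<^esub> \<psi> p)"
 "k \<odot>\<^bsub>CO Y\<^esub> c \<phi> = c (\<lambda>p\<in>cdom E Y. k \<odot>\<^bsub>W (fst p)\<^esub> \<phi> p)"
 by (simp_all add: cofree_obj_def)

lemma cofree_Mor [simp]:
 "Mor CF Y' Y t (c \<phi>) = c (\<lambda>p\<in>cdom E Y'. \<phi> (fst p, Comp E (fst p) Y' Y t (snd p)))"
 by (simp add: cofree_def)

lemma cdom_iff [simp]: "(X, s) \<in> cdom E Y \<longleftrightarrow> X \<in> Ob E \<and> s \<in> car (Hom E X Y)"
 by (simp add: cdom_def)

lemma cdomE: assumes "p \<in> cdom E Y" obtains X s where "p = (X, s)" "X \<in> Ob E" "s \<in> car (Hom E X Y)"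
 using assms by (auto simp: cdom_def)

lemma cofree_setI:
 assumes "\<And>X s. X \<in> Ob E ==> s \<in> car (Hom E X Y) ==> \<phi> (X, s) \<in> car (W X)"
  and "\<And>X s t. X \<in> Ob E ==> s \<in> car (Hom E X Y) ==> t \<in> car (Hom E X Y)
   ==> \<phi> (X, s \<oplus>\<^bsub>Hom E X Y\<^esub> t) = \<phi> (X, s) \<oplus>\<^bsub>W X\<^esub> \<phi> (X, t)"
  and "\<And>X s k. X \<in> Ob E ==> s \<in> car (Hom E X Y) ==> k \<in> car K
   ==> \<phi> (X, k \<odot>\<^bsub>Hom E X Y\<^esub> s) = k \<odot>\<^bsub>W X\<^esub> \<phi> (X, s)"
  and Y: "Y \<in> Ob E"
 shows "restrict \<phi> (cdom E Y) \<in> cofree_set K E W Y"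
proof -
 have "s \<oplus>\<^bsub>Hom E X Y\<^esub> t \<in> car (Hom E X Y)"
  if "X \<in> Ob E" "s \<in> car (Hom E X Y)" "t \<in> car (Hom E X Y)" for X s t
  using submodule_carrier[OF hom_space[OF that(1) Y]] that(2,3) unfolding submodule_iff[OF hom_space[OF that(1) Y]] by blast
 moreover have "k \<odot>\<^bsub>Hom E X Y\<^esub> s \<in> car (Hom E X Y)"
  if "X \<in> Ob E" "s \<in> car (Hom E X Y)" "k \<in> car K" for X s k
  using submodule_carrier[OF hom_space[OF that(1) Y]] that(2,3) unfolding submodule_iff[OF hom_space[OF that(1) Y]] by blast
 ultimately show ?thesis using assms by (auto simp: cofree_set_def)
qed

lemma cofree_setD:
 assumes "\<phi> \<in> cofree_set K E W Y"
 shows "\<And>X s. X \<in> Ob E ==> s \<in> car (Hom E X Y) ==> \<phi> (X, s) \<in> car (W X)"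
  and "\<And>X s t. X \<in> Ob E ==> s \<in> car (Hom E X Y) ==> t \<in> car (Hom E X Y)
   ==> \<phi> (X, s \<oplus>\<^bsub>Hom E X Y\<^esub> t) = \<phi> (X, s) \<oplus>\<^bsub>W X\<^esub> \<phi> (X, t)"
  and "\<And>X s k. X \<in> Ob E ==> s \<in> car (Hom E X Y) ==> k \<in> car K
   ==> \<phi> (X, k \<odot>\<^bsub>Hom E X Y\<^esub> s) = k \<odot>\<^bsub>W X\<^esub> \<phi> (X, s)"
  and "restrict \<phi> (cdom E Y) = \<phi>"
 using assms by (auto simp: cofree_set_def extensional_restrict)

lemma cofree_eqI:
 assumes "\<phi> \<in> cofree_set K E W Y" "\<psi> \<in> cofree_set K E W Y"
  and "\<And>X s. X \<in> Ob E ==> s \<in> car (Hom E X Y) ==> \<phi> (X, s) = \<psi> (X, s)"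
 shows "\<phi> = \<psi>"
 by (rule extensionalityI[of _ "cdom E Y"]) (use assms in \<open>auto simp: cofree_set_def cdom_def\<close>)

lemma cofree_plus:
 assumes \<phi>: "\<phi> \<in> cofree_set K E W Y" and \<psi>: "\<psi> \<in> cofree_set K E W Y" and Y: "Y \<in> Ob E"
 shows "(\<lambda>p\<in>cdom E Y. \<phi> p \<oplus>\<^bsub>W (fst p)\<^esub> \<psi> p) \<in> cofree_set K E W Y"
proof (rule cofree_setI[OF _ _ _ Y])
 fix X s assume X: "X \<in> Ob E" and s: "s \<in> car (Hom E X Y)"
 interpret W: module K "W X" by (rule W[OF X])
 note D = cofree_setD[OF \<phi>] cofree_setD[OF \<psi>]
 show "\<phi> (X, s) \<oplus>\<^bsub>W (fst (X, s))\<^esub> \<psi> (X, s) \<in> car (W X)" using X s D by simp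
 show "\<phi> (X, s \<oplus>\<^bsub>Hom E X Y\<^esub> t) \<oplus>\<^bsub>W (fst (X, s \<oplus>\<^bsub>Hom E X Y\<^esub> t))\<^esub> \<psi> (X, s \<oplus>\<^bsub>Hom E X Y\<^esub> t) =
  \<phi> (X, s) \<oplus>\<^bsub>W (fst (X, s))\<^esub> \<psi> (X, s) \<oplus>\<^bsub>W X\<^esub> (\<phi> (X, t) \<oplus>\<^bsub>W (fst (X, t))\<^esub> \<psi> (X, t))"
  if "t \<in> car (Hom E X Y)" for t
  using X s that D by (simp add: W.a_ac)
 show "\<phi> (X, k \<odot>\<^bsub>Hom E X Y\<^esub> s) \<oplus>\<^bsub>W (fst (X, k \<odot>\<^bsub>Hom E X Y\<^esub> s))\<^esub> \<psi> (X, k \<odot>\<^bsub>Hom E X Y\<^esub> s) =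
  k \<odot>\<^bsub>W X\<^esub> (\<phi> (X, s) \<oplus>\<^bsub>W (fst (X, s))\<^esub> \<psi> (X, s))" if "k \<in> car K" for k
  using X s that D by (simp add: W.smult_r_distr)
qed

lemma cofree_scale:
 assumes \<phi>: "\<phi> \<in> cofree_set K E W Y" and k: "k \<in> car K" and Y: "Y \<in> Ob E"
 shows "(\<lambda>p\<in>cdom E Y. k \<odot>\<^bsub>W (fst p)\<^esub> \<phi> p) \<in> cofree_set K E W Y"
proof (rule cofree_setI[OF _ _ _ Y])
 fix X s assume X: "X \<in> Ob E" and s: "s \<in> car (Hom E X Y)"
 interpret W: module K "W X" by (rule W[OF X])
 note D = cofree_setD[OF \<phi>]
 show "k \<odot>\<^bsub>W (fst (X, s))\<^esub> \<phi> (X, s) \<in> car (W X)" using X s k D by simp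
 show "k \<odot>\<^bsub>W (fst (X, s \<oplus>\<^bsub>Hom E X Y\<^esub> t))\<^esub> \<phi> (X, s \<oplus>\<^bsub>Hom E X Y\<^esub> t) =
  k \<odot>\<^bsub>W (fst (X, s))\<^esub> \<phi> (X, s) \<oplus>\<^bsub>W X\<^esub> k \<odot>\<^bsub>W (fst (X, t))\<^esub> \<phi> (X, t)"
  if "t \<in> car (Hom E X Y)" for t
  using X s that k D by (simp add: W.smult_r_distr)
 show "k \<odot>\<^bsub>W (fst (X, l \<odot>\<^bsub>Hom E X Y\<^esub> s))\<^esub> \<phi> (X, l \<odot>\<^bsub>Hom E X Y\<^esub> s) =
  l \<odot>\<^bsub>W X\<^esub> (k \<odot>\<^bsub>W (fst (X, s))\<^esub> \<phi> (X, s))" if "l \<in> car K" for l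
  using X s that k D by (simp add: W.smult_assoc1[symmetric] W.R.m_comm)
qed

lemma cofree_zero: assumes Y: "Y \<in> Ob E" shows "(\<lambda>p\<in>cdom E Y. \<zero>\<^bsub>W (fst p)\<^esub>) \<in> cofree_set K E W Y"
proof (rule cofree_setI[OF _ _ _ Y])
 fix X s assume X: "X \<in> Ob E"
 interpret W: module K "W X" by (rule W[OF X])
 show "\<zero>\<^bsub>W (fst (X, s))\<^esub> \<in> car (W X)"
  "\<zero>\<^bsub>W (fst (X, s \<oplus>\<^bsub>Hom E X Y\<^esub> t))\<^esub> = \<zero>\<^bsub>W (fst (X, s))\<^esub> \<oplus>\<^bsub>W X\<^esub> \<zero>\<^bsub>W (fst (X, t))\<^esub>" for t
  by simp_all
 show "\<zero>\<^bsub>W (fst (X, k \<odot>\<^bsub>Hom E X Y\<^esub> s))\<^esub> = k \<odot>\<^bsub>W X\<^esub> \<zero>\<^bsub>W (fst (X, s))\<^esub>" if "k \<in> car K" for k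
  using that by simp
qed

lemma cofree_obj_module: assumes Y: "Y \<in> Ob E" and K: "cring K" shows "module K (CO Y)"
 by (rule pointwise_module[where D="cdom E Y" and W="\<lambda>p. W (fst p)" and ev="inv_into UNIV c"])
  (use cofree_eqI[of _ Y] in \<open>auto simp: K W cofree_plus cofree_scale cofree_zero Y cofree_setD(1) elim!: cdomE\<close>)

lemma cofree_Mor_closed:
 assumes Y': "Y' \<in> Ob E" and Y: "Y \<in> Ob E" and t: "t \<in> car (Hom E Y' Y)" and \<phi>: "\<phi> \<in> cofree_set K E W Y"
 shows "(\<lambda>p\<in>cdom E Y'. \<phi> (fst p, Comp E (fst p) Y' Y t (snd p))) \<in> cofree_set K E W Y'"
 by (rule cofree_setI) (use assms in \<open>simp_all add: cofree_setD[OF \<phi>] comp_closed comp_add_right comp_smult_right\<close>)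

lemma cofree_module: assumes K: "cring K" shows "right_module K E CF"
proof (rule right_module.intro)
 show "module K (Obj CF Y)" if "Y \<in> Ob E" for Y
  using cofree_obj_module[OF that K] by simp
 fix Y' Y t x assume Y': "Y' \<in> Ob E" and Y: "Y \<in> Ob E" and t: "t \<in> car (Hom E Y' Y)"
  and "x \<in> car (Obj CF Y)"
 then obtain \<phi> where x: "\<phi> \<in> cofree_set K E W Y" "x = c \<phi>" by auto
 have p: "fst p \<in> Ob E" "Comp E (fst p) Y' Y t (snd p) \<in> car (Hom E (fst p) Y)" if "p \<in> cdom E Y'" for p
  using that Y Y' t by (auto simp: cdom_def comp_closed)
 show "Mor CF Y' Y t x \<in> car (Obj CF Y')"
  using x cofree_Mor_closed[OF Y' Y t] by simp
 { fix k assume "k \<in> car K"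
  then show "Mor CF Y' Y t (k \<odot>\<^bsub>Obj CF Y\<^esub> x) = k \<odot>\<^bsub>Obj CF Y'\<^esub> Mor CF Y' Y t x"
   using x p by (auto intro!: restrict_ext)
  then show "Mor CF Y' Y (k \<odot>\<^bsub>Hom E Y' Y\<^esub> t) x = k \<odot>\<^bsub>Obj CF Y'\<^esub> Mor CF Y' Y t x"
   using x p t Y Y' \<open>k \<in> car K\<close> by (auto intro!: restrict_ext simp: cdom_def comp_smult_left cofree_setD[OF x(1)]) }
 { fix y assume "y \<in> car (Obj CF Y)"
  then obtain \<psi> where y: "\<psi> \<in> cofree_set K E W Y" "y = c \<psi>" by auto
  show "Mor CF Y' Y t (x \<oplus>\<^bsub>Obj CF Y\<^esub> y)
    = Mor CF Y' Y t x \<oplus>\<^bsub>Obj CF Y'\<^esub> Mor CF Y' Y t y"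
   using x y p by (auto intro!: restrict_ext) }
 { fix u assume "u \<in> car (Hom E Y' Y)"
  then show "Mor CF Y' Y (t \<oplus>\<^bsub>Hom E Y' Y\<^esub> u) x
    = Mor CF Y' Y t x \<oplus>\<^bsub>Obj CF Y'\<^esub> Mor CF Y' Y u x"
   using x p t Y Y' by (auto intro!: restrict_ext simp: cdom_def comp_add_left comp_closed cofree_setD[OF x(1)]) }
next
 fix Y x assume Y: "Y \<in> Ob E" and "x \<in> car (Obj CF Y)"
 then obtain \<phi> where x: "\<phi> \<in> cofree_set K E W Y" "x = c \<phi>" by auto
 have "(\<lambda>p\<in>cdom E Y. \<phi> (fst p, Comp E (fst p) Y Y (Ident E Y) (snd p))) = restrict \<phi> (cdom E Y)"
  using Y by (intro restrict_ext) (auto simp: cdom_def ident_left)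
 then show "Mor CF Y Y (Ident E Y) x = x" using x by (simp add: cofree_setD(4))
next
 fix X Y Z f g x
 assume X: "X \<in> Ob E" and Y: "Y \<in> Ob E" and Z: "Z \<in> Ob E" and f: "f \<in> car (Hom E Y Z)"
  and g: "g \<in> car (Hom E X Y)" and "x \<in> car (Obj CF Z)"
 then obtain \<phi> where x: "\<phi> \<in> cofree_set K E W Z" "x = c \<phi>" by auto
 show "Mor CF X Z (Comp E X Y Z f g) x = Mor CF X Y g (Mor CF Y Z f x)"
  using x X Y Z f g by (auto intro!: restrict_ext simp: cdom_def comp_assoc comp_closed)
qed

lemma cofree_lift:
 assumes K: "cring K" and B: "right_module K E B" and b: "\<And>X. X \<in> Ob E ==> b X \<in> lin_maps K (Obj B X) (W X)"
 shows "cofree_lift K E c B b \<in> nat_maps K E B CF"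
proof -
 interpret B: right_module K E B by fact
 have set: "(\<lambda>p\<in>cdom E Y. b (fst p) (Mor B (fst p) Y (snd p) y)) \<in> cofree_set K E W Y"
  if "Y \<in> Ob E" "y \<in> car (Obj B Y)" for Y y
  by (rule cofree_setI) (use that in \<open>simp_all add: lin_closed[OF b] lin_add[OF b] lin_smult[OF b]
    B.mor_closed B.functor_add B.functor_smult\<close>)
 show ?thesis
 proof (rule nat_mapsI)
  fix Y assume Y: "Y \<in> Ob E"
  show "cofree_lift K E c B b Y \<in> lin_maps K (Obj B Y) (Obj CF Y)"
   unfolding cofree_lift_def using Y
   by (simp, intro lin_restrictI[OF B.obj_space[OF Y]])
    (auto simp: set[unfolded cdom_def] cdom_def B.mor_add B.mor_smult B.mor_closed lin_add[OF b] lin_smult[OF b] intro!: restrict_ext)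
 next
  show "cofree_lift K E c B b Y = undefined" if "Y \<notin> Ob E" for Y using that by (simp add: cofree_lift_def)
 next
  fix X Y f m assume X: "X \<in> Ob E" and Y: "Y \<in> Ob E" and f: "f \<in> car (Hom E X Y)" and m: "m \<in> car (Obj B Y)"
  show "cofree_lift K E c B b X (Mor B X Y f m) = Mor CF X Y f (cofree_lift K E c B b Y m)"
   using X Y f m by (auto simp: cofree_lift_def B.mor_closed cdom_def comp_closed B.functor_comp intro!: restrict_ext)
 qed
qed

text \<open>The other direction of the adjunction: by naturality the component of g y at s is the
  component of g (y s) at the identity.\<close>

lemma cofree_nat_map:
 assumes K: "cring K" and B: "right_module K E B" and g: "g \<in> nat_maps K E B CF"
  and Y: "Y \<in> Ob E" and y: "y \<in> car (Obj B Y)"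
 shows "g Y y = c (\<lambda>p\<in>cdom E Y. inv_into UNIV c (g (fst p) (Mor B (fst p) Y (snd p) y)) (fst p, Ident E (fst p)))"
proof -
 interpret B: right_module K E B by fact
 obtain \<phi> where x: "\<phi> \<in> cofree_set K E W Y" "g Y y = c \<phi>" using nat_maps_closed[OF g Y y] by auto
 have "inv_into UNIV c (g X (Mor B X Y s y)) (X, Ident E X) = \<phi> (X, s)" if "X \<in> Ob E" "s \<in> car (Hom E X Y)" for X s
  using nat_maps_natural[OF g that(1) Y that(2) y] x(2) that Y by (simp add: ident_closed ident_right)
 then have "(\<lambda>p\<in>cdom E Y. inv_into UNIV c (g (fst p) (Mor B (fst p) Y (snd p) y)) (fst p, Ident E (fst p))) = restrict \<phi> (cdom E Y)"
  by (intro restrict_ext) (auto simp: cdom_def)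
 then show ?thesis using x by (simp add: cofree_setD(4))
qed

text \<open>Through the adjunction the extension problem splits into one problem for linear maps at
  each object, where a linear left inverse of the injection solves it. The modules A and B may live
  in any types.\<close>

lemma cofree_extend:
 fixes A :: "('k, 'o, 'e, 'a) rmodule" and B :: "('k, 'o, 'e, 'b) rmodule"
 assumes K: "field K" and A: "right_module K E A" and B: "right_module K E B"
  and i: "i \<in> nat_maps K E A B" and inj: "\<And>X. X \<in> Ob E ==> inj_on (i X) (car (Obj A X))"
  and g: "g \<in> nat_maps K E A CF"
 shows "\<exists>g'\<in>nat_maps K E B CF. \<forall>X\<in>Ob E. \<forall>a\<in>car (Obj A X). g' X (i X a) = g X a"
proof -
 interpret KF: field K by fact
 have Kc: "cring K" by (rule KF.is_cring)
 interpret A: right_module K E A by fact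
 interpret B: right_module K E B by fact
 define b0 where "b0 X = (\<lambda>x\<in>car (Obj A X). inv_into UNIV c (g X x) (X, Ident E X))" for X
 have b0: "b0 X \<in> lin_maps K (Obj A X) (W X)" if X: "X \<in> Ob E" for X
  unfolding b0_def
 proof (rule lin_restrictI[OF A.obj_space[OF X]])
  fix x assume x: "x \<in> car (Obj A X)"
  obtain \<phi> where \<phi>: "\<phi> \<in> cofree_set K E W X" "g X x = c \<phi>" using nat_maps_closed[OF g X x] by auto
  show "inv_into UNIV c (g X x) (X, Ident E X) \<in> car (W X)"
   using \<phi> X by (simp add: cofree_setD[OF \<phi>(1)] ident_closed)
  { fix y assume y: "y \<in> car (Obj A X)"
   obtain \<psi> where \<psi>: "\<psi> \<in> cofree_set K E W X" "g X y = c \<psi>" using nat_maps_closed[OF g X y] by auto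
   show "inv_into UNIV c (g X (x \<oplus>\<^bsub>Obj A X\<^esub> y)) (X, Ident E X) = inv_into UNIV c (g X x) (X, Ident E X) \<oplus>\<^bsub>W X\<^esub> inv_into UNIV c (g X y) (X, Ident E X)"
    using \<phi> \<psi> X x y by (simp add: lin_add[OF nat_maps_lin[OF g X]] ident_closed) }
  { fix k assume k: "k \<in> car K"
   show "inv_into UNIV c (g X (k \<odot>\<^bsub>Obj A X\<^esub> x)) (X, Ident E X) = k \<odot>\<^bsub>W X\<^esub> inv_into UNIV c (g X x) (X, Ident E X)"
    using \<phi> X x k by (simp add: lin_smult[OF nat_maps_lin[OF g X]] ident_closed) }
 qed
 have "\<exists>s\<in>lin_maps K (Obj B X) (Obj A X). \<forall>x\<in>car (Obj A X). i X (s (i X x)) = i X x" if X: "X \<in> Ob E" for X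
  by (rule lin_pseudo_inverse[OF K A.obj_space[OF X] B.obj_space[OF X] nat_maps_lin[OF i X]])
 then obtain s where s: "\<And>X. X \<in> Ob E ==> s X \<in> lin_maps K (Obj B X) (Obj A X)"
  "\<And>X x. X \<in> Ob E ==> x \<in> car (Obj A X) ==> i X (s X (i X x)) = i X x" by metis
 \<comment> \<open>Since i X is injective, its pseudo-inverse is a left inverse.\<close>
 have si: "s X (i X x) = x" if "X \<in> Ob E" "x \<in> car (Obj A X)" for X x
  using s(2)[OF that] inj[OF that(1)] that lin_closed[OF s(1)[OF that(1)]] nat_maps_closed[OF i that]
  by (auto dest: inj_onD)
 define b where "b X = (\<lambda>x\<in>car (Obj B X). b0 X (s X x))" for X
 have b: "b X \<in> lin_maps K (Obj B X) (W X)" if "X \<in> Ob E" for X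
  unfolding b_def by (rule lin_compose[OF B.obj_space[OF that] s(1)[OF that] b0[OF that]])
 have "cofree_lift K E c B b X (i X a) = g X a" if X: "X \<in> Ob E" and a: "a \<in> car (Obj A X)" for X a
 proof -
  have "b Z (Mor B Z X t (i X a)) = inv_into UNIV c (g Z (Mor A Z X t a)) (Z, Ident E Z)"
   if Z: "Z \<in> Ob E" and t: "t \<in> car (Hom E Z X)" for Z t
  proof -
   have m: "Mor A Z X t a \<in> car (Obj A Z)" by (rule A.mor_closed[OF Z X t a])
   have "Mor B Z X t (i X a) = i Z (Mor A Z X t a)" using nat_maps_natural[OF i Z X t a] by simp
   then show ?thesis using si[OF Z m] m nat_maps_closed[OF i Z m] by (simp add: b_def b0_def)
  qed
  then show ?thesis
   unfolding cofree_nat_map[OF Kc A g X a] using X a nat_maps_closed[OF i X a]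
   by (auto simp: cofree_lift_def cdom_def intro!: restrict_ext)
 qed
 then show ?thesis using cofree_lift[OF Kc B b] by blast
qed

end

definition cofree_unit where
 "cofree_unit K E c N = cofree_lift K E c N (\<lambda>X. \<lambda>x\<in>car (Obj N X). x)"

text \<open>The component at the identity recovers x from its image, whence injectivity.\<close>

lemma cofree_unit:
 assumes K: "field K" and E: "linear_category K E" and N: "right_module K E N" and c: "inj c"
 shows "cofree_unit K E c N \<in> nat_maps K E N (cofree K E c (Obj N))"
  and "X \<in> Ob E ==> inj_on (cofree_unit K E c N X) (car (Obj N X))"
  and "right_module K E (cofree K E c (Obj N))"
proof -
 interpret KF: field K by fact
 interpret N: right_module K E N by fact
 interpret C: cofree_data K E c "Obj N"
  using E c N.obj_space by (intro cofree_data.intro cofree_data_axioms.intro) auto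
 show "cofree_unit K E c N \<in> nat_maps K E N (cofree K E c (Obj N))"
  unfolding cofree_unit_def by (rule C.cofree_lift[OF KF.is_cring N lin_id[OF N.obj_space]])
 show "right_module K E (cofree K E c (Obj N))" by (rule C.cofree_module[OF KF.is_cring])
 show "inj_on (cofree_unit K E c N X) (car (Obj N X))" if X: "X \<in> Ob E"
 proof (rule inj_onI)
  fix x y assume xy: "x \<in> car (Obj N X)" "y \<in> car (Obj N X)" "cofree_unit K E c N X x = cofree_unit K E c N X y"
  then have "(\<lambda>p\<in>cdom E X. (\<lambda>X. \<lambda>x\<in>car (Obj N X). x) (fst p) (Mor N (fst p) X (snd p) x)) (X, Ident E X)
   = (\<lambda>p\<in>cdom E X. (\<lambda>X. \<lambda>x\<in>car (Obj N X). x) (fst p) (Mor N (fst p) X (snd p) y)) (X, Ident E X)"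
   using X by (simp add: cofree_unit_def cofree_lift_def)
  then show "x = y" using X xy by (simp add: C.ident_closed N.functor_ident)
 qed
qed

lemma cofree_injective:
 fixes N :: "('k, 'o, 'e, 'w) rmodule" and c :: "('o \<times> 'e => 'w) => 'u"
 assumes K: "field K" and E: "linear_category K E" and N: "right_module K E N" and c: "inj c"
 shows "injective_module K E (cofree K E c (Obj N))"
proof -
 interpret N: right_module K E N by fact
 interpret C: cofree_data K E c "Obj N"
  using E c N.obj_space by (intro cofree_data.intro cofree_data_axioms.intro) auto
 show ?thesis
  unfolding injective_module_def using cofree_unit(3)[OF assms] C.cofree_extend[OF K] by blast
qed

text \<open>The unit embeds I into a cofree module. The injection c encodes that module in the type
  of I, the type in which \<open>injective_module\<close> poses its extension problems, so the
  identity of I extends along the unit.\<close>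

lemma injective_retract:
 fixes I :: "('k, 'o, 'e, 'u) rmodule" and c :: "('o \<times> 'e => 'u) => 'u"
 assumes K: "field K" and E: "linear_category K E" and I: "injective_module K E I" and c: "inj c"
 obtains r where "r \<in> nat_maps K E (cofree K E c (Obj I)) I"
  "\<And>X x. X \<in> Ob E ==> x \<in> car (Obj I X) ==> r X (cofree_unit K E c I X x) = x"
proof -
 have Im: "right_module K E I" using I by (simp add: injective_module_def)
 interpret I: right_module K E I by fact
 note u = cofree_unit[OF K E Im c]
 let ?id = "\<lambda>X\<in>Ob E. \<lambda>x\<in>car (Obj I X). x"
 have id: "?id \<in> nat_maps K E I I"
  by (rule nat_mapsI) (simp_all add: lin_id I.obj_space I.mor_closed)
 have "\<exists>r\<in>nat_maps K E (cofree K E c (Obj I)) I. \<forall>X\<in>Ob E. \<forall>a\<in>car (Obj I X). r X (cofree_unit K E c I X a) = ?id X a"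
  using I u id Im unfolding injective_module_def by blast
 with that show ?thesis by auto
qed

section \<open>Quotient modules and the construction of resolutions\<close>

definition quot_rmodule ::
 "'k ring => ('k, 'o, 'e, 'u) rmodule => ('o => 'u set) => ('k, 'o, 'e, 'u) rmodule" where
 "quot_rmodule K P S = \<lparr>Obj = (\<lambda>X. qspace K (Obj P X) (S X)),
   Mor = (\<lambda>X Y f m. prj K (Obj P X) (S X) (Mor P X Y f m))\<rparr>"

lemma quot_rmodule:
 assumes K: "field K" and P: "right_module K E P"
  and S: "\<And>X. X \<in> Ob E ==> submodule (S X) K (Obj P X)"
  and Mor: "\<And>X Y f m. X \<in> Ob E ==> Y \<in> Ob E ==> f \<in> car (Hom E X Y) ==> m \<in> S Y ==> Mor P X Y f m \<in> S X"
  and E: "linear_category K E"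
 shows "right_module K E (quot_rmodule K P S)"
  and "(\<lambda>X\<in>Ob E. prj K (Obj P X) (S X)) \<in> nat_maps K E P (quot_rmodule K P S)"
proof -
 interpret P: right_module K E P by fact
 interpret E: linear_category K E by fact
 note p = prj_lin[OF K P.obj_space S] and pe = prj_endo[OF K P.obj_space S]
 let ?p = "\<lambda>X. prj K (Obj P X) (S X)"
 have pc: "?p X m \<in> car (Obj P X)" if "X \<in> Ob E" "m \<in> car (Obj P X)" for X m
  using that lin_closed[OF pe] by blast
 have sub: "m \<in> car (Obj P X)" if "X \<in> Ob E" "m \<in> car (qspace K (Obj P X) (S X))" for X m
  using that qspace_subset[OF K P.obj_space S, of X] by blast
 have pq: "?p X m = m" if "X \<in> Ob E" "m \<in> car (qspace K (Obj P X) (S X))" for X m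
  using that qspace_carrier[OF K P.obj_space S, of X] prj_idem[OF K P.obj_space S, of X] by auto
 \<comment> \<open>The projection changes m by an element of S Y, which f carries into S X, where
   the outer projection kills it. This gives functoriality of the projected action.\<close>
 have key: "?p X (Mor P X Y f (?p Y m)) = ?p X (Mor P X Y f m)"
  if X: "X \<in> Ob E" and Y: "Y \<in> Ob E" and f: "f \<in> car (Hom E X Y)" and m: "m \<in> car (Obj P Y)" for X Y f m
 proof -
  let ?a = "Mor P X Y f m" and ?b = "Mor P X Y f (?p Y m)"
  have c: "?a \<in> car (Obj P X)" "?b \<in> car (Obj P X)" using that pc P.mor_closed by auto
  have "Mor P X Y f (dif K (Obj P Y) m (?p Y m)) \<in> S X"
   by (rule Mor[OF X Y f prj_dif[OF K P.obj_space[OF Y] S[OF Y] m]])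
  then have "dif K (Obj P X) ?a ?b \<in> S X" using P.mor_dif[OF X Y f m pc[OF Y m]] by simp
  then have "?p X (dif K (Obj P X) ?a ?b) = \<zero>\<^bsub>Obj P X\<^esub>"
   using prj_eq_zero[OF K P.obj_space[OF X] S[OF X] dif_closed[OF P.obj_space[OF X] c]] by simp
  then show ?thesis
   using lin_dif[OF pe[OF X X] P.obj_space[OF X] c] dif_eq_zero_iff[OF P.obj_space[OF X] pc[OF X c(1)] pc[OF X c(2)]] by simp
 qed
 show "right_module K E (quot_rmodule K P S)"
 proof (rule right_module.intro)
  show "module K (Obj (quot_rmodule K P S) X)" if "X \<in> Ob E" for X
   using qspace_module[OF K P.obj_space[OF that] S[OF that]] by (simp add: quot_rmodule_def)
  fix X Y f m assume X: "X \<in> Ob E" and Y: "Y \<in> Ob E" and f: "f \<in> car (Hom E X Y)"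
   and m: "m \<in> car (Obj (quot_rmodule K P S) Y)"
  then have m': "m \<in> car (Obj P Y)" using sub by (simp add: quot_rmodule_def)
  note pl = lin_closed[OF p[OF X X]] lin_add[OF pe[OF X X]] lin_smult[OF pe[OF X X]]
  show "Mor (quot_rmodule K P S) X Y f m \<in> car (Obj (quot_rmodule K P S) X)"
   using pl P.mor_closed[OF X Y f m'] by (simp add: quot_rmodule_def)
  { fix n assume "n \<in> car (Obj (quot_rmodule K P S) Y)"
   then have "n \<in> car (Obj P Y)" using sub Y by (simp add: quot_rmodule_def)
   then show "Mor (quot_rmodule K P S) X Y f (m \<oplus>\<^bsub>Obj (quot_rmodule K P S) Y\<^esub> n)
     = Mor (quot_rmodule K P S) X Y f m \<oplus>\<^bsub>Obj (quot_rmodule K P S) X\<^esub> Mor (quot_rmodule K P S) X Y f n"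
    using m' X Y f by (simp add: quot_rmodule_def P.mor_add P.mor_closed pl) }
  { fix k assume "k \<in> car K"
   then show "Mor (quot_rmodule K P S) X Y f (k \<odot>\<^bsub>Obj (quot_rmodule K P S) Y\<^esub> m)
     = k \<odot>\<^bsub>Obj (quot_rmodule K P S) X\<^esub> Mor (quot_rmodule K P S) X Y f m"
    "Mor (quot_rmodule K P S) X Y (k \<odot>\<^bsub>Hom E X Y\<^esub> f) m
     = k \<odot>\<^bsub>Obj (quot_rmodule K P S) X\<^esub> Mor (quot_rmodule K P S) X Y f m"
    using m' X Y f by (simp_all add: quot_rmodule_def P.mor_smult P.functor_smult P.mor_closed pl) }
  { fix g assume "g \<in> car (Hom E X Y)"
   then show "Mor (quot_rmodule K P S) X Y (f \<oplus>\<^bsub>Hom E X Y\<^esub> g) m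
     = Mor (quot_rmodule K P S) X Y f m \<oplus>\<^bsub>Obj (quot_rmodule K P S) X\<^esub> Mor (quot_rmodule K P S) X Y g m"
    using m' X Y f by (simp add: quot_rmodule_def P.functor_add P.mor_closed pl) }
 next
  fix X m assume X: "X \<in> Ob E" and m: "m \<in> car (Obj (quot_rmodule K P S) X)"
  then show "Mor (quot_rmodule K P S) X X (Ident E X) m = m"
   using sub[OF X] pq[OF X] by (simp add: quot_rmodule_def P.functor_ident)
 next
  fix X Y Z f g m assume X: "X \<in> Ob E" and Y: "Y \<in> Ob E" and Z: "Z \<in> Ob E"
   and f: "f \<in> car (Hom E Y Z)" and g: "g \<in> car (Hom E X Y)" and m: "m \<in> car (Obj (quot_rmodule K P S) Z)"
  then have "m \<in> car (Obj P Z)" using sub by (simp add: quot_rmodule_def)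
  then show "Mor (quot_rmodule K P S) X Z (Comp E X Y Z f g) m
    = Mor (quot_rmodule K P S) X Y g (Mor (quot_rmodule K P S) Y Z f m)"
   using X Y Z f g by (simp add: quot_rmodule_def P.functor_comp key P.mor_closed)
 qed
 show "(\<lambda>X\<in>Ob E. prj K (Obj P X) (S X)) \<in> nat_maps K E P (quot_rmodule K P S)"
  by (rule nat_mapsI) (simp_all add: quot_rmodule_def p key)
qed

text \<open>An embedding of N into an injective module I together with its cokernel Q. Q has the
  type of I, so that the step can be repeated.\<close>

definition inj_step :: "'k ring => ('k, 'o, 'e, 'z) lincat_scheme => ('k, 'o, 'e, 'w) rmodule => ('k, 'o, 'e, 'u) rmodule
  => ('o => 'w => 'u) => ('k, 'o, 'e, 'u) rmodule => ('o => 'u => 'u) => bool" where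
 "inj_step K E N I e Q \<pi> \<longleftrightarrow> injective_module K E I \<and> right_module K E Q \<and>
  e \<in> nat_maps K E N I \<and> \<pi> \<in> nat_maps K E I Q \<and>
  (\<forall>X\<in>Ob E. inj_on (e X) (car (Obj N X)) \<and> \<pi> X ` car (Obj I X) = car (Obj Q X) \<and>
   (\<forall>x\<in>car (Obj I X). \<pi> X x = \<zero>\<^bsub>Obj Q X\<^esub> \<longleftrightarrow> x \<in> e X ` car (Obj N X)))"

lemma injective_step:
 fixes N :: "('k, 'o, 'e, 'w) rmodule" and c :: "('o \<times> 'e => 'w) => 'u"
 assumes K: "field K" and E: "linear_category K E" and N: "right_module K E N" and c: "inj c"
 shows "\<exists>I e Q \<pi>. inj_step K E N (I :: ('k, 'o, 'e, 'u) rmodule) e Q \<pi>"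
proof -
 let ?I = "cofree K E c (Obj N) :: ('k, 'o, 'e, 'u) rmodule" and ?e = "cofree_unit K E c N"
 note u = cofree_unit[OF K E N c]
 interpret I: right_module K E ?I by (rule u(3))
 interpret N: right_module K E N by fact
 let ?S = "\<lambda>X. ?e X ` car (Obj N X)"
 have S: "submodule (?S X) K (Obj ?I X)" if "X \<in> Ob E" for X
  using submodule_image[OF nat_maps_lin[OF u(1)] N.obj_space I.obj_space submodule_carrier[OF N.obj_space]] that by blast
 have M: "Mor ?I X Y f m \<in> ?S X" if "X \<in> Ob E" "Y \<in> Ob E" "f \<in> car (Hom E X Y)" "m \<in> ?S Y" for X Y f m
  using that nat_maps_natural[OF u(1) that(1-3), symmetric] N.mor_closed[OF that(1-3)] by auto
 note q = quot_rmodule[OF K u(3) S M E]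
 show ?thesis
  unfolding inj_step_def
 proof (intro exI conjI ballI)
  show "injective_module K E ?I" by (rule cofree_injective[OF assms])
  show "right_module K E (quot_rmodule K ?I ?S)" by (rule q(1))
  show "?e \<in> nat_maps K E N ?I" by (rule u(1))
  show "(\<lambda>X\<in>Ob E. prj K (Obj ?I X) (?S X)) \<in> nat_maps K E ?I (quot_rmodule K ?I ?S)" by (rule q(2))
  fix X assume X: "X \<in> Ob E"
  show "inj_on (?e X) (car (Obj N X))" by (rule u(2)[OF X])
  show "(\<lambda>X\<in>Ob E. prj K (Obj ?I X) (?S X)) X ` car (Obj ?I X) = car (Obj (quot_rmodule K ?I ?S) X)"
   using qspace_carrier[OF K I.obj_space[OF X] S[OF X]] X by (simp add: quot_rmodule_def)
  fix x assume "x \<in> car (Obj ?I X)"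
  then show "(\<lambda>X\<in>Ob E. prj K (Obj ?I X) (?S X)) X x = \<zero>\<^bsub>Obj (quot_rmodule K ?I ?S) X\<^esub> \<longleftrightarrow> x \<in> ?e X ` car (Obj N X)"
   using prj_eq_zero[OF K I.obj_space[OF X] S[OF X]] X by (simp add: quot_rmodule_def)
 qed
qed

text \<open>The injection c0 carries N into the target type in the first step; c keeps the cofree
  modules on the later cokernels in it.\<close>

theorem injective_resolution_exists:
 fixes N :: "('k, 'o, 'e, 'v) rmodule" and c0 :: "('o \<times> 'e => 'v) => 'u" and c :: "('o \<times> 'e => 'u) => 'u"
 assumes K: "field K" and E: "linear_category K E" and N: "right_module K E N" and c0: "inj c0" and c: "inj c"
 shows "\<exists>(I :: nat => ('k, 'o, 'e, 'u) rmodule) d e. injective_resolution K E N I d e"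
proof -
 obtain I0 e0 Q0 \<pi>0 where s0: "inj_step K E N (I0 :: ('k, 'o, 'e, 'u) rmodule) e0 Q0 \<pi>0"
  using injective_step[OF K E N c0] by blast
 then have 0: "injective_module K E I0" "right_module K E Q0" "e0 \<in> nat_maps K E N I0" "\<pi>0 \<in> nat_maps K E I0 Q0"
   "\<And>X. X \<in> Ob E ==> inj_on (e0 X) (car (Obj N X))"
   "\<And>X. X \<in> Ob E ==> \<pi>0 X ` car (Obj I0 X) = car (Obj Q0 X)"
   "\<And>X x. X \<in> Ob E ==> x \<in> car (Obj I0 X) ==> \<pi>0 X x = \<zero>\<^bsub>Obj Q0 X\<^esub> \<longleftrightarrow> x \<in> e0 X ` car (Obj N X)"
  by (simp_all add: inj_step_def)
 \<comment> \<open>One choice for all modules at once, so that the cokernels can be defined by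
   recursion.\<close>
 have "\<forall>P :: ('k, 'o, 'e, 'u) rmodule. \<exists>t. right_module K E P \<longrightarrow>
   inj_step K E P (fst t :: ('k, 'o, 'e, 'u) rmodule) (fst (snd t)) (fst (snd (snd t))) (snd (snd (snd t)))"
  using injective_step[OF K E _ c] by (metis fst_conv snd_conv)
 then obtain F where F0: "\<And>P :: ('k, 'o, 'e, 'u) rmodule. right_module K E P ==>
   inj_step K E P (fst (F P) :: ('k, 'o, 'e, 'u) rmodule) (fst (snd (F P))) (fst (snd (snd (F P)))) (snd (snd (snd (F P))))"
  by (metis (no_types))
 define FI FE FQ FP where "FI P = fst (F P)" and "FE P = fst (snd (F P))" and "FQ P = fst (snd (snd (F P)))"
  and "FP P = snd (snd (snd (F P)))" for P
 have F: "injective_module K E (FI P) \<and> right_module K E (FQ P) \<and>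
  FE P \<in> nat_maps K E P (FI P) \<and> FP P \<in> nat_maps K E (FI P) (FQ P) \<and>
  (\<forall>X\<in>Ob E. inj_on (FE P X) (car (Obj P X)) \<and> FP P X ` car (Obj (FI P) X) = car (Obj (FQ P) X) \<and>
   (\<forall>x\<in>car (Obj (FI P) X). FP P X x = \<zero>\<^bsub>Obj (FQ P) X\<^esub> \<longleftrightarrow> x \<in> FE P X ` car (Obj P X)))"
  if "right_module K E P" for P
  using F0[OF that] unfolding inj_step_def FI_def FE_def FQ_def FP_def .
 define Q where "Q = rec_nat Q0 (\<lambda>_. FQ)"
 have Q_simps: "Q 0 = Q0" "Q (Suc n) = FQ (Q n)" for n by (simp_all add: Q_def)
 have Q: "right_module K E (Q n)" for n
  by (induction n) (use 0(2) F in \<open>auto simp: Q_simps\<close>)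
 define I where "I n = (case n of 0 => I0 | Suc m => FI (Q m))" for n
 define \<pi> where "\<pi> n = (case n of 0 => \<pi>0 | Suc m => FP (Q m))" for n
 define e where "e n = FE (Q n)" for n
 have I: "injective_module K E (I n)" for n using 0(1) F[OF Q] by (cases n) (auto simp: I_def)
 then have Im: "right_module K E (I n)" for n by (simp add: injective_module_def)
 have \<pi>: "\<pi> n \<in> nat_maps K E (I n) (Q n)" for n using 0(4) F[OF Q] by (cases n) (auto simp: I_def \<pi>_def Q_simps)
 have \<pi>s: "\<pi> n X ` car (Obj (I n) X) = car (Obj (Q n) X)" if "X \<in> Ob E" for n X
  using 0(6)[OF that] F[OF Q] that by (cases n) (auto simp: I_def \<pi>_def Q_simps)
 have e: "e n \<in> nat_maps K E (Q n) (I (Suc n))" for n using F[OF Q] by (auto simp: I_def e_def)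
 have ei: "inj_on (e n X) (car (Obj (Q n) X))" if "X \<in> Ob E" for n X using F[OF Q] that by (auto simp: e_def)
 have \<pi>z: "\<pi> (Suc n) X x = \<zero>\<^bsub>Obj (Q (Suc n)) X\<^esub> \<longleftrightarrow> x \<in> e n X ` car (Obj (Q n) X)"
  if "X \<in> Ob E" "x \<in> car (Obj (I (Suc n)) X)" for n X x
  using F[OF Q] that by (auto simp: I_def \<pi>_def e_def Q_simps)
 \<comment> \<open>Splicing: project onto the cokernel, then embed it into the next injective
   module.\<close>
 define d where "d n = (\<lambda>X\<in>Ob E. \<lambda>m\<in>car (Obj (I n) X). e n X (\<pi> n X m))" for n
 have d: "d n \<in> nat_maps K E (I n) (I (Suc n))" for n
  unfolding d_def by (rule nat_maps_compose[OF Im \<pi> e])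
 have dz: "d n X x = \<zero>\<^bsub>Obj (I (Suc n)) X\<^esub> \<longleftrightarrow> \<pi> n X x = \<zero>\<^bsub>Obj (Q n) X\<^esub>"
  if X: "X \<in> Ob E" and x: "x \<in> car (Obj (I n) X)" for n X x
 proof -
  have m: "module K (Obj (Q n) X)" "module K (Obj (I (Suc n)) X)"
   using right_module.obj_space[OF Q X] right_module.obj_space[OF Im X] by auto
  have "\<pi> n X x \<in> car (Obj (Q n) X)" by (rule nat_maps_closed[OF \<pi> X x])
  then show ?thesis
   using lin_inj_iff[OF nat_maps_lin[OF e X] m] ei[OF X] lin_zero[OF nat_maps_lin[OF e X] m] X x
   by (auto simp: d_def)
 qed
 have "injective_resolution K E N I d e0"
  unfolding injective_resolution_def
 proof (intro conjI allI ballI I d)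
  show "e0 \<in> nat_maps K E N (I 0)" using 0(3) by (simp add: I_def)
  fix X assume X: "X \<in> Ob E"
  show "inj_on (e0 X) (car (Obj N X))" by (rule 0(5)[OF X])
  show "e0 X ` car (Obj N X) = cocycles (\<lambda>n. Obj (I n) X) (\<lambda>n. d n X) 0"
  proof -
   have "cocycles (\<lambda>n. Obj (I n) X) (\<lambda>n. d n X) 0 = {x \<in> car (Obj I0 X). \<pi>0 X x = \<zero>\<^bsub>Obj Q0 X\<^esub>}"
    using dz[OF X, of _ 0] by (auto simp: cocycles_def I_def \<pi>_def Q_simps)
   then show ?thesis using 0(7)[OF X] nat_maps_closed[OF 0(3) X] by auto
  qed
  fix n
  have "cocycles (\<lambda>n. Obj (I n) X) (\<lambda>n. d n X) (Suc n) = {x \<in> car (Obj (I (Suc n)) X). \<pi> (Suc n) X x = \<zero>\<^bsub>Obj (Q (Suc n)) X\<^esub>}"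
   using dz[OF X, of _ "Suc n"] by (auto simp: cocycles_def)
  also have "\<dots> = e n X ` car (Obj (Q n) X)" using \<pi>z[OF X] nat_maps_closed[OF e X] by auto
  also have "\<dots> = e n X ` \<pi> n X ` car (Obj (I n) X)" by (simp add: \<pi>s[OF X])
  also have "\<dots> = d n X ` car (Obj (I n) X)" using X by (simp add: d_def image_image)
  finally show "d n X ` car (Obj (I n) X) = cocycles (\<lambda>n. Obj (I n) X) (\<lambda>n. d n X) (Suc n)" by simp
 qed
 then show ?thesis by blast
qed

text \<open>Pulling back along the second projection embeds powers with exponent 's into powers with
  exponent nat \<times> 's, under which the universe is closed.\<close>

lemma univ_power_injection: "\<exists>c :: ('s => ('s, 'v) univ) => ('s, 'v) univ. inj c"
proof -
 obtain c :: "(nat \<times> 's => ('s, 'v) univ) => ('s, 'v) univ" where c: "inj c" using univ_closed_power by blast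
 have "inj (\<lambda>(f :: 's => ('s, 'v) univ) p. f (snd (p :: nat \<times> 's)))"
 proof (intro injI ext)
  fix f g :: "'s => ('s, 'v) univ" and x q
  assume "(\<lambda>p :: nat \<times> 's. f (snd p)) = (\<lambda>p. g (snd p))"
  from fun_cong[OF this, of "(0, x)"] show "f x q = g x q" by simp
 qed
 from inj_compose[OF c this] show ?thesis by blast
qed

lemma univ_base_injection: "\<exists>c :: ('s => 'v) => ('s, 'v) univ. inj c"
proof (intro exI injI)
 fix f g :: "'s => 'v" assume "(\<lambda>p :: nat \<times> 's. f (snd p)) = (\<lambda>p. g (snd p))"
 from fun_cong[OF this] have "f x = g x" for x by (metis snd_conv)
 then show "f = g" by (rule ext)
qed

theorem chosen_resolution:
 fixes E :: "('k, 'o, 'e, 'z) lincat_scheme" and N :: "('k, 'o, 'e, 'v) rmodule"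
 assumes K: "field K" and E: "linear_category K E" and N: "right_module K E N"
  and c: "chosen_resolution K E N = (I, d, e)"
 shows "injective_resolution K E N I d e"
proof -
 obtain c0 :: "('o \<times> 'e => 'v) => ('o \<times> 'e, 'v) univ" where c0: "inj c0" using univ_base_injection by blast
 obtain c1 :: "('o \<times> 'e => ('o \<times> 'e, 'v) univ) => ('o \<times> 'e, 'v) univ" where c1: "inj c1" using univ_power_injection by blast
 have "\<exists>x. case x of (I, d, e) =>
   injective_resolution K E N (I :: nat => ('k, 'o, 'e, ('o \<times> 'e, 'v) univ) rmodule) d e"
  using injective_resolution_exists[OF K E N c0 c1] by auto
 from someI_ex[OF this] have "case chosen_resolution K E N of (I, d, e) => injective_resolution K E N I d e"
  unfolding chosen_resolution_def .
 then show ?thesis using c by simp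
qed

text \<open>\<open>H\<close> as a category with one object.  The composition is reversed, so that right modules over
 it are left \<open>H\<close>-modules.\<close>

definition cat_of :: "('k, 'h) hopf => ('k, unit, 'h) lincat" where
 "cat_of H = \<lparr>Ob = UNIV, Hom = (\<lambda>_ _. module.truncate H), Ident = (\<lambda>_. \<one>\<^bsub>H\<^esub>), Comp = (\<lambda>_ _ _ f g. g \<otimes>\<^bsub>H\<^esub> f)\<rparr>"

definition rmod_of :: "('k, 'h, 'v) hmodule => ('k, unit, 'h, 'v) rmodule" where
 "rmod_of V = \<lparr>Obj = (\<lambda>_. module.truncate V), Mor = (\<lambda>_ _. act V)\<rparr>"

definition hmod_of :: "('k, unit, 'h, 'v) rmodule => ('k, 'h, 'v) hmodule" where
 "hmod_of N = with_act (Obj N ()) (Mor N () ())"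

lemma cat_of_simps [simp]: "Ob (cat_of H) = UNIV" "Hom (cat_of H) X Y = module.truncate H"
 "Ident (cat_of H) X = \<one>\<^bsub>H\<^esub>" "Comp (cat_of H) X Y Z f g = g \<otimes>\<^bsub>H\<^esub> f"
 by (simp_all add: cat_of_def)

lemma rmod_of_simps [simp]: "Obj (rmod_of V) X = module.truncate V" "Mor (rmod_of V) X Y = act V"
 by (simp_all add: rmod_of_def)

lemma hmod_of_simps [simp]: "car (hmod_of N) = car (Obj N ())" "add (hmod_of N) = add (Obj N ())"
 "zero (hmod_of N) = zero (Obj N ())" "smult (hmod_of N) = smult (Obj N ())" "act (hmod_of N) = Mor N () ()"
 by (simp_all add: hmod_of_def)

lemma nat_maps_cat_of:
 "\<eta> \<in> nat_maps K (cat_of H) M N \<longleftrightarrow> \<eta> () \<in> H_maps K H (hmod_of M) (hmod_of N)"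
 by (auto simp: nat_maps_def H_maps_def lin_maps_def PiE_def extensional_def Pi_def)

lemma H_maps_rmod_of: "H_maps K H (hmod_of (rmod_of V)) (hmod_of N) = H_maps K H V (hmod_of N)"
 "H_maps K H (hmod_of M) (hmod_of (rmod_of V)) = H_maps K H (hmod_of M) V"
 by (simp_all add: H_maps_def lin_maps_def)

context hopf_algebra
begin

interpretation HM: module K H by (rule vector_space)
interpretation HR: ring H by (rule ring)
interpretation KF: field K by (rule field)

lemma cat_of: "linear_category K (cat_of H)"
 by (rule linear_category.intro)
  (simp_all add: module_truncate[OF vector_space] HR.l_distr HR.r_distr smult_mult_left smult_mult_right HR.m_assoc)

lemma rmod_of: "left_H_module K H V ==> right_module K (cat_of H) (rmod_of V)"
proof -
 assume "left_H_module K H V"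
 then interpret V: left_H_module K H V .
 show ?thesis
  by (rule right_module.intro)
   (simp_all add: module_truncate[OF V.vector_space] V.act_closed V.act_add_left V.act_add_right V.act_smult_left
    V.act_smult_right V.act_mult V.act_one)
qed

lemma hmod_of: "right_module K (cat_of H) N ==> left_H_module K H (hmod_of N)"
proof -
 assume "right_module K (cat_of H) N"
 then interpret N: right_module K "cat_of H" N .
 show ?thesis
  using N.mor_closed N.mor_add N.mor_smult N.functor_add N.functor_smult N.functor_ident N.functor_comp
  by (intro left_H_module.intro) (simp_all add: module_with_act[OF N.obj_space] hmod_of_def)
qed

lemma injective_hmod_of:
 fixes I :: "('k, unit, 'h, 'v) rmodule"
 assumes I: "injective_module K (cat_of H) I"
 shows "injective_H_module K H (hmod_of I)"
 unfolding injective_H_module_def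
proof (intro conjI allI impI)
 show "left_H_module K H (hmod_of I)" using I by (simp add: injective_module_def hmod_of)
 fix A B :: "('k, 'h, 'v) hmodule" and i g
 assume *: "left_H_module K H A \<and> left_H_module K H B \<and> i \<in> H_maps K H A B \<and> inj_on i (car A)
  \<and> g \<in> H_maps K H A (hmod_of I)"
 have i: "(\<lambda>_. i) \<in> nat_maps K (cat_of H) (rmod_of A) (rmod_of B)"
  using * by (simp add: nat_maps_cat_of H_maps_def lin_maps_def)
 have g: "(\<lambda>_. g) \<in> nat_maps K (cat_of H) (rmod_of A) I"
  using * by (simp add: nat_maps_cat_of H_maps_rmod_of)
 have "\<exists>g'\<in>nat_maps K (cat_of H) (rmod_of B) I. \<forall>X\<in>Ob (cat_of H). \<forall>a\<in>car (Obj (rmod_of A) X). g' X ((\<lambda>_. i) X a) = (\<lambda>_. g) X a"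
  using I[unfolded injective_module_def, THEN conjunct2, THEN spec, THEN spec, THEN spec, THEN spec,
    of "rmod_of A" "rmod_of B" "\<lambda>_. i" "\<lambda>_. g"] * rmod_of i g by auto
 then obtain g' where "g' \<in> nat_maps K (cat_of H) (rmod_of B) I" "\<And>a. a \<in> car A ==> g' () (i a) = g a" by auto
 then show "\<exists>g'\<in>H_maps K H B (hmod_of I). \<forall>a\<in>car A. g' (i a) = g a"
  by (intro bexI[of _ "g' ()"]) (simp_all add: nat_maps_cat_of H_maps_rmod_of)
qed

theorem chosen_H_resolution:
 fixes V :: "('k, 'h, 'v) hmodule"
 assumes V: "left_H_module K H V" and c: "chosen_H_resolution K H V = (J, d, e)"
 shows "injective_H_resolution K H V J d e"
proof -
 obtain c0 :: "('h => 'v) => ('h, 'v) univ" where c0: "inj c0" using univ_base_injection by blast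
 obtain c1 :: "('h => ('h, 'v) univ) => ('h, 'v) univ" where c1: "inj c1" using univ_power_injection by blast
 \<comment> \<open>Cofree modules over \<open>cat_of H\<close> are families indexed by unit \<times>
   'h. The trivial factor is dropped to reach the universe with exponent 'h.\<close>
 have "inj (\<lambda>(f :: unit \<times> 'h => 'v) h. f ((), h))" "inj (\<lambda>(f :: unit \<times> 'h => ('h, 'v) univ) h. f ((), h))"
  by (auto simp: inj_def fun_eq_iff)
 then obtain I d' e' where I: "injective_resolution K (cat_of H) (rmod_of V) (I :: nat => ('k, unit, 'h, ('h, 'v) univ) rmodule) d' e'"
  using injective_resolution_exists[OF field cat_of rmod_of[OF V] inj_compose[OF c0] inj_compose[OF c1]] by blast
 have "injective_H_resolution K H V (\<lambda>n. hmod_of (I n)) (\<lambda>n. d' n ()) (e' ())"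
  using I by (simp add: injective_resolution_def injective_H_resolution_def injective_hmod_of nat_maps_cat_of
    H_maps_rmod_of cocycles_def)
 then have "\<exists>x. case x of (J, d, e) => injective_H_resolution K H V (J :: nat => ('k, 'h, ('h, 'v) univ) hmodule) d e" by blast
 from someI_ex[OF this] have "case chosen_H_resolution K H V of (J, d, e) => injective_H_resolution K H V J d e"
  unfolding chosen_H_resolution_def .
 then show ?thesis using c by simp
qed

text \<open>A cofree module over H on J is the space of linear maps H \<rightarrow> J with
  translation as action, so a retraction onto the injective module J is what relative injectivity
  asks for. The injection c keeps the cofree module in the type over which the injectivity of J
  quantifies.\<close>

lemma injective_H_rinj:
 fixes J :: "('k, 'h, 'u) hmodule" and c :: "('h => 'u) => 'u"
 assumes J: "injective_H_module K H J" and c: "inj c"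
 shows "rinj K H J"
proof -
 have Jm: "left_H_module K H J" using J by (simp add: injective_H_module_def)
 interpret J: left_H_module K H J by (rule Jm)
 have "inj (\<lambda>(f :: unit \<times> 'h => 'u) h. f ((), h))"
  by (auto simp: inj_def fun_eq_iff)
 from inj_compose[OF c this] have c': "inj (c \<circ> (\<lambda>f h. f ((), h)))" .
 define C :: "(unit \<times> 'h => 'u) => 'u" where "C = c \<circ> (\<lambda>f h. f ((), h))"
 note C = c'[folded C_def]
 let ?E = "cat_of H" and ?N = "rmod_of J"
 let ?P = "cofree K ?E C (Obj ?N)" and ?u = "cofree_unit K ?E C ?N"
 interpret F: cofree_data K ?E C "Obj ?N"
  using cat_of C by (intro cofree_data.intro cofree_data_axioms.intro) (simp_all add: module_truncate[OF J.vector_space])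
 note u = cofree_unit[OF field cat_of rmod_of[OF Jm] C]
 let ?Q = "hmod_of ?P"
 have Q: "left_H_module K H ?Q" by (rule hmod_of[OF u(3)])
 have uH: "?u () \<in> H_maps K H J ?Q" using u(1) by (simp add: nat_maps_cat_of H_maps_rmod_of)
 let ?id = "\<lambda>x\<in>car J. x"
 have id: "?id \<in> H_maps K H J J"
  by (rule H_mapsI[OF lin_id[OF J.vector_space]]) (simp add: J.act_closed)
 have "inj_on (?u ()) (car J)" using u(2)[of "()"] by simp
 then obtain r where r: "r \<in> H_maps K H ?Q J" "\<And>x. x \<in> car J ==> r (?u () x) = x"
  using J[unfolded injective_H_module_def, THEN conjunct2, rule_format, of J ?Q "?u ()" ?id] Jm Q uH id by auto
 let ?f = "\<lambda>\<phi>. C (\<lambda>p\<in>cdom ?E (). \<phi> (snd p))"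
 have cdom: "p \<in> cdom ?E () \<longleftrightarrow> snd p \<in> car H" for p by (cases p) (simp add: cdom_def)
 have f: "?f \<phi> \<in> car ?Q" if \<phi>: "\<phi> \<in> lin_maps K H J" for \<phi>
 proof -
  have "(\<lambda>p\<in>cdom ?E (). \<phi> (snd p)) \<in> cofree_set K ?E (Obj ?N) ()"
   by (rule F.cofree_setI) (simp_all add: lin_closed[OF \<phi>] lin_add[OF \<phi>] lin_smult[OF \<phi>])
  then show ?thesis by simp
 qed
 show ?thesis
  unfolding rinj_def rinj_map_def
 proof (intro exI[of _ "\<lambda>\<phi>. r (?f \<phi>)"] conjI ballI)
  fix \<phi> assume \<phi>: "\<phi> \<in> lin_maps K H J"
  show "r (?f \<phi>) \<in> car J" by (rule H_maps_closed[OF r(1) f[OF \<phi>]])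
  { fix \<psi> assume \<psi>: "\<psi> \<in> lin_maps K H J"
   have "?f (\<lambda>h\<in>car H. \<phi> h \<oplus>\<^bsub>J\<^esub> \<psi> h) = ?f \<phi> \<oplus>\<^bsub>?Q\<^esub> ?f \<psi>"
    by (auto simp: cdom intro!: restrict_ext)
   then show "r (?f (\<lambda>h\<in>car H. \<phi> h \<oplus>\<^bsub>J\<^esub> \<psi> h)) = r (?f \<phi>) \<oplus>\<^bsub>J\<^esub> r (?f \<psi>)"
    using lin_add[OF H_maps_lin[OF r(1)] f[OF \<phi>] f[OF \<psi>]] by simp }
  { fix k assume k: "k \<in> car H"
   have "?f (\<lambda>h\<in>car H. \<phi> (h \<otimes>\<^bsub>H\<^esub> k)) = act ?Q k (?f \<phi>)"
    using k by (auto simp: cdom intro!: restrict_ext)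
   then show "r (?f (\<lambda>h\<in>car H. \<phi> (h \<otimes>\<^bsub>H\<^esub> k))) = act J k (r (?f \<phi>))"
    using H_maps_act[OF r(1) k f[OF \<phi>]] by simp }
 next
  fix x assume x: "x \<in> car J"
  have "?f (\<lambda>h\<in>car H. act J h x) = ?u () x"
   using x by (auto simp: cofree_unit_def cofree_lift_def cdom J.act_closed intro!: restrict_ext)
  then show "r (?f (\<lambda>h\<in>car H. act J h x)) = x" using r(2)[OF x] by simp
 qed
qed

theorem grothendieck_rinj:
 fixes A :: "nat => ('k, 'h, 'a) hmodule"
 assumes A: "\<And>q. left_H_module K H (A q)" and R: "\<And>q. rinj K H (A q)"
  and d: "\<And>q. d q \<in> H_maps K H (A q) (A (Suc q))"
  and dd: "\<And>q x. x \<in> car (A q) ==> d (Suc q) (d q x) = \<zero>\<^bsub>A (Suc (Suc q))\<^esub>"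
 shows "\<exists>E' d'. first_quadrant_spectral_sequence K E' d'
  \<and> (\<forall>p q. E' 2 (int p) (int q) = R_invariants K H p (H_cohomology A d q))
  \<and> converges_to K E' (\<lambda>n. cohomology (\<lambda>i. invariants H (A i)) d n)"
proof (rule grothendieck[where A = A and d = d, OF A R d dd])
 fix q
 let ?V = "H_cohomology A d q"
 obtain J dJ e where J: "chosen_H_resolution K H ?V = (J, dJ, e)" by (metis prod_cases3)
 have res: "injective_H_resolution K H ?V J dJ e"
  by (rule chosen_H_resolution[OF H_cohomology_module(1)[where A = A and d = d, OF A d dd] J])
 obtain c :: "('h => ('h, 'a set) univ) => ('h, 'a set) univ" where c: "inj c" using univ_power_injection by blast
 have "rinj K H (J n)" for n
  by (rule injective_H_rinj[OF _ c]) (use res in \<open>simp add: injective_H_resolution_def\<close>)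
 then show "case chosen_H_resolution K H ?V of (J, dJ, e) =>
   injective_H_resolution K H ?V J dJ e \<and> (\<forall>n. rinj K H (J n))"
  using res J by simp
qed

end

section \<open>Tensor products\<close>

text \<open>In contrast to \<open>lin_maps\<close> nothing is demanded outside the carrier, so plain
  lambda terms qualify and compose without restriction.\<close>

definition linop :: "'k ring => ('k, 'v, 'y) module_scheme => ('k, 'w, 'z) module_scheme => ('v => 'w) => bool" where
 "linop K V W f \<longleftrightarrow> (\<forall>x\<in>car V. f x \<in> car W) \<and>
   (\<forall>x\<in>car V. \<forall>y\<in>car V. f (x \<oplus>\<^bsub>V\<^esub> y) = f x \<oplus>\<^bsub>W\<^esub> f y) \<and>
   (\<forall>k\<in>car K. \<forall>x\<in>car V. f (k \<odot>\<^bsub>V\<^esub> x) = k \<odot>\<^bsub>W\<^esub> f x)"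

definition bilin :: "'k ring => ('k, 'a, 'y) module_scheme => ('k, 'b, 'z) module_scheme
  => ('k, 'p, 'q) module_scheme => ('a => 'b => 'p) => bool" where
 "bilin K V W P \<beta> \<longleftrightarrow> (\<forall>v\<in>car V. linop K W P (\<beta> v)) \<and> (\<forall>w\<in>car W. linop K V P (\<lambda>v. \<beta> v w))"

definition ev :: "('k, 'p, 'z) module_scheme => ('a => 'b => 'p) => ('a \<times> 'b) list => 'p" where
 "ev P \<beta> l = foldr (\<lambda>(v, w) s. \<beta> v w \<oplus>\<^bsub>P\<^esub> s) l \<zero>\<^bsub>P\<^esub>"

lemma ev_Nil [simp]: "ev P \<beta> [] = \<zero>\<^bsub>P\<^esub>"
 and ev_Cons [simp]: "ev P \<beta> ((v, w) # l) = \<beta> v w \<oplus>\<^bsub>P\<^esub> ev P \<beta> l"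
 by (simp_all add: ev_def)

lemma tsum_ev: "tsum P \<beta> t = ev P \<beta> (SOME l. l \<in> t)"
 by (simp add: tsum_def ev_def)

lemma linopI:
 "\<lbrakk>\<And>x. x \<in> car V ==> f x \<in> car W;
  \<And>x y. x \<in> car V ==> y \<in> car V ==> f (x \<oplus>\<^bsub>V\<^esub> y) = f x \<oplus>\<^bsub>W\<^esub> f y;
  \<And>k x. k \<in> car K ==> x \<in> car V ==> f (k \<odot>\<^bsub>V\<^esub> x) = k \<odot>\<^bsub>W\<^esub> f x\<rbrakk> \<Longrightarrow> linop K V W f"
 by (simp add: linop_def)

lemma linop_closed: "linop K V W f ==> x \<in> car V ==> f x \<in> car W" by (simp add: linop_def)
lemma linop_add: "linop K V W f ==> x \<in> car V ==> y \<in> car V ==> f (x \<oplus>\<^bsub>V\<^esub> y) = f x \<oplus>\<^bsub>W\<^esub> f y"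
 by (simp add: linop_def)
lemma linop_smult: "linop K V W f ==> k \<in> car K ==> x \<in> car V ==> f (k \<odot>\<^bsub>V\<^esub> x) = k \<odot>\<^bsub>W\<^esub> f x"
 by (simp add: linop_def)

lemma linop_zero: assumes "linop K V W f" "module K V" "module K W" shows "f \<zero>\<^bsub>V\<^esub> = \<zero>\<^bsub>W\<^esub>"
proof -
 interpret V: module K V by fact
 interpret W: module K W by fact
 have "f (\<zero>\<^bsub>K\<^esub> \<odot>\<^bsub>V\<^esub> \<zero>\<^bsub>V\<^esub>) = \<zero>\<^bsub>K\<^esub> \<odot>\<^bsub>W\<^esub> f \<zero>\<^bsub>V\<^esub>" by (rule linop_smult[OF assms(1)]) auto
 then show ?thesis using linop_closed[OF assms(1)] by simp
qed

lemma linop_id: "linop K V V (\<lambda>x. x)" by (simp add: linop_def)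

lemma linop_comp: "linop K W X g ==> linop K V W f ==> linop K V X (\<lambda>x. g (f x))"
 by (simp add: linop_def)

lemma linop_lin_maps: "f \<in> lin_maps K V W ==> linop K V W f"
 by (auto simp: linop_def lin_maps_def)

lemma linop_smult_const: assumes "module K W" "linop K V W f" "k \<in> car K" shows "linop K V W (\<lambda>x. k \<odot>\<^bsub>W\<^esub> f x)"
proof -
 interpret W: module K W by fact
 show ?thesis
 proof (rule linopI)
  fix x assume x: "x \<in> car V"
  show "k \<odot>\<^bsub>W\<^esub> f x \<in> car W" using linop_closed[OF assms(2) x] assms(3) by simp
  show "k \<odot>\<^bsub>W\<^esub> f (x \<oplus>\<^bsub>V\<^esub> y) = k \<odot>\<^bsub>W\<^esub> f x \<oplus>\<^bsub>W\<^esub> k \<odot>\<^bsub>W\<^esub> f y" if y: "y \<in> car V" for y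
   using x y assms(3) linop_closed[OF assms(2)] by (simp add: linop_add[OF assms(2)] W.smult_r_distr)
  show "k \<odot>\<^bsub>W\<^esub> f (a \<odot>\<^bsub>V\<^esub> x) = a \<odot>\<^bsub>W\<^esub> (k \<odot>\<^bsub>W\<^esub> f x)" if a: "a \<in> car K" for a
   using linop_closed[OF assms(2) x] W.smult_assoc1[OF assms(3) a] W.smult_assoc1[OF a assms(3)] W.R.m_comm[OF a assms(3)]
   by (simp add: linop_smult[OF assms(2) a x])
 qed
qed

lemma bilinI: "(\<And>v. v \<in> car V ==> linop K W P (\<beta> v)) ==> (\<And>w. w \<in> car W ==> linop K V P (\<lambda>v. \<beta> v w)) ==> bilin K V W P \<beta>"
 by (simp add: bilin_def)

lemma bilin_right: "bilin K V W P \<beta> ==> v \<in> car V ==> linop K W P (\<beta> v)" by (simp add: bilin_def)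
lemma bilin_left: "bilin K V W P \<beta> ==> w \<in> car W ==> linop K V P (\<lambda>v. \<beta> v w)" by (simp add: bilin_def)
lemma bilin_closed: "bilin K V W P \<beta> ==> v \<in> car V ==> w \<in> car W ==> \<beta> v w \<in> car P"
 using linop_closed[OF bilin_right] .

context
 fixes P :: "('k, 'p, 'z) module_scheme" and K :: "'k ring"
 assumes P: "module K P"
begin

interpretation P: module K P by (rule P)

lemma ev_closed: "l \<in> lists (A \<times> B) ==> (\<And>v w. v \<in> A ==> w \<in> B ==> \<beta> v w \<in> car P) ==> ev P \<beta> l \<in> car P"
 by (induction l) auto

lemma ev_append: "l \<in> lists (A \<times> B) ==> m \<in> lists (A \<times> B) ==> (\<And>v w. v \<in> A ==> w \<in> B ==> \<beta> v w \<in> car P)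
  ==> ev P \<beta> (l @ m) = ev P \<beta> l \<oplus>\<^bsub>P\<^esub> ev P \<beta> m"
proof (induction l)
 case Nil then show ?case using ev_closed[of m A B \<beta>] by simp
next
 case (Cons a l)
 then show ?case using ev_closed[of m A B \<beta>] ev_closed[of l A B \<beta>] by (cases a) (auto simp: P.a_assoc)
qed

lemma ev_plus: "l \<in> lists (A \<times> B) ==> (\<And>v w. v \<in> A ==> w \<in> B ==> \<beta> v w \<in> car P)
  ==> (\<And>v w. v \<in> A ==> w \<in> B ==> \<gamma> v w \<in> car P)
  ==> ev P (\<lambda>v w. \<beta> v w \<oplus>\<^bsub>P\<^esub> \<gamma> v w) l = ev P \<beta> l \<oplus>\<^bsub>P\<^esub> ev P \<gamma> l"
proof (induction l)
 case (Cons a l)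
 then show ?case using ev_closed[of l A B \<beta>] ev_closed[of l A B \<gamma>] by (cases a) (auto simp: P.a_ac)
qed simp

lemma ev_scale: "l \<in> lists (A \<times> B) ==> (\<And>v w. v \<in> A ==> w \<in> B ==> \<beta> v w \<in> car P) ==> k \<in> car K
  ==> ev P (\<lambda>v w. k \<odot>\<^bsub>P\<^esub> \<beta> v w) l = k \<odot>\<^bsub>P\<^esub> ev P \<beta> l"
proof (induction l)
 case (Cons a l)
 then show ?case using ev_closed[of l A B \<beta>] by (cases a) (auto simp: P.smult_r_distr)
qed simp

lemma ev_zero: "ev P (\<lambda>v w. \<zero>\<^bsub>P\<^esub>) l = \<zero>\<^bsub>P\<^esub>"
proof (induction l)
 case (Cons a l) then show ?case by (cases a) simp
qed simp

lemma ev_swap: "l \<in> lists (A \<times> B) ==> m \<in> lists (C \<times> D)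
  ==> (\<And>v w x y. v \<in> A ==> w \<in> B ==> x \<in> C ==> y \<in> D ==> \<beta> v w x y \<in> car P)
  ==> ev P (\<lambda>v w. ev P (\<beta> v w) m) l = ev P (\<lambda>x y. ev P (\<lambda>v w. \<beta> v w x y) l) m"
proof (induction l)
 case Nil then show ?case by (simp add: ev_zero)
next
 case (Cons a l)
 obtain v w where a: "a = (v, w)" by (cases a)
 have IH: "ev P (\<lambda>v w. ev P (\<beta> v w) m) l = ev P (\<lambda>x y. ev P (\<lambda>v w. \<beta> v w x y) l) m"
  using Cons by auto
 have "ev P (\<lambda>x y. \<beta> v w x y \<oplus>\<^bsub>P\<^esub> ev P (\<lambda>v w. \<beta> v w x y) l) m
   = ev P (\<lambda>x y. \<beta> v w x y) m \<oplus>\<^bsub>P\<^esub> ev P (\<lambda>x y. ev P (\<lambda>v w. \<beta> v w x y) l) m"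
  using Cons.prems a by (intro ev_plus[of m C D] ev_closed[of l A B]) auto
 then show ?case using IH a by simp
qed

end

lemma ev_hom: assumes P: "module K P" and Q: "module K Q" and F: "linop K P Q F"
 shows "l \<in> lists (A \<times> B) ==> (\<And>v w. v \<in> A ==> w \<in> B ==> \<beta> v w \<in> car P)
  ==> ev Q (\<lambda>v w. F (\<beta> v w)) l = F (ev P \<beta> l)"
proof (induction l)
 case Nil then show ?case using linop_zero[OF F P Q] by simp
next
 case (Cons a l)
 then show ?case using ev_closed[OF P, of l A B \<beta>] by (cases a) (auto simp: linop_add[OF F])
qed

section \<open>The congruence on words and the universal property\<close>

context
 fixes K :: "'k ring" and V :: "('k, 'a, 'y) module_scheme" and W :: "('k, 'b, 'z) module_scheme"
 assumes V: "module K V" and W: "module K W"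
begin

interpretation V: module K V by (rule V)
interpretation W: module K W by (rule W)

abbreviation "VW \<equiv> lists (car V \<times> car W)"
abbreviation "R \<equiv> tensor_rel K V W"
abbreviation "cls l \<equiv> R `` {l}"

lemma tensor_rel_lists: "(l, m) \<in> R ==> l \<in> VW \<and> m \<in> VW"
 by (induction rule: tensor_rel.induct) auto

text \<open>Each generator of the congruence is an identity that bilinear maps satisfy, so
  evaluation is constant on classes. Hence \<open>tsum\<close>, which evaluates a chosen
  representative, can be computed with any other one.\<close>

lemma tensor_rel_ev:
 assumes P: "module K P" and \<beta>: "bilin K V W P \<beta>"
 shows "(l, m) \<in> R ==> ev P \<beta> l = ev P \<beta> m"
proof (induction rule: tensor_rel.induct)
 interpret P: module K P by fact
 note c = bilin_closed[OF \<beta>]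
 { case (append l m l' m') then show ?case using tensor_rel_lists c by (simp add: ev_append[OF P, of _ "car V" "car W"]) }
 { case (commute l m) then show ?case using c by (simp add: ev_append[OF P, of _ "car V" "car W"] ev_closed[OF P, of _ "car V" "car W"] P.a_comm) }
 { case (add_left v v' w) then show ?case using c by (simp add: linop_add[OF bilin_left[OF \<beta>]]) }
 { case (add_right v w w') then show ?case using c by (simp add: linop_add[OF bilin_right[OF \<beta>]]) }
 { case (balanced k v w) then show ?case using c by (simp add: linop_smult[OF bilin_right[OF \<beta>]] linop_smult[OF bilin_left[OF \<beta>]]) }
 { case (zero w) then show ?case using linop_zero[OF bilin_left[OF \<beta>] V P] by simp }
qed auto

lemma smult_VW: "l \<in> VW ==> k \<in> car K ==> map (\<lambda>(v, w). (k \<odot>\<^bsub>V\<^esub> v, w)) l \<in> VW"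
 by (induction l) auto

lemma tensor_rel_smult:
 assumes k: "k \<in> car K"
 shows "(l, m) \<in> R ==> (map (\<lambda>(v, w). (k \<odot>\<^bsub>V\<^esub> v, w)) l, map (\<lambda>(v, w). (k \<odot>\<^bsub>V\<^esub> v, w)) m) \<in> R"
proof (induction rule: tensor_rel.induct)
 case (refl l)
 then show ?case using k by (intro tensor_rel.refl smult_VW)
next
 case (sym l m) show ?case by (rule tensor_rel.sym) (rule sym.IH)
next
 case (trans l m n) then show ?case by (blast intro: tensor_rel.trans)
next
 case (append l m l' m') then show ?case by (simp add: tensor_rel.append)
next
 case (commute l m)
 then show ?case using k unfolding map_append by (intro tensor_rel.commute smult_VW)
next
 case (add_left v v' w)
 then show ?case using k by (simp add: V.smult_r_distr tensor_rel.add_left)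
next
 case (add_right v w w')
 then show ?case using k by (simp add: tensor_rel.add_right)
next
 case (balanced j v w)
 then show ?case using k tensor_rel.balanced[of j K "k \<odot>\<^bsub>V\<^esub> v" V w W]
  by (simp add: V.smult_assoc1[symmetric] V.R.m_comm)
next
 case (zero w) then show ?case using k by (simp add: tensor_rel.zero)
qed

lemma tensor_equiv: "equiv VW R"
proof (rule equivI)
 show "refl_on VW R" by (rule refl_onI) (rule tensor_rel.refl)
 show "R \<subseteq> VW \<times> VW" by (rule subrelI) (drule tensor_rel_lists, simp only: mem_Sigma_iff)
 show "sym R" by (rule symI) (rule tensor_rel.sym)
 show "trans R" by (rule transI) (rule tensor_rel.trans)
qed

lemma cls_eq_iff: "l \<in> VW ==> m \<in> VW ==> cls l = cls m \<longleftrightarrow> (l, m) \<in> R"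
 using eq_equiv_class_iff[OF tensor_equiv] .

lemma cls_eqI: "(l, m) \<in> R ==> cls l = cls m"
 using equiv_class_eq[OF tensor_equiv] .

lemma tensor_carrier: "car (tensor K V W) = VW // R" by (simp add: tensor_def)

lemma cls_carrier: "l \<in> VW ==> cls l \<in> car (tensor K V W)"
 by (simp add: tensor_carrier quotientI)

lemma tensor_cases: assumes "t \<in> car (tensor K V W)" obtains l where "l \<in> VW" "t = cls l"
 using assms unfolding tensor_carrier by (rule quotientE) (rule that)

lemma tensor_rep: assumes t: "t \<in> car (tensor K V W)"
 shows "(SOME l. l \<in> t) \<in> VW" "cls (SOME l. l \<in> t) = t"
proof -
 obtain l where l: "l \<in> VW" "t = cls l" using t by (rule tensor_cases)
 then have "l \<in> t" using tensor_rel.refl[of l V W K] by simp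
 then have "(SOME l. l \<in> t) \<in> t" by (rule someI)
 then have *: "(l, SOME l. l \<in> t) \<in> R" using l by simp
 then show "(SOME l. l \<in> t) \<in> VW" using tensor_rel_lists by blast
 show "cls (SOME l. l \<in> t) = t" by (rule HOL.trans[OF cls_eqI[OF *, symmetric] l(2)[symmetric]])
qed

lemma cls_const: "l \<in> VW ==> (\<And>m. (l, m) \<in> R ==> f m = f l) ==> (\<Union>m\<in>cls l. f m) = f l"
 by (rule UN_constant_eq[of l]) (auto intro: tensor_rel.refl)

lemma tensor_add: assumes "l \<in> VW" "m \<in> VW" shows "cls l \<oplus>\<^bsub>tensor K V W\<^esub> cls m = cls (l @ m)"
proof -
 have "(\<Union>l'\<in>cls l. \<Union>m'\<in>cls m. cls (l' @ m')) = (\<Union>m'\<in>cls m. cls (l @ m'))"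
 proof (rule cls_const[OF assms(1)])
  fix l' assume l': "(l, l') \<in> R"
  have "cls (l' @ m') = cls (l @ m')" if "m' \<in> cls m" for m'
   using that l' by (intro cls_eqI tensor_rel.append tensor_rel.sym[OF l'] tensor_rel.refl) (use tensor_rel_lists in blast)
  then show "(\<Union>m'\<in>cls m. cls (l' @ m')) = (\<Union>m'\<in>cls m. cls (l @ m'))" by (rule SUP_cong[OF HOL.refl])
 qed
 also have "\<dots> = cls (l @ m)"
 proof (rule cls_const[OF assms(2)])
  fix m' assume "(m, m') \<in> R"
  then show "cls (l @ m') = cls (l @ m)"
   using assms by (intro cls_eqI tensor_rel.append tensor_rel.sym[of m m'] tensor_rel.refl) auto
 qed
 finally show ?thesis by (simp add: tensor_def)
qed

lemma tensor_smult: assumes "l \<in> VW" "k \<in> car K"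
 shows "k \<odot>\<^bsub>tensor K V W\<^esub> cls l = cls (map (\<lambda>(v, w). (k \<odot>\<^bsub>V\<^esub> v, w)) l)"
proof -
 have "(\<Union>m\<in>cls l. cls (map (\<lambda>(v, w). (k \<odot>\<^bsub>V\<^esub> v, w)) m)) = cls (map (\<lambda>(v, w). (k \<odot>\<^bsub>V\<^esub> v, w)) l)"
  by (rule cls_const[OF assms(1)], rule cls_eqI, rule tensor_rel_smult[OF assms(2)], rule tensor_rel.sym)
 then show ?thesis by (simp add: tensor_def)
qed

lemma tensor_zero: "\<zero>\<^bsub>tensor K V W\<^esub> = cls []" by (simp add: tensor_def)

text \<open>Each letter splits by additivity on the left; the commutation rule then sorts the
  letters into the two blocks. For the scalars -1 and 1 it provides the negatives in the tensor
  product.\<close>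

lemma tensor_rel_distrib:
 assumes a: "a \<in> car K" and b: "b \<in> car K"
 shows "l \<in> VW ==> (map (\<lambda>(v, w). ((a \<oplus>\<^bsub>K\<^esub> b) \<odot>\<^bsub>V\<^esub> v, w)) l,
  map (\<lambda>(v, w). (a \<odot>\<^bsub>V\<^esub> v, w)) l @ map (\<lambda>(v, w). (b \<odot>\<^bsub>V\<^esub> v, w)) l) \<in> R"
proof (induction l)
 case Nil show ?case by (simp add: tensor_rel.refl)
next
 case (Cons x l)
 obtain v w where x: "x = (v, w)" by (cases x)
 then have vw: "v \<in> car V" "w \<in> car W" "l \<in> VW" using Cons.prems by auto
 let ?a = "map (\<lambda>(v, w). (a \<odot>\<^bsub>V\<^esub> v, w)) l" and ?b = "map (\<lambda>(v, w). (b \<odot>\<^bsub>V\<^esub> v, w)) l"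
 let ?ab = "map (\<lambda>(v, w). ((a \<oplus>\<^bsub>K\<^esub> b) \<odot>\<^bsub>V\<^esub> v, w)) l"
 have ab: "?a \<in> VW" "?b \<in> VW" using smult_VW vw a b by blast+
 have "([((a \<oplus>\<^bsub>K\<^esub> b) \<odot>\<^bsub>V\<^esub> v, w)] @ ?ab, [(a \<odot>\<^bsub>V\<^esub> v, w), (b \<odot>\<^bsub>V\<^esub> v, w)] @ (?a @ ?b)) \<in> R"
  using vw a b Cons.IH by (intro tensor_rel.append) (auto simp: V.smult_l_distr intro: tensor_rel.add_left)
 moreover have "([(a \<odot>\<^bsub>V\<^esub> v, w)] @ ([(b \<odot>\<^bsub>V\<^esub> v, w)] @ ?a) @ ?b, [(a \<odot>\<^bsub>V\<^esub> v, w)] @ (?a @ [(b \<odot>\<^bsub>V\<^esub> v, w)]) @ ?b) \<in> R"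
  using vw a b ab by (intro tensor_rel.append tensor_rel.refl tensor_rel.commute) auto
 ultimately show ?case using x by (auto intro: tensor_rel.trans)
qed

lemma tensor_rel_zero_smult: "l \<in> VW ==> (map (\<lambda>(v, w). (\<zero>\<^bsub>K\<^esub> \<odot>\<^bsub>V\<^esub> v, w)) l, []) \<in> R"
proof (induction l)
 case Nil show ?case by (simp add: tensor_rel.refl)
next
 case (Cons x l)
 obtain v w where x: "x = (v, w)" by (cases x)
 have "([(\<zero>\<^bsub>V\<^esub>, w)] @ map (\<lambda>(v, w). (\<zero>\<^bsub>K\<^esub> \<odot>\<^bsub>V\<^esub> v, w)) l, [] @ []) \<in> R"
  using Cons x by (intro tensor_rel.append tensor_rel.zero) auto
 then show ?case using x Cons.prems by simp
qed

lemma tensor_module: "module K (tensor K V W)"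
proof (rule moduleI)
 let ?T = "tensor K V W"
 show "cring K" by (rule V.is_cring)
 have m1: "map (\<lambda>(v, w). (\<one>\<^bsub>K\<^esub> \<odot>\<^bsub>V\<^esub> v, w)) l = l" if "l \<in> VW" for l
  using that by (intro map_idI) auto
 show "abelian_group ?T"
 proof (rule abelian_groupI)
  fix x assume "x \<in> car ?T"
  then obtain l where l: "l \<in> VW" "x = cls l" by (rule tensor_cases)
  have "(\<ominus>\<^bsub>K\<^esub> \<one>\<^bsub>K\<^esub>) \<odot>\<^bsub>?T\<^esub> x \<oplus>\<^bsub>?T\<^esub> \<one>\<^bsub>K\<^esub> \<odot>\<^bsub>?T\<^esub> x = \<zero>\<^bsub>?T\<^esub>"
   using cls_eqI[OF tensor_rel_distrib[of "\<ominus>\<^bsub>K\<^esub> \<one>\<^bsub>K\<^esub>" "\<one>\<^bsub>K\<^esub>" l]] cls_eqI[OF tensor_rel_zero_smult[OF l(1)]] l smult_VW[OF l(1)]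
   by (simp add: tensor_smult tensor_add tensor_zero V.R.l_neg)
  moreover have "\<one>\<^bsub>K\<^esub> \<odot>\<^bsub>?T\<^esub> x = x" using l m1 by (simp add: tensor_smult)
  moreover have "(\<ominus>\<^bsub>K\<^esub> \<one>\<^bsub>K\<^esub>) \<odot>\<^bsub>?T\<^esub> x \<in> car ?T"
   using l smult_VW[OF l(1), of "\<ominus>\<^bsub>K\<^esub> \<one>\<^bsub>K\<^esub>"] by (simp add: tensor_smult cls_carrier)
  ultimately show "\<exists>y\<in>car ?T. y \<oplus>\<^bsub>?T\<^esub> x = \<zero>\<^bsub>?T\<^esub>" by auto
  show "\<zero>\<^bsub>?T\<^esub> \<oplus>\<^bsub>?T\<^esub> x = x" using l by (simp add: tensor_zero tensor_add)
  fix y assume "y \<in> car ?T"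
  then obtain m where m: "m \<in> VW" "y = cls m" by (rule tensor_cases)
  show "x \<oplus>\<^bsub>?T\<^esub> y \<in> car ?T" using l m by (simp add: tensor_add cls_carrier)
  show "x \<oplus>\<^bsub>?T\<^esub> y = y \<oplus>\<^bsub>?T\<^esub> x" using l m by (simp add: tensor_add cls_eqI tensor_rel.commute)
  fix z assume "z \<in> car ?T"
  then obtain n where n: "n \<in> VW" "z = cls n" by (rule tensor_cases)
  show "x \<oplus>\<^bsub>?T\<^esub> y \<oplus>\<^bsub>?T\<^esub> z = x \<oplus>\<^bsub>?T\<^esub> (y \<oplus>\<^bsub>?T\<^esub> z)" using l m n by (simp add: tensor_add)
 next
  show "\<zero>\<^bsub>?T\<^esub> \<in> car ?T" by (simp add: tensor_zero cls_carrier)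
 qed
 fix x assume "x \<in> car ?T"
 then obtain l where l: "l \<in> VW" "x = cls l" by (rule tensor_cases)
 show "\<one>\<^bsub>K\<^esub> \<odot>\<^bsub>?T\<^esub> x = x" using l m1 by (simp add: tensor_smult)
 fix a assume a: "a \<in> car K"
 note al = smult_VW[OF l(1) a]
 show "a \<odot>\<^bsub>?T\<^esub> x \<in> car ?T" using l a al by (simp add: tensor_smult cls_carrier)
 { fix b assume b: "b \<in> car K"
  show "(a \<oplus>\<^bsub>K\<^esub> b) \<odot>\<^bsub>?T\<^esub> x = a \<odot>\<^bsub>?T\<^esub> x \<oplus>\<^bsub>?T\<^esub> b \<odot>\<^bsub>?T\<^esub> x"
   using l a b al smult_VW[OF l(1) b] cls_eqI[OF tensor_rel_distrib[OF a b l(1)]] by (simp add: tensor_smult tensor_add)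
  have "map (\<lambda>(v, w). ((a \<otimes>\<^bsub>K\<^esub> b) \<odot>\<^bsub>V\<^esub> v, w)) l = map (\<lambda>(v, w). (a \<odot>\<^bsub>V\<^esub> v, w)) (map (\<lambda>(v, w). (b \<odot>\<^bsub>V\<^esub> v, w)) l)"
   using l(1) a b by (induction l) (auto simp: V.smult_assoc1)
  then show "(a \<otimes>\<^bsub>K\<^esub> b) \<odot>\<^bsub>?T\<^esub> x = a \<odot>\<^bsub>?T\<^esub> (b \<odot>\<^bsub>?T\<^esub> x)"
   using l a b smult_VW[OF l(1) b] by (simp only: l(2) tensor_smult V.R.m_closed) }
 fix y assume "y \<in> car ?T"
 then obtain m where m: "m \<in> VW" "y = cls m" by (rule tensor_cases)
 show "a \<odot>\<^bsub>?T\<^esub> (x \<oplus>\<^bsub>?T\<^esub> y) = a \<odot>\<^bsub>?T\<^esub> x \<oplus>\<^bsub>?T\<^esub> a \<odot>\<^bsub>?T\<^esub> y"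
  using l m a al smult_VW[OF m(1) a] by (simp add: tensor_smult tensor_add)
qed

lemma pure_closed: "v \<in> car V ==> w \<in> car W ==> pure K V W v w \<in> car (tensor K V W)"
 by (simp add: pure_def cls_carrier)

lemma pure_bilin: "bilin K V W (tensor K V W) (pure K V W)"
proof (intro bilinI linopI)
 fix v w k assume v: "v \<in> car V" and w: "w \<in> car W"
 show "pure K V W v w \<in> car (tensor K V W)" "pure K V W v w \<in> car (tensor K V W)"
  using v w by (simp_all add: pure_closed)
 { fix w' assume "w' \<in> car W"
  then show "pure K V W v (w \<oplus>\<^bsub>W\<^esub> w') = pure K V W v w \<oplus>\<^bsub>tensor K V W\<^esub> pure K V W v w'"
   using v w by (simp add: pure_def tensor_add cls_eqI tensor_rel.add_right) }
 { fix v' assume "v' \<in> car V"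
  then show "pure K V W (v \<oplus>\<^bsub>V\<^esub> v') w = pure K V W v w \<oplus>\<^bsub>tensor K V W\<^esub> pure K V W v' w"
   using v w by (simp add: pure_def tensor_add cls_eqI tensor_rel.add_left) }
 assume k: "k \<in> car K"
 show "pure K V W (k \<odot>\<^bsub>V\<^esub> v) w = k \<odot>\<^bsub>tensor K V W\<^esub> pure K V W v w"
  using v w k by (simp add: pure_def tensor_smult)
 then show "pure K V W v (k \<odot>\<^bsub>W\<^esub> w) = k \<odot>\<^bsub>tensor K V W\<^esub> pure K V W v w"
  using v w k cls_eqI[OF tensor_rel.balanced[OF k v w]] by (simp add: pure_def)
qed

lemma tsum_cls: "module K P ==> bilin K V W P \<beta> ==> l \<in> VW ==> tsum P \<beta> (cls l) = ev P \<beta> l"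
proof -
 assume P: "module K P" and \<beta>: "bilin K V W P \<beta>" and l: "l \<in> VW"
 have "(SOME m. m \<in> cls l) \<in> VW" "cls (SOME m. m \<in> cls l) = cls l" using tensor_rep[OF cls_carrier[OF l]] by auto
 then have "(SOME m. m \<in> cls l, l) \<in> R" using cls_eq_iff l by blast
 then show ?thesis unfolding tsum_ev using tensor_rel_ev[OF P \<beta>] by blast
qed

lemma tsum_linop: assumes P: "module K P" and \<beta>: "bilin K V W P \<beta>" shows "linop K (tensor K V W) P (tsum P \<beta>)"
proof (rule linopI)
 note c = bilin_closed[OF \<beta>]
 fix x assume "x \<in> car (tensor K V W)"
 then obtain l where l: "l \<in> VW" "x = cls l" by (rule tensor_cases)
 show "tsum P \<beta> x \<in> car P" using l c by (simp add: tsum_cls[OF P \<beta>] ev_closed[OF P, of _ "car V" "car W"])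
 { fix y assume "y \<in> car (tensor K V W)"
  then obtain m where m: "m \<in> VW" "y = cls m" by (rule tensor_cases)
  then show "tsum P \<beta> (x \<oplus>\<^bsub>tensor K V W\<^esub> y) = tsum P \<beta> x \<oplus>\<^bsub>P\<^esub> tsum P \<beta> y"
   using l c by (simp add: tensor_add tsum_cls[OF P \<beta>] ev_append[OF P, of _ "car V" "car W"]) }
 { fix k assume k: "k \<in> car K"
  have "ev P \<beta> (map (\<lambda>(v, w). (k \<odot>\<^bsub>V\<^esub> v, w)) l) = ev P (\<lambda>v w. k \<odot>\<^bsub>P\<^esub> \<beta> v w) l"
   using l(1) by (induction l) (auto simp: linop_smult[OF bilin_left[OF \<beta>] k])
  also have "\<dots> = k \<odot>\<^bsub>P\<^esub> ev P \<beta> l" using l c k by (intro ev_scale[OF P, of _ "car V" "car W"]) auto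
  finally show "tsum P \<beta> (k \<odot>\<^bsub>tensor K V W\<^esub> x) = k \<odot>\<^bsub>P\<^esub> tsum P \<beta> x"
   using l k smult_VW[OF l(1) k] by (simp add: tensor_smult tsum_cls[OF P \<beta>]) }
qed

lemma tsum_pure: assumes P: "module K P" and \<beta>: "bilin K V W P \<beta>" and "v \<in> car V" "w \<in> car W"
 shows "tsum P \<beta> (pure K V W v w) = \<beta> v w"
proof -
 interpret P: module K P by fact
 show ?thesis using assms bilin_closed[OF \<beta>] by (simp add: pure_def tsum_cls[OF P \<beta>])
qed

lemma tsum_closed: "module K P ==> t \<in> car (tensor K V W) ==>
  (\<And>v w. v \<in> car V ==> w \<in> car W ==> \<beta> v w \<in> car P) ==> tsum P \<beta> t \<in> car P"
 unfolding tsum_ev by (rule ev_closed[OF _ tensor_rep(1)])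

lemma tsum_cong: "t \<in> car (tensor K V W) ==>
  (\<And>v w. v \<in> car V ==> w \<in> car W ==> \<beta> v w = \<gamma> v w) ==> tsum P \<beta> t = tsum P \<gamma> t"
 unfolding tsum_ev
proof -
 assume t: "t \<in> car (tensor K V W)" and eq: "\<And>v w. v \<in> car V ==> w \<in> car W ==> \<beta> v w = \<gamma> v w"
 have "ev P \<beta> l = ev P \<gamma> l" if "l \<in> VW" for l using that by (induction l) (auto simp: eq)
 then show "ev P \<beta> (SOME l. l \<in> t) = ev P \<gamma> (SOME l. l \<in> t)" using tensor_rep(1)[OF t] by blast
qed

lemma tsum_hom: "module K P ==> module K Q ==> linop K P Q F ==> t \<in> car (tensor K V W) ==>
  (\<And>v w. v \<in> car V ==> w \<in> car W ==> \<beta> v w \<in> car P) ==>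
  F (tsum P \<beta> t) = tsum Q (\<lambda>v w. F (\<beta> v w)) t"
 unfolding tsum_ev by (rule ev_hom[OF _ _ _ tensor_rep(1), symmetric])

lemma tsum_linop_param:
 assumes P: "module K P" and t: "t \<in> car (tensor K V W)"
  and \<beta>: "\<And>v w. v \<in> car V ==> w \<in> car W ==> linop K U P (\<lambda>x. \<beta> x v w)"
 shows "linop K U P (\<lambda>x. tsum P (\<beta> x) t)"
proof (rule linopI)
 note c = linop_closed[OF \<beta>] and r = tensor_rep(1)[OF t]
 fix x assume x: "x \<in> car U"
 show "tsum P (\<beta> x) t \<in> car P" by (rule tsum_closed[OF P t c[OF _ _ x]])
 { fix y assume y: "y \<in> car U"
  have "tsum P (\<beta> (x \<oplus>\<^bsub>U\<^esub> y)) t = tsum P (\<lambda>v w. \<beta> x v w \<oplus>\<^bsub>P\<^esub> \<beta> y v w) t"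
   by (rule tsum_cong[OF t]) (simp add: linop_add[OF \<beta> x y])
  also have "\<dots> = tsum P (\<beta> x) t \<oplus>\<^bsub>P\<^esub> tsum P (\<beta> y) t"
   unfolding tsum_ev by (rule ev_plus[OF P r c[OF _ _ x] c[OF _ _ y]])
  finally show "tsum P (\<beta> (x \<oplus>\<^bsub>U\<^esub> y)) t = tsum P (\<beta> x) t \<oplus>\<^bsub>P\<^esub> tsum P (\<beta> y) t" . }
 { fix k assume k: "k \<in> car K"
  have "tsum P (\<beta> (k \<odot>\<^bsub>U\<^esub> x)) t = tsum P (\<lambda>v w. k \<odot>\<^bsub>P\<^esub> \<beta> x v w) t"
   by (rule tsum_cong[OF t]) (simp add: linop_smult[OF \<beta> k x])
  also have "\<dots> = k \<odot>\<^bsub>P\<^esub> tsum P (\<beta> x) t"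
   unfolding tsum_ev by (rule ev_scale[OF P r c[OF _ _ x] k])
  finally show "tsum P (\<beta> (k \<odot>\<^bsub>U\<^esub> x)) t = k \<odot>\<^bsub>P\<^esub> tsum P (\<beta> x) t" . }
qed

text \<open>By induction on words every tensor is a finite sum of pure tensors.\<close>

lemma tensor_linop_eqI:
 assumes P: "module K P" and f: "linop K (tensor K V W) P f" and g: "linop K (tensor K V W) P g"
  and eq: "\<And>v w. v \<in> car V ==> w \<in> car W ==> f (pure K V W v w) = g (pure K V W v w)"
  and t: "t \<in> car (tensor K V W)"
 shows "f t = g t"
proof -
 have *: "l \<in> VW ==> f (cls l) = g (cls l)" for l
 proof (induction l)
  case Nil
  show ?case using linop_zero[OF f tensor_module P] linop_zero[OF g tensor_module P] by (simp add: tensor_zero)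
 next
  case (Cons x l)
  obtain v w where x: "x = (v, w)" by (cases x)
  have vw: "v \<in> car V" "w \<in> car W" "l \<in> VW" using Cons.prems by (simp_all add: x)
  have "cls (x # l) = pure K V W v w \<oplus>\<^bsub>tensor K V W\<^esub> cls l"
   using vw x tensor_add[of "[(v, w)]" l] by (simp add: pure_def)
  then show ?case
   using vw eq Cons.IH linop_add[OF f pure_closed cls_carrier] linop_add[OF g pure_closed cls_carrier] by simp
 qed
 show ?thesis using t by (rule tensor_cases) (simp add: *)
qed

end

lemma tsum_swap:
 assumes "module K P" "module K V" "module K W" "module K V'" "module K W'"
  and t: "t \<in> car (tensor K V W)" and u: "u \<in> car (tensor K V' W')"
  and c: "\<And>v w x y. v \<in> car V ==> w \<in> car W ==> x \<in> car V' ==> y \<in> car W' ==> \<beta> v w x y \<in> car P"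
 shows "tsum P (\<lambda>v w. tsum P (\<beta> v w) u) t = tsum P (\<lambda>x y. tsum P (\<lambda>v w. \<beta> v w x y) t) u"
 unfolding tsum_ev
 by (rule ev_swap[OF assms(1) tensor_rep(1)[OF assms(2,3) t] tensor_rep(1)[OF assms(4,5) u] c])

section \<open>Sweedler sums\<close>

definition (in hopf_algebra) sw :: "('k, 'p, 'z) module_scheme => ('h => 'h => 'p) => 'h => 'p" where
 "sw P \<beta> h = tsum P \<beta> (comult H h)"

text \<open>The rules build up linear and bilinear expressions from their parts. They discharge the
  multilinearity on which the independence of Sweedler sums from representatives depends.\<close>

named_theorems lin

declare bilinI [lin] linop_id [lin]

context hopf_algebra
begin

interpretation H: ring H by (rule ring)
interpretation HV: module K H by (rule vector_space)

abbreviation S where "S \<equiv> antipode H"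
abbreviation eps where "eps \<equiv> counit H"

lemma S_closed [simp]: "a \<in> car H ==> S a \<in> car H"
 using antipode_bij by (auto simp: bij_betw_def)

lemma S_surj: assumes "a \<in> car H" obtains b where "b \<in> car H" "a = S b"
 using assms antipode_bij by (auto simp: bij_betw_def)

lemma eps_closed [simp]: "a \<in> car H ==> eps a \<in> car K"
 by (rule counit_closed)

lemma comult_lin: "linop K H (tensor K H H) (comult H)"
 by (rule linopI) (simp_all add: comult_closed comult_add comult_smult)

lemma mult_lin_left [lin]: "linop K V H f ==> b \<in> car H ==> linop K V H (\<lambda>x. f x \<cdot> b)"
 by (rule linop_comp[of K H H "\<lambda>x. x \<cdot> b"]) (auto intro!: linopI simp: smult_mult_left H.l_distr)

lemma mult_lin_right [lin]: "linop K V H f ==> b \<in> car H ==> linop K V H (\<lambda>x. b \<cdot> f x)"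
 by (rule linop_comp[of K H H "\<lambda>x. b \<cdot> x"]) (auto intro!: linopI simp: smult_mult_right H.r_distr)

lemma S_lin [lin]: "linop K V H f ==> linop K V H (\<lambda>x. S (f x))"
 by (rule linop_comp[of K H H S]) (auto intro!: linopI simp: antipode_add antipode_smult)

declare linop_smult_const [lin]

text \<open>As a congruence rule it supplies, during rewriting inside a sum, the membership of both
  legs in H, which almost all equations of the Hopf algebra require.\<close>

lemma sw_cong [cong]:
 "P = P' ==> h = h' ==> h' \<in> car H ==> (\<And>a b. a \<in> car H ==> b \<in> car H ==> \<beta> a b = \<gamma> a b) ==> sw P \<beta> h = sw P' \<gamma> h'"
 unfolding sw_def using tsum_cong[OF vector_space vector_space comult_closed] by blast

lemma sw_closed [simp]:
 "module K P ==> h \<in> car H ==> (\<And>a b. a \<in> car H ==> b \<in> car H ==> \<beta> a b \<in> car P) ==> sw P \<beta> h \<in> car P"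
 unfolding sw_def by (rule tsum_closed[OF vector_space vector_space _ comult_closed])

lemma sw_lin [lin]:
 assumes "module K P" "linop K V H f" "bilin K H H P \<beta>" shows "linop K V P (\<lambda>x. sw P \<beta> (f x))"
 unfolding sw_def
 by (rule linop_comp[OF linop_comp[OF tsum_linop[OF vector_space vector_space assms(1,3)] comult_lin] assms(2)])

lemma sw_lin_param [lin]:
 assumes "module K P" "h \<in> car H"
  and "\<And>a b. a \<in> car H ==> b \<in> car H ==> linop K V P (\<lambda>x. \<beta> x a b)"
 shows "linop K V P (\<lambda>x. sw P (\<beta> x) h)"
 unfolding sw_def
 by (rule tsum_linop_param[OF vector_space vector_space assms(1) comult_closed[OF assms(2)] assms(3)])

lemma sw_hom:
 assumes "module K P" "module K Q" "linop K P Q F" "h \<in> car H"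
  and "\<And>a b. a \<in> car H ==> b \<in> car H ==> \<beta> a b \<in> car P"
 shows "F (sw P \<beta> h) = sw Q (\<lambda>a b. F (\<beta> a b)) h"
 unfolding sw_def by (rule tsum_hom[OF vector_space vector_space assms(1-3) comult_closed[OF assms(4)] assms(5)])

lemma sw_smult:
 assumes "module K P" "h \<in> car H" "k \<in> car K"
  and "\<And>a b. a \<in> car H ==> b \<in> car H ==> \<beta> a b \<in> car P"
 shows "sw P (\<lambda>a b. k \<odot>\<^bsub>P\<^esub> \<beta> a b) h = k \<odot>\<^bsub>P\<^esub> sw P \<beta> h"
 by (rule sw_hom[OF assms(1,1) linop_smult_const[OF assms(1) linop_id assms(3)] assms(2,4), symmetric])

lemma sw_add:
 assumes "module K P" "h \<in> car H"
  and "\<And>a b. a \<in> car H ==> b \<in> car H ==> \<beta> a b \<in> car P"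
  and "\<And>a b. a \<in> car H ==> b \<in> car H ==> \<gamma> a b \<in> car P"
 shows "sw P (\<lambda>a b. \<beta> a b \<oplus>\<^bsub>P\<^esub> \<gamma> a b) h = sw P \<beta> h \<oplus>\<^bsub>P\<^esub> sw P \<gamma> h"
 unfolding sw_def tsum_ev
 by (rule ev_plus[OF assms(1) tensor_rep(1)[OF vector_space vector_space comult_closed[OF assms(2)]] assms(3,4)])

lemma sw_swap:
 assumes "module K P" "g \<in> car H" "h \<in> car H"
  and "\<And>a b x y. a \<in> car H ==> b \<in> car H ==> x \<in> car H ==> y \<in> car H ==> \<beta> a b x y \<in> car P"
 shows "sw P (\<lambda>a b. sw P (\<beta> a b) h) g = sw P (\<lambda>x y. sw P (\<lambda>a b. \<beta> a b x y) g) h"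
 unfolding sw_def
 by (rule tsum_swap[OF assms(1) vector_space vector_space vector_space vector_space comult_closed[OF assms(2)] comult_closed[OF assms(3)] assms(4)])

lemma pure_lin_right [lin]: "module K V ==> module K W ==> linop K U W f ==> v \<in> car V ==> linop K U (tensor K V W) (\<lambda>x. pure K V W v (f x))"
 by (rule linop_comp[OF bilin_right[OF pure_bilin]])

lemma pure_lin_left [lin]: "module K V ==> module K W ==> linop K U V f ==> w \<in> car W ==> linop K U (tensor K V W) (\<lambda>x. pure K V W (f x) w)"
 by (rule linop_comp[OF bilin_left[OF pure_bilin]])

lemmas HH_module = tensor_module[OF vector_space vector_space]

text \<open>A trilinear \<beta> induces a linear map F on H \<otimes> (H \<otimes> H). Applying F to
  the two sides of coassociativity gives the two iterated sums.\<close>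

lemma sw_coassoc:
 assumes P: "module K P" and h: "h \<in> car H"
  and 1: "\<And>x y. x \<in> car H ==> y \<in> car H ==> linop K H P (\<lambda>z. \<beta> z x y)"
  and 2: "\<And>x y. x \<in> car H ==> y \<in> car H ==> linop K H P (\<lambda>z. \<beta> x z y)"
  and 3: "\<And>x y. x \<in> car H ==> y \<in> car H ==> linop K H P (\<lambda>z. \<beta> x y z)"
 shows "sw P (\<lambda>a b. sw P (\<lambda>x y. \<beta> x y b) a) h = sw P (\<lambda>a b. sw P (\<lambda>x y. \<beta> a x y) b) h"
proof -
 let ?HH = "tensor K H H" and ?H3 = "tensor K H (tensor K H H)"
 have H3: "module K ?H3" by (rule tensor_module[OF vector_space HH_module])
 define F where "F = tsum P (\<lambda>x t. tsum P (\<lambda>y z. \<beta> x y z) t)"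
 have b23: "bilin K H H P (\<lambda>y z. \<beta> x y z)" if "x \<in> car H" for x
  using that 2 3 by (intro bilinI)
 have bl: "bilin K H ?HH P (\<lambda>x t. tsum P (\<lambda>y z. \<beta> x y z) t)"
 proof (rule bilinI)
  show "linop K ?HH P (\<lambda>t. tsum P (\<lambda>y z. \<beta> v y z) t)" if "v \<in> car H" for v
   by (rule tsum_linop[OF vector_space vector_space P b23[OF that]])
  show "linop K H P (\<lambda>x. tsum P (\<lambda>y z. \<beta> x y z) t)" if "t \<in> car ?HH" for t
   by (rule tsum_linop_param[OF vector_space vector_space P that 1])
 qed
 have F: "linop K ?H3 P F" unfolding F_def by (rule tsum_linop[OF vector_space HH_module P bl])
 have Fp: "F (pure K H ?HH x t) = tsum P (\<lambda>y z. \<beta> x y z) t" if "x \<in> car H" "t \<in> car ?HH" for x t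
  unfolding F_def by (rule tsum_pure[OF vector_space HH_module P bl that])
 have pc: "pure K H H x y \<in> car ?HH" if "x \<in> car H" "y \<in> car H" for x y
  by (rule pure_closed[OF vector_space vector_space that])
 have pc3: "pure K H ?HH x t \<in> car ?H3" if "x \<in> car H" "t \<in> car ?HH" for x t
  by (rule pure_closed[OF vector_space HH_module that])
 have "F (sw ?H3 (\<lambda>a b. sw ?H3 (\<lambda>x y. pure K H ?HH x (pure K H H y b)) a) h)
   = sw P (\<lambda>a b. F (sw ?H3 (\<lambda>x y. pure K H ?HH x (pure K H H y b)) a)) h"
  by (rule sw_hom[OF H3 P F h]) (simp add: H3 pc pc3)
 also have "\<dots> = sw P (\<lambda>a b. sw P (\<lambda>x y. F (pure K H ?HH x (pure K H H y b))) a) h"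
  using h by (intro sw_cong HOL.refl sw_hom[OF H3 P F]) (simp_all add: pc pc3)
 also have "\<dots> = sw P (\<lambda>a b. sw P (\<lambda>x y. \<beta> x y b) a) h"
  using h by (simp add: Fp pc tsum_pure[OF vector_space vector_space P b23])
 finally have L: "F (sw ?H3 (\<lambda>a b. sw ?H3 (\<lambda>x y. pure K H ?HH x (pure K H H y b)) a) h) = sw P (\<lambda>a b. sw P (\<lambda>x y. \<beta> x y b) a) h" .
 have "F (sw ?H3 (\<lambda>a b. pure K H ?HH a (comult H b)) h) = sw P (\<lambda>a b. F (pure K H ?HH a (comult H b))) h"
  by (rule sw_hom[OF H3 P F h]) (simp add: pc3 comult_closed)
 also have "\<dots> = sw P (\<lambda>a b. sw P (\<lambda>x y. \<beta> a x y) b) h"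
  using h by (simp add: Fp comult_closed sw_def)
 finally show ?thesis using L coassoc[OF h] unfolding sw_def by simp
qed

lemma sw_counit_left:
 assumes P: "module K P" and F: "linop K H P F" and h: "h \<in> car H"
 shows "sw P (\<lambda>a b. eps a \<odot>\<^bsub>P\<^esub> F b) h = F h"
proof -
 have "F (sw H (\<lambda>a b. eps a \<odot>\<^bsub>H\<^esub> b) h) = sw P (\<lambda>a b. F (eps a \<odot>\<^bsub>H\<^esub> b)) h"
  by (rule sw_hom[OF vector_space P F h]) simp
 then show ?thesis using h counit_left[OF h] by (simp add: linop_smult[OF F] flip: sw_def)
qed

lemma sw_counit_right:
 assumes P: "module K P" and F: "linop K H P F" and h: "h \<in> car H"
 shows "sw P (\<lambda>a b. eps b \<odot>\<^bsub>P\<^esub> F a) h = F h"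
proof -
 have "F (sw H (\<lambda>a b. eps b \<odot>\<^bsub>H\<^esub> a) h) = sw P (\<lambda>a b. F (eps b \<odot>\<^bsub>H\<^esub> a)) h"
  by (rule sw_hom[OF vector_space P F h]) simp
 then show ?thesis using h counit_right[OF h] by (simp add: linop_smult[OF F] flip: sw_def)
qed

lemma sw_antipode_left:
 assumes P: "module K P" and F: "linop K H P F" and h: "h \<in> car H"
 shows "sw P (\<lambda>a b. F (S a \<cdot> b)) h = eps h \<odot>\<^bsub>P\<^esub> F \<one>\<^bsub>H\<^esub>"
proof -
 have "F (sw H (\<lambda>a b. S a \<cdot> b) h) = sw P (\<lambda>a b. F (S a \<cdot> b)) h"
  by (rule sw_hom[OF vector_space P F h]) simp
 then show ?thesis using h antipode_left[OF h] by (simp add: linop_smult[OF F] flip: sw_def)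
qed

lemma sw_antipode_right:
 assumes P: "module K P" and F: "linop K H P F" and h: "h \<in> car H"
 shows "sw P (\<lambda>a b. F (a \<cdot> S b)) h = eps h \<odot>\<^bsub>P\<^esub> F \<one>\<^bsub>H\<^esub>"
proof -
 have "F (sw H (\<lambda>a b. a \<cdot> S b) h) = sw P (\<lambda>a b. F (a \<cdot> S b)) h"
  by (rule sw_hom[OF vector_space P F h]) simp
 then show ?thesis using h antipode_right[OF h] by (simp add: linop_smult[OF F] flip: sw_def)
qed

lemma sw_one: assumes P: "module K P" and \<beta>: "bilin K H H P \<beta>" shows "sw P \<beta> \<one>\<^bsub>H\<^esub> = \<beta> \<one>\<^bsub>H\<^esub> \<one>\<^bsub>H\<^esub>"
 unfolding sw_def comult_one by (rule tsum_pure[OF vector_space vector_space P \<beta>]) simp_all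

lemma sw_mult:
 assumes P: "module K P" and \<beta>: "bilin K H H P \<beta>" and a: "a \<in> car H" and b: "b \<in> car H"
 shows "sw P \<beta> (a \<cdot> b) = sw P (\<lambda>a\<^sub>1 a\<^sub>2. sw P (\<lambda>b\<^sub>1 b\<^sub>2. \<beta> (a\<^sub>1 \<cdot> b\<^sub>1) (a\<^sub>2 \<cdot> b\<^sub>2)) b) a"
proof -
 let ?HH = "tensor K H H"
 have F: "linop K ?HH P (tsum P \<beta>)" by (rule tsum_linop[OF vector_space vector_space P \<beta>])
 have pc: "pure K H H x y \<in> car ?HH" if "x \<in> car H" "y \<in> car H" for x y
  by (rule pure_closed[OF vector_space vector_space that])
 have "sw P \<beta> (a \<cdot> b) = tsum P \<beta> (sw ?HH (\<lambda>a\<^sub>1 a\<^sub>2. sw ?HH (\<lambda>b\<^sub>1 b\<^sub>2. pure K H H (a\<^sub>1 \<cdot> b\<^sub>1) (a\<^sub>2 \<cdot> b\<^sub>2)) b) a)"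
  using comult_mult[OF a b] by (simp add: sw_def)
 also have "\<dots> = sw P (\<lambda>a\<^sub>1 a\<^sub>2. tsum P \<beta> (sw ?HH (\<lambda>b\<^sub>1 b\<^sub>2. pure K H H (a\<^sub>1 \<cdot> b\<^sub>1) (a\<^sub>2 \<cdot> b\<^sub>2)) b)) a"
  by (rule sw_hom[OF HH_module P F a]) (simp add: HH_module b pc)
 also have "\<dots> = sw P (\<lambda>a\<^sub>1 a\<^sub>2. sw P (\<lambda>b\<^sub>1 b\<^sub>2. tsum P \<beta> (pure K H H (a\<^sub>1 \<cdot> b\<^sub>1) (a\<^sub>2 \<cdot> b\<^sub>2))) b) a"
  using a b by (intro sw_cong HOL.refl sw_hom[OF HH_module P F]) (simp_all add: pc)
 also have "\<dots> = sw P (\<lambda>a\<^sub>1 a\<^sub>2. sw P (\<lambda>b\<^sub>1 b\<^sub>2. \<beta> (a\<^sub>1 \<cdot> b\<^sub>1) (a\<^sub>2 \<cdot> b\<^sub>2)) b) a"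
  using a b by (simp add: tsum_pure[OF vector_space vector_space P \<beta>])
 finally show ?thesis .
qed

lemma S_one [simp]: "S \<one>\<^bsub>H\<^esub> = \<one>\<^bsub>H\<^esub>"
proof -
 have "sw H (\<lambda>a b. S a \<cdot> b) \<one>\<^bsub>H\<^esub> = eps \<one>\<^bsub>H\<^esub> \<odot>\<^bsub>H\<^esub> \<one>\<^bsub>H\<^esub>"
  unfolding sw_def by (rule antipode_left) simp
 moreover have "sw H (\<lambda>a b. S a \<cdot> b) \<one>\<^bsub>H\<^esub> = S \<one>\<^bsub>H\<^esub> \<cdot> \<one>\<^bsub>H\<^esub>"
  by (rule sw_one[OF vector_space]) (intro lin; simp)
 ultimately show ?thesis by (simp add: counit_one HV.smult_one)
qed

text \<open>Both sides are values of \<open>\<Sum> S (a\<^sub>1 b\<^sub>1) a\<^sub>2 b\<^sub>2 S b\<^sub>3 S a\<^sub>3\<close>.\<close>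

lemma S_mult:
 assumes a: "a \<in> car H" and b: "b \<in> car H"
 shows "S (a \<cdot> b) = S b \<cdot> S a"
proof -
 let ?Q = "sw H (\<lambda>a' a3. sw H (\<lambda>b' b3. sw H (\<lambda>a1 a2. sw H (\<lambda>b1 b2.
   S (a1 \<cdot> b1) \<cdot> (a2 \<cdot> b2) \<cdot> (S b3 \<cdot> S a3)) b') a') b) a"
 have 1: "sw H (\<lambda>a1 a2. sw H (\<lambda>b1 b2. S (a1 \<cdot> b1) \<cdot> (a2 \<cdot> b2) \<cdot> c) b') a'
   = eps a' \<odot>\<^bsub>H\<^esub> (eps b' \<odot>\<^bsub>H\<^esub> c)" if "a' \<in> car H" "b' \<in> car H" "c \<in> car H" for a' b' c
 proof -
  have "sw H (\<lambda>a1 a2. sw H (\<lambda>b1 b2. S (a1 \<cdot> b1) \<cdot> (a2 \<cdot> b2) \<cdot> c) b') a'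
    = sw H (\<lambda>x y. S x \<cdot> y \<cdot> c) (a' \<cdot> b')"
   using that by (intro sw_mult[where \<beta>="\<lambda>x y. S x \<cdot> y \<cdot> c", symmetric] vector_space lin) simp_all
  also have "\<dots> = eps (a' \<cdot> b') \<odot>\<^bsub>H\<^esub> (\<one>\<^bsub>H\<^esub> \<cdot> c)"
   using that by (intro sw_antipode_left[where F="\<lambda>x. x \<cdot> c"] vector_space lin) simp_all
  finally show ?thesis using that by (simp add: counit_mult HV.smult_assoc1)
 qed
 have "?Q = sw H (\<lambda>a' a3. sw H (\<lambda>b' b3. eps a' \<odot>\<^bsub>H\<^esub> (eps b' \<odot>\<^bsub>H\<^esub> (S b3 \<cdot> S a3))) b) a"
  using a b by (simp add: 1)
 also have "\<dots> = sw H (\<lambda>a' a3. eps a' \<odot>\<^bsub>H\<^esub> sw H (\<lambda>b' b3. eps b' \<odot>\<^bsub>H\<^esub> (S b3 \<cdot> S a3)) b) a"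
  using a b by (simp add: sw_smult vector_space)
 also have "\<dots> = sw H (\<lambda>a' a3. eps a' \<odot>\<^bsub>H\<^esub> (S b \<cdot> S a3)) a"
  using a b by (intro sw_cong HOL.refl arg_cong2[where f="smult H"]
    sw_counit_left[where F="\<lambda>x. S x \<cdot> c" for c] vector_space lin) simp_all
 also have "\<dots> = S b \<cdot> S a"
  using a b by (intro sw_counit_left[where F="\<lambda>x. S b \<cdot> S x"] vector_space lin) simp_all
 finally have Q1: "?Q = S b \<cdot> S a" .
 have 2: "sw H (\<lambda>b' b3. sw H (\<lambda>b1 b2. S (a1 \<cdot> b1) \<cdot> (a2 \<cdot> b2) \<cdot> (S b3 \<cdot> S a3)) b') b
   = S (a1 \<cdot> b) \<cdot> a2 \<cdot> S a3" if [simp]: "a1 \<in> car H" "a2 \<in> car H" "a3 \<in> car H" for a1 a2 a3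
 proof -
  have "sw H (\<lambda>b' b3. sw H (\<lambda>b1 b2. S (a1 \<cdot> b1) \<cdot> (a2 \<cdot> b2) \<cdot> (S b3 \<cdot> S a3)) b') b
    = sw H (\<lambda>b1 b'. sw H (\<lambda>b2 b3. S (a1 \<cdot> b1) \<cdot> (a2 \<cdot> b2) \<cdot> (S b3 \<cdot> S a3)) b') b"
   using b by (intro sw_coassoc[where \<beta>="\<lambda>b1 b2 b3. S (a1 \<cdot> b1) \<cdot> (a2 \<cdot> b2) \<cdot> (S b3 \<cdot> S a3)"] vector_space lin) simp_all
  also have "\<dots> = sw H (\<lambda>b1 b'. sw H (\<lambda>b2 b3. S (a1 \<cdot> b1) \<cdot> a2 \<cdot> (b2 \<cdot> S b3) \<cdot> S a3) b') b"
   using b by (simp add: H.m_assoc)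
  also have "\<dots> = sw H (\<lambda>b1 b'. eps b' \<odot>\<^bsub>H\<^esub> (S (a1 \<cdot> b1) \<cdot> a2 \<cdot> \<one>\<^bsub>H\<^esub> \<cdot> S a3)) b"
   using b by (intro sw_cong HOL.refl sw_antipode_right[where F="\<lambda>x. S (a1 \<cdot> c) \<cdot> a2 \<cdot> x \<cdot> S a3" for c] vector_space lin) simp_all
  also have "\<dots> = S (a1 \<cdot> b) \<cdot> a2 \<cdot> \<one>\<^bsub>H\<^esub> \<cdot> S a3"
   using b by (intro sw_counit_right[where F="\<lambda>x. S (a1 \<cdot> x) \<cdot> a2 \<cdot> \<one>\<^bsub>H\<^esub> \<cdot> S a3"] vector_space lin) simp_all
  finally show ?thesis using b by simp
 qed
 have "?Q = sw H (\<lambda>a' a3. sw H (\<lambda>a1 a2. sw H (\<lambda>b' b3. sw H (\<lambda>b1 b2.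
   S (a1 \<cdot> b1) \<cdot> (a2 \<cdot> b2) \<cdot> (S b3 \<cdot> S a3)) b') b) a') a"
  using a b by (intro sw_cong HOL.refl sw_swap vector_space) (simp_all add: vector_space)
 also have "\<dots> = sw H (\<lambda>a' a3. sw H (\<lambda>a1 a2. S (a1 \<cdot> b) \<cdot> a2 \<cdot> S a3) a') a"
  using a b by (simp add: 2)
 also have "\<dots> = sw H (\<lambda>a1 a'. sw H (\<lambda>a2 a3. S (a1 \<cdot> b) \<cdot> a2 \<cdot> S a3) a') a"
  using a b by (intro sw_coassoc[where \<beta>="\<lambda>a1 a2 a3. S (a1 \<cdot> b) \<cdot> a2 \<cdot> S a3"] vector_space lin) simp_all
 also have "\<dots> = sw H (\<lambda>a1 a'. sw H (\<lambda>a2 a3. S (a1 \<cdot> b) \<cdot> (a2 \<cdot> S a3)) a') a"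
  using a b by (simp add: H.m_assoc)
 also have "\<dots> = sw H (\<lambda>a1 a'. eps a' \<odot>\<^bsub>H\<^esub> (S (a1 \<cdot> b) \<cdot> \<one>\<^bsub>H\<^esub>)) a"
  using a b by (intro sw_cong HOL.refl sw_antipode_right[where F="\<lambda>x. S (c \<cdot> b) \<cdot> x" for c] vector_space lin) simp_all
 also have "\<dots> = S (a \<cdot> b) \<cdot> \<one>\<^bsub>H\<^esub>"
  using a b by (intro sw_counit_right[where F="\<lambda>x. S (x \<cdot> b) \<cdot> \<one>\<^bsub>H\<^esub>"] vector_space lin) simp_all
 finally show ?thesis using Q1 a b by simp
qed

text \<open>Applying \<epsilon> to \<open>\<Sum> S h\<^sub>1 h\<^sub>2 = \<epsilon> h 1\<close>
  gives \<open>\<Sum> \<epsilon> (S h\<^sub>1) \<epsilon> h\<^sub>2 = \<epsilon> h\<close>, and the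
  counit axiom contracts the left side to \<epsilon> (S h).\<close>

lemma eps_S: assumes h: "h \<in> car H" shows "eps (S h) = eps h"
proof -
 \<comment> \<open>K as a vector space over itself, so that sums of scalars are Sweedler sums
   too.\<close>
 let ?k = "\<lparr>carrier = car K, monoid.mult = mult K, one = one K, zero = zero K, add = add K, smult = mult K\<rparr>"
 have ag: "abelian_group ?k"
  by (rule abelian_groupI) (auto simp: HV.R.a_ac intro: HV.R.l_neg bexI[of _ "\<ominus>\<^bsub>K\<^esub> x" for x])
 have KM: "module K ?k"
  by (rule moduleI[OF HV.is_cring ag]) (simp_all add: HV.R.l_distr HV.R.r_distr HV.R.m_assoc)
 have e: "linop K H ?k eps" by (rule linopI) (simp_all add: counit_add counit_smult)
 have "sw ?k (\<lambda>a b. eps (S a \<cdot> b)) h = eps h \<odot>\<^bsub>?k\<^esub> eps \<one>\<^bsub>H\<^esub>"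
  by (rule sw_antipode_left[OF KM e h])
 also have "sw ?k (\<lambda>a b. eps (S a \<cdot> b)) h = sw ?k (\<lambda>a b. eps b \<odot>\<^bsub>?k\<^esub> eps (S a)) h"
  using h by (simp add: counit_mult HV.R.m_comm)
 also have "\<dots> = eps (S h)"
  by (rule sw_counit_right[OF KM linop_comp[OF e S_lin[OF linop_id]] h])
 finally show ?thesis using h by (simp add: counit_one)
qed

text \<open>Both sides are values of \<open>\<Sum> \<beta> (s\<^sub>1 h\<^sub>2 S h\<^sub>5) (s\<^sub>2 h\<^sub>3 S h\<^sub>4)\<close>, where \<open>s = S h\<^sub>1\<close>.\<close>

lemma S_comult:
 assumes P: "module K P" and \<beta>: "bilin K H H P \<beta>" and h: "h \<in> car H"
 shows "sw P \<beta> (S h) = sw P (\<lambda>a b. \<beta> (S b) (S a)) h"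
proof -
 interpret P: module K P by (rule P)
 note bl [lin] = linop_comp[OF bilin_left[OF \<beta>]] and br [lin] = linop_comp[OF bilin_right[OF \<beta>]]
 note bc [simp] = bilin_closed[OF \<beta>]
 let ?g = "\<lambda>q u v. sw P (\<lambda>q1 q2. \<beta> (u \<cdot> S q2) (v \<cdot> S q1)) q"
 let ?Q = "sw P (\<lambda>p q. sw P (\<lambda>x y. sw P (\<lambda>s1 s2. sw P (\<lambda>y1 y2. ?g q (s1 \<cdot> y1) (s2 \<cdot> y2)) y) (S x)) p) h"
 have gb [lin]: "bilin K H H P (?g q)" if "q \<in> car H" for q
  using that by (intro lin P) simp_all
 have "?Q = sw P (\<lambda>p q. sw P (\<lambda>x y. sw P (?g q) (S x \<cdot> y)) p) h"
  using h by (intro sw_cong HOL.refl sw_mult[symmetric] gb P) simp_all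
 also have "\<dots> = sw P (\<lambda>p q. eps p \<odot>\<^bsub>P\<^esub> sw P (?g q) \<one>\<^bsub>H\<^esub>) h"
  using h by (intro sw_cong HOL.refl sw_antipode_left[where F="sw P (?g c)" for c] P lin) simp_all
 also have "\<dots> = sw P (\<lambda>p q. eps p \<odot>\<^bsub>P\<^esub> ?g q \<one>\<^bsub>H\<^esub> \<one>\<^bsub>H\<^esub>) h"
  using h by (intro sw_cong HOL.refl arg_cong2[where f="smult P"] sw_one P gb) simp_all
 also have "\<dots> = sw P (\<lambda>p q. eps p \<odot>\<^bsub>P\<^esub> sw P (\<lambda>a b. \<beta> (S b) (S a)) q) h"
  using h by simp
 also have "\<dots> = sw P (\<lambda>a b. \<beta> (S b) (S a)) h"
  using h by (intro sw_counit_left P lin) simp_all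
 finally have Q1: "?Q = sw P (\<lambda>a b. \<beta> (S b) (S a)) h" .
 have inner: "sw P (\<lambda>y q. sw P (\<lambda>y1 y2. ?g q (s1 \<cdot> y1) (s2 \<cdot> y2)) y) r = eps r \<odot>\<^bsub>P\<^esub> \<beta> s1 s2"
  if [simp]: "r \<in> car H" "s1 \<in> car H" "s2 \<in> car H" for r s1 s2
 proof -
  have "sw P (\<lambda>y q. sw P (\<lambda>y1 y2. ?g q (s1 \<cdot> y1) (s2 \<cdot> y2)) y) r
    = sw P (\<lambda>y1 t. sw P (\<lambda>y2 q. sw P (\<lambda>q1 q2. \<beta> (s1 \<cdot> y1 \<cdot> S q2) (s2 \<cdot> y2 \<cdot> S q1)) q) t) r"
   by (intro sw_coassoc[where \<beta>="\<lambda>y1 y2 q. ?g q (s1 \<cdot> y1) (s2 \<cdot> y2)"] P lin) simp_all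
  also have "\<dots> = sw P (\<lambda>y1 t. sw P (\<lambda>w q2. sw P (\<lambda>y2 q1. \<beta> (s1 \<cdot> y1 \<cdot> S q2) (s2 \<cdot> y2 \<cdot> S q1)) w) t) r"
   by (intro sw_cong HOL.refl sw_coassoc[where \<beta>="\<lambda>y2 q1 q2. \<beta> (s1 \<cdot> y1 \<cdot> S q2) (s2 \<cdot> y2 \<cdot> S q1)" for y1, symmetric] P lin) simp_all
  also have "\<dots> = sw P (\<lambda>y1 t. sw P (\<lambda>w q2. sw P (\<lambda>y2 q1. \<beta> (s1 \<cdot> y1 \<cdot> S q2) (s2 \<cdot> (y2 \<cdot> S q1))) w) t) r"
   by (simp add: H.m_assoc)
  also have "\<dots> = sw P (\<lambda>y1 t. sw P (\<lambda>w q2. eps w \<odot>\<^bsub>P\<^esub> \<beta> (s1 \<cdot> y1 \<cdot> S q2) (s2 \<cdot> \<one>\<^bsub>H\<^esub>)) t) r"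
   by (intro sw_cong HOL.refl sw_antipode_right[where F="\<lambda>x. \<beta> c (s2 \<cdot> x)" for c] P lin) simp_all
  also have "\<dots> = sw P (\<lambda>y1 t. \<beta> (s1 \<cdot> y1 \<cdot> S t) (s2 \<cdot> \<one>\<^bsub>H\<^esub>)) r"
   by (intro sw_cong HOL.refl sw_counit_left[where F="\<lambda>q. \<beta> (s1 \<cdot> c \<cdot> S q) (s2 \<cdot> \<one>\<^bsub>H\<^esub>)" for c] P lin) simp_all
  also have "\<dots> = sw P (\<lambda>y1 t. \<beta> (s1 \<cdot> (y1 \<cdot> S t)) s2) r"
   by (simp add: H.m_assoc)
  also have "\<dots> = eps r \<odot>\<^bsub>P\<^esub> \<beta> (s1 \<cdot> \<one>\<^bsub>H\<^esub>) s2"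
   by (intro sw_antipode_right[where F="\<lambda>x. \<beta> (s1 \<cdot> x) s2"] P lin) simp_all
  finally show ?thesis by simp
 qed
 have "?Q = sw P (\<lambda>x r. sw P (\<lambda>y q. sw P (\<lambda>s1 s2. sw P (\<lambda>y1 y2. ?g q (s1 \<cdot> y1) (s2 \<cdot> y2)) y) (S x)) r) h"
  using h by (intro sw_coassoc[where \<beta>="\<lambda>x y q. sw P (\<lambda>s1 s2. sw P (\<lambda>y1 y2. ?g q (s1 \<cdot> y1) (s2 \<cdot> y2)) y) (S x)"] P lin) simp_all
 also have "\<dots> = sw P (\<lambda>x r. sw P (\<lambda>s1 s2. sw P (\<lambda>y q. sw P (\<lambda>y1 y2. ?g q (s1 \<cdot> y1) (s2 \<cdot> y2)) y) r) (S x)) h"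
  using h by (intro sw_cong HOL.refl sw_swap P) (simp_all add: P)
 also have "\<dots> = sw P (\<lambda>x r. eps r \<odot>\<^bsub>P\<^esub> sw P \<beta> (S x)) h"
  using h by (simp add: inner sw_smult P)
 also have "\<dots> = sw P \<beta> (S h)"
  using h by (intro sw_counit_right[where F="\<lambda>x. sw P \<beta> (S x)"] P lin \<beta>) simp_all
 finally show ?thesis using Q1 by simp
qed

end

section \<open>Smash products\<close>

locale smash_setup = hopf_algebra K H + left_H_category K H C
 for K :: "'k ring" and H :: "('k, 'h) hopf" and C :: "('k, 'h, 'o, 'c) hcat"
begin

interpretation H: ring H by (rule ring)
interpretation HV: module K H by (rule vector_space)

abbreviation Sm where "Sm X Y \<equiv> tensor K (Hom C X Y) H"
abbreviation pr where "pr X Y \<equiv> pure K (Hom C X Y) H"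
abbreviation scomp where "scomp X Y Z \<equiv> Comp (smash K H C) X Y Z"

lemma H_module: "module K H" by (rule vector_space)

lemma hact_closed [simp]: "X \<in> Ob C ==> Y \<in> Ob C ==> h \<in> car H ==> f \<in> car (Hom C X Y) ==> hact C X Y h f \<in> car (Hom C X Y)"
 using left_H_module.act_closed[OF hom_H_module] by (simp add: with_act_simps)

lemma hact_one: "X \<in> Ob C ==> Y \<in> Ob C ==> f \<in> car (Hom C X Y) ==> hact C X Y \<one>\<^bsub>H\<^esub> f = f"
 using left_H_module.act_one[OF hom_H_module] by (simp add: with_act_simps)

lemma hact_mult: "X \<in> Ob C ==> Y \<in> Ob C ==> g \<in> car H ==> h \<in> car H ==> f \<in> car (Hom C X Y)
  ==> hact C X Y (g \<cdot> h) f = hact C X Y g (hact C X Y h f)"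
 using left_H_module.act_mult[OF hom_H_module] by (simp add: with_act_simps)

lemma hact_lin_right [lin]:
 assumes "X \<in> Ob C" "Y \<in> Ob C" "linop K V (Hom C X Y) f" "h \<in> car H"
 shows "linop K V (Hom C X Y) (\<lambda>x. hact C X Y h (f x))"
proof -
 interpret L: left_H_module K H "with_act (Hom C X Y) (hact C X Y)" by (rule hom_H_module[OF assms(1,2)])
 have "linop K (Hom C X Y) (Hom C X Y) (hact C X Y h)"
  using L.act_closed[OF assms(4)] L.act_add_right[OF assms(4)] L.act_smult_right[OF _ assms(4)]
  by (intro linopI) (simp_all add: with_act_simps)
 from linop_comp[OF this assms(3)] show ?thesis .
qed

lemma hact_lin_left [lin]:
 assumes "X \<in> Ob C" "Y \<in> Ob C" "linop K V H f" "c \<in> car (Hom C X Y)"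
 shows "linop K V (Hom C X Y) (\<lambda>x. hact C X Y (f x) c)"
proof -
 interpret L: left_H_module K H "with_act (Hom C X Y) (hact C X Y)" by (rule hom_H_module[OF assms(1,2)])
 have "linop K H (Hom C X Y) (\<lambda>h. hact C X Y h c)"
  using L.act_closed[of _ c] L.act_add_left[of _ _ c] L.act_smult_left[of _ _ c] assms(4)
  by (intro linopI) (simp_all add: with_act_simps)
 from linop_comp[OF this assms(3)] show ?thesis .
qed

lemma comp_lin_left [lin]:
 assumes "X \<in> Ob C" "Y \<in> Ob C" "Z \<in> Ob C" "linop K V (Hom C Y Z) f" "g \<in> car (Hom C X Y)"
 shows "linop K V (Hom C X Z) (\<lambda>x. Comp C X Y Z (f x) g)"
 by (rule linop_comp[OF _ assms(4), of "Hom C X Z" "\<lambda>x. Comp C X Y Z x g"], rule linopI)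
  (simp_all add: assms comp_closed comp_add_left comp_smult_left)

lemma comp_lin_right [lin]:
 assumes "X \<in> Ob C" "Y \<in> Ob C" "Z \<in> Ob C" "linop K V (Hom C X Y) f" "g \<in> car (Hom C Y Z)"
 shows "linop K V (Hom C X Z) (\<lambda>x. Comp C X Y Z g (f x))"
 by (rule linop_comp[OF _ assms(4), of "Hom C X Z" "\<lambda>x. Comp C X Y Z g x"], rule linopI)
  (simp_all add: assms comp_closed comp_add_right comp_smult_right)

declare comp_closed [simp] hom_space [simp, lin] H_module [simp, lin] ident_closed [simp]

lemma Sm_module [simp, lin]: "X \<in> Ob C ==> Y \<in> Ob C ==> module K (Sm X Y)"
 by (rule tensor_module) simp_all

lemma pr_closed [simp]: "X \<in> Ob C ==> Y \<in> Ob C ==> f \<in> car (Hom C X Y) ==> h \<in> car H ==> pr X Y f h \<in> car (Sm X Y)"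
 by (rule pure_closed) simp_all

lemma smash_simps [simp]: "Ob (smash K H C) = Ob C" "Hom (smash K H C) X Y = Sm X Y"
 "Ident (smash K H C) X = pr X X (Ident C X) \<one>\<^bsub>H\<^esub>"
 by (simp_all add: smash_def)

text \<open>The composite of two pure tensors as an expression linear in each of the four entries,
  from which the bilinearity of composition is derived.\<close>

definition pcomp where "pcomp X Y Z f h g h' =
 sw (Sm X Z) (\<lambda>h\<^sub>1 h\<^sub>2. pr X Z (Comp C X Y Z f (hact C X Y h\<^sub>1 g)) (h\<^sub>2 \<cdot> h')) h"

lemma scomp_eq: "scomp X Y Z s t = tsum (Sm X Z) (\<lambda>f h. tsum (Sm X Z) (pcomp X Y Z f h) t) s"
 by (simp add: smash_def pcomp_def[abs_def] sw_def)

lemma pcomp_right: "X \<in> Ob C ==> Y \<in> Ob C ==> Z \<in> Ob C ==> f \<in> car (Hom C Y Z) ==> h \<in> car H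
  ==> bilin K (Hom C X Y) H (Sm X Z) (pcomp X Y Z f h)"
 unfolding pcomp_def[abs_def] by (intro lin) simp_all

lemma pcomp_left: "X \<in> Ob C ==> Y \<in> Ob C ==> Z \<in> Ob C ==> g \<in> car (Hom C X Y) ==> h' \<in> car H
  ==> bilin K (Hom C Y Z) H (Sm X Z) (\<lambda>f h. pcomp X Y Z f h g h')"
 unfolding pcomp_def[abs_def] by (intro lin) simp_all

lemma scomp_bilin: assumes "X \<in> Ob C" "Y \<in> Ob C" "Z \<in> Ob C" "t \<in> car (Sm X Y)"
 shows "bilin K (Hom C Y Z) H (Sm X Z) (\<lambda>f h. tsum (Sm X Z) (pcomp X Y Z f h) t)"
 using assms
 by (intro bilinI tsum_linop_param[of K "Hom C X Y" H] bilin_left[OF pcomp_left] bilin_right[OF pcomp_left]) simp_all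

lemma scomp_lin_left [lin]:
 assumes "X \<in> Ob C" "Y \<in> Ob C" "Z \<in> Ob C" "linop K V (Sm Y Z) F" "t \<in> car (Sm X Y)"
 shows "linop K V (Sm X Z) (\<lambda>x. scomp X Y Z (F x) t)"
 unfolding scomp_eq using assms
 by (intro linop_comp[OF _ assms(4)] tsum_linop scomp_bilin) simp_all

lemma scomp_lin_right [lin]:
 assumes "X \<in> Ob C" "Y \<in> Ob C" "Z \<in> Ob C" "linop K V (Sm X Y) F" "s \<in> car (Sm Y Z)"
 shows "linop K V (Sm X Z) (\<lambda>x. scomp X Y Z s (F x))"
 unfolding scomp_eq using assms
 by (intro linop_comp[OF _ assms(4)] tsum_linop_param[of K "Hom C Y Z" H] tsum_linop pcomp_right) simp_all

lemma scomp_closed [simp]: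
 assumes "X \<in> Ob C" "Y \<in> Ob C" "Z \<in> Ob C" "s \<in> car (Sm Y Z)" "t \<in> car (Sm X Y)"
 shows "scomp X Y Z s t \<in> car (Sm X Z)"
 using linop_closed[OF scomp_lin_right[OF assms(1-3) linop_id assms(4)] assms(5)] .

lemma scomp_pure:
 assumes "X \<in> Ob C" "Y \<in> Ob C" "Z \<in> Ob C" "f \<in> car (Hom C Y Z)" "h \<in> car H" "g \<in> car (Hom C X Y)" "h' \<in> car H"
 shows "scomp X Y Z (pr Y Z f h) (pr X Y g h') =
  sw (Sm X Z) (\<lambda>h\<^sub>1 h\<^sub>2. pr X Z (Comp C X Y Z f (hact C X Y h\<^sub>1 g)) (h\<^sub>2 \<cdot> h')) h"
proof -
 have "scomp X Y Z (pr Y Z f h) (pr X Y g h') = tsum (Sm X Z) (pcomp X Y Z f h) (pr X Y g h')"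
  unfolding scomp_eq using assms by (intro tsum_pure scomp_bilin) simp_all
 also have "\<dots> = pcomp X Y Z f h g h'" using assms by (intro tsum_pure pcomp_right) simp_all
 finally show ?thesis by (simp add: pcomp_def)
qed

text \<open>Both sides expand to \<open>\<Sum> f (h\<^sub>1 g) (h\<^sub>2 h'\<^sub>1 e) # h\<^sub>3
  h'\<^sub>2 h''\<close>. On the left this uses that comultiplication is multiplicative, on the
  right the rule for the action of h on a composite together with coassociativity.\<close>

lemma scomp_assoc_pure:
 assumes [simp]: "W \<in> Ob C" "X \<in> Ob C" "Y \<in> Ob C" "Z \<in> Ob C"
  and [simp]: "f \<in> car (Hom C Y Z)" "h \<in> car H" "g \<in> car (Hom C X Y)" "h' \<in> car H" "e \<in> car (Hom C W X)" "h'' \<in> car H"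
 shows "scomp W X Z (scomp X Y Z (pr Y Z f h) (pr X Y g h')) (pr W X e h'')
  = scomp W Y Z (pr Y Z f h) (scomp W X Y (pr X Y g h') (pr W X e h''))"
proof -
 let ?T = "Sm W Z"
 let ?t = "\<lambda>p x y a b. pr W Z (Comp C W Y Z f (Comp C W X Y (hact C X Y p g) (hact C W X x (hact C W X a e)))) (y \<cdot> (b \<cdot> h''))"
 have "scomp W X Z (scomp X Y Z (pr Y Z f h) (pr X Y g h')) (pr W X e h'')
   = sw ?T (\<lambda>p q. scomp W X Z (pr X Z (Comp C X Y Z f (hact C X Y p g)) (q \<cdot> h')) (pr W X e h'')) h"
  by (subst scomp_pure; (simp; fail)?) (intro sw_hom[where F="\<lambda>x. scomp W X Z x (pr W X e h'')"] lin; simp)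
 also have "\<dots> = sw ?T (\<lambda>p q. sw ?T (\<lambda>u v. pr W Z (Comp C W X Z (Comp C X Y Z f (hact C X Y p g)) (hact C W X u e)) (v \<cdot> h'')) (q \<cdot> h')) h"
  by (simp add: scomp_pure)
 also have "\<dots> = sw ?T (\<lambda>p q. sw ?T (\<lambda>x y. sw ?T (\<lambda>a b. pr W Z (Comp C W X Z (Comp C X Y Z f (hact C X Y p g)) (hact C W X (x \<cdot> a) e)) ((y \<cdot> b) \<cdot> h'')) h') q) h"
  by (intro sw_cong HOL.refl sw_mult lin) simp_all
 also have "\<dots> = sw ?T (\<lambda>p q. sw ?T (\<lambda>x y. sw ?T (\<lambda>a b. ?t p x y a b) h') q) h"
  by (simp add: comp_assoc hact_mult H.m_assoc)
 finally have L: "scomp W X Z (scomp X Y Z (pr Y Z f h) (pr X Y g h')) (pr W X e h'')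
   = sw ?T (\<lambda>p q. sw ?T (\<lambda>x y. sw ?T (\<lambda>a b. ?t p x y a b) h') q) h" .
 have "scomp W Y Z (pr Y Z f h) (scomp W X Y (pr X Y g h') (pr W X e h''))
   = sw ?T (\<lambda>a b. scomp W Y Z (pr Y Z f h) (pr W Y (Comp C W X Y g (hact C W X a e)) (b \<cdot> h''))) h'"
  by (subst scomp_pure[of W X Y g h' e h'']; (simp; fail)?) (intro sw_hom[where F="\<lambda>x. scomp W Y Z (pr Y Z f h) x"] lin; simp)
 also have "\<dots> = sw ?T (\<lambda>a b. sw ?T (\<lambda>r y. pr W Z (Comp C W Y Z f (hact C W Y r (Comp C W X Y g (hact C W X a e)))) (y \<cdot> (b \<cdot> h''))) h) h'"
  by (simp add: scomp_pure)
 also have "\<dots> = sw ?T (\<lambda>a b. sw ?T (\<lambda>r y. sw ?T (\<lambda>p x. ?t p x y a b) r) h) h'"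
 proof (intro sw_cong HOL.refl)
  fix a b r y assume [simp]: "a \<in> car H" "b \<in> car H" "r \<in> car H" "y \<in> car H"
  have "hact C W Y r (Comp C W X Y g (hact C W X a e)) = sw (Hom C W Y) (\<lambda>p x. Comp C W X Y (hact C X Y p g) (hact C W X x (hact C W X a e))) r"
   unfolding sw_def by (rule hact_comp) simp_all
  then show "pr W Z (Comp C W Y Z f (hact C W Y r (Comp C W X Y g (hact C W X a e)))) (y \<cdot> (b \<cdot> h''))
    = sw ?T (\<lambda>p x. ?t p x y a b) r"
   by (simp only:) (intro sw_hom[where F="\<lambda>z. pr W Z (Comp C W Y Z f z) (y \<cdot> (b \<cdot> h''))"] lin; simp)
 qed simp_all
 also have "\<dots> = sw ?T (\<lambda>a b. sw ?T (\<lambda>p q. sw ?T (\<lambda>x y. ?t p x y a b) q) h) h'"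
  by (intro sw_cong HOL.refl sw_coassoc lin) simp_all
 also have "\<dots> = sw ?T (\<lambda>p q. sw ?T (\<lambda>a b. sw ?T (\<lambda>x y. ?t p x y a b) q) h') h"
  by (intro sw_swap) simp_all
 also have "\<dots> = sw ?T (\<lambda>p q. sw ?T (\<lambda>x y. sw ?T (\<lambda>a b. ?t p x y a b) h') q) h"
  by (intro sw_cong HOL.refl sw_swap) simp_all
 finally show ?thesis using L by simp
qed

lemma Sm_eqI:
 assumes "X \<in> Ob C" "Y \<in> Ob C" "module K P" "linop K (Sm X Y) P F" "linop K (Sm X Y) P G" "s \<in> car (Sm X Y)"
  and "\<And>f h. f \<in> car (Hom C X Y) ==> h \<in> car H ==> F (pr X Y f h) = G (pr X Y f h)"
 shows "F s = G s"
 by (rule tensor_linop_eqI[OF _ _ assms(3-5,7,6)]) (simp_all add: assms)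

lemma scomp_assoc:
 assumes [simp]: "W \<in> Ob C" "X \<in> Ob C" "Y \<in> Ob C" "Z \<in> Ob C"
  and s [simp]: "s \<in> car (Sm Y Z)" and t [simp]: "t \<in> car (Sm X Y)" and u [simp]: "u \<in> car (Sm W X)"
 shows "scomp W X Z (scomp X Y Z s t) u = scomp W Y Z s (scomp W X Y t u)"
proof (rule Sm_eqI[OF _ _ _ _ _ s, where F="\<lambda>s. scomp W X Z (scomp X Y Z s t) u" and G="\<lambda>s. scomp W Y Z s (scomp W X Y t u)"])
 show "linop K (Sm Y Z) (Sm W Z) (\<lambda>s. scomp W X Z (scomp X Y Z s t) u)" by (intro lin) simp_all
 show "linop K (Sm Y Z) (Sm W Z) (\<lambda>s. scomp W Y Z s (scomp W X Y t u))" by (intro lin) simp_all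
 fix f h assume [simp]: "f \<in> car (Hom C Y Z)" "h \<in> car H"
 show "scomp W X Z (scomp X Y Z (pr Y Z f h) t) u = scomp W Y Z (pr Y Z f h) (scomp W X Y t u)"
 proof (rule Sm_eqI[OF _ _ _ _ _ t, where F="\<lambda>t. scomp W X Z (scomp X Y Z (pr Y Z f h) t) u" and G="\<lambda>t. scomp W Y Z (pr Y Z f h) (scomp W X Y t u)"])
  show "linop K (Sm X Y) (Sm W Z) (\<lambda>t. scomp W X Z (scomp X Y Z (pr Y Z f h) t) u)" by (intro lin) simp_all
  show "linop K (Sm X Y) (Sm W Z) (\<lambda>t. scomp W Y Z (pr Y Z f h) (scomp W X Y t u))" by (intro lin) simp_all
  fix g h' assume [simp]: "g \<in> car (Hom C X Y)" "h' \<in> car H"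
  show "scomp W X Z (scomp X Y Z (pr Y Z f h) (pr X Y g h')) u = scomp W Y Z (pr Y Z f h) (scomp W X Y (pr X Y g h') u)"
  proof (rule Sm_eqI[OF _ _ _ _ _ u, where F="\<lambda>u. scomp W X Z (scomp X Y Z (pr Y Z f h) (pr X Y g h')) u" and G="\<lambda>u. scomp W Y Z (pr Y Z f h) (scomp W X Y (pr X Y g h') u)"])
   show "linop K (Sm W X) (Sm W Z) (\<lambda>u. scomp W X Z (scomp X Y Z (pr Y Z f h) (pr X Y g h')) u)" by (intro lin) simp_all
   show "linop K (Sm W X) (Sm W Z) (\<lambda>u. scomp W Y Z (pr Y Z f h) (scomp W X Y (pr X Y g h') u))" by (intro lin) simp_all
  qed (simp_all add: scomp_assoc_pure)
 qed simp_all
qed simp_all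

lemma scomp_ident_left:
 assumes [simp]: "X \<in> Ob C" "Y \<in> Ob C" and s [simp]: "s \<in> car (Sm X Y)"
 shows "scomp X Y Y (pr Y Y (Ident C Y) \<one>\<^bsub>H\<^esub>) s = s"
proof (rule Sm_eqI[OF _ _ _ _ _ s, where F="\<lambda>s. scomp X Y Y (pr Y Y (Ident C Y) \<one>\<^bsub>H\<^esub>) s" and G="\<lambda>s. s"])
 show "linop K (Sm X Y) (Sm X Y) (\<lambda>s. scomp X Y Y (pr Y Y (Ident C Y) \<one>\<^bsub>H\<^esub>) s)" by (intro lin) simp_all
 fix f h assume [simp]: "f \<in> car (Hom C X Y)" "h \<in> car H"
 have "scomp X Y Y (pr Y Y (Ident C Y) \<one>\<^bsub>H\<^esub>) (pr X Y f h) =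
   sw (Sm X Y) (\<lambda>a b. pr X Y (Comp C X Y Y (Ident C Y) (hact C X Y a f)) (b \<cdot> h)) \<one>\<^bsub>H\<^esub>"
  by (rule scomp_pure) simp_all
 also have "\<dots> = pr X Y (Comp C X Y Y (Ident C Y) (hact C X Y \<one>\<^bsub>H\<^esub> f)) (\<one>\<^bsub>H\<^esub> \<cdot> h)"
  by (intro sw_one lin) simp_all
 finally show "scomp X Y Y (pr Y Y (Ident C Y) \<one>\<^bsub>H\<^esub>) (pr X Y f h) = pr X Y f h"
  by (simp add: hact_one ident_left)
qed (simp_all add: linop_id)

lemma scomp_ident_right:
 assumes [simp]: "X \<in> Ob C" "Y \<in> Ob C" and s [simp]: "s \<in> car (Sm X Y)"
 shows "scomp X X Y s (pr X X (Ident C X) \<one>\<^bsub>H\<^esub>) = s"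
proof (rule Sm_eqI[OF _ _ _ _ _ s, where F="\<lambda>s. scomp X X Y s (pr X X (Ident C X) \<one>\<^bsub>H\<^esub>)" and G="\<lambda>s. s"])
 show "linop K (Sm X Y) (Sm X Y) (\<lambda>s. scomp X X Y s (pr X X (Ident C X) \<one>\<^bsub>H\<^esub>))" by (intro lin) simp_all
 fix f h assume [simp]: "f \<in> car (Hom C X Y)" "h \<in> car H"
 have "scomp X X Y (pr X Y f h) (pr X X (Ident C X) \<one>\<^bsub>H\<^esub>) =
   sw (Sm X Y) (\<lambda>a b. pr X Y (Comp C X X Y f (hact C X X a (Ident C X))) (b \<cdot> \<one>\<^bsub>H\<^esub>)) h"
  by (rule scomp_pure) simp_all
 also have "\<dots> = sw (Sm X Y) (\<lambda>a b. eps a \<odot>\<^bsub>Sm X Y\<^esub> pr X Y f b) h"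
  by (simp add: hact_ident comp_smult_right ident_right linop_smult[OF pure_lin_left[OF _ _ linop_id]])
 also have "\<dots> = pr X Y f h"
  by (intro sw_counit_left lin) simp_all
 finally show "scomp X X Y (pr X Y f h) (pr X X (Ident C X) \<one>\<^bsub>H\<^esub>) = pr X Y f h" .
qed (simp_all add: linop_id)

lemma smash_linear_category: "linear_category K (smash K H C)"
proof (rule linear_category.intro, unfold smash_simps)
 show "scomp X Y Z (f \<oplus>\<^bsub>Sm Y Z\<^esub> f') g = scomp X Y Z f g \<oplus>\<^bsub>Sm X Z\<^esub> scomp X Y Z f' g"
  if "X \<in> Ob C" "Y \<in> Ob C" "Z \<in> Ob C" "f \<in> car (Sm Y Z)" "f' \<in> car (Sm Y Z)" "g \<in> car (Sm X Y)" for X Y Z f f' g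
  using linop_add[OF scomp_lin_left[OF that(1-3) linop_id that(6)] that(4,5)] .
 show "scomp X Y Z f (g \<oplus>\<^bsub>Sm X Y\<^esub> g') = scomp X Y Z f g \<oplus>\<^bsub>Sm X Z\<^esub> scomp X Y Z f g'"
  if "X \<in> Ob C" "Y \<in> Ob C" "Z \<in> Ob C" "f \<in> car (Sm Y Z)" "g \<in> car (Sm X Y)" "g' \<in> car (Sm X Y)" for X Y Z f g g'
  using linop_add[OF scomp_lin_right[OF that(1-3) linop_id that(4)] that(5,6)] .
 show "scomp X Y Z (k \<odot>\<^bsub>Sm Y Z\<^esub> f) g = k \<odot>\<^bsub>Sm X Z\<^esub> scomp X Y Z f g"
  if "X \<in> Ob C" "Y \<in> Ob C" "Z \<in> Ob C" "k \<in> car K" "f \<in> car (Sm Y Z)" "g \<in> car (Sm X Y)" for X Y Z k f g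
  using linop_smult[OF scomp_lin_left[OF that(1-3) linop_id that(6)] that(4,5)] .
 show "scomp X Y Z f (k \<odot>\<^bsub>Sm X Y\<^esub> g) = k \<odot>\<^bsub>Sm X Z\<^esub> scomp X Y Z f g"
  if "X \<in> Ob C" "Y \<in> Ob C" "Z \<in> Ob C" "k \<in> car K" "f \<in> car (Sm Y Z)" "g \<in> car (Sm X Y)" for X Y Z k f g
  using linop_smult[OF scomp_lin_right[OF that(1-3) linop_id that(5)] that(4,6)] .
qed (simp_all add: scomp_assoc scomp_ident_left scomp_ident_right)

end

section \<open>Natural maps and the spaces that they form\<close>

lemma linop_restrict: assumes "module K V" "linop K V W f" shows "restrict f (car V) \<in> lin_maps K V W"
 by (rule lin_restrictI[OF assms(1)]) (simp_all add: linop_closed[OF assms(2)] linop_add[OF assms(2)] linop_smult[OF assms(2)])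

lemma nat_maps_eqI:
 assumes "\<eta> \<in> nat_maps K E M N" "\<theta> \<in> nat_maps K E M N"
  and "\<And>X m. X \<in> Ob E ==> m \<in> car (Obj M X) ==> \<eta> X m = \<theta> X m"
 shows "\<eta> = \<theta>"
proof
 fix X show "\<eta> X = \<theta> X"
 proof (cases "X \<in> Ob E")
  case True
  from lin_eqI[OF nat_maps_lin[OF assms(1) True] nat_maps_lin[OF assms(2) True]] show ?thesis using assms(3)[OF True] by blast
 qed (simp add: nat_maps_undef[OF assms(1)] nat_maps_undef[OF assms(2)])
qed

lemma nat_maps_restrictI:
 assumes M: "\<And>X. X \<in> Ob E ==> module K (Obj M X)"
  and c: "\<And>X Y f m. X \<in> Ob E ==> Y \<in> Ob E ==> f \<in> car (Hom E X Y) ==> m \<in> car (Obj M Y) ==> Mor M X Y f m \<in> car (Obj M X)"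
  and "\<And>X. X \<in> Ob E ==> linop K (Obj M X) (Obj N X) (\<eta> X)"
  and "\<And>X Y f m. X \<in> Ob E ==> Y \<in> Ob E ==> f \<in> car (Hom E X Y) ==> m \<in> car (Obj M Y)
   ==> \<eta> X (Mor M X Y f m) = Mor N X Y f (\<eta> Y m)"
 shows "(\<lambda>X\<in>Ob E. \<lambda>m\<in>car (Obj M X). \<eta> X m) \<in> nat_maps K E M N"
 by (rule nat_mapsI) (simp_all add: assms linop_restrict)

lemma Hom_Mod_simps [simp]:
 "car (Hom_Mod K E M N) = nat_maps K E M N"
 "\<zero>\<^bsub>Hom_Mod K E M N\<^esub> = (\<lambda>X\<in>Ob E. \<lambda>m\<in>car (Obj M X). \<zero>\<^bsub>Obj N X\<^esub>)"
 "\<eta> \<oplus>\<^bsub>Hom_Mod K E M N\<^esub> \<theta> = (\<lambda>X\<in>Ob E. \<lambda>m\<in>car (Obj M X). \<eta> X m \<oplus>\<^bsub>Obj N X\<^esub> \<theta> X m)"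
 "k \<odot>\<^bsub>Hom_Mod K E M N\<^esub> \<eta> = (\<lambda>X\<in>Ob E. \<lambda>m\<in>car (Obj M X). k \<odot>\<^bsub>Obj N X\<^esub> \<eta> X m)"
 by (simp_all add: Hom_Mod_def)

lemma Hom_Mod_module:
 assumes K: "cring K" and M: "right_module K E M" and N: "right_module K E N"
 shows "module K (Hom_Mod K E M N)"
proof -
 interpret K: cring K by fact
 interpret M: right_module K E M by fact
 interpret N: right_module K E N by fact
 note l = linop_lin_maps[OF nat_maps_lin]
 note c = nat_maps_closed
 note NM = module.axioms(2)[OF N.obj_space]
 have add: "(\<lambda>X\<in>Ob E. \<lambda>m\<in>car (Obj M X). \<eta> X m \<oplus>\<^bsub>Obj N X\<^esub> \<theta> X m) \<in> nat_maps K E M N"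
  if e: "\<eta> \<in> nat_maps K E M N" and t: "\<theta> \<in> nat_maps K E M N" for \<eta> \<theta>
 proof (rule nat_maps_restrictI[OF M.obj_space M.mor_closed])
  fix X assume X: "X \<in> Ob E"
  interpret NX: module K "Obj N X" by (rule N.obj_space[OF X])
  show "linop K (Obj M X) (Obj N X) (\<lambda>m. \<eta> X m \<oplus>\<^bsub>Obj N X\<^esub> \<theta> X m)"
   using c[OF e X] c[OF t X]
   by (intro linopI) (simp_all add: linop_add[OF l[OF e X]] linop_add[OF l[OF t X]]
    linop_smult[OF l[OF e X]] linop_smult[OF l[OF t X]] NX.smult_r_distr NX.a_ac)
  fix Y f m assume "Y \<in> Ob E" "f \<in> car (Hom E X Y)" "m \<in> car (Obj M Y)"
  then show "\<eta> X (Mor M X Y f m) \<oplus>\<^bsub>Obj N X\<^esub> \<theta> X (Mor M X Y f m) = Mor N X Y f (\<eta> Y m \<oplus>\<^bsub>Obj N Y\<^esub> \<theta> Y m)"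
   using X by (simp add: nat_maps_natural[OF e] nat_maps_natural[OF t] N.mor_add c[OF e] c[OF t])
 qed
 have zero: "(\<lambda>X\<in>Ob E. \<lambda>m\<in>car (Obj M X). \<zero>\<^bsub>Obj N X\<^esub>) \<in> nat_maps K E M N"
 proof (rule nat_maps_restrictI[OF M.obj_space M.mor_closed])
  fix X assume X: "X \<in> Ob E"
  interpret NX: module K "Obj N X" by (rule N.obj_space[OF X])
  show "linop K (Obj M X) (Obj N X) (\<lambda>m. \<zero>\<^bsub>Obj N X\<^esub>)" by (rule linopI) simp_all
  fix Y f m assume Y: "Y \<in> Ob E" and f: "f \<in> car (Hom E X Y)" and m: "m \<in> car (Obj M Y)"
  show "\<zero>\<^bsub>Obj N X\<^esub> = Mor N X Y f \<zero>\<^bsub>Obj N Y\<^esub>"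
   using lin_zero[OF N.mor_lin[OF X Y f] N.obj_space[OF Y] N.obj_space[OF X]]
    module.axioms(2)[OF N.obj_space[OF Y]] by (simp add: abelian_group_def abelian_monoid.zero_closed)
 qed
 have smult: "(\<lambda>X\<in>Ob E. \<lambda>m\<in>car (Obj M X). k \<odot>\<^bsub>Obj N X\<^esub> \<eta> X m) \<in> nat_maps K E M N"
  if e: "\<eta> \<in> nat_maps K E M N" and k: "k \<in> car K" for \<eta> k
  by (rule nat_maps_restrictI[OF M.obj_space M.mor_closed])
   (simp_all add: linop_smult_const[OF N.obj_space l[OF e] k] nat_maps_natural[OF e] N.mor_smult k c[OF e])
 show ?thesis
  by (rule pointwise_module[where D="SIGMA X:Ob E. car (Obj M X)" and W="\<lambda>p. Obj N (fst p)" and ev="\<lambda>\<eta> p. \<eta> (fst p) (snd p)"])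
   (use K nat_maps_eqI[of _ K E M N] in \<open>auto simp: add zero smult N.obj_space intro: nat_maps_closed\<close>)
qed

lemma restrict_module_simps [simp]:
 "Obj (restrict_module K H C M) = Obj M"
 "Mor (restrict_module K H C M) X Y f = Mor M X Y (pure K (Hom C X Y) H f \<one>\<^bsub>H\<^esub>)"
 by (simp_all add: restrict_module_def)

section \<open>Right modules over the smash product\<close>

locale smod = smash_setup K H C + right_module K "smash K H C" M
 for K :: "'k ring" and H :: "('k, 'h) hopf" and C :: "('k, 'h, 'o, 'c) hcat"
  and M :: "('k, 'o, ('c, 'h) tensor, 'm) rmodule"
begin

interpretation H: ring H by (rule ring)
interpretation HV: module K H by (rule vector_space)

lemmas sm = obj_space mor_closed mor_add mor_smult functor_add functor_smult functor_ident functor_comp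
lemmas sm' = sm[unfolded smash_simps]

lemma obj_mod [simp, lin]: "X \<in> Ob C ==> module K (Obj M X)" by (rule sm')

lemma Mor_closed [simp]: "X \<in> Ob C ==> Y \<in> Ob C ==> s \<in> car (Sm X Y) ==> m \<in> car (Obj M Y) ==> Mor M X Y s m \<in> car (Obj M X)"
 by (rule sm')

lemma Mor_lin_m [lin]:
 assumes "X \<in> Ob C" "Y \<in> Ob C" "s \<in> car (Sm X Y)" "linop K V (Obj M Y) g"
 shows "linop K V (Obj M X) (\<lambda>x. Mor M X Y s (g x))"
 by (rule linop_comp[OF _ assms(4), of "Obj M X" "\<lambda>x. Mor M X Y s x"], rule linopI) (simp_all add: sm' assms)

lemma Mor_lin_s [lin]:
 assumes "X \<in> Ob C" "Y \<in> Ob C" "linop K V (Sm X Y) g" "m \<in> car (Obj M Y)"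
 shows "linop K V (Obj M X) (\<lambda>x. Mor M X Y (g x) m)"
 by (rule linop_comp[OF _ assms(3), of "Obj M X" "\<lambda>x. Mor M X Y x m"], rule linopI) (simp_all add: sm' assms)

text \<open>As f # h = (f # 1)(id # h), the module structure consists of right actions of H on the
  single objects, \<open>rh\<close>, and a right action of C, \<open>cr\<close>. They are tied
  together by \<open>cr_rh\<close>.\<close>

abbreviation rh where "rh X h m \<equiv> Mor M X X (pr X X (Ident C X) h) m"
abbreviation cr where "cr X Y f m \<equiv> Mor M X Y (pr X Y f \<one>\<^bsub>H\<^esub>) m"

lemma scomp_ident_pure: assumes [simp]: "X \<in> Ob C" "Y \<in> Ob C" "f \<in> car (Hom C X Y)" "g \<in> car H" "h \<in> car H"
 shows "scomp X X Y (pr X Y f g) (pr X X (Ident C X) h) = pr X Y f (g \<cdot> h)"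
proof -
 have "scomp X X Y (pr X Y f g) (pr X X (Ident C X) h) = sw (Sm X Y) (\<lambda>a b. eps a \<odot>\<^bsub>Sm X Y\<^esub> pr X Y f (b \<cdot> h)) g"
  by (simp add: scomp_pure hact_ident comp_smult_right ident_right linop_smult[OF pure_lin_left[OF _ _ linop_id]])
 also have "\<dots> = pr X Y f (g \<cdot> h)"
  by (intro sw_counit_left[where F="\<lambda>b. pr X Y f (b \<cdot> h)"] lin) simp_all
 finally show ?thesis .
qed

lemma rh_mult: "X \<in> Ob C ==> g \<in> car H ==> h \<in> car H ==> m \<in> car (Obj M X) ==> rh X (g \<cdot> h) m = rh X h (rh X g m)"
 by (simp add: sm' flip: scomp_ident_pure)

lemma rh_one [simp]: "X \<in> Ob C ==> m \<in> car (Obj M X) ==> rh X \<one>\<^bsub>H\<^esub> m = m"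
 by (rule sm')

lemma Mor_pure: "X \<in> Ob C ==> Y \<in> Ob C ==> f \<in> car (Hom C X Y) ==> h \<in> car H ==> m \<in> car (Obj M Y)
  ==> Mor M X Y (pr X Y f h) m = rh X h (cr X Y f m)"
 using functor_comp[unfolded smash_simps, of X X Y "pr X Y f \<one>\<^bsub>H\<^esub>" "pr X X (Ident C X) h" m] by (simp add: scomp_ident_pure)

text \<open>This is the relation \<open>(id # h) (f # 1) = \<Sum> h\<^sub>1 f # h\<^sub>2\<close> of
  the smash product, applied to m. In a contravariant functor the left factor acts first.\<close>

lemma cr_rh:
 assumes [simp]: "X \<in> Ob C" "Y \<in> Ob C" "f \<in> car (Hom C X Y)" "h \<in> car H" "m \<in> car (Obj M Y)"
 shows "cr X Y f (rh Y h m) = sw (Obj M X) (\<lambda>a b. rh X b (cr X Y (hact C X Y a f) m)) h"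
proof -
 have "cr X Y f (rh Y h m) = Mor M X Y (scomp X Y Y (pr Y Y (Ident C Y) h) (pr X Y f \<one>\<^bsub>H\<^esub>)) m"
  by (simp add: sm')
 also have "scomp X Y Y (pr Y Y (Ident C Y) h) (pr X Y f \<one>\<^bsub>H\<^esub>) = sw (Sm X Y) (\<lambda>a b. pr X Y (hact C X Y a f) b) h"
  by (simp add: scomp_pure ident_left)
 also have "Mor M X Y (sw (Sm X Y) (\<lambda>a b. pr X Y (hact C X Y a f) b) h) m = sw (Obj M X) (\<lambda>a b. Mor M X Y (pr X Y (hact C X Y a f) b) m) h"
  by (intro sw_hom[where F="\<lambda>s. Mor M X Y s m"] lin) simp_all
 also have "\<dots> = sw (Obj M X) (\<lambda>a b. rh X b (cr X Y (hact C X Y a f) m)) h"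
  by (intro sw_cong HOL.refl Mor_pure) simp_all
 finally show ?thesis .
qed

lemma cr_comp:
 assumes [simp]: "X \<in> Ob C" "Y \<in> Ob C" "Z \<in> Ob C" "f \<in> car (Hom C Y Z)" "g \<in> car (Hom C X Y)" "m \<in> car (Obj M Z)"
 shows "cr X Z (Comp C X Y Z f g) m = cr X Y g (cr Y Z f m)"
proof -
 have "scomp X Y Z (pr Y Z f \<one>\<^bsub>H\<^esub>) (pr X Y g \<one>\<^bsub>H\<^esub>)
   = sw (Sm X Z) (\<lambda>a b. pr X Z (Comp C X Y Z f (hact C X Y a g)) (b \<cdot> \<one>\<^bsub>H\<^esub>)) \<one>\<^bsub>H\<^esub>"
  by (rule scomp_pure) simp_all
 also have "\<dots> = pr X Z (Comp C X Y Z f (hact C X Y \<one>\<^bsub>H\<^esub> g)) (\<one>\<^bsub>H\<^esub> \<cdot> \<one>\<^bsub>H\<^esub>)"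
  by (intro sw_one lin) simp_all
 finally have "pr X Z (Comp C X Y Z f g) \<one>\<^bsub>H\<^esub> = scomp X Y Z (pr Y Z f \<one>\<^bsub>H\<^esub>) (pr X Y g \<one>\<^bsub>H\<^esub>)"
  by (simp add: hact_one)
 then show ?thesis by (simp add: sm')
qed

lemma restrict_right_module: "right_module K C (restrict_module K H C M)"
 using cr_comp
 by (intro right_module.intro)
  (simp_all add: sm' linop_add[OF pure_lin_left[OF _ _ linop_id]] linop_smult[OF pure_lin_left[OF _ _ linop_id]])

end

section \<open>Maps that are linear over \<open>C\<close>\<close>

locale hom_setup = smash_setup K H C + M: smod K H C M + N: smod K H C N
 for K :: "'k ring" and H :: "('k, 'h) hopf" and C :: "('k, 'h, 'o, 'c) hcat"
  and M :: "('k, 'o, ('c, 'h) tensor, 'm) rmodule" and N :: "('k, 'o, ('c, 'h) tensor, 'n) rmodule"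
begin

interpretation H: ring H by (rule ring)
interpretation HV: module K H by (rule vector_space)

abbreviation rM where "rM \<equiv> restrict_module K H C M"
abbreviation rN where "rN \<equiv> restrict_module K H C N"
abbreviation Hc where "Hc \<equiv> nat_maps K C rM rN"

abbreviation A where "A \<equiv> H_Hom_Mod K H C M N"
abbreviation HC where "HC \<equiv> Hom_Mod K C rM rN"

text \<open>A right action of \<open>H\<close> on the \<open>C\<close>-linear maps.  As \<open>S\<close> reverses products and coproducts, \<open>h \<in> H\<close>
 acts in \<open>H_Hom_Mod\<close> as \<open>S h\<close> does here.\<close>

definition ract where
 "ract h \<eta> = (\<lambda>X\<in>Ob C. \<lambda>m\<in>car (Obj M X). sw (Obj N X) (\<lambda>a b. N.rh X b (\<eta> X (M.rh X (S a) m))) h)"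

lemma eta_lin: "\<eta> \<in> Hc ==> X \<in> Ob C ==> linop K V (Obj M X) g ==> linop K V (Obj N X) (\<lambda>x. \<eta> X (g x))"
 using linop_comp[OF linop_lin_maps[OF nat_maps_lin]] by force

lemma eta_closed: "\<eta> \<in> Hc ==> X \<in> Ob C ==> m \<in> car (Obj M X) ==> \<eta> X m \<in> car (Obj N X)"
 using nat_maps_closed[of \<eta> K C rM rN X m] by simp

lemma eta_natural: "\<eta> \<in> Hc ==> X \<in> Ob C ==> Y \<in> Ob C ==> f \<in> car (Hom C X Y) ==> m \<in> car (Obj M Y)
  ==> \<eta> X (M.cr X Y f m) = N.cr X Y f (\<eta> Y m)"
 using nat_maps_natural[of \<eta> K C rM rN X Y f m] by simp

text \<open>Moving f past the outer factor and then past the inner one twists it into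
  \<open>S h\<^sub>2 h\<^sub>3 f\<close>, while the legs \<open>h\<^sub>1\<close> and
  \<open>h\<^sub>4\<close> stay in the outer places. The two twists cancel by the antipode
  axiom.\<close>

lemma ract_closed:
 assumes h [simp]: "h \<in> car H" and e: "\<eta> \<in> Hc"
 shows "ract h \<eta> \<in> Hc"
proof -
 note [lin] = eta_lin[OF e] and [simp] = eta_closed[OF e]
 have "(\<lambda>X\<in>Ob C. \<lambda>m\<in>car (Obj rM X). sw (Obj N X) (\<lambda>a b. N.rh X b (\<eta> X (M.rh X (S a) m))) h) \<in> Hc"
 proof (rule nat_maps_restrictI)
  fix X assume X [simp]: "X \<in> Ob C"
  show "linop K (Obj rM X) (Obj rN X) (\<lambda>m. sw (Obj N X) (\<lambda>a b. N.rh X b (\<eta> X (M.rh X (S a) m))) h)"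
   unfolding restrict_module_simps by (intro lin) simp_all
  fix Y f m assume [simp]: "Y \<in> Ob C" "f \<in> car (Hom C X Y)" and "m \<in> car (Obj rM Y)"
  then have [simp]: "m \<in> car (Obj M Y)" by simp
  let ?P = "Obj N X"
  let ?g = "\<lambda>p q x y. N.rh X y (\<eta> X (M.rh X (S p) (M.cr X Y (hact C X Y (S q \<cdot> x) f) m)))"
  \<comment> \<open>As S reverses the coproduct, f' becomes S q f' with the second leg q of a, and
    the first leg p remains as the action of S p.\<close>
  have 1: "\<eta> X (M.cr X Y f' (M.rh Y (S a) m)) = sw ?P (\<lambda>p q. \<eta> X (M.rh X (S p) (M.cr X Y (hact C X Y (S q) f') m))) a"
   if [simp]: "a \<in> car H" "f' \<in> car (Hom C X Y)" for a f'
  proof -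
   have "M.cr X Y f' (M.rh Y (S a) m) = sw (Obj M X) (\<lambda>s t. M.rh X t (M.cr X Y (hact C X Y s f') m)) (S a)"
    by (rule M.cr_rh) simp_all
   also have "\<dots> = sw (Obj M X) (\<lambda>p q. M.rh X (S p) (M.cr X Y (hact C X Y (S q) f') m)) a"
    by (intro S_comult[where \<beta>="\<lambda>s t. M.rh X t (M.cr X Y (hact C X Y s f') m)"] lin) simp_all
   finally have "\<eta> X (M.cr X Y f' (M.rh Y (S a) m)) = \<eta> X (sw (Obj M X) (\<lambda>p q. M.rh X (S p) (M.cr X Y (hact C X Y (S q) f') m)) a)" by simp
   also have "\<dots> = sw ?P (\<lambda>p q. \<eta> X (M.rh X (S p) (M.cr X Y (hact C X Y (S q) f') m))) a"
    by (intro sw_hom lin) simp_all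
   finally show ?thesis .
  qed
  have "N.cr X Y f (sw (Obj N Y) (\<lambda>a b. N.rh Y b (\<eta> Y (M.rh Y (S a) m))) h)
    = sw ?P (\<lambda>a b. N.cr X Y f (N.rh Y b (\<eta> Y (M.rh Y (S a) m)))) h"
   by (intro sw_hom lin) simp_all
  also have "\<dots> = sw ?P (\<lambda>a b. sw ?P (\<lambda>x y. N.rh X y (N.cr X Y (hact C X Y x f) (\<eta> Y (M.rh Y (S a) m)))) b) h"
   by (intro sw_cong HOL.refl N.cr_rh) simp_all
  also have "\<dots> = sw ?P (\<lambda>a b. sw ?P (\<lambda>x y. N.rh X y (\<eta> X (M.cr X Y (hact C X Y x f) (M.rh Y (S a) m)))) b) h"
   by (simp add: eta_natural[OF e])
  also have "\<dots> = sw ?P (\<lambda>a b. sw ?P (\<lambda>x y. N.rh X y (sw ?P (\<lambda>p q. \<eta> X (M.rh X (S p) (M.cr X Y (hact C X Y (S q) (hact C X Y x f)) m))) a)) b) h"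
   by (simp add: 1)
  also have "\<dots> = sw ?P (\<lambda>a b. sw ?P (\<lambda>x y. sw ?P (\<lambda>p q. ?g p q x y) a) b) h"
  proof (intro sw_cong HOL.refl)
   fix a b x y assume [simp]: "a \<in> car H" "b \<in> car H" "x \<in> car H" "y \<in> car H"
   have "N.rh X y (sw ?P (\<lambda>p q. \<eta> X (M.rh X (S p) (M.cr X Y (hact C X Y (S q) (hact C X Y x f)) m))) a)
     = sw ?P (\<lambda>p q. N.rh X y (\<eta> X (M.rh X (S p) (M.cr X Y (hact C X Y (S q) (hact C X Y x f)) m)))) a"
    by (intro sw_hom lin) simp_all
   then show "N.rh X y (sw ?P (\<lambda>p q. \<eta> X (M.rh X (S p) (M.cr X Y (hact C X Y (S q) (hact C X Y x f)) m))) a)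
     = sw ?P (\<lambda>p q. ?g p q x y) a" by (simp add: hact_mult)
  qed simp_all
  also have "\<dots> = sw ?P (\<lambda>a b. sw ?P (\<lambda>p q. sw ?P (\<lambda>x y. ?g p q x y) b) a) h"
   by (intro sw_cong HOL.refl sw_swap) simp_all
  \<comment> \<open>Coassociativity, here and in the next step, brings the two middle legs q and x
    together.\<close>
  also have "\<dots> = sw ?P (\<lambda>p t. sw ?P (\<lambda>q b. sw ?P (\<lambda>x y. ?g p q x y) b) t) h"
   by (intro sw_coassoc lin) simp_all
  also have "\<dots> = sw ?P (\<lambda>p t. sw ?P (\<lambda>w y. sw ?P (\<lambda>q x. ?g p q x y) w) t) h"
   by (intro sw_cong HOL.refl sw_coassoc[symmetric] lin) simp_all
  also have "\<dots> = sw ?P (\<lambda>p t. sw ?P (\<lambda>w y. eps w \<odot>\<^bsub>?P\<^esub> N.rh X y (\<eta> X (M.rh X (S p) (M.cr X Y (hact C X Y \<one>\<^bsub>H\<^esub> f) m)))) t) h"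
   by (intro sw_cong HOL.refl sw_antipode_left[where F="\<lambda>z. N.rh X y (\<eta> X (M.rh X (S p) (M.cr X Y (hact C X Y z f) m)))" for y p] lin) simp_all
  also have "\<dots> = sw ?P (\<lambda>p t. N.rh X t (\<eta> X (M.rh X (S p) (M.cr X Y (hact C X Y \<one>\<^bsub>H\<^esub> f) m)))) h"
   by (intro sw_cong HOL.refl sw_counit_left lin) simp_all
  finally show "sw ?P (\<lambda>a b. N.rh X b (\<eta> X (M.rh X (S a) (Mor rM X Y f m)))) h
    = Mor rN X Y f (sw (Obj N Y) (\<lambda>a b. N.rh Y b (\<eta> Y (M.rh Y (S a) m))) h)"
   by (simp add: hact_one)
 qed simp_all
 then show ?thesis by (simp add: ract_def)
qed

lemma ract_apply [simp]: "X \<in> Ob C ==> m \<in> car (Obj M X) ==> ract h \<eta> X m = sw (Obj N X) (\<lambda>a b. N.rh X b (\<eta> X (M.rh X (S a) m))) h"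
 by (simp add: ract_def)

lemma Hc_eqI: "\<eta> \<in> Hc ==> \<theta> \<in> Hc ==> (\<And>X m. X \<in> Ob C ==> m \<in> car (Obj M X) ==> \<eta> X m = \<theta> X m) ==> \<eta> = \<theta>"
 by (rule nat_maps_eqI[of _ K C rM rN]) simp_all

lemma ract_mult:
 assumes [simp]: "k \<in> car H" "l \<in> car H" and e: "\<eta> \<in> Hc"
 shows "ract (k \<cdot> l) \<eta> = ract l (ract k \<eta>)"
proof (rule Hc_eqI)
 note [lin] = eta_lin[OF e] and [simp] = eta_closed[OF e]
 fix X m assume [simp]: "X \<in> Ob C" "m \<in> car (Obj M X)"
 let ?P = "Obj N X"
 have "ract (k \<cdot> l) \<eta> X m = sw ?P (\<lambda>a b. sw ?P (\<lambda>x y. N.rh X (b \<cdot> y) (\<eta> X (M.rh X (S (a \<cdot> x)) m))) l) k"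
  unfolding ract_apply[OF \<open>X \<in> Ob C\<close> \<open>m \<in> car (Obj M X)\<close>] by (intro sw_mult lin) simp_all
 also have "\<dots> = sw ?P (\<lambda>a b. sw ?P (\<lambda>x y. N.rh X y (N.rh X b (\<eta> X (M.rh X (S a) (M.rh X (S x) m))))) l) k"
  by (simp add: S_mult N.rh_mult M.rh_mult)
 also have "\<dots> = sw ?P (\<lambda>x y. sw ?P (\<lambda>a b. N.rh X y (N.rh X b (\<eta> X (M.rh X (S a) (M.rh X (S x) m))))) k) l"
  by (rule sw_swap) simp_all
 also have "\<dots> = sw ?P (\<lambda>x y. N.rh X y (sw ?P (\<lambda>a b. N.rh X b (\<eta> X (M.rh X (S a) (M.rh X (S x) m)))) k)) l"
  by (intro sw_cong HOL.refl sw_hom[symmetric] lin) simp_all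
 finally show "ract (k \<cdot> l) \<eta> X m = ract l (ract k \<eta>) X m" by simp
qed (simp_all add: ract_closed e)

lemma ract_one: assumes e: "\<eta> \<in> Hc" shows "ract \<one>\<^bsub>H\<^esub> \<eta> = \<eta>"
proof (rule Hc_eqI)
 note [lin] = eta_lin[OF e] and [simp] = eta_closed[OF e]
 fix X m assume [simp]: "X \<in> Ob C" "m \<in> car (Obj M X)"
 have "ract \<one>\<^bsub>H\<^esub> \<eta> X m = N.rh X \<one>\<^bsub>H\<^esub> (\<eta> X (M.rh X (S \<one>\<^bsub>H\<^esub>) m))"
  unfolding ract_apply[OF \<open>X \<in> Ob C\<close> \<open>m \<in> car (Obj M X)\<close>] by (intro sw_one lin) simp_all
 then show "ract \<one>\<^bsub>H\<^esub> \<eta> X m = \<eta> X m" by simp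
qed (simp_all add: ract_closed e)

lemma H_Hom_simps [simp]:
 "car A = Hc"
 "\<zero>\<^bsub>A\<^esub> = \<zero>\<^bsub>HC\<^esub>"
 "\<eta> \<oplus>\<^bsub>A\<^esub> \<theta> = \<eta> \<oplus>\<^bsub>HC\<^esub> \<theta>"
 "k \<odot>\<^bsub>A\<^esub> \<eta> = k \<odot>\<^bsub>HC\<^esub> \<eta>"
 by (simp_all add: H_Hom_Mod_def)

lemma H_Hom_act:
 assumes h [simp]: "h \<in> car H" and e: "\<eta> \<in> Hc"
 shows "act A h \<eta> = ract (S h) \<eta>"
proof -
 note [lin] = eta_lin[OF e] and [simp] = eta_closed[OF e]
 have "sw (Obj N X) (\<lambda>a b. N.rh X b (\<eta> X (M.rh X (S a) m))) (S h)
   = tsum (Obj N X) (\<lambda>h\<^sub>1 h\<^sub>2. module_hact K H C N X h\<^sub>1 (\<eta> X (module_hact K H C M X (antipode H h\<^sub>2) m))) (comult H h)"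
  if [simp]: "X \<in> Ob C" "m \<in> car (Obj M X)" for X m
 proof -
  have "sw (Obj N X) (\<lambda>a b. N.rh X b (\<eta> X (M.rh X (S a) m))) (S h)
    = sw (Obj N X) (\<lambda>a b. N.rh X (S a) (\<eta> X (M.rh X (S (S b)) m))) h"
   by (intro S_comult[where \<beta>="\<lambda>a b. N.rh X b (\<eta> X (M.rh X (S a) m))"] lin) simp_all
  then show ?thesis by (simp add: sw_def module_hact_def)
 qed
 then show ?thesis by (simp add: H_Hom_Mod_def ract_def)
qed

lemma Hom_module: "module K HC"
 by (rule Hom_Mod_module[OF HV.is_cring M.restrict_right_module N.restrict_right_module])

lemma ract_lin_left: assumes e: "\<eta> \<in> Hc" shows "linop K H HC (\<lambda>h. ract h \<eta>)"
proof -
 interpret HM: module K "HC" by (rule Hom_module)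
 note [lin] = eta_lin[OF e] and [simp] = eta_closed[OF e]
 have l: "linop K H (Obj N X) (\<lambda>h. sw (Obj N X) (\<lambda>a b. N.rh X b (\<eta> X (M.rh X (S a) m))) h)"
  if [simp]: "X \<in> Ob C" "m \<in> car (Obj M X)" for X m
  by (intro lin) simp_all
 show ?thesis
 proof (rule linopI)
  fix g h assume [simp]: "g \<in> car H" "h \<in> car H"
  show "ract (g \<oplus>\<^bsub>H\<^esub> h) \<eta> = ract g \<eta> \<oplus>\<^bsub>HC\<^esub> ract h \<eta>"
   using HM.add.m_closed[of "ract g \<eta>" "ract h \<eta>"]
   by (intro Hc_eqI) (simp_all add: ract_closed e linop_add[OF l])
 next
  fix k h assume [simp]: "k \<in> car K" "h \<in> car H"
  show "ract (k \<odot>\<^bsub>H\<^esub> h) \<eta> = k \<odot>\<^bsub>HC\<^esub> ract h \<eta>"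
   using HM.smult_closed[of k "ract h \<eta>"]
   by (intro Hc_eqI) (simp_all add: ract_closed e linop_smult[OF l])
 qed (simp add: ract_closed e)
qed

lemma ract_lin_right: assumes h [simp]: "h \<in> car H" shows "linop K HC HC (ract h)"
proof -
 interpret HM: module K "HC" by (rule Hom_module)
 have ev: "linop K HC (Obj N X) (\<lambda>\<eta>. \<eta> X m)" if "X \<in> Ob C" "m \<in> car (Obj M X)" for X m
  using that eta_closed by (intro linopI) simp_all
 have l: "linop K HC (Obj N X) (\<lambda>\<eta>. sw (Obj N X) (\<lambda>a b. N.rh X b (\<eta> X (M.rh X (S a) m))) h)"
  if [simp]: "X \<in> Ob C" "m \<in> car (Obj M X)" for X m
  by (intro lin ev) simp_all
 show ?thesis
 proof (rule linopI)
  fix \<eta> \<theta> assume a: "\<eta> \<in> car HC" "\<theta> \<in> car HC"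
  show "ract h (\<eta> \<oplus>\<^bsub>HC\<^esub> \<theta>) = ract h \<eta> \<oplus>\<^bsub>HC\<^esub> ract h \<theta>"
  proof (rule Hc_eqI)
   fix X m assume X: "X \<in> Ob C" "m \<in> car (Obj M X)"
   then show "ract h (\<eta> \<oplus>\<^bsub>HC\<^esub> \<theta>) X m = (ract h \<eta> \<oplus>\<^bsub>HC\<^esub> ract h \<theta>) X m"
    using linop_add[OF l[OF X] a] by simp
  qed (use a HM.a_closed[of \<eta> \<theta>] HM.a_closed[of "ract h \<eta>" "ract h \<theta>"] in \<open>simp_all add: ract_closed\<close>)
 next
  fix k \<eta> assume k: "k \<in> car K" and a: "\<eta> \<in> car HC"
  show "ract h (k \<odot>\<^bsub>HC\<^esub> \<eta>) = k \<odot>\<^bsub>HC\<^esub> ract h \<eta>"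
  proof (rule Hc_eqI)
   fix X m assume X: "X \<in> Ob C" "m \<in> car (Obj M X)"
   then show "ract h (k \<odot>\<^bsub>HC\<^esub> \<eta>) X m = (k \<odot>\<^bsub>HC\<^esub> ract h \<eta>) X m"
    using linop_smult[OF l[OF X] k a] by simp
  qed (use a k HM.smult_closed[of k \<eta>] HM.smult_closed[of k "ract h \<eta>"] in \<open>simp_all add: ract_closed\<close>)
 qed (simp add: ract_closed)
qed

lemma H_Hom_module: "left_H_module K H A"
proof (rule left_H_module.intro)
 let ?A = A
 show V: "module K ?A" unfolding H_Hom_Mod_def by (rule module_with_act[OF Hom_module])
 interpret A: module K ?A by (rule V)
 note cl = A.a_closed[unfolded H_Hom_simps(1,3)] A.smult_closed[unfolded H_Hom_simps(1,4)]
 note [simp del] = Hom_Mod_simps(2-4)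
 note [simp] = H_Hom_act ract_closed cl
 note ll = linop_comp[OF ract_lin_left S_lin[OF linop_id]]
 show "act ?A h v \<in> car ?A" if "h \<in> car H" "v \<in> car ?A" for h v
  using that by simp
 show "act ?A (g \<oplus>\<^bsub>H\<^esub> h) v = act ?A g v \<oplus>\<^bsub>?A\<^esub> act ?A h v"
  if "g \<in> car H" "h \<in> car H" "v \<in> car ?A" for g h v
  using that by (simp add: linop_add[OF ll])
 show "act ?A h (v \<oplus>\<^bsub>?A\<^esub> w) = act ?A h v \<oplus>\<^bsub>?A\<^esub> act ?A h w"
  if "h \<in> car H" "v \<in> car ?A" "w \<in> car ?A" for h v w
  using that by (simp add: linop_add[OF ract_lin_right])
 show "act ?A (k \<odot>\<^bsub>H\<^esub> h) v = k \<odot>\<^bsub>?A\<^esub> act ?A h v"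
  if "k \<in> car K" "h \<in> car H" "v \<in> car ?A" for k h v
  using that by (simp add: linop_smult[OF ll])
 show "act ?A h (k \<odot>\<^bsub>?A\<^esub> v) = k \<odot>\<^bsub>?A\<^esub> act ?A h v"
  if "k \<in> car K" "h \<in> car H" "v \<in> car ?A" for k h v
  using that by (simp add: linop_smult[OF ract_lin_right])
 show "act ?A (g \<cdot> h) v = act ?A g (act ?A h v)"
  if "g \<in> car H" "h \<in> car H" "v \<in> car ?A" for g h v
  using that by (simp add: S_mult ract_mult)
 show "act ?A \<one>\<^bsub>H\<^esub> v = v" if "v \<in> car ?A" for v
  using that by (simp add: ract_one)
qed

text \<open>Written out, m is acted upon by \<open>k\<^sub>1 S k\<^sub>2\<close>, which the antipode
  axiom collapses, and \<open>k\<^sub>3\<close> is left outside. The identity is needed twice: for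
  the linearity over H of invariant maps, and for the behaviour of \<open>Phi\<close> on the
  unit.\<close>

lemma ract_collapse:
 assumes e: "\<eta> \<in> Hc" and [simp]: "X \<in> Ob C" "k \<in> car H" "m \<in> car (Obj M X)"
 shows "sw (Obj N X) (\<lambda>a b. ract b \<eta> X (M.rh X a m)) k = N.rh X k (\<eta> X m)"
proof -
 note [lin] = eta_lin[OF e] and [simp] = eta_closed[OF e]
 let ?P = "Obj N X"
 have "sw ?P (\<lambda>a b. ract b \<eta> X (M.rh X a m)) k = sw ?P (\<lambda>a b. sw ?P (\<lambda>x y. N.rh X y (\<eta> X (M.rh X (a \<cdot> S x) m))) b) k"
  by (simp add: M.rh_mult)
 also have "\<dots> = sw ?P (\<lambda>w y. sw ?P (\<lambda>a x. N.rh X y (\<eta> X (M.rh X (a \<cdot> S x) m))) w) k"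
  by (intro sw_coassoc[symmetric] lin) simp_all
 also have "\<dots> = sw ?P (\<lambda>w y. eps w \<odot>\<^bsub>?P\<^esub> N.rh X y (\<eta> X (M.rh X \<one>\<^bsub>H\<^esub> m))) k"
  by (intro sw_cong HOL.refl sw_antipode_right[where F="\<lambda>z. N.rh X y (\<eta> X (M.rh X z m))" for y] lin) simp_all
 also have "\<dots> = N.rh X k (\<eta> X (M.rh X \<one>\<^bsub>H\<^esub> m))"
  by (intro sw_counit_left lin) simp_all
 finally show ?thesis by simp
qed

text \<open>If \<eta> commutes with H, then in \<open>ract\<close> both actions act on \<eta> m and
  combine to \<open>S a b\<close>, which collapses to \<epsilon>. Conversely, if every translate of
  \<eta> is its multiple by \<epsilon>, then \<open>ract_collapse\<close> together with the counit
  axiom reads \<eta> (m k) = (\<eta> m) k.\<close>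

lemma invariant_iff:
 "\<eta> \<in> Hc \<and> (\<forall>h\<in>car H. act A h \<eta> = eps h \<odot>\<^bsub>A\<^esub> \<eta>)
  \<longleftrightarrow> \<eta> \<in> nat_maps K (smash K H C) M N"
proof
 assume e: "\<eta> \<in> nat_maps K (smash K H C) M N"
 have nat: "\<eta> X (Mor M X Y s m) = Mor N X Y s (\<eta> Y m)" if "X \<in> Ob C" "Y \<in> Ob C" "s \<in> car (Sm X Y)" "m \<in> car (Obj M Y)" for X Y s m
  using nat_maps_natural[OF e, of X Y s m] that by simp
 have cl: "\<eta> X m \<in> car (Obj N X)" if "X \<in> Ob C" "m \<in> car (Obj M X)" for X m
  using nat_maps_closed[OF e, of X m] that by simp
 have e': "\<eta> \<in> Hc"
  by (rule nat_mapsI) (use nat_maps_lin[OF e] nat_maps_undef[OF e] nat in simp_all)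
 have "ract (S h) \<eta> = eps h \<odot>\<^bsub>HC\<^esub> \<eta>" if h [simp]: "h \<in> car H" for h
 proof (rule Hc_eqI)
  show "eps h \<odot>\<^bsub>HC\<^esub> \<eta> \<in> Hc"
   using module.smult_closed[OF Hom_module, of "eps h" \<eta>] e' by (simp del: Hom_Mod_simps(4))
  fix X m assume X [simp]: "X \<in> Ob C" "m \<in> car (Obj M X)"
  note [simp] = cl
  have "ract (S h) \<eta> X m = sw (Obj N X) (\<lambda>a b. N.rh X (S a \<cdot> b) (\<eta> X m)) (S h)"
   by (simp add: nat N.rh_mult)
  also have "\<dots> = eps (S h) \<odot>\<^bsub>Obj N X\<^esub> N.rh X \<one>\<^bsub>H\<^esub> (\<eta> X m)"
   by (intro sw_antipode_left[where F="\<lambda>z. N.rh X z (\<eta> X m)"] lin) simp_all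
  finally show "ract (S h) \<eta> X m = (eps h \<odot>\<^bsub>HC\<^esub> \<eta>) X m" by (simp add: eps_S)
 qed (simp add: ract_closed e')
 then show "\<eta> \<in> Hc \<and> (\<forall>h\<in>car H. act A h \<eta> = eps h \<odot>\<^bsub>A\<^esub> \<eta>)"
  using e' by (simp add: H_Hom_act)
next
 assume a: "\<eta> \<in> Hc \<and> (\<forall>h\<in>car H. act A h \<eta> = eps h \<odot>\<^bsub>A\<^esub> \<eta>)"
 then have e: "\<eta> \<in> Hc" by simp
 note [lin] = eta_lin[OF e] and [simp] = eta_closed[OF e]
 have r: "ract k \<eta> = eps k \<odot>\<^bsub>HC\<^esub> \<eta>" if k: "k \<in> car H" for k
 proof -
  \<comment> \<open>The action \<open>act\<close> only involves elements S h; surjectivity of S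
    extends invariance to all of \<open>ract\<close>.\<close>
  obtain h where "h \<in> car H" "k = S h" using k by (rule S_surj)
  then show ?thesis using a by (simp add: H_Hom_act[OF _ e] eps_S del: Hom_Mod_simps(4))
 qed
 have rh: "\<eta> X (M.rh X k m) = N.rh X k (\<eta> X m)"
  if [simp]: "X \<in> Ob C" "k \<in> car H" "m \<in> car (Obj M X)" for X k m
 proof -
  let ?P = "Obj N X"
  have "\<eta> X (M.rh X k m) = sw ?P (\<lambda>a b. eps b \<odot>\<^bsub>?P\<^esub> \<eta> X (M.rh X a m)) k"
   by (intro sw_counit_right[symmetric] lin) simp_all
  also have "\<dots> = sw ?P (\<lambda>a b. ract b \<eta> X (M.rh X a m)) k"
   by (intro sw_cong HOL.refl) (simp_all only: r, simp_all)
  finally show ?thesis by (simp add: ract_collapse[OF e] del: ract_apply)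
 qed
 show "\<eta> \<in> nat_maps K (smash K H C) M N"
 proof (rule nat_mapsI, unfold smash_simps)
  show "\<eta> X \<in> lin_maps K (Obj M X) (Obj N X)" if "X \<in> Ob C" for X using nat_maps_lin[OF e that] by simp
  show "\<eta> X = undefined" if "X \<notin> Ob C" for X using nat_maps_undef[OF e that] .
  fix X Y s m assume [simp]: "X \<in> Ob C" "Y \<in> Ob C" and s: "s \<in> car (Sm X Y)" and [simp]: "m \<in> car (Obj M Y)"
  show "\<eta> X (Mor M X Y s m) = Mor N X Y s (\<eta> Y m)"
  proof (rule Sm_eqI[OF _ _ _ _ _ s, where F="\<lambda>s. \<eta> X (Mor M X Y s m)" and G="\<lambda>s. Mor N X Y s (\<eta> Y m)"])
   show "linop K (Sm X Y) (Obj N X) (\<lambda>s. \<eta> X (Mor M X Y s m))" by (intro lin) simp_all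
   show "linop K (Sm X Y) (Obj N X) (\<lambda>s. Mor N X Y s (\<eta> Y m))" by (intro lin) simp_all
   show "\<eta> X (Mor M X Y (pr X Y f h) m) = Mor N X Y (pr X Y f h) (\<eta> Y m)" if [simp]: "f \<in> car (Hom C X Y)" "h \<in> car H" for f h
   proof -
    have "\<eta> X (Mor M X Y (pr X Y f h) m) = \<eta> X (M.rh X h (M.cr X Y f m))"
     by (subst M.Mor_pure) simp_all
    also have "\<dots> = N.rh X h (N.cr X Y f (\<eta> Y m))" by (simp add: rh eta_natural[OF e])
    also have "\<dots> = Mor N X Y (pr X Y f h) (\<eta> Y m)" by (rule N.Mor_pure[symmetric]) simp_all
    finally show ?thesis .
   qed
  qed simp_all
 qed
qed

lemma invariants_H_Hom: "invariants H A = Hom_Mod K (smash K H C) M N"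
 unfolding invariants_def H_Hom_simps(1) invariant_iff[symmetric, unfolded atomize_eq]
 using invariant_iff
 by (simp add: module.truncate_def H_Hom_Mod_def with_act_def module.extend_def hmodule.fields_def Hom_Mod_def)

end

text \<open>The map f commutes with the actions of H on its source and target, so composing with it
  commutes with the action on C-linear maps. The restriction provides the extensionality that
  \<open>H_maps\<close> demands.\<close>

lemma Hom_Mod_map_H:
 assumes "hom_setup K H C M N" "hom_setup K H C M N'" and f: "f \<in> nat_maps K (smash K H C) N N'"
 shows "restrict (Hom_Mod_map C M f) (car (H_Hom_Mod K H C M N)) \<in> H_maps K H (H_Hom_Mod K H C M N) (H_Hom_Mod K H C M N')"
proof -
 interpret A: hom_setup K H C M N by fact
 interpret B: hom_setup K H C M N' by fact
 interpret H: ring H by (rule A.ring)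
 note sm = A.smash_simps
 have fl: "linop K V (Obj N' X) (\<lambda>x. f X (g x))" if "X \<in> Ob C" "linop K V (Obj N X) g" for V g X
  using linop_comp[OF linop_lin_maps[OF nat_maps_lin[OF f]] that(2)] that(1) by simp
 have fc [simp]: "f X m \<in> car (Obj N' X)" if "X \<in> Ob C" "m \<in> car (Obj N X)" for X m
  using nat_maps_closed[OF f, of X m] that by simp
 have fn: "f X (Mor N X Y s m) = Mor N' X Y s (f Y m)" if "X \<in> Ob C" "Y \<in> Ob C" "s \<in> car (A.Sm X Y)" "m \<in> car (Obj N Y)" for X Y s m
  using nat_maps_natural[OF f, of X Y s m] that by simp
 have ap: "Hom_Mod_map C M f \<eta> X m = f X (\<eta> X m)" if "X \<in> Ob C" "m \<in> car (Obj M X)" for \<eta> X m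
  using that by (simp add: Hom_Mod_map_def)
 have cl: "Hom_Mod_map C M f \<eta> \<in> B.Hc" if e: "\<eta> \<in> A.Hc" for \<eta>
 proof -
  have "(\<lambda>X\<in>Ob C. \<lambda>m\<in>car (Obj A.rM X). f X (\<eta> X m)) \<in> B.Hc"
  proof (rule nat_maps_restrictI)
   show "linop K (Obj A.rM X) (Obj B.rN X) (\<lambda>m. f X (\<eta> X m))" if "X \<in> Ob C" for X
    using fl[OF that A.eta_lin[OF e that linop_id]] by simp
  qed (simp_all add: fn A.eta_natural[OF e] A.eta_closed[OF e])
  then show ?thesis by (simp add: Hom_Mod_map_def)
 qed
 interpret AM: left_H_module K H "H_Hom_Mod K H C M N" by (rule A.H_Hom_module)
 interpret AH: module K "H_Hom_Mod K H C M N" by (rule AM.vector_space)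
 interpret BM: left_H_module K H "H_Hom_Mod K H C M N'" by (rule B.H_Hom_module)
 interpret BH: module K "H_Hom_Mod K H C M N'" by (rule BM.vector_space)
 note flin = linop_lin_maps[OF nat_maps_lin[OF f], unfolded sm]
 note Ac = AH.a_closed AH.smult_closed AM.act_closed and Bc = BH.a_closed BH.smult_closed BM.act_closed
 show ?thesis
 proof (rule H_mapsI)
  show "restrict (Hom_Mod_map C M f) (car (H_Hom_Mod K H C M N)) \<in> lin_maps K (H_Hom_Mod K H C M N) (H_Hom_Mod K H C M N')"
  proof (rule lin_restrictI[OF AM.vector_space])
   show "Hom_Mod_map C M f x \<in> car (H_Hom_Mod K H C M N')" if "x \<in> car (H_Hom_Mod K H C M N)" for x
    using that cl by simp
   fix x assume x: "x \<in> car (H_Hom_Mod K H C M N)"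
   { fix y assume y: "y \<in> car (H_Hom_Mod K H C M N)"
    show "Hom_Mod_map C M f (x \<oplus>\<^bsub>H_Hom_Mod K H C M N\<^esub> y) = Hom_Mod_map C M f x \<oplus>\<^bsub>H_Hom_Mod K H C M N'\<^esub> Hom_Mod_map C M f y"
    proof (rule B.Hc_eqI)
     fix X m assume "X \<in> Ob C" "m \<in> car (Obj M X)"
     then show "Hom_Mod_map C M f (x \<oplus>\<^bsub>H_Hom_Mod K H C M N\<^esub> y) X m = (Hom_Mod_map C M f x \<oplus>\<^bsub>H_Hom_Mod K H C M N'\<^esub> Hom_Mod_map C M f y) X m"
      using x y by (simp add: ap linop_add[OF flin] A.eta_closed)
    qed (use cl x y Ac(1)[of x y] Bc(1)[of "Hom_Mod_map C M f x" "Hom_Mod_map C M f y"] in simp_all) }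
   { fix k assume k: "k \<in> car K"
    show "Hom_Mod_map C M f (k \<odot>\<^bsub>H_Hom_Mod K H C M N\<^esub> x) = k \<odot>\<^bsub>H_Hom_Mod K H C M N'\<^esub> Hom_Mod_map C M f x"
    proof (rule B.Hc_eqI)
     fix X m assume "X \<in> Ob C" "m \<in> car (Obj M X)"
     then show "Hom_Mod_map C M f (k \<odot>\<^bsub>H_Hom_Mod K H C M N\<^esub> x) X m = (k \<odot>\<^bsub>H_Hom_Mod K H C M N'\<^esub> Hom_Mod_map C M f x) X m"
      using x k by (simp add: ap linop_smult[OF flin] A.eta_closed)
    qed (use cl x k Ac(2)[of k x] Bc(2)[of k "Hom_Mod_map C M f x"] in simp_all) }
  qed
  fix h v assume h [simp]: "h \<in> car H" and v: "v \<in> car (H_Hom_Mod K H C M N)"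
  then have v' [simp]: "v \<in> A.Hc" by simp
  note [simp] = A.eta_closed[OF v']
  have "Hom_Mod_map C M f (A.ract (A.S h) v) = B.ract (A.S h) (Hom_Mod_map C M f v)"
  proof (rule B.Hc_eqI)
   fix X m assume [simp]: "X \<in> Ob C" "m \<in> car (Obj M X)"
   have "f X (A.sw (Obj N X) (\<lambda>a b. A.N.rh X b (v X (A.M.rh X (A.S a) m))) (A.S h))
     = A.sw (Obj N' X) (\<lambda>a b. f X (A.N.rh X b (v X (A.M.rh X (A.S a) m)))) (A.S h)"
    by (intro A.sw_hom fl linop_id) simp_all
   then show "Hom_Mod_map C M f (A.ract (A.S h) v) X m = B.ract (A.S h) (Hom_Mod_map C M f v) X m"
    by (simp add: ap fn)
  qed (simp_all add: cl A.ract_closed B.ract_closed)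
  then show "restrict (Hom_Mod_map C M f) (car (H_Hom_Mod K H C M N)) (act (H_Hom_Mod K H C M N) h v)
    = act (H_Hom_Mod K H C M N') h (restrict (Hom_Mod_map C M f) (car (H_Hom_Mod K H C M N)) v)"
   by (simp add: A.H_Hom_act B.H_Hom_act cl A.ract_closed)
 qed
qed

section \<open>Relative injectivity of the maps into an injective module\<close>

locale hom_cofree = hom_setup K H C M N
 for K :: "'k ring" and H :: "('k, 'h) hopf" and C :: "('k, 'h, 'o, 'c) hcat"
  and M :: "('k, 'o, ('c, 'h) tensor, 'm) rmodule" and N :: "('k, 'o, ('c, 'h) tensor, 'n) rmodule" +
 fixes c :: "('o \<times> ('c, 'h) tensor => 'n) => 'n"
 assumes c_inj: "inj c"
begin

interpretation H: ring H by (rule ring)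
interpretation HV: module K H by (rule vector_space)

abbreviation F where "F \<equiv> cofree K (smash K H C) c (Obj N)"

sublocale CD: cofree_data K "smash K H C" c "Obj N"
 by (intro cofree_data.intro cofree_data_axioms.intro) (simp_all add: smash_linear_category c_inj)

sublocale B: hom_setup K H C M F
 by (intro hom_setup.intro smod.intro)
  (rule smash_setup_axioms M.right_module_axioms CD.cofree_module[OF HV.is_cring])+

abbreviation dec where "dec \<equiv> inv_into UNIV c"
definition Sinv where "Sinv = inv_into (car H) S"

lemma Sinv_closed [simp]: "a \<in> car H ==> Sinv a \<in> car H"
 unfolding Sinv_def using antipode_bij by (metis bij_betw_def inv_into_into)

lemma S_Sinv [simp]: "a \<in> car H ==> S (Sinv a) = a"
 unfolding Sinv_def using antipode_bij by (metis bij_betw_def f_inv_into_f)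

lemma Sinv_S [simp]: "a \<in> car H ==> Sinv (S a) = a"
 unfolding Sinv_def using antipode_bij by (metis bij_betw_def inv_into_f_f)

lemma S_eqD: "a \<in> car H ==> b \<in> car H ==> S a = S b ==> a = b"
 using antipode_bij by (auto simp: bij_betw_def inj_on_def)

lemma Sinv_lin [lin]: assumes "linop K V H g" shows "linop K V H (\<lambda>x. Sinv (g x))"
proof (rule linop_comp[OF _ assms], rule linopI)
 show "Sinv (a \<oplus>\<^bsub>H\<^esub> b) = Sinv a \<oplus>\<^bsub>H\<^esub> Sinv b" if "a \<in> car H" "b \<in> car H" for a b
  using that by (rule_tac S_eqD) (simp_all add: antipode_add)
 show "Sinv (k \<odot>\<^bsub>H\<^esub> a) = k \<odot>\<^bsub>H\<^esub> Sinv a" if "k \<in> car K" "a \<in> car H" for k a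
  using that by (rule_tac S_eqD) (simp_all add: antipode_smult)
qed simp

lemma Sinv_mult: "a \<in> car H ==> b \<in> car H ==> Sinv (a \<cdot> b) = Sinv b \<cdot> Sinv a"
 by (rule_tac S_eqD) (simp_all add: S_mult)

lemma scomp_one_pure:
 assumes [simp]: "X \<in> Ob C" "Y \<in> Ob C" "Z \<in> Ob C" "g \<in> car (Hom C X Y)" "f \<in> car (Hom C Z X)" "h \<in> car H"
 shows "scomp Z X Y (pr X Y g \<one>\<^bsub>H\<^esub>) (pr Z X f h) = pr Z Y (Comp C Z X Y g f) h"
proof -
 have "scomp Z X Y (pr X Y g \<one>\<^bsub>H\<^esub>) (pr Z X f h)
   = sw (Sm Z Y) (\<lambda>a b. pr Z Y (Comp C Z X Y g (hact C Z X a f)) (b \<cdot> h)) \<one>\<^bsub>H\<^esub>"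
  by (rule scomp_pure) simp_all
 also have "\<dots> = pr Z Y (Comp C Z X Y g (hact C Z X \<one>\<^bsub>H\<^esub> f)) (\<one>\<^bsub>H\<^esub> \<cdot> h)"
  by (intro sw_one lin) simp_all
 finally show ?thesis by (simp add: hact_one)
qed

lemma F_cases: assumes "x \<in> car (Obj F X)" obtains \<phi> where "x = c \<phi>" "\<phi> \<in> cofree_set K (smash K H C) (Obj N) X"
 using assms by auto

lemma F_eqI:
 assumes "x \<in> car (Obj F X)" "y \<in> car (Obj F X)"
  and "\<And>Z s. Z \<in> Ob C ==> s \<in> car (Sm Z X) ==> dec x (Z, s) = dec y (Z, s)"
 shows "x = y"
proof -
 obtain \<phi> where \<phi>: "x = c \<phi>" "\<phi> \<in> cofree_set K (smash K H C) (Obj N) X" using assms(1) by (rule F_cases)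
 obtain \<psi> where \<psi>: "y = c \<psi>" "\<psi> \<in> cofree_set K (smash K H C) (Obj N) X" using assms(2) by (rule F_cases)
 have "\<phi> = \<psi>" by (rule CD.cofree_eqI[OF \<phi>(2) \<psi>(2)]) (use assms(3) \<phi>(1) \<psi>(1) in simp)
 then show ?thesis using \<phi> \<psi> by simp
qed

lemma dec_closed [simp]: "x \<in> car (Obj F X) ==> Z \<in> Ob C ==> s \<in> car (Sm Z X) ==> dec x (Z, s) \<in> car (Obj N Z)"
 using CD.cofree_setD(1)[of _ X Z s] by (auto elim!: F_cases)

lemma dec_lin_x [lin]:
 assumes X: "X \<in> Ob C" "Z \<in> Ob C" "s \<in> car (Sm Z X)" and g: "linop K V (Obj F X) g"
 shows "linop K V (Obj N Z) (\<lambda>x. dec (g x) (Z, s))"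
proof (rule linop_comp[OF _ g, of "Obj N Z" "\<lambda>x. dec x (Z, s)"], rule linopI)
 fix x assume x: "x \<in> car (Obj F X)"
 then obtain \<phi> where \<phi>: "x = c \<phi>" by (rule F_cases)
 show "dec x (Z, s) \<in> car (Obj N Z)" using dec_closed[OF x X(2,3)] .
 show "dec (x \<oplus>\<^bsub>Obj F X\<^esub> y) (Z, s) = dec x (Z, s) \<oplus>\<^bsub>Obj N Z\<^esub> dec y (Z, s)" if "y \<in> car (Obj F X)" for y
  using that X \<phi> by (auto elim!: F_cases)
 show "dec (k \<odot>\<^bsub>Obj F X\<^esub> x) (Z, s) = k \<odot>\<^bsub>Obj N Z\<^esub> dec x (Z, s)" for k
  using X \<phi> by simp
qed

lemma dec_lin_s [lin]:
 assumes X: "X \<in> Ob C" "Z \<in> Ob C" "x \<in> car (Obj F X)" and g: "linop K V (Sm Z X) g"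
 shows "linop K V (Obj N Z) (\<lambda>y. dec x (Z, g y))"
proof -
 obtain \<phi> where \<phi>: "x = c \<phi>" "\<phi> \<in> cofree_set K (smash K H C) (Obj N) X" using X(3) by (rule F_cases)
 have "linop K (Sm Z X) (Obj N Z) (\<lambda>s. dec x (Z, s))"
  using CD.cofree_setD(1-3)[OF \<phi>(2), of Z] X(2) \<phi>(1) by (intro linopI) simp_all
 from linop_comp[OF this g] show ?thesis .
qed

lemma dec_Mor [simp]:
 assumes "x \<in> car (Obj F X)" "Z \<in> Ob C" "Z' \<in> Ob C" "s \<in> car (Sm Z Z')"
 shows "dec (Mor F Z' X t x) (Z, s) = dec x (Z, scomp Z Z' X t s)"
 using assms(1) by (rule F_cases) (simp add: assms)

text \<open>A \<open>C\<close>-linear map into the cofree module is determined by the values at \<open>id # h\<close>, because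
 \<open>f # h = (f # 1)(id # h)\<close>.\<close>

lemma cofree_maps_eqI:
 assumes \<eta>: "\<eta> \<in> B.Hc" and \<theta>: "\<theta> \<in> B.Hc"
  and eq: "\<And>X m h. X \<in> Ob C ==> m \<in> car (Obj M X) ==> h \<in> car H
   ==> dec (\<eta> X m) (X, pr X X (Ident C X) h) = dec (\<theta> X m) (X, pr X X (Ident C X) h)"
 shows "\<eta> = \<theta>"
proof (rule B.Hc_eqI[OF \<eta> \<theta>])
 fix X m assume X [simp]: "X \<in> Ob C" and m [simp]: "m \<in> car (Obj M X)"
 note [simp] = B.eta_closed[OF \<eta>, simplified] B.eta_closed[OF \<theta>, simplified]
 have e: "\<eta> X m \<in> car (Obj F X)" "\<theta> X m \<in> car (Obj F X)" by simp_all
 have v: "dec (\<zeta> X m) (Z, pr Z X f h) = dec (\<zeta> Z (M.cr Z X f m)) (Z, pr Z Z (Ident C Z) h)"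
  if \<zeta>: "\<zeta> \<in> B.Hc" and [simp]: "Z \<in> Ob C" "f \<in> car (Hom C Z X)" "h \<in> car H" for \<zeta> Z f h
 proof -
  have "dec (\<zeta> Z (M.cr Z X f m)) (Z, pr Z Z (Ident C Z) h) = dec (B.N.cr Z X f (\<zeta> X m)) (Z, pr Z Z (Ident C Z) h)"
   by (simp add: B.eta_natural[OF \<zeta>])
  also have "\<dots> = dec (\<zeta> X m) (Z, scomp Z Z X (pr Z X f \<one>\<^bsub>H\<^esub>) (pr Z Z (Ident C Z) h))"
   by (rule dec_Mor[OF B.eta_closed[OF \<zeta>]]) simp_all
  finally show ?thesis by (simp add: M.scomp_ident_pure)
 qed
 show "\<eta> X m = \<theta> X m"
 proof (rule F_eqI[OF e])
  fix Z s assume Z [simp]: "Z \<in> Ob C" and s: "s \<in> car (Sm Z X)"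
  show "dec (\<eta> X m) (Z, s) = dec (\<theta> X m) (Z, s)"
   by (rule Sm_eqI[OF _ _ _ _ _ s, where F="\<lambda>s. dec (\<eta> X m) (Z, s)" and G="\<lambda>s. dec (\<theta> X m) (Z, s)" and P="Obj N Z"])
    (simp_all add: v \<eta> \<theta> eq dec_lin_s[OF X Z e(1) linop_id] dec_lin_s[OF X Z e(2) linop_id])
 qed
qed

text \<open>The inverse antipode undoes the S through which H acts on C-linear maps: for \<phi> = (h
  \<mapsto> h \<eta>) the value at \<open>Sinv b\<close> is \<open>ract b \<eta>\<close>. Then
  \<open>ract_collapse\<close> evaluates the sum to (\<eta> m)(f # h), which is the unit of the
  cofree module at \<eta> m.\<close>

definition ph where "ph \<phi> X m Z s = tsum (Obj N Z) (\<lambda>f h. sw (Obj N Z) (\<lambda>a b. \<phi> (Sinv b) Z (M.rh Z a (M.cr Z X f m))) h) s"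
definition Phi where "Phi \<phi> = (\<lambda>X\<in>Ob C. \<lambda>m\<in>car (Obj M X). c (\<lambda>p\<in>cdom (smash K H C) X. ph \<phi> X m (fst p) (snd p)))"

context
 fixes \<phi> assumes \<phi>: "\<phi> \<in> lin_maps K H A"
begin

lemma phi_Hc: "h \<in> car H ==> \<phi> h \<in> Hc"
 using lin_closed[OF \<phi>] by simp

lemma phi_closed: "h \<in> car H ==> Z \<in> Ob C ==> m \<in> car (Obj M Z) ==> \<phi> h Z m \<in> car (Obj N Z)"
 by (rule eta_closed[OF phi_Hc])

lemma phi_lin_left:
 assumes "Z \<in> Ob C" "m \<in> car (Obj M Z)" "linop K V H g" shows "linop K V (Obj N Z) (\<lambda>x. \<phi> (g x) Z m)"
proof -
 have "linop K HC (Obj N Z) (\<lambda>\<eta>. \<eta> Z m)" using assms eta_closed by (intro linopI) simp_all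
 moreover have "linop K V HC (\<lambda>x. \<phi> (g x))"
  using linop_comp[OF linop_lin_maps[OF \<phi>] assms(3)] by (simp add: linop_def)
 ultimately show ?thesis by (rule linop_comp)
qed

lemma phi_lin_right:
 assumes "h \<in> car H" "Z \<in> Ob C" "linop K V (Obj M Z) g" shows "linop K V (Obj N Z) (\<lambda>x. \<phi> h Z (g x))"
 by (rule eta_lin[OF phi_Hc[OF assms(1)] assms(2,3)])

lemmas phi_rules = phi_lin_left phi_lin_right

lemma ph_bilin: "X \<in> Ob C ==> Z \<in> Ob C ==> m \<in> car (Obj M X) ==>
  bilin K (Hom C Z X) H (Obj N Z) (\<lambda>f h. sw (Obj N Z) (\<lambda>a b. \<phi> (Sinv b) Z (M.rh Z a (M.cr Z X f m))) h)"
 by (intro lin phi_rules) (simp_all add: phi_closed)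

lemma ph_pure: "X \<in> Ob C ==> Z \<in> Ob C ==> m \<in> car (Obj M X) ==> f \<in> car (Hom C Z X) ==> h \<in> car H ==>
  ph \<phi> X m Z (pr Z X f h) = sw (Obj N Z) (\<lambda>a b. \<phi> (Sinv b) Z (M.rh Z a (M.cr Z X f m))) h"
 unfolding ph_def by (rule tsum_pure[OF _ _ _ ph_bilin]) simp_all

lemma ph_lin_s: "X \<in> Ob C ==> Z \<in> Ob C ==> m \<in> car (Obj M X) ==> linop K V (Sm Z X) g ==> linop K V (Obj N Z) (\<lambda>x. ph \<phi> X m Z (g x))"
 unfolding ph_def by (rule linop_comp[OF tsum_linop[OF _ _ _ ph_bilin]]) simp_all

lemma ph_lin_m: "X \<in> Ob C ==> Z \<in> Ob C ==> s \<in> car (Sm Z X) ==> linop K V (Obj M X) g ==> linop K V (Obj N Z) (\<lambda>x. ph \<phi> X (g x) Z s)"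
 unfolding ph_def by (intro tsum_linop_param[of K "Hom C Z X" H] lin phi_rules) (simp_all add: phi_closed)

lemma ph_closed: "X \<in> Ob C ==> Z \<in> Ob C ==> m \<in> car (Obj M X) ==> s \<in> car (Sm Z X) ==> ph \<phi> X m Z s \<in> car (Obj N Z)"
 using linop_closed[OF ph_lin_s[OF _ _ _ linop_id]] .

lemma Phi_F: assumes [simp]: "X \<in> Ob C" "m \<in> car (Obj M X)" shows "Phi \<phi> X m \<in> car (Obj F X)"
proof -
 have "(\<lambda>p\<in>cdom (smash K H C) X. ph \<phi> X m (fst p) (snd p)) \<in> cofree_set K (smash K H C) (Obj N) X"
  by (rule CD.cofree_setI)
   (simp_all add: ph_closed linop_add[OF ph_lin_s[OF _ _ _ linop_id]] linop_smult[OF ph_lin_s[OF _ _ _ linop_id]])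
 then show ?thesis by (simp add: Phi_def)
qed

lemma dec_Phi: "X \<in> Ob C ==> m \<in> car (Obj M X) ==> Z \<in> Ob C ==> s \<in> car (Sm Z X) ==> dec (Phi \<phi> X m) (Z, s) = ph \<phi> X m Z s"
 by (simp add: Phi_def)

text \<open>Since (g # 1)(f # h) = (g f) # h, letting g act on m and letting it act on the cofree
  module both replace f by g f.\<close>

lemma Phi_closed: "Phi \<phi> \<in> B.Hc"
proof -
 have "(\<lambda>X\<in>Ob C. \<lambda>m\<in>car (Obj rM X). Phi \<phi> X m) \<in> B.Hc"
 proof (rule nat_maps_restrictI)
  fix X assume X [simp]: "X \<in> Ob C"
  interpret FX: module K "Obj F X" by (rule B.N.obj_mod[OF X])
  interpret MX: module K "Obj M X" by (rule M.obj_mod[OF X])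
  show "linop K (Obj rM X) (Obj B.rN X) (Phi \<phi> X)"
  proof (rule linopI, unfold restrict_module_simps)
   fix x assume x [simp]: "x \<in> car (Obj M X)"
   note [simp del] = CD.cofree_obj_simps cofree_Obj
   show "Phi \<phi> X x \<in> car (Obj F X)" by (rule Phi_F) simp_all
   show "Phi \<phi> X (x \<oplus>\<^bsub>Obj M X\<^esub> y) = Phi \<phi> X x \<oplus>\<^bsub>Obj F X\<^esub> Phi \<phi> X y" if [simp]: "y \<in> car (Obj M X)" for y
    by (rule F_eqI[where X=X]) (simp_all add: Phi_F dec_Phi linop_add[OF ph_lin_m[OF _ _ _ linop_id]] linop_add[OF dec_lin_x[OF _ _ _ linop_id]])
   show "Phi \<phi> X (k \<odot>\<^bsub>Obj M X\<^esub> x) = k \<odot>\<^bsub>Obj F X\<^esub> Phi \<phi> X x" if [simp]: "k \<in> car K" for k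
    by (rule F_eqI[where X=X]) (simp_all add: Phi_F dec_Phi linop_smult[OF ph_lin_m[OF _ _ _ linop_id]] linop_smult[OF dec_lin_x[OF _ _ _ linop_id]])
  qed
  fix Y g m assume Y [simp]: "Y \<in> Ob C" and g [simp]: "g \<in> car (Hom C X Y)" and "m \<in> car (Obj rM Y)"
  then have m [simp]: "m \<in> car (Obj M Y)" by simp
  have "Phi \<phi> X (M.cr X Y g m) = B.N.cr X Y g (Phi \<phi> Y m)"
  proof (rule F_eqI)
   show "Phi \<phi> X (M.cr X Y g m) \<in> car (Obj F X)" "B.N.cr X Y g (Phi \<phi> Y m) \<in> car (Obj F X)"
    by (rule Phi_F B.N.Mor_closed; simp add: Phi_F del: CD.cofree_obj_simps cofree_Obj)+
   fix Z s assume Z [simp]: "Z \<in> Ob C" and s [simp]: "s \<in> car (Sm Z X)"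
   have "ph \<phi> X (M.cr X Y g m) Z s = ph \<phi> Y m Z (scomp Z X Y (pr X Y g \<one>\<^bsub>H\<^esub>) s)"
   proof (rule Sm_eqI[OF _ _ _ _ _ s, where F="\<lambda>s. ph \<phi> X (M.cr X Y g m) Z s" and G="\<lambda>s. ph \<phi> Y m Z (scomp Z X Y (pr X Y g \<one>\<^bsub>H\<^esub>) s)" and P="Obj N Z"])
    show "linop K (Sm Z X) (Obj N Z) (ph \<phi> X (M.cr X Y g m) Z)" by (rule ph_lin_s[OF _ _ _ linop_id]) simp_all
    show "linop K (Sm Z X) (Obj N Z) (\<lambda>s. ph \<phi> Y m Z (scomp Z X Y (pr X Y g \<one>\<^bsub>H\<^esub>) s))" by (intro ph_lin_s lin) simp_all
   qed (simp_all add: ph_pure scomp_one_pure M.cr_comp)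
   then show "dec (Phi \<phi> X (M.cr X Y g m)) (Z, s) = dec (B.N.cr X Y g (Phi \<phi> Y m)) (Z, s)"
    using dec_Mor[OF Phi_F[OF Y m] Z \<open>X \<in> Ob C\<close> s] by (simp add: dec_Phi)
  qed
  then show "Phi \<phi> X (Mor rM X Y g m) = Mor B.rN X Y g (Phi \<phi> Y m)" by simp
 qed simp_all
 then show ?thesis by (simp add: Phi_def)
qed

end

text \<open>By \<open>cofree_maps_eqI\<close> the comparison takes place at id # h. With l = S k,
  the first two legs of l meet as \<open>S l\<^sub>1 l\<^sub>2\<close> and cancel. The remaining leg
  turns the argument of \<phi> into \<open>Sinv (l h\<^sub>2) = Sinv h\<^sub>2 k\<close>, which is
  the translation by k.\<close>

lemma Phi_equivariant:
 assumes \<phi>: "\<phi> \<in> lin_maps K H A" and k [simp]: "k \<in> car H"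
 shows "Phi (\<lambda>h\<in>car H. \<phi> (h \<cdot> k)) = B.ract (S k) (Phi \<phi>)" (is "Phi ?\<psi> = _")
proof (rule cofree_maps_eqI[OF Phi_closed B.ract_closed[OF _ Phi_closed[OF \<phi>]]])
 show \<psi>: "?\<psi> \<in> lin_maps K H A" by (rule lin_H_rmult[OF \<phi> k])
 note [lin] = phi_rules[OF \<phi>] and [simp] = phi_closed[OF \<phi>]
 fix X m h assume [simp]: "X \<in> Ob C" "m \<in> car (Obj M X)" and h [simp]: "h \<in> car H"
 let ?P = "Obj N X"
 let ?G = "\<lambda>z q. sw ?P (\<lambda>x y. \<phi> (Sinv (q \<cdot> y)) X (M.rh X x (M.rh X z m))) h"
 note F_simps = Phi_F[OF \<phi>] dec_Phi[OF \<phi>] ph_pure[OF \<phi>]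
 have "dec (B.ract (S k) (Phi \<phi>) X m) (X, pr X X (Ident C X) h)
   = dec (sw (Obj F X) (\<lambda>a b. B.N.rh X b (Phi \<phi> X (M.rh X (S a) m))) (S k)) (X, pr X X (Ident C X) h)"
  by (simp del: CD.cofree_obj_simps cofree_Obj)
 also have "\<dots> = sw ?P (\<lambda>a b. dec (B.N.rh X b (Phi \<phi> X (M.rh X (S a) m))) (X, pr X X (Ident C X) h)) (S k)"
  by (rule sw_hom[OF _ _ dec_lin_x[where X=X, OF _ _ _ linop_id]]) (simp_all add: F_simps del: CD.cofree_obj_simps cofree_Obj)
 also have "\<dots> = sw ?P (\<lambda>a b. ph \<phi> X (M.rh X (S a) m) X (pr X X (Ident C X) (b \<cdot> h))) (S k)"
  by (simp add: F_simps dec_Mor[OF Phi_F[OF \<phi>]] M.scomp_ident_pure del: CD.cofree_obj_simps cofree_Obj cong: sw_cong)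
 also have "\<dots> = sw ?P (\<lambda>a b. sw ?P (\<lambda>x y. \<phi> (Sinv y) X (M.rh X x (M.rh X (S a) m))) (b \<cdot> h)) (S k)"
  by (simp add: F_simps)
 also have "\<dots> = sw ?P (\<lambda>a b. sw ?P (\<lambda>p q. sw ?P (\<lambda>x y. \<phi> (Sinv (q \<cdot> y)) X (M.rh X (p \<cdot> x) (M.rh X (S a) m))) h) b) (S k)"
  by (intro sw_cong HOL.refl sw_mult lin) simp_all
 also have "\<dots> = sw ?P (\<lambda>a b. sw ?P (\<lambda>p q. ?G (S a \<cdot> p) q) b) (S k)"
  by (simp add: M.rh_mult)
 also have "\<dots> = sw ?P (\<lambda>w q. sw ?P (\<lambda>a p. ?G (S a \<cdot> p) q) w) (S k)"
  by (intro sw_coassoc[symmetric] lin) simp_all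
 also have "\<dots> = sw ?P (\<lambda>w q. eps w \<odot>\<^bsub>?P\<^esub> ?G \<one>\<^bsub>H\<^esub> q) (S k)"
  by (intro sw_cong HOL.refl sw_antipode_left[where F="\<lambda>z. ?G z q" for q] lin) simp_all
 also have "\<dots> = ?G \<one>\<^bsub>H\<^esub> (S k)"
  by (intro sw_counit_left lin) simp_all
 also have "\<dots> = sw ?P (\<lambda>x y. \<phi> (Sinv y \<cdot> k) X (M.rh X x m)) h"
  by (simp add: Sinv_mult)
 also have "\<dots> = dec (Phi ?\<psi> X m) (X, pr X X (Ident C X) h)"
  by (simp add: dec_Phi[OF \<psi>] ph_pure[OF \<psi>])
 finally show "dec (Phi ?\<psi> X m) (X, pr X X (Ident C X) h) = dec (B.ract (S k) (Phi \<phi>) X m) (X, pr X X (Ident C X) h)" by simp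
qed simp

lemma Phi_add:
 assumes \<phi>: "\<phi> \<in> lin_maps K H A" and \<psi>: "\<psi> \<in> lin_maps K H A"
 shows "Phi (\<lambda>h\<in>car H. \<phi> h \<oplus>\<^bsub>A\<^esub> \<psi> h) = Phi \<phi> \<oplus>\<^bsub>B.A\<^esub> Phi \<psi>" (is "Phi ?s = _")
proof (rule cofree_maps_eqI[OF Phi_closed])
 interpret HA: left_H_module K H A by (rule H_Hom_module)
 interpret BM: module K "Hom_Mod K C B.rM B.rN" by (rule B.Hom_module)
 show s: "?s \<in> lin_maps K H A" by (rule lin_plus[OF vector_space HA.vector_space \<phi> \<psi>])
 show "Phi \<phi> \<oplus>\<^bsub>B.A\<^esub> Phi \<psi> \<in> B.Hc"
  using BM.a_closed[of "Phi \<phi>" "Phi \<psi>"] Phi_closed[OF \<phi>] Phi_closed[OF \<psi>] by (simp del: Hom_Mod_simps(3))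
 fix X m h assume [simp]: "X \<in> Ob C" "m \<in> car (Obj M X)" "h \<in> car H"
 let ?P = "Obj N X"
 have "dec (Phi ?s X m) (X, pr X X (Ident C X) h) = sw ?P (\<lambda>a b. ?s (Sinv b) X (M.rh X a (M.cr X X (Ident C X) m))) h"
  by (rule HOL.trans[OF dec_Phi[OF s] ph_pure[OF s]]) simp_all
 also have "\<dots> = sw ?P (\<lambda>a b. \<phi> (Sinv b) X (M.rh X a m) \<oplus>\<^bsub>?P\<^esub> \<psi> (Sinv b) X (M.rh X a m)) h"
  by simp
 also have "\<dots> = sw ?P (\<lambda>a b. \<phi> (Sinv b) X (M.rh X a m)) h \<oplus>\<^bsub>?P\<^esub> sw ?P (\<lambda>a b. \<psi> (Sinv b) X (M.rh X a m)) h"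
  by (rule sw_add) (simp_all add: phi_closed[OF \<phi>] phi_closed[OF \<psi>])
 also have "\<dots> = dec (Phi \<phi> X m \<oplus>\<^bsub>Obj F X\<^esub> Phi \<psi> X m) (X, pr X X (Ident C X) h)"
  by (subst linop_add[OF dec_lin_x[OF _ _ _ linop_id] Phi_F[OF \<phi>] Phi_F[OF \<psi>]])
   (simp_all add: dec_Phi[OF \<phi>] ph_pure[OF \<phi>] dec_Phi[OF \<psi>] ph_pure[OF \<psi>])
 finally show "dec (Phi ?s X m) (X, pr X X (Ident C X) h) = dec ((Phi \<phi> \<oplus>\<^bsub>B.A\<^esub> Phi \<psi>) X m) (X, pr X X (Ident C X) h)"
  by (simp del: CD.cofree_obj_simps cofree_Obj)
qed

lemma Phi_unit:
 assumes e: "\<eta> \<in> Hc" and X [simp]: "X \<in> Ob C" and m [simp]: "m \<in> car (Obj M X)"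
 shows "Phi (\<lambda>h\<in>car H. act A h \<eta>) X m = cofree_unit K (smash K H C) c N X (\<eta> X m)" (is "Phi ?\<psi> X m = _")
proof (rule F_eqI)
 note [lin] = eta_lin[OF e] and [simp] = eta_closed[OF e]
 have \<psi>: "?\<psi> \<in> lin_maps K H A" by (rule lin_H_act[OF H_Hom_module]) (simp add: e)
 show "Phi ?\<psi> X m \<in> car (Obj F X)" by (rule Phi_F[OF \<psi>]) simp_all
 show "cofree_unit K (smash K H C) c N X (\<eta> X m) \<in> car (Obj F X)"
  using nat_maps_closed[OF cofree_unit(1)[OF field smash_linear_category N.right_module_axioms c_inj], of X "\<eta> X m"]
  by (simp del: CD.cofree_obj_simps)
 fix Z s assume Z [simp]: "Z \<in> Ob C" and s [simp]: "s \<in> car (Sm Z X)"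
 have "ph ?\<psi> X m Z s = Mor N Z X s (\<eta> X m)"
 proof (rule Sm_eqI[OF _ _ _ _ _ s, where F="ph ?\<psi> X m Z" and G="\<lambda>s. Mor N Z X s (\<eta> X m)" and P="Obj N Z"])
  show "linop K (Sm Z X) (Obj N Z) (ph ?\<psi> X m Z)" by (rule ph_lin_s[OF \<psi> _ _ _ linop_id]) simp_all
  show "linop K (Sm Z X) (Obj N Z) (\<lambda>s. Mor N Z X s (\<eta> X m))" by (intro lin) simp_all
  fix f h assume [simp]: "f \<in> car (Hom C Z X)" "h \<in> car H"
  have "ph ?\<psi> X m Z (pr Z X f h) = sw (Obj N Z) (\<lambda>a b. ?\<psi> (Sinv b) Z (M.rh Z a (M.cr Z X f m))) h"
   by (rule ph_pure[OF \<psi>]) simp_all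
  also have "\<dots> = sw (Obj N Z) (\<lambda>a b. ract b \<eta> Z (M.rh Z a (M.cr Z X f m))) h"
   by (simp add: H_Hom_act e del: ract_apply)
  also have "\<dots> = N.rh Z h (\<eta> Z (M.cr Z X f m))"
   by (rule ract_collapse[OF e]) simp_all
  also have "\<dots> = Mor N Z X (pr Z X f h) (\<eta> X m)"
   by (simp add: eta_natural[OF e] N.Mor_pure[of Z X f h])
  finally show "ph ?\<psi> X m Z (pr Z X f h) = Mor N Z X (pr Z X f h) (\<eta> X m)" .
 qed simp_all
 then show "dec (Phi ?\<psi> X m) (Z, s) = dec (cofree_unit K (smash K H C) c N X (\<eta> X m)) (Z, s)"
  by (simp add: dec_Phi[OF \<psi>] cofree_unit_def cofree_lift_def)
qed

text \<open>\<open>Phi\<close> is additive and equivariant, and it sends h \<mapsto> h \<eta> to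
  \<eta> followed by the unit. The retraction r of the unit, applied afterwards, gives back
  \<eta>.\<close>

lemma rinj_H_Hom:
 assumes r: "r \<in> nat_maps K (smash K H C) F N"
  and ru: "\<And>X x. X \<in> Ob C ==> x \<in> car (Obj N X) ==> r X (cofree_unit K (smash K H C) c N X x) = x"
 shows "rinj K H A"
proof -
 let ?B = "B.A"
 define R where "R = restrict (Hom_Mod_map C M r) (car ?B)"
 have R: "R \<in> H_maps K H ?B A" unfolding R_def
  by (rule Hom_Mod_map_H[OF B.hom_setup_axioms hom_setup_axioms r])
 note PB = Phi_closed[folded B.H_Hom_simps(1)]
 show ?thesis unfolding rinj_def rinj_map_def
 proof (intro exI[of _ "\<lambda>\<phi>. R (Phi \<phi>)"] conjI ballI)
  show "R (Phi \<phi>) \<in> car A" if "\<phi> \<in> lin_maps K H A" for \<phi>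
   by (rule H_maps_closed[OF R PB[OF that]])
  show "R (Phi (\<lambda>h\<in>car H. \<phi> h \<oplus>\<^bsub>A\<^esub> \<psi> h)) = R (Phi \<phi>) \<oplus>\<^bsub>A\<^esub> R (Phi \<psi>)"
   if "\<phi> \<in> lin_maps K H A" "\<psi> \<in> lin_maps K H A" for \<phi> \<psi>
   unfolding Phi_add[OF that] by (rule lin_add[OF H_maps_lin[OF R] PB[OF that(1)] PB[OF that(2)]])
  show "R (Phi (\<lambda>h\<in>car H. \<phi> (h \<cdot> k))) = act A k (R (Phi \<phi>))"
   if k: "k \<in> car H" and \<phi>: "\<phi> \<in> lin_maps K H A" for k \<phi>
   unfolding Phi_equivariant[OF \<phi> k] B.H_Hom_act[OF k Phi_closed[OF \<phi>], symmetric]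
   by (rule H_maps_act[OF R k PB[OF \<phi>]])
  show "R (Phi (\<lambda>h\<in>car H. act A h u)) = u" if u: "u \<in> car A" for u
  proof (rule Hc_eqI)
   have \<psi>: "(\<lambda>h\<in>car H. act A h u) \<in> lin_maps K H A" by (rule lin_H_act[OF H_Hom_module u])
   show "R (Phi (\<lambda>h\<in>car H. act A h u)) \<in> Hc" using H_maps_closed[OF R PB[OF \<psi>]] by simp
   show "u \<in> Hc" using u by simp
   then show "R (Phi (\<lambda>h\<in>car H. act A h u)) X m = u X m" if "X \<in> Ob C" "m \<in> car (Obj M X)" for X m
    using that PB[OF \<psi>] by (simp add: R_def Hom_Mod_map_def Phi_unit ru eta_closed del: B.H_Hom_simps)
  qed
 qed
qed

end

section \<open>Assembly: the spectral sequence of Ext\<close>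

lemma coboundaries_cong:
 assumes "\<And>n x. x \<in> car (V n) ==> d n x = d' n x"
 shows "coboundaries V d = coboundaries V d'"
 using assms by (auto simp: coboundaries_def fun_eq_iff split: nat.split intro!: image_cong)

lemma cocycles_cong:
 assumes "\<And>n x. x \<in> car (V n) ==> d n x = d' n x"
 shows "cocycles V d = cocycles V d'"
 using assms by (auto simp: cocycles_def fun_eq_iff)

lemma cohomology_cong:
 assumes "\<And>n x. x \<in> car (V n) ==> d n x = d' n x"
 shows "cohomology V d = cohomology V d'"
 unfolding cohomology_def[abs_def] by (simp only: coboundaries_cong[OF assms] cocycles_cong[OF assms])

lemma H_cohomology_cong:
 assumes "\<And>n x. x \<in> car (V n) ==> d n x = d' n x"
 shows "H_cohomology V d = H_cohomology V d'"
 unfolding H_cohomology_def[abs_def]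
 by (simp only: coboundaries_cong[of V d d', OF assms] cohomology_cong[of V d d', OF assms])

theorem theorem3p15:
  fixes K :: "'k ring"
    and H :: "('k, 'h) hopf"
    and C :: "('k, 'h, 'o, 'c) hcat"
    and M :: "('k, 'o, ('c, 'h) tensor, 'm) rmodule"
    and N :: "('k, 'o, ('c, 'h) tensor, 'n) rmodule"
  assumes "hopf_algebra K H"
    and "left_H_category K H C"
    and "right_module K (smash K H C) M"
    and "right_module K (smash K H C) N"
  shows "\<exists>E d. first_quadrant_spectral_sequence K E d
    \<and> (\<forall>p q. E 2 (int p) (int q) = R_invariants K H p (H_Ext K H C q M N))
    \<and> converges_to K E (\<lambda>n. RHom K (smash K H C) n M N)"
proof -
 interpret smash_setup K H C by (rule smash_setup.intro[OF assms(1,2)])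
 obtain I d e where Ide: "chosen_resolution K (smash K H C) N = (I, d, e)" by (metis prod_cases3)
 have res: "injective_resolution K (smash K H C) N I d e"
  by (rule chosen_resolution[OF field smash_linear_category assms(4) Ide])
 have inj: "injective_module K (smash K H C) (I n)" for n
  using res by (simp add: injective_resolution_def)
 have Im: "right_module K (smash K H C) (I n)" for n
  using inj[of n] by (simp add: injective_module_def)
 have d: "d n \<in> nat_maps K (smash K H C) (I n) (I (Suc n))" for n
  using res by (simp add: injective_resolution_def)
 have hset: "hom_setup K H C M (I n)" for n
  by (intro hom_setup.intro smod.intro smash_setup_axioms assms(3) Im)
 let ?A = "\<lambda>n. H_Hom_Mod K H C M (I n)"
 let ?f = "\<lambda>n. Hom_Mod_map C M (d n)"
 \<comment> \<open>The extensional version of the differential, as required of equivariant maps;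
   cohomology depends only on values in the carriers, so nothing changes.\<close>
 define g where "g n = restrict (?f n) (car (?A n))" for n
 have g: "g n \<in> H_maps K H (?A n) (?A (Suc n))" for n
  unfolding g_def by (rule Hom_Mod_map_H[OF hset hset d])
 have fg: "?f n x = g n x" if "x \<in> car (?A n)" for n x using that by (simp add: g_def)
 have rinj: "rinj K H (?A n)" for n
 proof -
  \<comment> \<open>The universe of the resolution absorbs powers with the objects and morphisms of
    C # H as exponent. So the cofree module on I n fits into the type of I n, and I n is a retract
    of it.\<close>
  obtain c :: "('o \<times> ('c, 'h) tensor => ('o \<times> ('c, 'h) tensor, 'n) univ) => ('o \<times> ('c, 'h) tensor, 'n) univ"
   where c: "inj c" using univ_power_injection by blast
  obtain r where r: "r \<in> nat_maps K (smash K H C) (cofree K (smash K H C) c (Obj (I n))) (I n)"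
   "\<And>X x. X \<in> Ob (smash K H C) ==> x \<in> car (Obj (I n) X) ==> r X (cofree_unit K (smash K H C) c (I n) X x) = x"
   using injective_retract[OF field smash_linear_category inj c] by blast
  interpret hom_cofree K H C M "I n" c
   by (intro hom_cofree.intro hom_cofree_axioms.intro hset c)
  show ?thesis by (rule rinj_H_Hom[OF r(1)]) (simp add: r(2))
 qed
 have dd: "g (Suc n) (g n x) = \<zero>\<^bsub>?A (Suc (Suc n))\<^esub>" if x: "x \<in> car (?A n)" for n x
 proof -
  interpret A0: hom_setup K H C M "I n" by (rule hset)
  interpret A2: hom_setup K H C M "I (Suc (Suc n))" by (rule hset)
  have "d (Suc n) X (d n X y) = \<zero>\<^bsub>Obj (I (Suc (Suc n))) X\<^esub>" if "X \<in> Ob C" "y \<in> car (Obj (I n) X)" for X y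
  proof -
   have "d n X ` car (Obj (I n) X) = cocycles (\<lambda>n. Obj (I n) X) (\<lambda>n. d n X) (Suc n)"
    using res that(1) by (simp add: injective_resolution_def)
   then have "d n X y \<in> cocycles (\<lambda>n. Obj (I n) X) (\<lambda>n. d n X) (Suc n)" using that(2) by blast
   then show ?thesis by (simp add: cocycles_def)
  qed
  then have "?f (Suc n) (?f n x) = \<zero>\<^bsub>?A (Suc (Suc n))\<^esub>"
   using x by (simp add: Hom_Mod_map_def A0.eta_closed)
  then show ?thesis using fg[OF x] fg[OF H_maps_closed[OF g x]] by simp
 qed
 \<comment> \<open>Invariants of the C-linear maps are the maps over C # H, as an equality of
   records; this turns the abutment into the complex that defines \<open>RHom\<close>.\<close>
 have inv: "invariants H (?A i) = Hom_Mod K (smash K H C) M (I i)" for i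
  by (rule hom_setup.invariants_H_Hom[OF hset])
 have fm: "Hom_Mod_map (smash K H C) M \<theta> = Hom_Mod_map C M \<theta>" for \<theta> :: "'o => ('o \<times> ('c, 'h) tensor, 'n) univ => ('o \<times> ('c, 'h) tensor, 'n) univ"
  by (simp add: Hom_Mod_map_def fun_eq_iff)
 have "car (invariants H (?A i)) \<subseteq> car (?A i)" for i by (auto simp: invariants_def)
 then have "cohomology (\<lambda>i. invariants H (?A i)) ?f = cohomology (\<lambda>i. invariants H (?A i)) g"
  by (intro cohomology_cong fg) blast
 moreover have "RHom K (smash K H C) n M N = cohomology (\<lambda>i. invariants H (?A i)) ?f n" for n
  by (simp add: RHom_def Ide inv fm)
 moreover have "H_Ext K H C q M N = H_cohomology ?A g q" for q
  by (simp add: H_Ext_def Ide H_cohomology_cong[of ?A ?f g, OF fg])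
 moreover obtain E d' where "first_quadrant_spectral_sequence K E d'"
  "\<forall>p q. E 2 (int p) (int q) = R_invariants K H p (H_cohomology ?A g q)"
  "converges_to K E (\<lambda>n. cohomology (\<lambda>i. invariants H (?A i)) g n)"
  using grothendieck_rinj[where A="?A" and d=g, OF hom_setup.H_Hom_module[OF hset] rinj g dd] by blast
 ultimately show ?thesis by auto
qed

end
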